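(* Let $g$ be either a totally positive function of Gaussian type or the hyperbolic secant $g(x)=\operatorname{sech}(ax)$ with $a>0$, and let $\Lambda\subseteq\mathbb{R}$ be a separated set. Let $\{p_1,\dots,p_N\}$ be a basis of the space of polynomials of degree less than $N$, set $g^j=p_j(\frac{d}{dx})g$ for $j=1,\dots,N$, and $G=(g^1,\dots,g^N)$. Then $\mathcal{G}(G,(-\Lambda)\times\mathbb{Z})$ is a frame for $L^2(\mathbb{R})$ if and only if $D^-(\Lambda)>1/N$.
   Context: $g$ is totally positive of Gaussian type if $\hat g(\xi)=\prod_{j=1}^n(1+2\pi i\delta_j\xi)^{-1}e^{-c\xi^2}$ with $\delta_j\in\mathbb{R}$, $c>0$, $n\in\mathbb{N}\cup\{0\}$. Separated: distinct points have mutual distance bounded below by a positive constant. Time-frequency shifts: $\pi(x,w)h(t)=h(t-x)e^{2\pi iwt}$. For windows $G=(g^1,\dots,g^N)$ and $\Delta\subseteq\mathbb{R}^2$, the multi-window Gabor system is $\mathcal{G}(G,\Delta)=\{\pi(x,w)g^j:(x,w)\in\Delta,\ j=1,\dots,N\}$. $D^-(\Lambda)=\liminf_{r\to\infty}\inf_{x\in\mathbb{R}}\frac{\#(\Lambda\cap[x-r,x+r])}{2r}$. *)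

theory Defs
  imports "HOL-Analysis.Analysis" "HOL-Computational_Algebra.Polynomial"
begin

definition L2 :: "(real \<Rightarrow> complex) set" where
  "L2 = {f. f \<in> borel_measurable lebesgue \<and>
            integrable lebesgue (\<lambda>t. (cmod (f t))^2)}"

definition l2_inner :: "(real \<Rightarrow> complex) \<Rightarrow> (real \<Rightarrow> complex) \<Rightarrow> complex" where
  "l2_inner f h = (LINT t|lebesgue. f t * cnj (h t))"

definition l2_norm :: "(real \<Rightarrow> complex) \<Rightarrow> real" where
  "l2_norm f = sqrt (LINT t|lebesgue. (cmod (f t))^2)"

definition is_frame :: "'i set \<Rightarrow> ('i \<Rightarrow> real \<Rightarrow> complex) \<Rightarrow> bool" where
  "is_frame I phi \<longleftrightarrow> (\<forall>i\<in>I. phi i \<in> L2) \<and>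
     (\<exists>A B. 0 < A \<and> 0 < B \<and>
        (\<forall>f\<in>L2. (\<lambda>i. (cmod (l2_inner f (phi i)))^2) summable_on I \<and>
                 A * (l2_norm f)^2 \<le> (\<Sum>\<^sub>\<infinity>i\<in>I. (cmod (l2_inner f (phi i)))^2) \<and>
                 (\<Sum>\<^sub>\<infinity>i\<in>I. (cmod (l2_inner f (phi i)))^2) \<le> B * (l2_norm f)^2))"

definition fourier :: "(real \<Rightarrow> complex) \<Rightarrow> real \<Rightarrow> complex" where
  "fourier f \<xi> = (LINT t|lebesgue. f t * exp (- 2 * pi * \<i> * complex_of_real (t * \<xi>)))"

definition tfshift :: "real \<Rightarrow> real \<Rightarrow> (real \<Rightarrow> complex) \<Rightarrow> real \<Rightarrow> complex" where
  "tfshift x w h t = h (t - x) * exp (2 * pi * \<i> * complex_of_real (w * t))"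

definition gabor_frame :: "(nat \<Rightarrow> real \<Rightarrow> complex) \<Rightarrow> nat \<Rightarrow> (real \<times> real) set \<Rightarrow> bool" where
  "gabor_frame G N \<Delta> \<longleftrightarrow> is_frame (\<Delta> \<times> {1..N}) (\<lambda>((x, w), j). tfshift x w (G j))"

text \<open>g is taken to be the continuous (hence everywhere-defined, smooth) representative.\<close>
definition tp_gaussian_type :: "(real \<Rightarrow> complex) \<Rightarrow> bool" where
  "tp_gaussian_type g \<longleftrightarrow> continuous_on UNIV g \<and> integrable lebesgue g \<and>
     (\<exists>(n::nat) (\<delta>::nat \<Rightarrow> real) (c::real). c > 0 \<and>
        (\<forall>\<xi>. fourier g \<xi> =
              (\<Prod>j\<in>{1..n}. inverse (1 + 2 * pi * \<i> * complex_of_real (\<delta> j * \<xi>)))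
              * exp (- complex_of_real (c * \<xi>^2))))"

definition deriv_iter :: "nat \<Rightarrow> (real \<Rightarrow> complex) \<Rightarrow> real \<Rightarrow> complex" where
  "deriv_iter k f = ((\<lambda>h x. vector_derivative h (at x)) ^^ k) f"

definition poly_diff_op :: "complex poly \<Rightarrow> (real \<Rightarrow> complex) \<Rightarrow> real \<Rightarrow> complex" where
  "poly_diff_op p f x = (\<Sum>k\<le>degree p. coeff p k * deriv_iter k f x)"

definition separated :: "real set \<Rightarrow> bool" where
  "separated \<Lambda> \<longleftrightarrow> (\<exists>d>0. \<forall>x\<in>\<Lambda>. \<forall>y\<in>\<Lambda>. x \<noteq> y \<longrightarrow> d \<le> \<bar>x - y\<bar>)"

definition lower_density :: "real set \<Rightarrow> ereal" where
  "lower_density \<Lambda> = Liminf at_top (\<lambda>r::real.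
      INF x::real. ereal (real (card (\<Lambda> \<inter> {x - r..x + r})) / (2 * r)))"

definition poly_basis :: "nat \<Rightarrow> (nat \<Rightarrow> complex poly) \<Rightarrow> bool" where
  "poly_basis N p \<longleftrightarrow>
     (\<forall>j\<in>{1..N}. degree (p j) < N) \<and>
     (\<forall>c::nat \<Rightarrow> complex. (\<Sum>j=1..N. smult (c j) (p j)) = 0 \<longrightarrow> (\<forall>j\<in>{1..N}. c j = 0)) \<and>
     (\<forall>q::complex poly. degree q < N \<longrightarrow> (\<exists>c. q = (\<Sum>j=1..N. smult (c j) (p j))))"

end

theory Submission
  imports Defs "HOL-Complex_Analysis.Complex_Analysis" "HOL-Probability.Probability" "HOL-Real_Asymp.Real_Asymp"
begin

text \<open>Let \<open>f\<close> be a series \<open>\<Sum>\<^sub>k c\<^sub>k g(x - k)\<close> whose coefficients grow exponentially at a small rate. If \<open>f\<close>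
  vanishes, with multiplicities, at points \<open>t\<^sub>i\<close> with \<open>t\<^sub>i - \<theta> i\<close> bounded for some \<open>0 < \<theta> < 1\<close>, then \<open>c = 0\<close>.
  For a Gaussian, \<open>f\<close> is \<open>e\<^sup>-\<^sup>a\<^sup>x\<^sup>2\<close> times a Laurent series in \<open>w = e\<^sup>2\<^sup>a\<^sup>x\<close>; dividing out its zeros and applying
  the maximum principle on an annulus bounds it by a quantity that tends to \<open>0\<close>. A factor
  \<open>(1 + 2 \<pi> i \<delta> \<xi>)\<^sup>-\<^sup>1\<close> of the Fourier transform corresponds to solving \<open>h + \<delta> h' = g\<close>, so Rolle's theorem passes
  the zeros on to the series with one factor less. For the hyperbolic secant, multiplication by a theta
  function turns \<open>f\<close> into a series of the Gaussian kind.

  By compactness, this uniqueness gives a bound of \<open>\<Sum>\<^sub>k c\<^sub>k\<^sup>2\<close> by the squares of the derivatives of order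
  \<open>s < N\<close> of \<open>f\<close> on \<open>x + \<Lambda>\<close>, uniformly in \<open>x\<close>, as soon as \<open>D\<^sup>-(\<Lambda>) > 1/N\<close>. Parseval's identity in the
  modulation variable shows that the frame inequality is the integral of such inequalities over \<open>x\<close> in a
  unit cell. Conversely, a frame yields them for all \<open>x\<close>, with the values on \<open>x + \<Lambda>\<close> replaced by suprema
  over short intervals; this leaves enough room to compare \<open>\<Lambda>\<close> with a dilate \<open>(1 + \<eta>) \<Lambda>\<close> and so to force
  the strict inequality for the density.\<close>

section \<open>Exponential sums\<close>

text \<open>A window enters only as a real function with exponentially decaying derivatives for
  which zeros of mean spacing \<open>\<theta> < 1\<close> annihilate a series of integer translates.
  Two demands shape this property. The \<open>N\<close> windows record the derivatives of order
  below \<open>N\<close>, so every sampling point counts \<open>N\<close> times; hence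
  multiplicities, and hence the critical density \<open>1 / N\<close>. And compactness normalises a
  counterexample at one index only, so its limit is controlled in a weighted sum, not in l2; hence
  coefficients that grow.

  The converse has a different obstacle. A frame inequality speaks about integrals over
  \<open>x\<close> and gives nothing at a single \<open>x\<close>. Test functions are therefore
  spread over an interval of length comparable to \<open>\<eta>\<close>, and the resulting constant
  must not depend on \<open>\<eta>\<close>, because the same \<open>\<eta>\<close> is the excess of
  the dilation \<open>1 + \<eta>\<close>. The choice \<open>\<eta> = \<epsilon>\<^sup>2\<close>,
  with \<open>1 / \<epsilon>\<close> the length of localisation, makes the error of the deformation
  of order \<open>\<epsilon>\<close>, while the localisation window still contains
  \<open>1 / \<epsilon>\<close> indices.\<close>

lemma sum_exp_nat_bound:
  fixes \<kappa> :: real and i :: "'a \<Rightarrow> nat"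
  assumes "\<kappa> > 0" "finite F" "inj_on i F"
  shows "(\<Sum>k\<in>F. exp (- \<kappa> * real (i k))) \<le> 1 + 1 / \<kappa>"
proof -
  have e: "exp (- \<kappa> * real n) = exp (- \<kappa>) ^ n" for n
    by (metis exp_of_nat2_mult mult.commute)
  have lt: "exp (- \<kappa>) < 1" using assms by simp
  have "(\<Sum>k\<in>F. exp (- \<kappa> * real (i k))) = (\<Sum>n\<in>i ` F. exp (- \<kappa>) ^ n)"
    unfolding e by (simp add: sum.reindex[OF assms(3)])
  also have "\<dots> \<le> (\<Sum>n. exp (- \<kappa>) ^ n)"
    using assms lt by (intro sum_le_suminf) (auto intro!: summable_geometric)
  also have "\<dots> = 1 / (1 - exp (- \<kappa>))"
    using lt by (intro suminf_geometric) simp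
  also have "\<dots> \<le> 1 + 1 / \<kappa>"
  proof -
    have "1 + \<kappa> \<le> exp \<kappa>" by (rule exp_ge_add_one_self)
    then have "exp (- \<kappa>) * (1 + \<kappa>) \<le> 1"
      using mult_left_mono[of "1 + \<kappa>" "exp \<kappa>" "exp (-\<kappa>)"] by (simp add: exp_minus)
    then have "\<kappa> \<le> (1 - exp (- \<kappa>)) * (1 + \<kappa>)" by (simp add: algebra_simps)
    then show ?thesis using assms lt by (simp add: field_simps)
  qed
  finally show ?thesis .
qed

text \<open>On each side of \<open>x\<close> the distance to \<open>k\<close> is at least a natural
  number that determines \<open>k\<close>, so two geometric series suffice. The point is uniformity
  in \<open>x\<close>.\<close>

lemma sum_exp_int_bound:
  fixes \<kappa> x :: real and F :: "int set"
  assumes \<kappa>: "\<kappa> > 0" and F: "finite F"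
  shows "(\<Sum>k\<in>F. exp (- \<kappa> * \<bar>of_int k - x\<bar>)) \<le> 2 * (1 + 1 / \<kappa>)"
proof -
  let ?F1 = "{k\<in>F. \<lceil>x\<rceil> \<le> k}" and ?F2 = "{k\<in>F. k < \<lceil>x\<rceil>}"
  have "(\<Sum>k\<in>?F1. exp (- \<kappa> * \<bar>of_int k - x\<bar>)) \<le> (\<Sum>k\<in>?F1. exp (- \<kappa> * real (nat (k - \<lceil>x\<rceil>))))"
    using \<kappa> by (intro sum_mono) (auto simp: of_nat_nat, linarith+)
  also have "\<dots> \<le> 1 + 1 / \<kappa>"
    using F by (intro sum_exp_nat_bound[OF \<kappa>]) (auto simp: inj_on_def)
  finally have 1: "(\<Sum>k\<in>?F1. exp (- \<kappa> * \<bar>of_int k - x\<bar>)) \<le> 1 + 1 / \<kappa>" .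
  have "(\<Sum>k\<in>?F2. exp (- \<kappa> * \<bar>of_int k - x\<bar>)) \<le> (\<Sum>k\<in>?F2. exp (- \<kappa> * real (nat (\<lceil>x\<rceil> - 1 - k))))"
    using \<kappa> by (intro sum_mono) (auto simp: of_nat_nat, linarith+)
  also have "\<dots> \<le> 1 + 1 / \<kappa>"
    using F by (intro sum_exp_nat_bound[OF \<kappa>]) (auto simp: inj_on_def)
  finally have 2: "(\<Sum>k\<in>?F2. exp (- \<kappa> * \<bar>of_int k - x\<bar>)) \<le> 1 + 1 / \<kappa>" .
  have "F = ?F1 \<union> ?F2" by auto
  then have "(\<Sum>k\<in>F. exp (- \<kappa> * \<bar>of_int k - x\<bar>)) = (\<Sum>k\<in>?F1. exp (- \<kappa> * \<bar>of_int k - x\<bar>)) + (\<Sum>k\<in>?F2. exp (- \<kappa> * \<bar>of_int k - x\<bar>))"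
    using F by (metis (no_types, lifting) sum.union_disjoint finite_Un disjoint_iff mem_Collect_eq not_less)
  with 1 2 show ?thesis by simp
qed

text \<open>Rounding \<open>f y / d\<close> down is injective on a \<open>d\<close>-separated family
  and reduces the sum to one over integers; \<open>exp (\<kappa> * d)\<close> pays for the rounding
  error. The map \<open>f\<close> admits images of points, such as those of a dilated set.\<close>

lemma sum_exp_separated_bound:
  fixes \<kappa> d x :: real and S :: "'a set" and f :: "'a \<Rightarrow> real"
  assumes \<kappa>: "\<kappa> > 0" and d: "d > 0" and S: "finite S"
    and sep: "\<And>y z. y \<in> S \<Longrightarrow> z \<in> S \<Longrightarrow> y \<noteq> z \<Longrightarrow> d \<le> \<bar>f y - f z\<bar>"
  shows "(\<Sum>y\<in>S. exp (- \<kappa> * \<bar>f y - x\<bar>)) \<le> exp (\<kappa> * d) * (2 * (1 + 1 / (\<kappa> * d)))"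
proof -
  have inj: "inj_on (\<lambda>y. \<lfloor>f y / d\<rfloor>) S"
  proof (rule inj_onI, rule ccontr)
    fix y z assume *: "y \<in> S" "z \<in> S" "\<lfloor>f y / d\<rfloor> = \<lfloor>f z / d\<rfloor>" "y \<noteq> z"
    then have "\<bar>f y / d - f z / d\<bar> < 1" by linarith
    then have "\<bar>f y - f z\<bar> < d" using d by (simp add: diff_divide_distrib[symmetric] abs_divide divide_less_eq)
    with sep[of y z] * show False by auto
  qed
  have "exp (- \<kappa> * \<bar>f y - x\<bar>) \<le> exp (\<kappa> * d) * exp (- (\<kappa> * d) * \<bar>of_int \<lfloor>f y / d\<rfloor> - x / d\<bar>)" for y
  proof -
    have "\<bar>f y / d - x / d\<bar> = \<bar>f y - x\<bar> / d" using d by (simp add: diff_divide_distrib[symmetric] abs_divide)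
    then have "\<bar>f y - x\<bar> / d \<ge> \<bar>of_int \<lfloor>f y / d\<rfloor> - x / d\<bar> - 1" by linarith
    then have "\<bar>f y - x\<bar> \<ge> d * \<bar>of_int \<lfloor>f y / d\<rfloor> - x / d\<bar> - d"
      using d mult_left_mono[of "\<bar>of_int \<lfloor>f y / d\<rfloor> - x / d\<bar> - 1" "\<bar>f y - x\<bar> / d" d] by (simp add: right_diff_distrib)
    then have "\<kappa> * \<bar>f y - x\<bar> \<ge> \<kappa> * (d * \<bar>of_int \<lfloor>f y / d\<rfloor> - x / d\<bar> - d)" using \<kappa> by (intro mult_left_mono) auto
    then show ?thesis unfolding exp_add[symmetric] exp_le_cancel_iff by (simp add: algebra_simps)
  qed
  then have "(\<Sum>y\<in>S. exp (- \<kappa> * \<bar>f y - x\<bar>))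
      \<le> (\<Sum>y\<in>S. exp (\<kappa> * d) * exp (- (\<kappa> * d) * \<bar>of_int \<lfloor>f y / d\<rfloor> - x / d\<bar>))"
    by (intro sum_mono)
  also have "\<dots> = exp (\<kappa> * d) * (\<Sum>k\<in>(\<lambda>y. \<lfloor>f y / d\<rfloor>) ` S. exp (- (\<kappa> * d) * \<bar>of_int k - x / d\<bar>))"
    unfolding sum_distrib_left by (simp add: sum.reindex[OF inj])
  also have "\<dots> \<le> exp (\<kappa> * d) * (2 * (1 + 1 / (\<kappa> * d)))"
    using \<kappa> d S by (intro mult_left_mono sum_exp_int_bound) auto
  finally show ?thesis .
qed

section \<open>Absolutely convergent series over the integers\<close>

lemma summable_on_exp_int:
  fixes \<kappa> x :: real
  assumes "\<kappa> > 0"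
  shows "(\<lambda>k::int. exp (- \<kappa> * \<bar>of_int k - x\<bar>)) summable_on UNIV"
  using sum_exp_int_bound[OF assms]
  by (intro nonneg_bdd_above_summable_on) (auto intro!: bdd_aboveI2)

lemma infsum_exp_int_bound:
  fixes \<kappa> x :: real
  assumes "\<kappa> > 0"
  shows "(\<Sum>\<^sub>\<infinity>k::int. exp (- \<kappa> * \<bar>of_int k - x\<bar>)) \<le> 2 * (1 + 1 / \<kappa>)"
  using assms by (intro infsum_le_finite_sums summable_on_exp_int sum_exp_int_bound) auto

lemma abs_summable_on_exp_bound:
  fixes u :: "int \<Rightarrow> 'a::banach"
  assumes "\<kappa> > 0" "\<And>k. norm (u k) \<le> C * exp (- \<kappa> * \<bar>of_int k - x\<bar>)"
  shows "(\<lambda>k. norm (u k)) summable_on UNIV"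
  by (rule Infinite_Sum.abs_summable_on_comparison_test'[OF summable_on_cmult_right[OF summable_on_exp_int[OF assms(1)]]])
    (use assms(2) in auto)

text \<open>Enumerating the integers by \<open>int_decode\<close> carries theorems on sequences
  (Tannery, Weierstrass, termwise differentiation) over to sums over all integers; absolute
  convergence makes the order irrelevant.\<close>

lemma infsum_int_eq_suminf:
  fixes u :: "int \<Rightarrow> 'a::banach"
  assumes "(\<lambda>k. norm (u k)) summable_on UNIV"
  shows "summable (\<lambda>n. norm (u (int_decode n)))" "(\<Sum>\<^sub>\<infinity>k. u k) = (\<Sum>n. u (int_decode n))"
    "(\<lambda>n. u (int_decode n)) sums (\<Sum>\<^sub>\<infinity>k. u k)"
proof -
  have 1: "(\<lambda>n. norm (u (int_decode n))) summable_on UNIV"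
    using assms by (subst summable_on_reindex_bij_betw[OF bij_int_decode])
  then show "summable (\<lambda>n. norm (u (int_decode n)))" by (rule summable_on_imp_summable)
  have "u summable_on UNIV" using assms by (rule Infinite_Sum.abs_summable_summable)
  then have "(\<lambda>n. u (int_decode n)) summable_on UNIV" by (subst summable_on_reindex_bij_betw[OF bij_int_decode])
  then have "((\<lambda>n. u (int_decode n)) has_sum (\<Sum>\<^sub>\<infinity>n. u (int_decode n))) UNIV" by simp
  then show "(\<lambda>n. u (int_decode n)) sums (\<Sum>\<^sub>\<infinity>k. u k)"
    unfolding infsum_reindex_bij_betw[OF bij_int_decode] by (rule has_sum_imp_sums)
  then show "(\<Sum>\<^sub>\<infinity>k. u k) = (\<Sum>n. u (int_decode n))" by (simp add: sums_iff)
qed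

lemma infsum_int_tendsto:
  fixes a :: "int \<Rightarrow> nat \<Rightarrow> 'a :: {real_normed_algebra, banach}"
  assumes lim: "\<And>k. (\<lambda>n. a k n) \<longlonglongrightarrow> b k"
    and bd: "\<And>k n. norm (a k n) \<le> M k" and M: "M summable_on UNIV"
  shows "(\<lambda>n. \<Sum>\<^sub>\<infinity>k. a k n) \<longlonglongrightarrow> (\<Sum>\<^sub>\<infinity>k. b k)"
proof -
  have Ma: "(\<lambda>k. norm (M k)) summable_on UNIV" using M by (intro summable_on_iff_abs_summable_on_real[THEN iffD1])
  have a: "(\<lambda>k. norm (a k n)) summable_on UNIV" for n
    by (rule Infinite_Sum.abs_summable_on_comparison_test'[OF M]) (rule bd)
  have "norm (b k) \<le> M k" for k
    by (rule Lim_bounded[OF tendsto_norm[OF lim]]) (use bd in auto)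
  then have b: "(\<lambda>k. norm (b k)) summable_on UNIV"
    by (rule Infinite_Sum.abs_summable_on_comparison_test'[OF M])
  have "(\<lambda>n. \<Sum>j. a (int_decode j) n) \<longlonglongrightarrow> (\<Sum>j. b (int_decode j))"
  proof -
    have ev: "\<forall>\<^sub>F p in sequentially \<times>\<^sub>F sequentially. (\<lambda>(k, n). norm (a (int_decode k) n) \<le> M (int_decode k)) p"
      using bd by (intro always_eventually) auto
    show ?thesis
      using tannerys_theorem[OF lim ev summable_norm_cancel[OF infsum_int_eq_suminf(1)[OF Ma]]] by auto
  qed
  then show ?thesis by (simp add: infsum_int_eq_suminf(2)[OF a] infsum_int_eq_suminf(2)[OF b])
qed

lemma has_real_derivative_infsum_int:
  fixes u u' :: "int \<Rightarrow> real \<Rightarrow> real"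
  assumes der: "\<And>k x. (u k has_real_derivative u' k x) (at x)"
    and bd: "\<And>R. \<exists>M. M summable_on UNIV \<and> (\<forall>k. \<forall>x. \<bar>x\<bar> \<le> R \<longrightarrow> \<bar>u' k x\<bar> \<le> M k)"
    and sm: "\<And>x. (\<lambda>k. u k x) summable_on UNIV"
  shows "((\<lambda>x. \<Sum>\<^sub>\<infinity>k. u k x) has_real_derivative (\<Sum>\<^sub>\<infinity>k. u' k x)) (at x)"
proof -
  have a: "(\<lambda>k. norm (u k x)) summable_on UNIV" for x
    using sm by (intro summable_on_iff_abs_summable_on_real[THEN iffD1])
  obtain M where M: "M summable_on UNIV" "\<And>k y. \<bar>y\<bar> \<le> \<bar>x\<bar> + 1 \<Longrightarrow> \<bar>u' k y\<bar> \<le> M k"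
    using bd[of "\<bar>x\<bar> + 1"] by blast
  have Ma: "(\<lambda>k. norm (M k)) summable_on UNIV" using M by (intro summable_on_iff_abs_summable_on_real[THEN iffD1])
  have b: "(\<lambda>k. norm (u' k x)) summable_on UNIV"
    by (rule Infinite_Sum.abs_summable_on_comparison_test'[OF M(1)]) (use M(2) in auto)
  let ?S = "ball 0 (\<bar>x\<bar> + 1) :: real set"
  have uc: "uniformly_convergent_on ?S (\<lambda>n y. \<Sum>i<n. u' (int_decode i) y)"
    using M(2) summable_norm_cancel[OF infsum_int_eq_suminf(1)[OF Ma]]
    by (intro Weierstrass_m_test'[where M = "\<lambda>i. M (int_decode i)"]) (auto simp: dist_real_def)
  have "((\<lambda>x. \<Sum>n. u (int_decode n) x) has_real_derivative (\<Sum>n. u' (int_decode n) x)) (at x)"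
    using summable_norm_cancel[OF infsum_int_eq_suminf(1)[OF a]] uc
    by (intro has_field_derivative_series'(2)[where S = ?S and ?x0.0=x])
      (auto intro: DERIV_subset der simp: dist_real_def interior_open)
  then show ?thesis by (simp add: infsum_int_eq_suminf(2)[OF a] infsum_int_eq_suminf(2)[OF b])
qed

lemma has_integral_exp_int:
  "((\<lambda>x. exp (2 * pi * \<i> * of_int l * complex_of_real x)) has_integral (if l = 0 then 1 else 0)) {y..y + 1}"
proof (cases "l = 0")
  case True
  have "((\<lambda>x::real. 1 :: complex) has_integral (1 :: complex)) {y..y + 1}"
    using has_integral_const_real[of "1 :: complex" y "y + 1"] by simp
  then show ?thesis using True by simp
next
  case False
  let ?c = "2 * pi * \<i> * of_int l :: complex"
  have c: "?c \<noteq> 0" using False by simp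
  have "((\<lambda>x. exp (?c * complex_of_real x)) has_integral
      exp (?c * complex_of_real (y + 1)) / ?c - exp (?c * complex_of_real y) / ?c) {y..y + 1}"
  proof (rule fundamental_theorem_of_calculus)
    fix x :: real
    have "((\<lambda>x. exp (?c * x) / ?c) has_field_derivative exp (?c * of_real x)) (at (of_real x))"
      using c by (auto intro!: derivative_eq_intros)
    then show "((\<lambda>x. exp (?c * complex_of_real x) / ?c) has_vector_derivative exp (?c * complex_of_real x)) (at x within {y..y + 1})"
      by (rule has_vector_derivative_real_field)
  qed auto
  moreover have "exp ?c = 1" using exp_integer_2pi[of "of_int l"] by (simp add: mult_ac)
  then have "exp (?c * complex_of_real (y + 1)) = exp (?c * complex_of_real y)"
    by (simp only: of_real_add of_real_1 distrib_left exp_add mult_1_right)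
  ultimately show ?thesis using False by simp
qed

section \<open>Zeros with multiplicity and Rolle's theorem\<close>

text \<open>A function bundled with all its derivatives, so that a linear relation between
  derivatives is an identity in \<open>s\<close> and multiplicities can be read off without
  computing derivatives.\<close>

definition jet :: "(nat \<Rightarrow> real \<Rightarrow> real) \<Rightarrow> bool" where
  "jet F \<longleftrightarrow> (\<forall>s x. (F s has_real_derivative F (Suc s) x) (at x))"

text \<open>A run of \<open>s + 1\<close> equal terms of \<open>t\<close> stands for a zero of multiplicity at least \<open>s + 1\<close>.\<close>
definition zero_seq :: "(nat \<Rightarrow> real \<Rightarrow> real) \<Rightarrow> (int \<Rightarrow> real) \<Rightarrow> bool" where
  "zero_seq F t \<longleftrightarrow> mono t \<and> (\<forall>i s. t (i + int s) = t i \<longrightarrow> F s (t i) = 0)"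

lemma jetD: "jet F \<Longrightarrow> (F s has_real_derivative F (Suc s) x) (at x)"
  by (simp add: jet_def)

lemma zero_seqD: "zero_seq F t \<Longrightarrow> t (i + int s) = t i \<Longrightarrow> F s (t i) = 0"
  by (simp add: zero_seq_def)

text \<open>The definition tests, for each start, the order equal to the length of the run;
  monotonicity squeezes the intermediate terms and so yields all lower orders.\<close>

lemma zero_seq_run:
  assumes "zero_seq F t" "t (i + int s) = t i" "r \<le> s"
  shows "F r (t i) = 0"
proof -
  have "t i \<le> t (i + int r)" "t (i + int r) \<le> t (i + int s)"
    using assms(1,3) by (auto simp: zero_seq_def elim!: monoD)
  then show ?thesis using assms by (intro zero_seqD[OF assms(1)]) auto
qed

text \<open>Rolle's theorem for \<open>e\<^sup>-\<^sup>\<sigma>\<^sup>x f(x)\<close>: passing to \<open>f' - \<sigma> f\<close> lowers each multiplicity by one and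
  adds one zero in each gap.\<close>
lemma zero_seq_rolle:
  assumes F: "jet F" and t: "zero_seq F t"
  obtains t' where "zero_seq (\<lambda>s x. F (Suc s) x - \<sigma> * F s x) t'"
    "\<And>i. t i \<le> t' i" "\<And>i. t' i \<le> t (i + 1)"
    "\<And>i s. t' (i + int (Suc s)) = t' i \<Longrightarrow> t (i + int (Suc (Suc s))) = t i"
proof -
  have mono: "mono t" using t by (simp add: zero_seq_def)
  have m1: "t i \<le> t j" if "i \<le> j" for i j using mono that by (rule monoD)
  have ex: "\<exists>\<xi>. t i < \<xi> \<and> \<xi> < t (i + 1) \<and> F 1 \<xi> - \<sigma> * F 0 \<xi> = 0" if lt: "t i < t (i + 1)" for i
  proof -
    let ?f = "\<lambda>x. exp (- \<sigma> * x) * F 0 x"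
    have der: "(?f has_real_derivative (exp (- \<sigma> * x) * (F 1 x - \<sigma> * F 0 x))) (at x)" for x
      using jetD[OF F, of 0 x] by (auto intro!: derivative_eq_intros simp: algebra_simps)
    have z: "F 0 (t i) = 0" "F 0 (t (i + 1)) = 0" using zero_seqD[OF t, of _ 0] by simp_all
    have "\<exists>\<xi>>t i. \<xi> < t (i + 1) \<and> ?f (t (i + 1)) - ?f (t i) = (t (i + 1) - t i) * (exp (- \<sigma> * \<xi>) * (F 1 \<xi> - \<sigma> * F 0 \<xi>))"
      using lt der by (intro MVT2) auto
    then show ?thesis using lt z by auto
  qed
  \<comment> \<open>In a proper gap an interior zero is chosen; between two equal terms the old
    point is kept, where the multiplicity drops by one.\<close>
  define t' where "t' i = (if t i < t (i + 1) then SOME \<xi>. t i < \<xi> \<and> \<xi> < t (i + 1) \<and> F 1 \<xi> - \<sigma> * F 0 \<xi> = 0 else t i)" for i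
  have gap: "t i < t' i \<and> t' i < t (i + 1) \<and> F 1 (t' i) - \<sigma> * F 0 (t' i) = 0" if "t i < t (i + 1)" for i
    unfolding t'_def using that someI_ex[OF ex[OF that]] by simp
  have eq: "t' i = t i" "t (i + 1) = t i" if "\<not> t i < t (i + 1)" for i
    using that m1[of i "i + 1"] by (auto simp: t'_def)
  have lo: "t i \<le> t' i" for i using gap[of i] eq[of i] by (cases "t i < t (i + 1)") auto
  have hi: "t' i \<le> t (i + 1)" for i using gap[of i] eq[of i] by (cases "t i < t (i + 1)") auto
  \<comment> \<open>A point chosen in a proper gap lies strictly inside it, so an equality of terms
    of \<open>t'\<close> cannot involve such a gap. Hence the run of \<open>t\<close> is one term
    longer than that of \<open>t'\<close>.\<close>
  have run: "t (i + int (Suc (Suc s))) = t i \<and> t' i = t i" if "t' (i + int (Suc s)) = t' i" for i s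
  proof -
    have 1: "t' i \<le> t (i + 1)" "t (i + 1) \<le> t (i + int (Suc s))" "t (i + int (Suc s)) \<le> t' (i + int (Suc s))"
      using hi lo by (auto intro: m1)
    have 2: "\<not> t i < t (i + 1)" using gap[of i] 1 that by auto
    have 3: "\<not> t (i + int (Suc s)) < t (i + int (Suc s) + 1)"
      using gap[of "i + int (Suc s)"] 1 that by auto
    show ?thesis using 1 eq[OF 2] eq[OF 3] that by (auto simp: algebra_simps)
  qed
  have mono': "t' i \<le> t' j" if "i \<le> j" for i j
  proof (cases "i = j")
    case False
    then have "t (i + 1) \<le> t j" using that by (intro m1) auto
    then show ?thesis using hi[of i] lo[of j] by auto
  qed auto
  have "zero_seq (\<lambda>s x. F (Suc s) x - \<sigma> * F s x) t'"
    unfolding zero_seq_def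
  proof (intro conjI allI impI)
    show "mono t'" using mono' by (intro monoI) auto
    fix i s assume *: "t' (i + int s) = t' i"
    show "F (Suc s) (t' i) - \<sigma> * F s (t' i) = 0"
    proof (cases s)
      case 0
      show ?thesis
      proof (cases "t i < t (i + 1)")
        case False
        then have "t (i + int 1) = t i" using eq[of i] by auto
        then show ?thesis using zero_seq_run[OF t, of i 1] eq(1)[OF False] 0 by simp
      qed (use gap[of i] 0 in auto)
    next
      case (Suc r)
      from run[of i r] * Suc have "t (i + int (Suc (Suc r))) = t i" "t' i = t i" by auto
      then show ?thesis using zero_seq_run[OF t, of i "Suc (Suc r)"] Suc by simp
    qed
  qed
  then show ?thesis using that lo hi run by blast
qed

section \<open>Products of jets by Leibniz's rule\<close>

definition jet_prod :: "(nat \<Rightarrow> real \<Rightarrow> real) \<Rightarrow> (nat \<Rightarrow> real \<Rightarrow> real) \<Rightarrow> nat \<Rightarrow> real \<Rightarrow> real" where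
  "jet_prod E F s x = (\<Sum>i\<le>s. real (s choose i) * E i x * F (s - i) x)"

lemma jet_jet_prod:
  assumes E: "jet E" and F: "jet F"
  shows "jet (jet_prod E F)"
  unfolding jet_def
proof (intro allI)
  fix s x
  have "((\<lambda>x. \<Sum>i\<le>s. real (s choose i) * E i x * F (s - i) x) has_real_derivative
      (\<Sum>i\<le>s. real (s choose i) * E (Suc i) x * F (s - i) x + real (s choose i) * E i x * F (Suc (s - i)) x)) (at x)"
    by (auto intro!: derivative_eq_intros sum.cong jetD[OF E] jetD[OF F] simp: algebra_simps)
  moreover have "(\<Sum>i\<le>s. real (s choose i) * E (Suc i) x * F (s - i) x + real (s choose i) * E i x * F (Suc (s - i)) x)
      = (\<Sum>i\<le>s. real (s choose i) * E (Suc i) x * F (s - i) x) + (\<Sum>i\<le>Suc s. real (s choose i) * E i x * F (Suc s - i) x)"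
    by (simp add: sum.distrib Suc_diff_le binomial_eq_0)
  moreover have "(\<Sum>i\<le>Suc s. real (s choose i) * E i x * F (Suc s - i) x)
     = E 0 x * F (Suc s) x + (\<Sum>i\<le>s. real (s choose Suc i) * E (Suc i) x * F (s - i) x)"
    by (simp add: sum.atMost_Suc_shift del: sum.atMost_Suc)
  moreover have "(\<Sum>i\<le>s. real (s choose i) * E (Suc i) x * F (s - i) x) + (E 0 x * F (Suc s) x + (\<Sum>i\<le>s. real (s choose Suc i) * E (Suc i) x * F (s - i) x))
      = E 0 x * F (Suc s) x + (\<Sum>i\<le>s. real (Suc s choose Suc i) * E (Suc i) x * F (s - i) x)"
    by (simp add: sum.distrib ring_distribs)
  moreover have "\<dots> = (\<Sum>i\<le>Suc s. real (Suc s choose i) * E i x * F (Suc s - i) x)"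
    by (simp add: sum.atMost_Suc_shift del: sum.atMost_Suc binomial_Suc_Suc)
  ultimately show "(jet_prod E F s has_real_derivative jet_prod E F (Suc s) x) (at x)"
    unfolding jet_prod_def[abs_def] by (simp only:)
qed

text \<open>Derivatives are unique, so the zeroth component determines a jet. An identity between
  functions thus passes to all derivatives at no cost.\<close>

lemma jet_unique:
  assumes "jet F" "jet H" "\<And>x. F 0 x = H 0 x"
  shows "F s = H s"
proof (induction s)
  case (Suc s)
  show ?case
  proof
    fix x
    have "(F s has_real_derivative H (Suc s) x) (at x)" unfolding Suc by (rule jetD[OF assms(2)])
    then show "F (Suc s) x = H (Suc s) x" by (rule DERIV_unique[OF jetD[OF assms(1)]])
  qed
qed (use assms in auto)

text \<open>By Leibniz's rule \<open>H s\<close> is a combination of the \<open>F r\<close> with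
  \<open>r \<le> s\<close>, and these all vanish along a run. This allows a series to be replaced by
  a smooth multiple that is a theta series.\<close>

lemma zero_seq_mult:
  assumes "jet E" "jet F" "jet H" "\<And>x. H 0 x = E 0 x * F 0 x" "zero_seq F t"
  shows "zero_seq H t"
  unfolding zero_seq_def
proof (intro conjI allI impI)
  show "mono t" using assms by (simp add: zero_seq_def)
  fix i s assume *: "t (i + int s) = t i"
  have "H s = jet_prod E F s"
    by (rule jet_unique[OF assms(3) jet_jet_prod[OF assms(1,2)]]) (simp add: jet_prod_def assms(4))
  then show "H s (t i) = 0"
    unfolding jet_prod_def by (simp add: zero_seq_run[OF assms(5) *])
qed

section \<open>Series of integer translates and uniqueness from zeros\<close>

definition decay_jet :: "real \<Rightarrow> (nat \<Rightarrow> real \<Rightarrow> real) \<Rightarrow> bool" where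
  "decay_jet \<kappa> G \<longleftrightarrow> jet G \<and> (\<forall>s. \<exists>C. \<forall>x. \<bar>G s x\<bar> \<le> C * exp (- \<kappa> * \<bar>x\<bar>))"

definition shift_series :: "(int \<Rightarrow> real) \<Rightarrow> (nat \<Rightarrow> real \<Rightarrow> real) \<Rightarrow> nat \<Rightarrow> real \<Rightarrow> real" where
  "shift_series c G s x = (\<Sum>\<^sub>\<infinity>k. c k * G s (x - of_int k))"

definition zero_uniq :: "real \<Rightarrow> (nat \<Rightarrow> real \<Rightarrow> real) \<Rightarrow> bool" where
  "zero_uniq \<epsilon> G \<longleftrightarrow> (\<forall>c C \<theta> K t. (\<forall>k. \<bar>c k\<bar> \<le> C * exp (\<epsilon> * \<bar>of_int k\<bar>)) \<longrightarrow> 0 < \<theta> \<longrightarrow> \<theta> < 1 \<longrightarrow>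
     (\<forall>i. \<bar>t i - \<theta> * of_int i\<bar> \<le> K) \<longrightarrow> zero_seq (shift_series c G) t \<longrightarrow> (\<forall>k. c k = 0))"

lemma bound_const_nonneg:
  fixes C u v :: real
  assumes "\<bar>u\<bar> \<le> C * exp v"
  shows "C \<ge> 0"
proof -
  have "0 \<le> C * exp v" using assms by linarith
  then show ?thesis by (simp add: zero_le_mult_iff)
qed

text \<open>A majorant that is uniform for \<open>\<bar>x\<bar> \<le> R\<close> and summable over
  \<open>k\<close> as soon as \<open>\<epsilon> < \<kappa>\<close>; it serves for summability,
  termwise differentiation and passage to the limit alike.\<close>

lemma shift_term_bound:
  fixes c :: "int \<Rightarrow> real"
  assumes c: "\<bar>c k\<bar> \<le> C * exp (\<epsilon> * \<bar>of_int k\<bar>)" and G: "\<And>x. \<bar>G x\<bar> \<le> D * exp (- \<kappa> * \<bar>x\<bar>)"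
    and x: "\<bar>x\<bar> \<le> R" and \<kappa>: "\<kappa> \<ge> 0"
  shows "\<bar>c k * G (x - of_int k)\<bar> \<le> C * D * exp (\<kappa> * R) * exp (- (\<kappa> - \<epsilon>) * \<bar>of_int k - 0\<bar>)"
proof -
  have C: "C \<ge> 0" using c by (rule bound_const_nonneg)
  have D: "D \<ge> 0" using G[of 0] abs_ge_zero[of "G 0"] by simp
  have "\<kappa> * \<bar>of_int k\<bar> \<le> \<kappa> * (\<bar>x - of_int k\<bar> + R)" using \<kappa> x by (intro mult_left_mono) auto
  then have e: "\<epsilon> * \<bar>of_int k\<bar> + (- \<kappa> * \<bar>x - of_int k\<bar>) \<le> \<kappa> * R + (- (\<kappa> - \<epsilon>) * \<bar>of_int k - 0\<bar>)"
    by (simp add: algebra_simps)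
  have "\<bar>c k * G (x - of_int k)\<bar> \<le> (C * exp (\<epsilon> * \<bar>of_int k\<bar>)) * (D * exp (- \<kappa> * \<bar>x - of_int k\<bar>))"
    unfolding abs_mult using c G C by (intro mult_mono) auto
  also have "\<dots> = C * D * exp (\<epsilon> * \<bar>of_int k\<bar> + (- \<kappa> * \<bar>x - of_int k\<bar>))"
    by (simp only: exp_add mult_ac)
  also have "\<dots> \<le> C * D * exp (\<kappa> * R + (- (\<kappa> - \<epsilon>) * \<bar>of_int k - 0\<bar>))"
    using C D e by (intro mult_left_mono) auto
  finally show ?thesis by (simp add: exp_add mult_ac)
qed

lemma shift_series_summable:
  assumes "decay_jet \<kappa> G" "\<And>k. \<bar>c k\<bar> \<le> C * exp (\<epsilon> * \<bar>of_int k\<bar>)" "\<epsilon> < \<kappa>" "\<kappa> \<ge> 0"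
  shows "(\<lambda>k. c k * G s (x - of_int k)) summable_on UNIV"
proof -
  obtain D where D: "\<And>x. \<bar>G s x\<bar> \<le> D * exp (- \<kappa> * \<bar>x\<bar>)" using assms(1) by (auto simp: decay_jet_def)
  have "(\<lambda>k. norm (c k * G s (x - of_int k))) summable_on UNIV"
    using assms shift_term_bound[where c = c and G = "G s", OF assms(2) D order_refl assms(4)]
    by (intro abs_summable_on_exp_bound[where \<kappa> = "\<kappa> - \<epsilon>" and x = 0]) auto
  then show ?thesis by (rule summable_on_iff_abs_summable_on_real[THEN iffD2])
qed

lemma jet_shift_series:
  assumes "decay_jet \<kappa> G" "\<And>k. \<bar>c k\<bar> \<le> C * exp (\<epsilon> * \<bar>of_int k\<bar>)" "\<epsilon> < \<kappa>" "\<kappa> \<ge> 0"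
  shows "jet (shift_series c G)"
  unfolding jet_def shift_series_def
proof (intro allI has_real_derivative_infsum_int)
  have j: "jet G" using assms(1) by (simp add: decay_jet_def)
  fix s k x
  have "((\<lambda>x. c k * G s (x - of_int k)) has_real_derivative c k * (G (Suc s) (x - of_int k) * 1)) (at x)"
    by (intro DERIV_cmult DERIV_chain2[where f = "G s"] jetD[OF j]) (auto intro!: derivative_eq_intros)
  then show "((\<lambda>x. c k * G s (x - of_int k)) has_real_derivative c k * G (Suc s) (x - of_int k)) (at x)" by simp
  show "(\<lambda>k. c k * G s (x - of_int k)) summable_on UNIV" by (rule shift_series_summable[OF assms])
next
  fix s x R
  obtain D where D: "\<And>x. \<bar>G (Suc s) x\<bar> \<le> D * exp (- \<kappa> * \<bar>x\<bar>)" using assms(1) by (auto simp: decay_jet_def)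
  have "\<forall>k. \<forall>x. \<bar>x\<bar> \<le> R \<longrightarrow> \<bar>c k * G (Suc s) (x - of_int k)\<bar> \<le> C * D * exp (\<kappa> * R) * exp (- (\<kappa> - \<epsilon>) * \<bar>of_int k - 0\<bar>)"
    using shift_term_bound[where c = c and G = "G (Suc s)", OF assms(2) D _ assms(4)] by blast
  moreover have "(\<lambda>k::int. C * D * exp (\<kappa> * R) * exp (- (\<kappa> - \<epsilon>) * \<bar>of_int k - 0\<bar>)) summable_on UNIV"
    using assms by (intro summable_on_cmult_right summable_on_exp_int) auto
  ultimately show "\<exists>M. M summable_on UNIV \<and> (\<forall>k. \<forall>x. \<bar>x\<bar> \<le> R \<longrightarrow> \<bar>c k * G (Suc s) (x - of_int k)\<bar> \<le> M k)" by blast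
qed

lemma zero_uniq_step:
  assumes G: "decay_jet \<kappa> G" and H: "decay_jet \<kappa> H" and \<epsilon>: "\<epsilon> < \<kappa>" "\<kappa> \<ge> 0" and \<delta>: "\<delta> \<noteq> 0"
    and rel: "\<And>s x. H s x + \<delta> * H (Suc s) x = G s x" and uniq: "zero_uniq \<epsilon> G"
  shows "zero_uniq \<epsilon> H"
  unfolding zero_uniq_def
proof (intro allI impI)
  fix c C \<theta> K t k
  assume c: "\<forall>k. \<bar>c k\<bar> \<le> C * exp (\<epsilon> * \<bar>of_int k\<bar>)" and \<theta>: "0 < \<theta>" "\<theta> < 1"
    and t: "\<forall>i. \<bar>t i - \<theta> * of_int i\<bar> \<le> K" and z: "zero_seq (shift_series c H) t"
  have c': "\<And>k. \<bar>c k\<bar> \<le> C * exp (\<epsilon> * \<bar>of_int k\<bar>)" using c by blast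
  \<comment> \<open>With \<open>\<sigma> = - 1 / \<delta>\<close> the combination
    \<open>F' - \<sigma> F\<close> equals \<open>(F + \<delta> F') / \<delta>\<close>, which is the
    series of \<open>G\<close> up to a constant factor.\<close>
  obtain t' where t': "zero_seq (\<lambda>s x. shift_series c H (Suc s) x - (- 1 / \<delta>) * shift_series c H s x) t'"
    "\<And>i. t i \<le> t' i" "\<And>i. t' i \<le> t (i + 1)"
    by (rule zero_seq_rolle[OF jet_shift_series[OF H c' \<epsilon>] z, of "- 1 / \<delta>"]) blast
  have "shift_series c G s x = \<delta> * (shift_series c H (Suc s) x - (- 1 / \<delta>) * shift_series c H s x)" for s x
  proof -
    note sm = shift_series_summable[OF H c' \<epsilon>]
    have "shift_series c G s x = (\<Sum>\<^sub>\<infinity>k. c k * H s (x - of_int k) + \<delta> * (c k * H (Suc s) (x - of_int k)))"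
      unfolding shift_series_def rel[symmetric] by (simp add: algebra_simps)
    also have "\<dots> = shift_series c H s x + \<delta> * shift_series c H (Suc s) x"
      unfolding shift_series_def
      by (subst infsum_add[OF sm summable_on_cmult_right[OF sm]], subst infsum_cmult_right[OF sm], rule refl)
    finally show ?thesis using \<delta> by (simp add: field_simps)
  qed
  then have z': "zero_seq (shift_series c G) t'" using t'(1) unfolding zero_seq_def by auto
  \<comment> \<open>The new point lies between two neighbours of the old sequence, whose ideal
    positions differ by \<open>\<theta> < 1\<close>; only \<open>K\<close> changes.\<close>
  have "\<bar>t' i - \<theta> * of_int i\<bar> \<le> K + 1" for i
    using t'(2,3)[of i] spec[OF t, of i] spec[OF t, of "i + 1"] \<theta> by (simp add: algebra_simps abs_le_iff)
  then show "c k = 0" using uniq c \<theta> z' unfolding zero_uniq_def by blast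
qed

text \<open>Since \<open>- a * k\<^sup>2 + 2 * a * k * x = a * x\<^sup>2 - a * (x -
  k)\<^sup>2\<close>, this is a series of translated Gaussians multiplied by
  \<open>exp (a * x\<^sup>2)\<close>, or its derivative of order \<open>s\<close>. In this form
  \<open>x\<close> enters only through powers of \<open>exp (2 * a * x)\<close>.\<close>

definition theta_series :: "real \<Rightarrow> (int \<Rightarrow> real) \<Rightarrow> nat \<Rightarrow> real \<Rightarrow> real" where
  "theta_series a d s x = (\<Sum>\<^sub>\<infinity>k. d k * ((2 * a * of_int k) ^ s * exp (- a * (of_int k)\<^sup>2 + 2 * a * of_int k * x)))"

lemma pow_le_fact_exp: "u ^ s \<le> fact s * exp (u::real)" if "u \<ge> 0"
proof -
  have s: "(\<lambda>n. u ^ n / fact n) sums exp u" using exp_converges[of u] by (simp add: field_simps)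
  have "u ^ s / fact s \<le> (\<Sum>n. u ^ n / fact n)"
    using sum_le_suminf[of "\<lambda>n. u ^ n / fact n" "{s}"] s that by (auto simp: sums_iff)
  then show ?thesis using s by (simp add: sums_iff field_simps)
qed

lemma quadratic_le: "a > 0 \<Longrightarrow> D * u - a * u\<^sup>2 \<le> D\<^sup>2 / (4 * a)" for a D u :: real
proof -
  assume a: "a > 0"
  have "0 \<le> (2 * a * u - D)\<^sup>2" by simp
  then show ?thesis using a by (simp add: field_simps power2_eq_square)
qed

text \<open>All linear terms in the absolute value of \<open>k\<close> are collected, together with
  one to spare for summability, and the Gaussian factor absorbs them by completing the square. Hence
  any exponential growth rate \<open>B\<close> of the coefficients is harmless.\<close>

lemma theta_term_bound:
  fixes d :: "int \<Rightarrow> real"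
  assumes a: "a > 0" and d: "\<bar>d k\<bar> \<le> C * exp (B * \<bar>of_int k\<bar>)" and x: "\<bar>x\<bar> \<le> R"
  shows "\<bar>d k * ((2 * a * of_int k) ^ s * exp (- a * (of_int k)\<^sup>2 + 2 * a * of_int k * x))\<bar>
     \<le> C * fact s * exp ((B + 2 * a + 2 * a * R + 1)\<^sup>2 / (4 * a)) * exp (- 1 * \<bar>of_int k - 0\<bar>)"
proof -
  let ?k = "\<bar>of_int k\<bar> :: real"
  have C: "C \<ge> 0" using d by (rule bound_const_nonneg)
  have "of_int k * x \<le> ?k * R" 
  proof -
    have "of_int k * x \<le> ?k * \<bar>x\<bar>" unfolding abs_mult[symmetric] by simp
    also have "\<dots> \<le> ?k * R" using x by (intro mult_left_mono) auto
    finally show ?thesis .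
  qed
  then have "2 * a * (of_int k * x) \<le> 2 * a * (?k * R)" using a by (intro mult_left_mono) auto
  then have "- a * (of_int k)\<^sup>2 + 2 * a * of_int k * x + 2 * a * ?k + B * ?k + ?k \<le> (B + 2 * a + 2 * a * R + 1) * ?k - a * ?k\<^sup>2"
    by (simp add: algebra_simps)
  also have "\<dots> \<le> (B + 2 * a + 2 * a * R + 1)\<^sup>2 / (4 * a)" by (rule quadratic_le[OF a])
  finally have e: "B * ?k + 2 * a * ?k + (- a * (of_int k)\<^sup>2 + 2 * a * of_int k * x) \<le> (B + 2 * a + 2 * a * R + 1)\<^sup>2 / (4 * a) + - 1 * \<bar>of_int k - 0\<bar>"
    by simp
  have "\<bar>(2 * a * of_int k) ^ s\<bar> \<le> fact s * exp (2 * a * ?k)"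
    using pow_le_fact_exp[of "2 * a * ?k" s] a by (simp add: power_abs abs_mult)
  then have "\<bar>d k * ((2 * a * of_int k) ^ s * exp (- a * (of_int k)\<^sup>2 + 2 * a * of_int k * x))\<bar>
     \<le> (C * exp (B * ?k)) * ((fact s * exp (2 * a * ?k)) * exp (- a * (of_int k)\<^sup>2 + 2 * a * of_int k * x))"
    unfolding abs_mult using d C by (intro mult_mono) auto
  also have "\<dots> = C * fact s * exp (B * ?k + 2 * a * ?k + (- a * (of_int k)\<^sup>2 + 2 * a * of_int k * x))"
    by (simp only: exp_add mult_ac)
  also have "\<dots> \<le> C * fact s * exp ((B + 2 * a + 2 * a * R + 1)\<^sup>2 / (4 * a) + - 1 * \<bar>of_int k - 0\<bar>)"
    using C e by (intro mult_left_mono) auto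
  finally show ?thesis by (simp only: exp_add mult_ac)
qed

lemma theta_series_summable:
  fixes d :: "int \<Rightarrow> real"
  assumes a: "a > 0" and d: "\<And>k. \<bar>d k\<bar> \<le> C * exp (B * \<bar>of_int k\<bar>)"
  shows "(\<lambda>k. d k * ((2 * a * of_int k) ^ s * exp (- a * (of_int k)\<^sup>2 + 2 * a * of_int k * x))) summable_on UNIV"
proof -
  have "(\<lambda>k. norm (d k * ((2 * a * of_int k) ^ s * exp (- a * (of_int k)\<^sup>2 + 2 * a * of_int k * x)))) summable_on UNIV"
    using theta_term_bound[where d = d and x = x and R = "\<bar>x\<bar>" and s = s, OF a d order_refl]
    by (intro abs_summable_on_exp_bound[where \<kappa> = 1 and x = 0]) auto
  then show ?thesis by (rule summable_on_iff_abs_summable_on_real[THEN iffD2])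
qed

lemma jet_theta_series:
  assumes a: "a > 0" and d: "\<And>k. \<bar>d k\<bar> \<le> C * exp (B * \<bar>of_int k\<bar>)"
  shows "jet (theta_series a d)"
  unfolding jet_def theta_series_def
proof (intro allI has_real_derivative_infsum_int)
  fix s k x
  show "((\<lambda>x. d k * ((2 * a * of_int k) ^ s * exp (- a * (of_int k)\<^sup>2 + 2 * a * of_int k * x))) has_real_derivative
      d k * ((2 * a * of_int k) ^ Suc s * exp (- a * (of_int k)\<^sup>2 + 2 * a * of_int k * x))) (at x)"
    by (auto intro!: derivative_eq_intros)
  show "(\<lambda>k. d k * ((2 * a * of_int k) ^ s * exp (- a * (of_int k)\<^sup>2 + 2 * a * of_int k * x))) summable_on UNIV"
    by (rule theta_series_summable[OF assms])
next
  fix s x R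
  have "\<forall>k. \<forall>x. \<bar>x\<bar> \<le> R \<longrightarrow> \<bar>d k * ((2 * a * of_int k) ^ Suc s * exp (- a * (of_int k)\<^sup>2 + 2 * a * of_int k * x))\<bar>
     \<le> C * fact (Suc s) * exp ((B + 2 * a + 2 * a * R + 1)\<^sup>2 / (4 * a)) * exp (- 1 * \<bar>of_int k - 0\<bar>)"
    using theta_term_bound[where d = d, OF a d] by blast
  moreover have "(\<lambda>k::int. C * fact (Suc s) * exp ((B + 2 * a + 2 * a * R + 1)\<^sup>2 / (4 * a)) * exp (- 1 * \<bar>of_int k - 0\<bar>)) summable_on UNIV"
    by (intro summable_on_cmult_right summable_on_exp_int) auto
  ultimately show "\<exists>M. M summable_on UNIV \<and> (\<forall>k. \<forall>x. \<bar>x\<bar> \<le> R \<longrightarrow>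
     \<bar>d k * ((2 * a * of_int k) ^ Suc s * exp (- a * (of_int k)\<^sup>2 + 2 * a * of_int k * x))\<bar> \<le> M k)" by blast
qed

section \<open>Theta series\<close>

text \<open>Multiplication by the exponential of frequency \<open>- m\<close> and integration over a
  unit interval leave only \<open>a m\<close>; absolute convergence makes the limit uniform.\<close>

lemma fourier_series_unique:
  fixes a :: "int \<Rightarrow> complex"
  assumes a: "(\<lambda>k. norm (a k)) summable_on UNIV"
    and z: "\<And>x. (\<Sum>\<^sub>\<infinity>k. a k * exp (2 * pi * \<i> * of_int k * complex_of_real x)) = 0"
  shows "a m = 0"
proof -
  let ?e = "\<lambda>l x. exp (2 * pi * \<i> * of_int l * complex_of_real x)"
  have "uniform_limit (cbox 0 1) (\<lambda>X x. \<Sum>k\<in>X. a k * ?e (k - m) x) (\<lambda>x. \<Sum>\<^sub>\<infinity>k. a k * ?e (k - m) x) (finite_subsets_at_top UNIV)"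
    by (intro Weierstrass_m_test_general[OF _ a]) (simp add: norm_mult)
  moreover have "(\<Sum>\<^sub>\<infinity>k. a k * ?e (k - m) x) = 0" for x
  proof -
    have "(\<Sum>\<^sub>\<infinity>k. a k * ?e (k - m) x) = (\<Sum>\<^sub>\<infinity>k. ?e (- m) x * (a k * ?e k x))"
      by (simp add: exp_add[symmetric] algebra_simps)
    also have "\<dots> = ?e (- m) x * (\<Sum>\<^sub>\<infinity>k. a k * ?e k x)" by (rule infsum_cmult_right')
    finally show ?thesis using z by simp
  qed
  ultimately have "uniform_limit (cbox 0 1) (\<lambda>X x. \<Sum>k\<in>X. a k * ?e (k - m) x) (\<lambda>x::real. 0) (finite_subsets_at_top UNIV)"
    by simp
  then obtain I J where I: "\<And>X. ((\<lambda>x. \<Sum>k\<in>X. a k * ?e (k - m) x) has_integral I X) (cbox 0 1)"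
    and J: "((\<lambda>x. 0) has_integral J) (cbox 0 (1::real))" and lim: "(I \<longlongrightarrow> J) (finite_subsets_at_top UNIV)"
    by (rule uniform_limit_integral_cbox) (auto intro!: continuous_intros)
  have "J = 0" using J by (metis has_integral_0_eq)
  have ev: "I X = a m" if "finite X" "m \<in> X" for X
  proof -
    have "((\<lambda>x. \<Sum>k\<in>X. a k * ?e (k - m) x) has_integral (\<Sum>k\<in>X. a k * (if k - m = 0 then 1 else 0))) (cbox 0 1)"
      unfolding cbox_interval
      by (intro has_integral_sum that has_integral_mult_right has_integral_exp_int[of _ 0, unfolded add_0_left])
    then have "I X = (\<Sum>k\<in>X. a k * (if k - m = 0 then 1 else 0))" using I has_integral_unique by blast
    also have "\<dots> = (\<Sum>k\<in>X. if k = m then a k else 0)" by (intro sum.cong) auto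
    finally show ?thesis using that by (simp add: sum.delta)
  qed
  have "\<forall>\<^sub>F X in finite_subsets_at_top UNIV. I X = a m"
    unfolding eventually_finite_subsets_at_top by (intro exI[of _ "{m}"]) (use ev in auto)
  then have "(I \<longlongrightarrow> a m) (finite_subsets_at_top UNIV)" by (rule tendsto_eventually)
  with lim \<open>J = 0\<close> show ?thesis using tendsto_unique finite_subsets_at_top_neq_bot by metis
qed

text \<open>Zeros are divided out one at a time, each quotient extending over a removable
  singularity. The zeros are distinct, so the linear factors already divided out do not vanish at
  the next one.\<close>

lemma holomorphic_factor_prod:
  assumes "open A" "finite Z" "Z \<subseteq> A" "f holomorphic_on A" "\<And>z. z \<in> Z \<Longrightarrow> f z = 0"
  shows "\<exists>g. g holomorphic_on A \<and> (\<forall>w\<in>A. f w = g w * (\<Prod>z\<in>Z. w - z))"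
  using assms(2-5)
proof (induction Z)
  case empty
  then show ?case by auto
next
  case (insert z Z)
  then obtain g where g: "g holomorphic_on A" "\<forall>w\<in>A. f w = g w * (\<Prod>z\<in>Z. w - z)" by auto
  have "(\<Prod>y\<in>Z. z - y) \<noteq> 0" using insert by auto
  then have gz: "g z = 0" using g(2) insert by (metis insertI1 mult_eq_0_iff subsetD)
  define h where "h w = (if w = z then deriv g z else g w / (w - z))" for w
  have h: "h holomorphic_on A"
    by (rule pole_theorem_open_0[OF g(1) assms(1), where a = z]) (auto simp: h_def gz)
  have "g w = h w * (w - z)" for w by (auto simp: h_def gz)
  then show ?case using g(2) h insert by (intro exI[of _ h]) (auto simp: mult_ac)
qed

text \<open>The theta series in the variable \<open>w = exp (2 * a * x)\<close>, extended to complex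
  \<open>w\<close>.\<close>

definition laurent :: "real \<Rightarrow> (int \<Rightarrow> real) \<Rightarrow> complex \<Rightarrow> complex" where
  "laurent a d w = (\<Sum>\<^sub>\<infinity>k. of_real (d k * exp (- a * (of_int k)\<^sup>2)) * w powi k)"

text \<open>For \<open>norm w = exp (2 * a * X)\<close> the exponent is
  \<open>a * X\<^sup>2 - a * (k - X)\<^sup>2\<close>. The terms concentrate near
  \<open>k = X\<close>, and what remains is the growth \<open>exp (a * X\<^sup>2)\<close>, which
  later competes with the number of zeros.\<close>

lemma laurent_term_bound:
  fixes d :: "int \<Rightarrow> real" and w :: complex
  assumes a: "a > 0" and d: "\<bar>d k\<bar> \<le> C * exp (B * \<bar>of_int k\<bar>)" and B: "B \<ge> 0"
    and w: "w \<noteq> 0" "norm w = exp (2 * a * X)"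
  shows "norm (of_real (d k * exp (- a * (of_int k)\<^sup>2)) * w powi k)
    \<le> C * exp ((B + 1)\<^sup>2 / (4 * a) + a * X\<^sup>2 + B * \<bar>X\<bar>) * exp (- 1 * \<bar>of_int k - X\<bar>)"
proof -
  let ?k = "of_int k :: real"
  have C: "C \<ge> 0" using d by (rule bound_const_nonneg)
  have "norm (of_real (d k * exp (- a * ?k\<^sup>2)) * w powi k) = \<bar>d k\<bar> * exp (- a * ?k\<^sup>2 + ?k * (2 * a * X))"
    unfolding norm_mult norm_power_int w exp_power_int norm_of_real abs_mult exp_add by simp
  also have "\<dots> \<le> (C * exp (B * \<bar>?k\<bar>)) * exp (- a * ?k\<^sup>2 + ?k * (2 * a * X))"
    using d by (intro mult_right_mono) auto
  also have "\<dots> = C * exp (B * \<bar>?k\<bar> + (- a * ?k\<^sup>2 + ?k * (2 * a * X)))" by (simp only: exp_add mult_ac)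
  also have "\<dots> \<le> C * exp ((B + 1)\<^sup>2 / (4 * a) + a * X\<^sup>2 + B * \<bar>X\<bar> + (- 1 * \<bar>?k - X\<bar>))"
  proof -
    have "B * \<bar>?k\<bar> \<le> B * (\<bar>?k - X\<bar> + \<bar>X\<bar>)" using B by (intro mult_left_mono) auto
    moreover have "(B + 1) * \<bar>?k - X\<bar> - a * \<bar>?k - X\<bar>\<^sup>2 \<le> (B + 1)\<^sup>2 / (4 * a)" by (rule quadratic_le[OF a])
    moreover have "\<bar>?k - X\<bar>\<^sup>2 = ?k\<^sup>2 - 2 * ?k * X + X\<^sup>2" by (simp add: power2_eq_square algebra_simps)
    then have "a * \<bar>?k - X\<bar>\<^sup>2 = a * ?k\<^sup>2 - ?k * (2 * a * X) + a * X\<^sup>2" by (simp only:) (simp add: algebra_simps)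
    ultimately have "B * \<bar>?k\<bar> + (- a * ?k\<^sup>2 + ?k * (2 * a * X)) \<le> (B + 1)\<^sup>2 / (4 * a) + a * X\<^sup>2 + B * \<bar>X\<bar> + (- 1 * \<bar>?k - X\<bar>)"
      by (simp add: algebra_simps)
    then show ?thesis using C by (intro mult_left_mono) auto
  qed
  finally show ?thesis by (simp only: exp_add mult_ac)
qed

context
  fixes a B C :: real and d :: "int \<Rightarrow> real"
  assumes a: "a > 0" and B: "B \<ge> 0" and d: "\<And>k. \<bar>d k\<bar> \<le> C * exp (B * \<bar>of_int k\<bar>)"
begin

lemma laurent_abs_summable:
  fixes w :: complex
  assumes "w \<noteq> 0"
  shows "(\<lambda>k. norm (of_real (d k * exp (- a * (of_int k)\<^sup>2)) * w powi k)) summable_on UNIV"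
proof -
  define X where "X = ln (norm w) / (2 * a)"
  have X: "norm w = exp (2 * a * X)" using assms a by (simp add: X_def)
  show ?thesis
    by (rule abs_summable_on_exp_bound[OF _ laurent_term_bound[where d = d, OF a d B assms X]]) simp
qed

lemma laurent_bound:
  assumes "norm w = exp (2 * a * X)"
  shows "norm (laurent a d w) \<le> 4 * C * exp ((B + 1)\<^sup>2 / (4 * a)) * exp (a * X\<^sup>2 + B * \<bar>X\<bar>)"
proof -
  have w: "w \<noteq> 0" using assms by auto
  have C: "C \<ge> 0" using d by (rule bound_const_nonneg)
  let ?M = "C * exp ((B + 1)\<^sup>2 / (4 * a) + a * X\<^sup>2 + B * \<bar>X\<bar>)"
  have "norm (laurent a d w) \<le> (\<Sum>\<^sub>\<infinity>k. norm (of_real (d k * exp (- a * (of_int k)\<^sup>2)) * w powi k))"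
    unfolding laurent_def by (rule norm_infsum_bound[OF laurent_abs_summable[OF w]])
  also have "\<dots> \<le> (\<Sum>\<^sub>\<infinity>k::int. ?M * exp (- 1 * \<bar>of_int k - X\<bar>))"
    by (intro infsum_mono laurent_abs_summable[OF w] summable_on_cmult_right summable_on_exp_int
        laurent_term_bound[where d = d, OF a d B w assms]) simp
  also have "\<dots> = ?M * (\<Sum>\<^sub>\<infinity>k::int. exp (- 1 * \<bar>of_int k - X\<bar>))" by (rule infsum_cmult_right')
  also have "\<dots> \<le> ?M * (2 * (1 + 1 / 1))" using C by (intro mult_left_mono infsum_exp_int_bound) auto
  finally show ?thesis by (simp add: exp_add mult_ac)
qed

lemma laurent_holomorphic: "laurent a d holomorphic_on - {0}"
proof (rule holomorphic_uniform_sequence)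
  let ?u = "\<lambda>k w. complex_of_real (d k * exp (- a * (of_int k)\<^sup>2)) * w powi k"
  show "open (- {0 :: complex})" by auto
  show "(\<lambda>w. \<Sum>i<n. ?u (int_decode i) w) holomorphic_on - {0}" for n
    by (intro holomorphic_intros) auto
  fix z :: complex assume "z \<in> - {0}"
  then have z: "z \<noteq> 0" by simp
  define r where "r = norm z / 2"
  have r: "r > 0" using z by (simp add: r_def)
  have nz: "w \<noteq> 0" "r \<le> norm w" "norm w \<le> 3 * r" if "w \<in> cball z r" for w
  proof -
    have "norm (z - w) \<le> r" using that by (simp add: dist_norm)
    then show "r \<le> norm w" "norm w \<le> 3 * r" using norm_triangle_ineq2[of z w] norm_triangle_ineq2[of w z]
      by (auto simp: r_def norm_minus_commute)
    then show "w \<noteq> 0" using r by auto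
  qed
  have subs: "cball z r \<subseteq> - {0}" using nz(1) by blast
  \<comment> \<open>The modulus of \<open>w powi k\<close> is monotone in that of \<open>w\<close>,
    increasing or decreasing with the sign of \<open>k\<close>, so on the disc every term is
    dominated by its values at the two radii \<open>r\<close> and \<open>3 * r\<close>.\<close>
  let ?M = "\<lambda>k. norm (?u k (of_real r)) + norm (?u k (of_real (3 * r)))"
  have M: "(\<lambda>k. norm (?M k)) summable_on UNIV"
    using r by (intro summable_on_iff_abs_summable_on_real[THEN iffD1] summable_on_add laurent_abs_summable) auto
  have le: "norm (?u k w) \<le> ?M k" if "w \<in> cball z r" for k w
  proof (cases "k \<ge> 0")
    case True
    then have "norm w powi k \<le> (3 * r) powi k" using nz[OF that] by (intro power_int_mono) auto
    then have "norm (?u k w) \<le> norm (?u k (of_real (3 * r)))" using r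
      by (simp add: norm_mult norm_power_int mult_left_mono)
    then show ?thesis by (simp add: add_increasing)
  next
    case False
    then have "norm w powi k \<le> r powi k" using nz[OF that] r by (intro power_int_antimono) auto
    then have "norm (?u k w) \<le> norm (?u k (of_real r))" using r
      by (simp add: norm_mult norm_power_int mult_left_mono)
    then show ?thesis by (simp add: add_increasing2)
  qed
  have "uniform_limit (cball z r) (\<lambda>n w. \<Sum>i<n. ?u (int_decode i) w) (\<lambda>w. \<Sum>i. ?u (int_decode i) w) sequentially"
    using le summable_norm_cancel[OF infsum_int_eq_suminf(1)[OF M]]
    by (intro Weierstrass_m_test[where M = "\<lambda>i. ?M (int_decode i)"]) auto
  moreover have "(\<Sum>i. ?u (int_decode i) w) = laurent a d w" if "w \<in> cball z r" for w
    unfolding laurent_def by (rule infsum_int_eq_suminf(2)[OF laurent_abs_summable[OF nz(1)[OF that]], symmetric])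
  ultimately have "uniform_limit (cball z r) (\<lambda>n w. \<Sum>i<n. ?u (int_decode i) w) (laurent a d) sequentially"
    by (subst (asm) uniform_limit_cong'[where g = "\<lambda>n w. \<Sum>i<n. ?u (int_decode i) w" and i = "laurent a d"]) auto
  then show "\<exists>e>0. cball z e \<subseteq> - {0} \<and> uniform_limit (cball z e) (\<lambda>n w. \<Sum>i<n. ?u (int_decode i) w) (laurent a d) sequentially"
    using r subs by (intro exI[of _ r]) auto
qed

lemma laurent_exp: "laurent a d (of_real (exp (2 * a * x))) = of_real (theta_series a d 0 x)"
proof -
  have "laurent a d (of_real (exp (2 * a * x))) = (\<Sum>\<^sub>\<infinity>k. of_real (d k * ((2 * a * of_int k) ^ 0 * exp (- a * (of_int k)\<^sup>2 + 2 * a * of_int k * x))))"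
    unfolding laurent_def
  proof (intro infsum_cong)
    fix k :: int
    have "of_real (exp (2 * a * x)) powi k = complex_of_real (exp (2 * a * of_int k * x))"
      by (simp only: of_real_power_int[symmetric] exp_power_int) (simp add: mult_ac)
    then show "complex_of_real (d k * exp (- a * (of_int k)\<^sup>2)) * of_real (exp (2 * a * x)) powi k
       = of_real (d k * ((2 * a * of_int k) ^ 0 * exp (- a * (of_int k)\<^sup>2 + 2 * a * of_int k * x)))"
      by (simp only: exp_add of_real_mult power_0 mult_1_left mult.assoc)
  qed
  also have "\<dots> = of_real (theta_series a d 0 x)"
    unfolding theta_series_def using has_sum_of_real[OF has_sum_infsum[OF theta_series_summable[OF a d]]] by (rule infsumI)
  finally show ?thesis .
qed

lemma laurent_eq_0D:
  assumes "\<And>w. norm w = 1 \<Longrightarrow> laurent a d w = 0"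
  shows "d m = 0"
proof -
  have "complex_of_real (d m * exp (- a * (of_int m)\<^sup>2)) = 0"
  proof (rule fourier_series_unique)
    show "(\<lambda>k. norm (complex_of_real (d k * exp (- a * (of_int k)\<^sup>2)))) summable_on UNIV"
      using laurent_abs_summable[of 1] by (simp add: power_int_1_left)
    fix x :: real
    have "laurent a d (exp (2 * pi * \<i> * of_real x)) = 0" by (intro assms) (simp add: norm_exp_eq_Re)
    then show "(\<Sum>\<^sub>\<infinity>k. complex_of_real (d k * exp (- a * (of_int k)\<^sup>2)) * exp (2 * pi * \<i> * of_int k * complex_of_real x)) = 0"
      by (simp add: laurent_def exp_power_int mult_ac)
  qed
  then show ?thesis by simp
qed

end

section \<open>Too many zeros force a Laurent series to vanish\<close>

lemma sum_int_symmetric: "(\<Sum>j\<in>{- int n..int n}. real_of_int j) = 0"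
proof -
  have "(\<Sum>j\<in>{- int n..int n}. real_of_int j) = (\<Sum>j\<in>{- int n..int n}. - real_of_int j)"
    by (intro sum.reindex_bij_witness[where i = uminus and j = uminus]) auto
  then show ?thesis by (simp add: sum_negf)
qed

lemma sum_int_positive_part: "(\<Sum>j\<in>{- int n..int n}. max 0 (real_of_int j)) = real n * (real n + 1) / 2"
proof (induction n)
  case (Suc n)
  have "{- int (Suc n)..int (Suc n)} = insert (- int (Suc n)) (insert (int (Suc n)) {- int n..int n})" by auto
  then show ?case using Suc by (simp add: field_simps)
qed simp

text \<open>A Jensen-type count. The zeros with index in \<open>{- n..n}\<close> are divided out on
  an annulus that just contains them. At \<open>w0\<close> the quadratic part of the exponent then
  has three sources: growth on the boundary, division by the zeros there, and multiplication by them
  at \<open>w0\<close>. The unit circle suffices, because vanishing there already determines the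
  coefficients.\<close>

lemma theta_strict_zeros_laurent:
  fixes a B C \<theta> K :: real and d :: "int \<Rightarrow> real" and t :: "int \<Rightarrow> real"
  assumes a: "a > 0" and B: "B \<ge> 0" and d: "\<And>k. \<bar>d k\<bar> \<le> C * exp (B * \<bar>of_int k\<bar>)"
    and \<theta>: "0 < \<theta>" "\<theta> < 1" and t: "\<And>i. \<bar>t i - \<theta> * of_int i\<bar> \<le> K" and mono: "strict_mono t"
    and z: "\<And>i. theta_series a d 0 (t i) = 0" and w0: "norm w0 = 1"
  shows "laurent a d w0 = 0"
proof -
  \<comment> \<open>By the margin 1 in \<open>R\<close> below, the radius of a boundary circle and
    that of any zero differ at least by the factor \<open>exp (2 * a)\<close>, so their difference
    is at least \<open>exp (- M)\<close> times the larger one.\<close>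
  define M where "M = - ln (1 - exp (- 2 * a))"
  define C1 where "C1 = 4 * C * exp ((B + 1)\<^sup>2 / (4 * a))"
  have q: "1 - exp (- 2 * a) = exp (- M)" using a by (simp add: M_def)
  have K: "K \<ge> 0" using t[of 0] by linarith
  have C: "C \<ge> 0" using d by (rule bound_const_nonneg)
  have C1: "C1 \<ge> 0" using C by (simp add: C1_def)
  have M: "M \<ge> 0" using a by (simp add: M_def)
  have F: "laurent a d holomorphic_on - {0}" by (rule laurent_holomorphic[OF a B d])
  define R where "R n = \<theta> * real n + K + 1" for n
  \<comment> \<open>\<open>V n\<close> bounds the quotient times \<open>w ^ n\<close> on both
    boundary circles: growth \<open>a * (R n)\<^sup>2\<close>, a gain \<open>2 * a * R n * n\<close>
    from the zeros, and terms linear in \<open>n\<close>. \<open>P n\<close> bounds the product of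
    the divided factors on the unit circle.\<close>
  define V where "V n = C1 * exp (a * (R n)\<^sup>2 + B * R n - 2 * a * R n * real n + (M + 2 * a * K) * (2 * real n + 1))" for n
  define P where "P n = exp ((ln 2 + 2 * a * K) * (2 * real n + 1) + a * \<theta> * real n * (real n + 1))" for n
  have bound: "norm (laurent a d w0) \<le> V n * P n" for n
  proof -
    let ?J = "{- int n..int n}"
    let ?w = "\<lambda>j. complex_of_real (exp (2 * a * t j))"
    have card: "real (card ?J) = 2 * real n + 1" by simp
    have R: "R n > 0" using \<theta> K by (simp add: R_def add_nonneg_pos)
    have tJ: "t j \<le> R n - 1" "- (R n - 1) \<le> t j" if "j \<in> ?J" for j
    proof -
      have "real_of_int j \<le> real n" "- real n \<le> real_of_int j" using that by auto
      then have "\<theta> * real_of_int j \<le> \<theta> * real n" "\<theta> * (- real n) \<le> \<theta> * real_of_int j"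
        using \<theta> by (simp_all only: mult_left_mono less_imp_le)
      then show "t j \<le> R n - 1" "- (R n - 1) \<le> t j" using t[of j] by (auto simp: R_def abs_le_iff)
    qed
    have inj: "inj_on ?w ?J"
      using a strict_mono_eq[OF mono] by (auto simp: inj_on_def)
    have zero: "laurent a d v = 0" if "v \<in> ?w ` ?J" for v
      using that laurent_exp[OF a B d] z by auto
    obtain g where g: "g holomorphic_on - {0}" and fg: "\<And>w. w \<noteq> 0 \<Longrightarrow> laurent a d w = g w * (\<Prod>z\<in>?w ` ?J. w - z)"
      using holomorphic_factor_prod[of "- {0}" "?w ` ?J" "laurent a d"] F zero by fastforce
    have fg': "norm (laurent a d w) = norm (g w) * (\<Prod>j\<in>?J. norm (w - ?w j))" if "w \<noteq> 0" for w
      unfolding fg[OF that] prod.reindex[OF inj] by (simp add: norm_mult prod_norm)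
    have Fb: "norm (laurent a d w) \<le> C1 * exp (a * (R n)\<^sup>2 + B * R n)" if "norm w = exp (2 * a * R n) \<or> norm w = exp (2 * a * (- R n))" for w
      using that laurent_bound[OF a B d, of w "R n"] laurent_bound[OF a B d, of w "- R n"] R by (auto simp: C1_def)
    \<comment> \<open>The factor \<open>w ^ n\<close> balances the circles: the product over
      \<open>2 * n + 1\<close> zeros is large only on the outer circle, and \<open>w ^ n\<close>
      gives about half of that gain to the inner one.\<close>
    have outer: "norm (w ^ n * g w) \<le> V n" if w: "norm w = exp (2 * a * R n)" for w
    proof -
      have nz: "w \<noteq> 0" using w by auto
      have "exp ((2 * a * R n - M) * (2 * real n + 1)) = (\<Prod>j\<in>?J. exp (2 * a * R n - M))"
        by (simp add: exp_of_nat_mult[symmetric] mult.commute)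
      also have "\<dots> \<le> (\<Prod>j\<in>?J. norm (w - ?w j))"
      proof (intro prod_mono conjI)
        fix j assume j: "j \<in> ?J"
        have "a * t j \<le> a * (R n - 1)" using tJ[OF j] a by (intro mult_left_mono) auto
        then have "exp (2 * a * t j) \<le> exp (2 * a * R n + - 2 * a)" by (simp add: algebra_simps)
        moreover have "exp (2 * a * R n - M) = exp (2 * a * R n) * (1 - exp (- 2 * a))"
          unfolding q exp_add[symmetric] by simp
        ultimately have "exp (2 * a * R n - M) \<le> exp (2 * a * R n) - exp (2 * a * t j)"
          unfolding exp_add by (simp add: right_diff_distrib)
        also have "\<dots> \<le> norm (w - ?w j)" using norm_triangle_ineq2[of w "?w j"] w by simp
        finally show "exp (2 * a * R n - M) \<le> norm (w - ?w j)" .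
      qed auto
      finally have prod: "exp ((2 * a * R n - M) * (2 * real n + 1)) \<le> (\<Prod>j\<in>?J. norm (w - ?w j))" .
      have "norm (w ^ n * g w) * exp ((2 * a * R n - M) * (2 * real n + 1)) \<le> norm (w ^ n * g w) * (\<Prod>j\<in>?J. norm (w - ?w j))"
        using prod by (rule mult_left_mono) simp
      also have "\<dots> = norm (w ^ n) * norm (laurent a d w)" using fg'[OF nz] by (simp add: norm_mult)
      also have "\<dots> \<le> exp (2 * a * R n * real n) * (C1 * exp (a * (R n)\<^sup>2 + B * R n))"
        using Fb w by (intro mult_mono) (auto simp: norm_power exp_of_nat_mult[symmetric] mult_ac)
      finally have "norm (w ^ n * g w) \<le> exp (2 * a * R n * real n) * (C1 * exp (a * (R n)\<^sup>2 + B * R n)) / exp ((2 * a * R n - M) * (2 * real n + 1))"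
        by (simp add: pos_le_divide_eq)
      also have "\<dots> = C1 * exp (2 * a * R n * real n + (a * (R n)\<^sup>2 + B * R n) - (2 * a * R n - M) * (2 * real n + 1))"
        by (simp only: exp_diff exp_add mult_ac times_divide_eq_right)
      also have "\<dots> \<le> V n"
      proof -
        have "0 \<le> 2 * a * R n" "0 \<le> 2 * a * K * (2 * real n + 1)" using a R K by auto
        then have "2 * a * R n * real n + (a * (R n)\<^sup>2 + B * R n) - (2 * a * R n - M) * (2 * real n + 1)
          \<le> a * (R n)\<^sup>2 + B * R n - 2 * a * R n * real n + (M + 2 * a * K) * (2 * real n + 1)"
          by (simp add: algebra_simps)
        then show ?thesis unfolding V_def using C1 by (intro mult_left_mono) auto
      qed
      finally show ?thesis .
    qed
    have inner: "norm (w ^ n * g w) \<le> V n" if w: "norm w = exp (2 * a * (- R n))" for w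
    proof -
      have nz: "w \<noteq> 0" using w by auto
      \<comment> \<open>On the inner circle a factor has size about
        \<open>exp (2 * a * t j)\<close>. The ideal positions \<open>\<theta> * j\<close> cancel in
        pairs, so only the deviations remain, at most \<open>K\<close> for each point.\<close>
      have "- K * (2 * real n + 1) = (\<Sum>j\<in>?J. \<theta> * of_int j - K)"
        using sum_int_symmetric[of n] card by (simp add: sum_subtractf sum_distrib_left[symmetric])
      also have "\<dots> \<le> (\<Sum>j\<in>?J. t j)" using t by (intro sum_mono) (simp add: abs_le_iff algebra_simps)
      finally have "2 * a * (- K * (2 * real n + 1)) \<le> 2 * a * (\<Sum>j\<in>?J. t j)" using a by (intro mult_left_mono) auto
      moreover have "(\<Sum>j\<in>?J. 2 * a * t j - M) = 2 * a * (\<Sum>j\<in>?J. t j) - M * (2 * real n + 1)"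
        using card by (simp add: sum_subtractf sum_distrib_left[symmetric])
      ultimately have "exp (- (2 * a * K + M) * (2 * real n + 1)) \<le> exp (\<Sum>j\<in>?J. 2 * a * t j - M)"
        by (simp add: algebra_simps)
      also have "\<dots> = (\<Prod>j\<in>?J. exp (2 * a * t j - M))" by (simp add: exp_sum)
      also have "\<dots> \<le> (\<Prod>j\<in>?J. norm (w - ?w j))"
      proof (intro prod_mono conjI)
        fix j assume j: "j \<in> ?J"
        have "a * (1 - R n) \<le> a * t j" using tJ[OF j] a by (intro mult_left_mono) auto
        then have "exp (2 * a * (- R n)) \<le> exp (2 * a * t j + - 2 * a)" by (simp add: algebra_simps)
        moreover have "exp (2 * a * t j - M) = exp (2 * a * t j) * (1 - exp (- 2 * a))"
          unfolding q exp_add[symmetric] by simp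
        ultimately have "exp (2 * a * t j - M) \<le> exp (2 * a * t j) - exp (2 * a * (- R n))"
          unfolding exp_add by (simp add: right_diff_distrib)
        also have "\<dots> \<le> norm (w - ?w j)" using norm_triangle_ineq2[of "?w j" w] w by (simp add: norm_minus_commute)
        finally show "exp (2 * a * t j - M) \<le> norm (w - ?w j)" .
      qed auto
      finally have prod: "exp (- (2 * a * K + M) * (2 * real n + 1)) \<le> (\<Prod>j\<in>?J. norm (w - ?w j))" .
      have "norm (w ^ n * g w) * exp (- (2 * a * K + M) * (2 * real n + 1)) \<le> norm (w ^ n * g w) * (\<Prod>j\<in>?J. norm (w - ?w j))"
        using prod by (rule mult_left_mono) simp
      also have "\<dots> = norm (w ^ n) * norm (laurent a d w)" using fg'[OF nz] by (simp add: norm_mult)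
      also have "\<dots> \<le> exp (2 * a * (- R n) * real n) * (C1 * exp (a * (R n)\<^sup>2 + B * R n))"
        using Fb w by (intro mult_mono) (auto simp: norm_power exp_of_nat_mult[symmetric] mult_ac)
      finally have "norm (w ^ n * g w) \<le> exp (2 * a * (- R n) * real n) * (C1 * exp (a * (R n)\<^sup>2 + B * R n)) / exp (- (2 * a * K + M) * (2 * real n + 1))"
        by (simp add: pos_le_divide_eq)
      also have "\<dots> = C1 * exp (2 * a * (- R n) * real n + (a * (R n)\<^sup>2 + B * R n) - (- (2 * a * K + M) * (2 * real n + 1)))"
        by (simp only: exp_diff exp_add mult_ac times_divide_eq_right)
      also have "\<dots> = V n" unfolding V_def by (simp add: algebra_simps)
      finally show ?thesis .
    qed
    let ?S = "{w. exp (2 * a * (- R n)) \<le> norm w \<and> norm w \<le> exp (2 * a * R n)} :: complex set"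
    have cl: "closed ?S" by (intro closed_Collect_conj closed_Collect_le continuous_intros)
    have nz: "w \<noteq> 0" if "w \<in> ?S" for w using that by (auto simp: not_le)
    have hol: "(\<lambda>w. w ^ n * g w) holomorphic_on - {0}" using g by (intro holomorphic_intros)
    have sub: "?S \<subseteq> - {0}" using nz by auto
    have fr: "norm w = exp (2 * a * R n) \<or> norm w = exp (2 * a * (- R n))" if "w \<in> frontier ?S" for w
    proof -
      have "open {w::complex. exp (2 * a * (- R n)) < norm w \<and> norm w < exp (2 * a * R n)}"
        by (intro open_Collect_conj open_Collect_less continuous_intros)
      then have "{w::complex. exp (2 * a * (- R n)) < norm w \<and> norm w < exp (2 * a * R n)} \<subseteq> interior ?S"
        by (intro interior_maximal) auto
      moreover have "w \<in> ?S" "w \<notin> interior ?S" using that cl by (simp_all add: frontier_def)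
      ultimately show ?thesis by force
    qed
    have "norm (w0 ^ n * g w0) \<le> V n"
    proof (rule maximum_modulus_frontier[where S = ?S and f = "\<lambda>w. w ^ n * g w"])
      show "(\<lambda>w. w ^ n * g w) holomorphic_on interior ?S"
        using hol sub interior_subset by (meson holomorphic_on_subset order_trans)
      show "continuous_on (closure ?S) (\<lambda>w. w ^ n * g w)"
        using hol sub cl by (simp add: holomorphic_on_imp_continuous_on holomorphic_on_subset)
      show "bounded ?S" by (intro boundedI[where B = "exp (2 * a * R n)"]) auto
      show "w0 \<in> ?S" using w0 a R by simp
    qed (use fr outer inner in blast)
    then have gw: "norm (g w0) \<le> V n" using w0 by (simp add: norm_mult norm_power)
    \<comment> \<open>Only positive \<open>j\<close> contribute to the quadratic part:
      \<open>2 * a * \<theta>\<close> times the sum of \<open>1, ..., n\<close>.\<close>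
    have "(\<Prod>j\<in>?J. norm (w0 - ?w j)) \<le> (\<Prod>j\<in>?J. exp ((ln 2 + 2 * a * K) + 2 * a * \<theta> * max 0 (real_of_int j)))"
    proof (intro prod_mono conjI)
      fix j
      have e1: "2 * a * t j \<le> 2 * a * K + 2 * a * \<theta> * max 0 (real_of_int j)"
      proof -
        have "\<theta> * real_of_int j \<le> \<theta> * max 0 (real_of_int j)" using \<theta> by (intro mult_left_mono) auto
        then have "t j \<le> K + \<theta> * max 0 (real_of_int j)" using t[of j] by (simp add: abs_le_iff)
        then have "2 * a * t j \<le> 2 * a * (K + \<theta> * max 0 (real_of_int j))" using a by (intro mult_left_mono) auto
        then show ?thesis by (simp add: algebra_simps)
      qed
      have e0: "0 \<le> 2 * a * K + 2 * a * \<theta> * max 0 (real_of_int j)" using a K \<theta> by simp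
      have "norm (w0 - ?w j) \<le> 1 + exp (2 * a * t j)" using norm_triangle_ineq4[of w0 "?w j"] w0 by simp
      also have "\<dots> \<le> 2 * exp (2 * a * K + 2 * a * \<theta> * max 0 (real_of_int j))"
      proof -
        have "1 \<le> exp (2 * a * K + 2 * a * \<theta> * max 0 (real_of_int j))" using e0 by simp
        moreover have "exp (2 * a * t j) \<le> exp (2 * a * K + 2 * a * \<theta> * max 0 (real_of_int j))" using e1 by simp
        ultimately show ?thesis by linarith
      qed
      also have "\<dots> = exp ((ln 2 + 2 * a * K) + 2 * a * \<theta> * max 0 (real_of_int j))" by (simp add: exp_add mult_ac)
      finally show "norm (w0 - ?w j) \<le> exp ((ln 2 + 2 * a * K) + 2 * a * \<theta> * max 0 (real_of_int j))" .
    qed auto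
    also have "\<dots> = exp (\<Sum>j\<in>?J. (ln 2 + 2 * a * K) + 2 * a * \<theta> * max 0 (real_of_int j))" by (simp add: exp_sum)
    also have "(\<Sum>j\<in>?J. (ln 2 + 2 * a * K) + 2 * a * \<theta> * max 0 (real_of_int j))
       = (ln 2 + 2 * a * K) * (2 * real n + 1) + a * \<theta> * real n * (real n + 1)"
      unfolding sum.distrib sum_distrib_left[symmetric] sum_int_positive_part sum_constant card
      by (simp add: algebra_simps)
    finally have "(\<Prod>j\<in>?J. norm (w0 - ?w j)) \<le> P n" by (simp add: P_def)
    moreover have "w0 \<noteq> 0" using w0 by auto
    moreover have "0 \<le> V n" using C1 by (simp add: V_def)
    ultimately show ?thesis unfolding fg'[OF \<open>w0 \<noteq> 0\<close>] using gw by (intro mult_mono prod_nonneg) auto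
  qed
  \<comment> \<open>The quadratic coefficients add up to
    \<open>a * \<theta>\<^sup>2 - 2 * a * \<theta> + a * \<theta> = - p\<close>, negative exactly
    because \<open>\<theta>\<close> lies between 0 and 1; \<open>\<beta>\<close> and
    \<open>\<gamma>\<close> collect the rest.\<close>
  define p \<beta> \<gamma> where "p = a * \<theta> * (1 - \<theta>)"
    and "\<beta> = 2 * a * \<theta> * (K + 1) + B * \<theta> - 2 * a * (K + 1) + 2 * (M + 2 * a * K) + 2 * (ln 2 + 2 * a * K) + a * \<theta>"
    and "\<gamma> = a * (K + 1)\<^sup>2 + B * (K + 1) + (M + 2 * a * K) + (ln 2 + 2 * a * K)"
  have "V n * P n = C1 * exp (- p * (real n)\<^sup>2 + \<beta> * real n + \<gamma>)" for n
    unfolding V_def P_def R_def p_def \<beta>_def \<gamma>_def mult.assoc exp_add[symmetric]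
    by (simp add: power2_eq_square algebra_simps)
  moreover have "p > 0" using a \<theta> by (simp add: p_def)
  then have "(\<lambda>n::nat. C1 * exp (- p * (real n)\<^sup>2 + \<beta> * real n + \<gamma>)) \<longlonglongrightarrow> 0" by real_asymp
  ultimately have "(\<lambda>n. V n * P n) \<longlonglongrightarrow> 0" by simp
  then have "norm (laurent a d w0) \<le> 0" using bound by (intro LIMSEQ_le_const[of _ 0]) auto
  then show ?thesis by simp
qed

text \<open>Induction on the largest multiplicity. Rolle's theorem with \<open>\<sigma> = a\<close>
  shortens the runs and multiplies \<open>d k\<close> by \<open>a * (2 * k - 1)\<close>, which never
  vanishes since \<open>2 * k - 1\<close> is odd; the plain derivative would lose
  \<open>d 0\<close>. The growth rate of the coefficients increases, which is why \<open>B\<close>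
  is arbitrary.\<close>

lemma theta_zeros_gap_unique:
  fixes a B C \<theta> K :: real and d :: "int \<Rightarrow> real" and t :: "int \<Rightarrow> real"
  assumes a: "a > 0" and \<theta>: "0 < \<theta>" "\<theta> < 1"
  assumes "B \<ge> 0" "\<And>k. \<bar>d k\<bar> \<le> C * exp (B * \<bar>of_int k\<bar>)"
    "\<And>i. \<bar>t i - \<theta> * of_int i\<bar> \<le> K" "zero_seq (theta_series a d) t" "\<And>i. t i < t (i + int (Suc m))"
  shows "d k = 0"
  using assms(4-)
proof (induction m arbitrary: d t B C K k)
  case 0
  have "strict_mono t"
  proof (rule strict_monoI)
    fix i j :: int assume "i < j"
    then have "t i < t (i + 1)" "t (i + 1) \<le> t j"
      using 0(5)[of i] 0(4) by (auto simp: zero_seq_def elim!: monoD)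
    then show "t i < t j" by simp
  qed
  moreover have "theta_series a d 0 (t i) = 0" for i using zero_seqD[OF 0(4), of i 0] by simp
  ultimately have "laurent a d w = 0" if "norm w = 1" for w
    using theta_strict_zeros_laurent[OF a 0(1) 0(2) \<theta> 0(3) _ _ that] by blast
  then show ?case by (rule laurent_eq_0D[OF a 0(1) 0(2)])
next
  case (Suc m)
  let ?d = "\<lambda>k. (2 * a * of_int k - a) * d k"
  obtain t' where t': "zero_seq (\<lambda>s x. theta_series a d (Suc s) x - a * theta_series a d s x) t'"
    "\<And>i. t i \<le> t' i" "\<And>i. t' i \<le> t (i + 1)"
    "\<And>i s. t' (i + int (Suc s)) = t' i \<Longrightarrow> t (i + int (Suc (Suc s))) = t i"
    by (rule zero_seq_rolle[OF jet_theta_series[OF a Suc.prems(2)] Suc.prems(4), of a]) blast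
  have eq: "theta_series a d (Suc s) x - a * theta_series a d s x = theta_series a ?d s x" for s x
  proof -
    let ?u = "\<lambda>s k. d k * ((2 * a * of_int k) ^ s * exp (- a * (of_int k)\<^sup>2 + 2 * a * of_int k * x))"
    have s: "?u s summable_on UNIV" for s by (rule theta_series_summable[OF a Suc.prems(2)])
    have "theta_series a d (Suc s) x - a * theta_series a d s x = (\<Sum>\<^sub>\<infinity>k. ?u (Suc s) k + (- a) * ?u s k)"
      unfolding theta_series_def
      by (subst infsum_add[OF s summable_on_cmult_right[OF s]], subst infsum_cmult_right[OF s], simp)
    also have "\<dots> = theta_series a ?d s x"
      unfolding theta_series_def by (intro infsum_cong) (simp add: algebra_simps)
    finally show ?thesis .
  qed
  have bd: "\<bar>?d k\<bar> \<le> (a * C) * exp ((B + 2) * \<bar>of_int k\<bar>)" for k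
  proof -
    have "\<bar>2 * a * of_int k - a\<bar> \<le> \<bar>2 * a * of_int k\<bar> + \<bar>a\<bar>" by (rule abs_triangle_ineq4)
    also have "\<dots> = a * (1 + 2 * \<bar>of_int k\<bar>)" using a by (simp add: abs_mult algebra_simps)
    also have "\<dots> \<le> a * exp (2 * \<bar>of_int k\<bar>)"
      using a exp_ge_add_one_self[of "2 * \<bar>of_int k\<bar>"] by (intro mult_left_mono) auto
    finally have "\<bar>?d k\<bar> \<le> (a * exp (2 * \<bar>of_int k\<bar>)) * (C * exp (B * \<bar>of_int k\<bar>))"
      unfolding abs_mult using Suc.prems(2) a by (intro mult_mono) auto
    also have "\<dots> = (a * C) * exp ((B + 2) * \<bar>of_int k\<bar>)" by (simp add: exp_add ring_distribs mult_ac)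
    finally show ?thesis .
  qed
  have gap: "t' i < t' (i + int (Suc m))" for i
  proof -
    have "t' i \<le> t' (i + int (Suc m))" using t'(1) by (auto simp: zero_seq_def elim!: monoD)
    moreover have "t' (i + int (Suc m)) \<noteq> t' i" using t'(4)[of i m] Suc.prems(5)[of i] by auto
    ultimately show ?thesis by simp
  qed
  have "\<bar>t' i - \<theta> * of_int i\<bar> \<le> K + 1" for i
    using t'(2,3)[of i] Suc.prems(3)[of i] Suc.prems(3)[of "i + 1"] \<theta> by (simp add: algebra_simps abs_le_iff)
  then have "?d k = 0"
    using Suc.IH[of "B + 2" ?d "a * C" t' "K + 1" k] bd gap t'(1) Suc.prems(1) unfolding eq by auto
  moreover have "2 * a * of_int k - a \<noteq> 0"
  proof
    assume "2 * a * of_int k - a = 0"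
    then have "a * (2 * real_of_int k - 1) = 0" by (simp add: algebra_simps)
    then have "2 * real_of_int k = 1" using a by simp
    then have "2 * k = 1" by linarith
    then show False by presburger
  qed
  ultimately show ?case by simp
qed

text \<open>Points within \<open>K\<close> of \<open>\<theta> * i\<close> cannot stay equal over
  more than \<open>2 * K / \<theta>\<close> steps, so the multiplicities are bounded.\<close>

theorem theta_zeros_unique:
  fixes a B C \<theta> K :: real and d :: "int \<Rightarrow> real" and t :: "int \<Rightarrow> real"
  assumes a: "a > 0" and \<theta>: "0 < \<theta>" "\<theta> < 1"
    and d: "\<And>k. \<bar>d k\<bar> \<le> C * exp (B * \<bar>of_int k\<bar>)"
    and t: "\<And>i. \<bar>t i - \<theta> * of_int i\<bar> \<le> K" and z: "zero_seq (theta_series a d) t"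
  shows "d k = 0"
proof -
  obtain m :: nat where m: "2 * K / \<theta> < real m" using reals_Archimedean2 by blast
  have "t i < t (i + int (Suc m))" for i
  proof -
    have "2 * K < \<theta> * real m" using m \<theta> by (simp add: field_simps)
    then show ?thesis using t[of i] t[of "i + int (Suc m)"] \<theta> by (simp add: algebra_simps abs_le_iff)
  qed
  moreover have "\<bar>d k\<bar> \<le> C * exp (max 0 B * \<bar>of_int k\<bar>)" for k
  proof -
    have "C \<ge> 0" using d by (rule bound_const_nonneg)
    then have "C * exp (B * \<bar>of_int k\<bar>) \<le> C * exp (max 0 B * \<bar>of_int k\<bar>)"
      by (intro mult_left_mono) (auto intro!: mult_right_mono)
    then show ?thesis using d[of k] by linarith
  qed
  ultimately show ?thesis
    by (intro theta_zeros_gap_unique[OF a \<theta> _ _ t z, where B = "max 0 B" and C = C and m = m]) auto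
qed

section \<open>Totally positive functions of Gaussian type\<close>

lemma poly_le_exp:
  fixes p :: "real poly"
  shows "\<exists>C. \<forall>x. \<bar>poly p x\<bar> \<le> C * exp \<bar>x\<bar>"
proof (intro exI allI)
  fix x :: real
  have "\<bar>poly p x\<bar> \<le> (\<Sum>i\<le>degree p. \<bar>coeff p i * x ^ i\<bar>)" unfolding poly_altdef by (rule sum_abs)
  also have "\<dots> \<le> (\<Sum>i\<le>degree p. \<bar>coeff p i\<bar> * (fact i * exp \<bar>x\<bar>))"
    unfolding abs_mult power_abs by (intro sum_mono mult_left_mono pow_le_fact_exp) auto
  finally show "\<bar>poly p x\<bar> \<le> (\<Sum>i\<le>degree p. \<bar>coeff p i\<bar> * fact i) * exp \<bar>x\<bar>"
    by (simp only: sum_distrib_right mult.assoc)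
qed

text \<open>Hermite polynomials up to scaling: the derivative of
  \<open>q * exp (- a * x\<^sup>2)\<close> has the polynomial factor
  \<open>q' - 2 * a * x * q\<close>.\<close>

fun gauss_poly :: "real \<Rightarrow> real \<Rightarrow> nat \<Rightarrow> real poly" where
  "gauss_poly \<gamma> a 0 = [:\<gamma>:]"
| "gauss_poly \<gamma> a (Suc s) = pderiv (gauss_poly \<gamma> a s) - [:0, 2 * a:] * gauss_poly \<gamma> a s"

definition gauss_jet :: "real \<Rightarrow> real \<Rightarrow> nat \<Rightarrow> real \<Rightarrow> real" where
  "gauss_jet \<gamma> a s x = poly (gauss_poly \<gamma> a s) x * exp (- a * x\<^sup>2)"

lemma gauss_jet_0: "gauss_jet \<gamma> a 0 x = \<gamma> * exp (- a * x\<^sup>2)"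
  by (simp add: gauss_jet_def)

lemma jet_gauss_jet: "jet (gauss_jet \<gamma> a)"
  unfolding jet_def gauss_jet_def
  by (auto intro!: derivative_eq_intros simp: algebra_simps)

lemma decay_jet_gauss_jet:
  assumes "a > 0"
  shows "decay_jet \<kappa> (gauss_jet \<gamma> a)"
  unfolding decay_jet_def
proof (intro conjI allI jet_gauss_jet)
  fix s
  obtain C where C: "\<And>x. \<bar>poly (gauss_poly \<gamma> a s) x\<bar> \<le> C * exp \<bar>x\<bar>" using poly_le_exp by blast
  have C0: "C \<ge> 0" using C by (rule bound_const_nonneg)
  show "\<exists>C. \<forall>x. \<bar>gauss_jet \<gamma> a s x\<bar> \<le> C * exp (- \<kappa> * \<bar>x\<bar>)"
  proof (intro exI allI)
    fix x
    have "\<bar>gauss_jet \<gamma> a s x\<bar> \<le> (C * exp \<bar>x\<bar>) * exp (- a * x\<^sup>2)"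
      unfolding gauss_jet_def abs_mult using C[of x] by (simp add: mult_right_mono)
    also have "\<dots> = C * exp (\<bar>x\<bar> + - a * x\<^sup>2)" by (simp only: exp_add mult_ac)
    also have "\<dots> \<le> C * exp ((1 + \<kappa>)\<^sup>2 / (4 * a) + - \<kappa> * \<bar>x\<bar>)"
      using C0 quadratic_le[OF assms, of "1 + \<kappa>" "\<bar>x\<bar>"] by (intro mult_left_mono) (auto simp: algebra_simps)
    finally show "\<bar>gauss_jet \<gamma> a s x\<bar> \<le> (C * exp ((1 + \<kappa>)\<^sup>2 / (4 * a))) * exp (- \<kappa> * \<bar>x\<bar>)"
      by (simp only: exp_add mult_ac)
  qed
qed

lemma zero_uniq_gauss_jet:
  assumes a: "a > 0" and \<gamma>: "\<gamma> \<noteq> 0"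
  shows "zero_uniq \<epsilon> (gauss_jet \<gamma> a)"
  unfolding zero_uniq_def
proof (intro allI impI)
  fix c C \<theta> K t k
  assume c: "\<forall>k. \<bar>c k\<bar> \<le> C * exp (\<epsilon> * \<bar>of_int k\<bar>)" and \<theta>: "0 < \<theta>" "\<theta> < 1"
    and t: "\<forall>i. \<bar>t i - \<theta> * of_int i\<bar> \<le> K" and z: "zero_seq (shift_series c (gauss_jet \<gamma> a)) t"
  have c': "\<And>k. \<bar>c k\<bar> \<le> C * exp (\<epsilon> * \<bar>of_int k\<bar>)" using c by blast
  have "zero_seq (theta_series a c) t"
  \<comment> \<open>The factor \<open>exp (a * x\<^sup>2) / \<gamma>\<close> that produces the theta
    series is itself a Gaussian jet, with \<open>- a\<close> in place of \<open>a\<close>.\<close>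
  proof (rule zero_seq_mult[OF jet_gauss_jet[of "1 / \<gamma>" "- a"] _ jet_theta_series[OF a c'] _ z])
    show "jet (shift_series c (gauss_jet \<gamma> a))"
      by (rule jet_shift_series[OF decay_jet_gauss_jet[OF a, of "max 0 \<epsilon> + 1"] c']) auto
    fix x
    have "theta_series a c 0 x = (\<Sum>\<^sub>\<infinity>k. (exp (a * x\<^sup>2) / \<gamma>) * (c k * gauss_jet \<gamma> a 0 (x - of_int k)))"
      unfolding theta_series_def
    proof (intro infsum_cong)
      fix k :: int
      have "- a * (of_int k)\<^sup>2 + 2 * a * of_int k * x = a * x\<^sup>2 + - a * (x - of_int k)\<^sup>2"
        by (simp add: power2_eq_square algebra_simps)
      then have "exp (- a * (of_int k)\<^sup>2 + 2 * a * of_int k * x) = exp (a * x\<^sup>2) * exp (- a * (x - of_int k)\<^sup>2)"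
        by (simp only: exp_add)
      then show "c k * ((2 * a * of_int k) ^ 0 * exp (- a * (of_int k)\<^sup>2 + 2 * a * of_int k * x))
         = (exp (a * x\<^sup>2) / \<gamma>) * (c k * gauss_jet \<gamma> a 0 (x - of_int k))"
        using \<gamma> by (simp add: gauss_jet_0)
    qed
    also have "\<dots> = (exp (a * x\<^sup>2) / \<gamma>) * shift_series c (gauss_jet \<gamma> a) 0 x"
      unfolding shift_series_def by (rule infsum_cmult_right')
    finally show "theta_series a c 0 x = gauss_jet (1 / \<gamma>) (- a) 0 x * shift_series c (gauss_jet \<gamma> a) 0 x"
      by (simp add: gauss_jet_0)
  qed
  then show "c k = 0" using theta_zeros_unique[OF a \<theta> c', where t = t and K = K] t by blast
qed

text \<open>\<open>E - A\<close> and \<open>E + A\<close> are both nondecreasing. This bounds an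
  increment by a primitive of the majorant without any integral.\<close>

lemma deriv_le_imp_diff_le:
  fixes A E :: "real \<Rightarrow> real"
  assumes "y \<le> x" "\<And>u. y \<le> u \<Longrightarrow> u \<le> x \<Longrightarrow> (A has_real_derivative f u) (at u)"
    "\<And>u. y \<le> u \<Longrightarrow> u \<le> x \<Longrightarrow> (E has_real_derivative e u) (at u)"
    "\<And>u. y \<le> u \<Longrightarrow> u \<le> x \<Longrightarrow> \<bar>f u\<bar> \<le> e u"
  shows "\<bar>A x - A y\<bar> \<le> E x - E y"
proof -
  have "(\<lambda>u. E u - A u) y \<le> (\<lambda>u. E u - A u) x"
  proof (rule DERIV_nonneg_imp_nondecreasing[OF assms(1)])
    fix u assume u: "y \<le> u" "u \<le> x"
    show "\<exists>l. ((\<lambda>u. E u - A u) has_real_derivative l) (at u) \<and> l \<ge> 0"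
      using assms(2-4)[OF u] by (intro exI[of _ "e u - f u"] conjI DERIV_diff) auto
  qed
  moreover have "(\<lambda>u. E u + A u) y \<le> (\<lambda>u. E u + A u) x"
  proof (rule DERIV_nonneg_imp_nondecreasing[OF assms(1)])
    fix u assume u: "y \<le> u" "u \<le> x"
    show "\<exists>l. ((\<lambda>u. E u + A u) has_real_derivative l) (at u) \<and> l \<ge> 0"
      using assms(2-4)[OF u] by (intro exI[of _ "e u + f u"] conjI DERIV_add) auto
  qed
  ultimately show ?thesis by auto
qed

text \<open>The solution is \<open>\<delta>\<^sup>-\<^sup>1 e\<^sup>-\<^sup>x\<^sup>/\<^sup>\<delta> \<integral> e\<^sup>t\<^sup>/\<^sup>\<delta> u(t) dt\<close>, integrated over \<open>t \<le> x\<close>.\<close>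
lemma decaying_ode_solution:
  fixes u :: "real \<Rightarrow> real"
  assumes \<delta>: "\<delta> > 0" and \<kappa>: "\<kappa> > 0" "\<kappa> < 1 / \<delta>" and cont: "\<And>x. isCont u x"
    and u: "\<And>x. \<bar>u x\<bar> \<le> C * exp (- \<kappa> * \<bar>x\<bar>)"
  shows "\<exists>h D. (\<forall>x. (h has_real_derivative (u x - h x) / \<delta>) (at x)) \<and> (\<forall>x. \<bar>h x\<bar> \<le> D * exp (- \<kappa> * \<bar>x\<bar>))"
proof -
  have C: "C \<ge> 0" using u by (rule bound_const_nonneg)
  let ?f = "\<lambda>t. exp (t / \<delta>) * u t"
  obtain A where A0: "\<And>x. (A has_vector_derivative ?f x) (at x)"
  proof -
    have "isCont ?f x" for x using cont \<delta> by (intro continuous_intros) auto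
    then have "\<exists>F. \<forall>x. (F has_vector_derivative ?f x) (at x)"
      using einterval_antiderivative[of "-\<infinity>" "\<infinity>" ?f] by simp
    then show thesis using that by blast
  qed
  then have A: "(A has_real_derivative ?f x) (at x)" for x
    by (simp add: has_real_derivative_iff_has_vector_derivative)
  \<comment> \<open>The growth rates of \<open>exp (t / \<delta>) * u t\<close> on the negative and
    the positive half-line; \<open>\<beta>' > 0\<close> is the hypothesis
    \<open>\<kappa> < 1 / \<delta>\<close>.\<close>
  define \<beta> \<beta>' where "\<beta> = 1 / \<delta> + \<kappa>" and "\<beta>' = 1 / \<delta> - \<kappa>"
  have \<beta>: "\<beta> > 0" "\<beta>' > 0" using \<delta> \<kappa> by (auto simp: \<beta>_def \<beta>'_def add_pos_pos)
  have fb: "\<bar>?f t\<bar> \<le> C * exp (t / \<delta> + - \<kappa> * \<bar>t\<bar>)" for t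
    using mult_left_mono[OF u[of t], of "exp (t / \<delta>)"] by (simp only: exp_add abs_mult mult_ac) simp
  have neg: "\<bar>A x - A y\<bar> \<le> C / \<beta> * exp (\<beta> * x) - C / \<beta> * exp (\<beta> * y)" if "y \<le> x" "x \<le> 0" for x y
  proof (rule deriv_le_imp_diff_le[OF that(1) A])
    fix t assume t: "y \<le> t" "t \<le> x"
    show "((\<lambda>x. C / \<beta> * exp (\<beta> * x)) has_real_derivative C * exp (\<beta> * t)) (at t)"
      using \<beta> by (auto intro!: derivative_eq_intros)
    show "\<bar>?f t\<bar> \<le> C * exp (\<beta> * t)" using fb[of t] t that by (simp add: \<beta>_def algebra_simps)
  qed
  have pos: "\<bar>A x - A 0\<bar> \<le> C / \<beta>' * exp (\<beta>' * x) - C / \<beta>' * exp (\<beta>' * 0)" if "0 \<le> x" for x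
  proof (rule deriv_le_imp_diff_le[OF that A])
    fix t assume t: "0 \<le> t" "t \<le> x"
    show "((\<lambda>x. C / \<beta>' * exp (\<beta>' * x)) has_real_derivative C * exp (\<beta>' * t)) (at t)"
      using \<beta> by (auto intro!: derivative_eq_intros)
    show "\<bar>?f t\<bar> \<le> C * exp (\<beta>' * t)" using fb[of t] t that by (simp add: \<beta>'_def algebra_simps)
  qed
  have lim0: "(\<lambda>n. C / \<beta> * exp (\<beta> * (- real n))) \<longlonglongrightarrow> 0" using \<beta> by real_asymp
  have "Cauchy (\<lambda>n. A (- real n))"
  proof (rule metric_CauchyI)
    fix e :: real assume "e > 0"
    then have "\<forall>\<^sub>F n in sequentially. C / \<beta> * exp (\<beta> * (- real n)) < e" using lim0 by (intro order_tendstoD(2))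
    then obtain N where N: "\<And>n. n \<ge> N \<Longrightarrow> C / \<beta> * exp (\<beta> * (- real n)) < e" by (auto simp: eventually_sequentially)
    have p: "0 \<le> C / \<beta> * exp v" for v using C \<beta> by simp
    have *: "\<bar>A (- real m) - A (- real n)\<bar> < e" if "m \<ge> N" "m \<le> n" for m n
    proof -
      have "\<bar>A (- real m) - A (- real n)\<bar> \<le> C / \<beta> * exp (\<beta> * (- real m)) - C / \<beta> * exp (\<beta> * (- real n))"
        using that by (intro neg) auto
      then show ?thesis using N[OF that(1)] p[of "\<beta> * (- real n)"] by linarith
    qed
    have "dist (A (- real m)) (A (- real n)) < e" if "m \<ge> N" "n \<ge> N" for m n
      using *[of m n] *[of n m] that by (cases "m \<le> n") (auto simp: dist_real_def abs_minus_commute)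
    then show "\<exists>M. \<forall>m\<ge>M. \<forall>n\<ge>M. dist (A (- real m)) (A (- real n)) < e" by blast
  qed
  \<comment> \<open>\<open>L\<close> is the value of the antiderivative at minus infinity, so that
    \<open>A x - L\<close> is the integral over \<open>t \<le> x\<close>.\<close>
  then obtain L where L: "(\<lambda>n. A (- real n)) \<longlonglongrightarrow> L" using Cauchy_convergent convergent_def by blast
  have AL: "\<bar>A x - L\<bar> \<le> C / \<beta> * exp (\<beta> * x)" if "x \<le> 0" for x
  proof -
    have "(\<lambda>n. \<bar>A x - A (- real n)\<bar>) \<longlonglongrightarrow> \<bar>A x - L\<bar>" by (intro tendsto_intros L)
    moreover obtain N :: nat where "- x \<le> real N" using real_arch_simple by blast
    then have "\<bar>A x - A (- real n)\<bar> \<le> C / \<beta> * exp (\<beta> * x)" if "n \<ge> N" for n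
    proof -
      have "\<bar>A x - A (- real n)\<bar> \<le> C / \<beta> * exp (\<beta> * x) - C / \<beta> * exp (\<beta> * (- real n))"
        using that \<open>- x \<le> real N\<close> \<open>x \<le> 0\<close> by (intro neg) auto
      moreover have "0 \<le> C / \<beta> * exp (\<beta> * (- real n))" using C \<beta> by simp
      ultimately show ?thesis by linarith
    qed
    ultimately show ?thesis by (intro LIMSEQ_le_const2) auto
  qed
  define h where "h x = exp (- x / \<delta>) * (A x - L) / \<delta>" for x
  have "(h has_real_derivative (u x - h x) / \<delta>) (at x)" for x
  proof -
    have "exp (- x / \<delta>) * exp (x / \<delta>) = 1" by (simp add: exp_add[symmetric])
    then show ?thesis unfolding h_def using \<delta> A[of x]
      by (auto intro!: derivative_eq_intros simp: field_simps)
  qed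
  moreover have "\<bar>h x\<bar> \<le> ((C / \<beta> + C / \<beta>') / \<delta>) * exp (- \<kappa> * \<bar>x\<bar>)" for x
  proof -
    have *: "exp (- x / \<delta>) * \<bar>A x - L\<bar> \<le> (C / \<beta> + C / \<beta>') * exp (- \<kappa> * \<bar>x\<bar>)"
    proof (cases "x \<le> 0")
      case True
      have "exp (- x / \<delta>) * \<bar>A x - L\<bar> \<le> exp (- x / \<delta>) * (C / \<beta> * exp (\<beta> * x))"
        using AL[OF True] by (intro mult_left_mono) auto
      also have "\<dots> = C / \<beta> * exp (- x / \<delta> + \<beta> * x)" by (simp only: exp_add mult_ac)
      also have "- x / \<delta> + \<beta> * x = - \<kappa> * \<bar>x\<bar>" using True by (simp add: \<beta>_def algebra_simps)
      also have "C / \<beta> * exp (- \<kappa> * \<bar>x\<bar>) \<le> (C / \<beta> + C / \<beta>') * exp (- \<kappa> * \<bar>x\<bar>)"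
        using C \<beta> by (intro mult_right_mono) auto
      finally show ?thesis .
    next
      case False
      have "\<bar>A x - L\<bar> \<le> \<bar>A 0 - L\<bar> + \<bar>A x - A 0\<bar>" by simp
      also have "\<dots> \<le> C / \<beta> + C / \<beta>' * exp (\<beta>' * x)"
      proof -
        have "0 \<le> C / \<beta>'" using C \<beta> by simp
        then show ?thesis using AL[of 0] pos[of x] False by simp
      qed
      also have "\<dots> \<le> C / \<beta> * exp (\<beta>' * x) + C / \<beta>' * exp (\<beta>' * x)"
      proof -
        have "0 \<le> C / \<beta>" "1 \<le> exp (\<beta>' * x)" using C \<beta> False by auto
        then show ?thesis using mult_left_mono[of 1 "exp (\<beta>' * x)" "C / \<beta>"] by simp
      qed
      finally have "exp (- x / \<delta>) * \<bar>A x - L\<bar> \<le> exp (- x / \<delta>) * ((C / \<beta> + C / \<beta>') * exp (\<beta>' * x))"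
        by (intro mult_left_mono) (auto simp: distrib_right)
      also have "\<dots> = (C / \<beta> + C / \<beta>') * exp (- x / \<delta> + \<beta>' * x)" by (simp only: exp_add mult_ac)
      also have "- x / \<delta> + \<beta>' * x = - \<kappa> * \<bar>x\<bar>" using False by (simp add: \<beta>'_def algebra_simps)
      finally show ?thesis .
    qed
    have "\<bar>h x\<bar> = exp (- x / \<delta>) * \<bar>A x - L\<bar> / \<delta>" using \<delta> by (simp add: h_def abs_mult)
    also have "\<dots> \<le> (C / \<beta> + C / \<beta>') * exp (- \<kappa> * \<bar>x\<bar>) / \<delta>" using \<delta> * by (intro divide_right_mono) auto
    finally show ?thesis by simp
  qed
  ultimately show ?thesis by blast
qed

text \<open>Only \<open>H 0\<close> requires solving the equation. The equation itself then defines
  the higher derivatives, which inherit the decay from \<open>G\<close> and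
  \<open>H 0\<close>.\<close>

lemma exponential_convolution_jet_pos:
  assumes G: "decay_jet \<kappa> G" and \<delta>: "\<delta> > 0" and \<kappa>: "\<kappa> > 0" "\<kappa> < 1 / \<delta>"
  shows "\<exists>H. decay_jet \<kappa> H \<and> (\<forall>s x. H s x + \<delta> * H (Suc s) x = G s x)"
proof -
  have jG: "jet G" and bG: "\<And>s. \<exists>C. \<forall>x. \<bar>G s x\<bar> \<le> C * exp (- \<kappa> * \<bar>x\<bar>)" using G by (auto simp: decay_jet_def)
  obtain C where "\<And>x. \<bar>G 0 x\<bar> \<le> C * exp (- \<kappa> * \<bar>x\<bar>)" using bG by blast
  moreover have "isCont (G 0) x" for x using jetD[OF jG] by (rule DERIV_isCont)
  ultimately obtain h D where h: "\<And>x. (h has_real_derivative (G 0 x - h x) / \<delta>) (at x)"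
    "\<And>x. \<bar>h x\<bar> \<le> D * exp (- \<kappa> * \<bar>x\<bar>)"
    using decaying_ode_solution[OF \<delta> \<kappa>, of "G 0" C] by blast
  define H where "H = rec_nat h (\<lambda>s Hs x. (G s x - Hs x) / \<delta>)"
  have H: "H 0 = h" "H (Suc s) = (\<lambda>x. (G s x - H s x) / \<delta>)" for s by (simp_all add: H_def)
  have "(H s has_real_derivative H (Suc s) x) (at x)" for s x
  proof (induction s)
    case (Suc s)
    then show ?case unfolding H(2)[of "Suc s"] unfolding H(2)[of s]
      using \<delta> by (auto intro!: derivative_eq_intros jetD[OF jG] simp: H(2))
  qed (simp add: H h)
  then have "jet H" by (simp add: jet_def)
  moreover have "\<exists>C. \<forall>x. \<bar>H s x\<bar> \<le> C * exp (- \<kappa> * \<bar>x\<bar>)" for s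
  proof (induction s)
    case (Suc s)
    then obtain C1 where C1: "\<And>x. \<bar>H s x\<bar> \<le> C1 * exp (- \<kappa> * \<bar>x\<bar>)" by blast
    obtain C2 where C2: "\<And>x. \<bar>G s x\<bar> \<le> C2 * exp (- \<kappa> * \<bar>x\<bar>)" using bG by blast
    have "\<bar>H (Suc s) x\<bar> \<le> ((C1 + C2) / \<delta>) * exp (- \<kappa> * \<bar>x\<bar>)" for x
    proof -
      have "\<bar>G s x - H s x\<bar> \<le> (C1 + C2) * exp (- \<kappa> * \<bar>x\<bar>)"
        using C1[of x] C2[of x] by (simp add: distrib_right)
      then have "\<bar>G s x - H s x\<bar> / \<delta> \<le> (C1 + C2) * exp (- \<kappa> * \<bar>x\<bar>) / \<delta>" using \<delta> by (intro divide_right_mono) auto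
      then show ?thesis using \<delta> by (simp add: H)
    qed
    then show ?case by blast
  qed (use h H in auto)
  ultimately have "decay_jet \<kappa> H" by (simp add: decay_jet_def)
  moreover have "H s x + \<delta> * H (Suc s) x = G s x" for s x using \<delta> by (simp add: H)
  ultimately show ?thesis by blast
qed

lemma decay_jet_reflect:
  assumes "decay_jet \<kappa> G"
  shows "decay_jet \<kappa> (\<lambda>s x. (-1) ^ s * G s (- x))"
proof -
  have j: "jet G" using assms by (simp add: decay_jet_def)
  have "((\<lambda>x. (-1) ^ s * G s (- x)) has_real_derivative (-1) ^ s * (G (Suc s) (- x) * (- 1))) (at x)" for s x
    by (intro DERIV_cmult DERIV_chain2[where f = "G s"] jetD[OF j]) (auto intro!: derivative_eq_intros)
  then have "jet (\<lambda>s x. (-1) ^ s * G s (- x))" by (simp add: jet_def)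
  moreover have "\<exists>C. \<forall>x. \<bar>(-1) ^ s * G s (- x)\<bar> \<le> C * exp (- \<kappa> * \<bar>x\<bar>)" for s
  proof -
    obtain C where C: "\<And>x. \<bar>G s x\<bar> \<le> C * exp (- \<kappa> * \<bar>x\<bar>)" using assms by (auto simp: decay_jet_def)
    show ?thesis using C[of "- x" for x] by (intro exI[of _ C]) (simp add: abs_mult power_abs)
  qed
  ultimately show ?thesis by (simp add: decay_jet_def)
qed

text \<open>For \<open>\<delta> < 0\<close> the reflection \<open>x \<mapsto> - x\<close> changes
  the sign of \<open>\<delta>\<close>; the sign \<open>(-1) ^ s\<close> is what it does to the
  derivative of order \<open>s\<close>.\<close>

lemma exponential_convolution_jet:
  assumes G: "decay_jet \<kappa> G" and \<delta>: "\<delta> \<noteq> 0" and \<kappa>: "\<kappa> > 0" "\<kappa> * \<bar>\<delta>\<bar> < 1"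
  shows "\<exists>H. decay_jet \<kappa> H \<and> (\<forall>s x. H s x + \<delta> * H (Suc s) x = G s x)"
proof (cases "\<delta> > 0")
  case True
  then show ?thesis using exponential_convolution_jet_pos[OF G True \<kappa>(1)] \<kappa> by (simp add: field_simps)
next
  case False
  then have "- \<delta> > 0" "\<kappa> < 1 / - \<delta>" using \<delta> \<kappa> by (auto simp: field_simps)
  then obtain H where H: "decay_jet \<kappa> H" "\<And>s x. H s x + - \<delta> * H (Suc s) x = (-1) ^ s * G s (- x)"
    using exponential_convolution_jet_pos[OF decay_jet_reflect[OF G] _ \<kappa>(1)] by blast
  have "(-1) ^ s * H s (- x) + \<delta> * ((-1) ^ Suc s * H (Suc s) (- x)) = G s x" for s x
  proof -
    have "(-1) ^ s * H s (- x) + \<delta> * ((-1) ^ Suc s * H (Suc s) (- x)) = (-1) ^ s * (H s (- x) + - \<delta> * H (Suc s) (- x))"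
      by (simp add: algebra_simps)
    also have "\<dots> = ((-1) ^ s * (-1) ^ s) * G s x" unfolding H(2) by simp
    also have "\<dots> = G s x" by (simp add: power_mult_distrib[symmetric])
    finally show ?thesis .
  qed
  then show ?thesis using decay_jet_reflect[OF H(1)] by blast
qed

section \<open>Fourier transforms of decaying functions and their injectivity\<close>

lemma integrable_exp_abs:
  fixes \<kappa> :: real
  assumes "\<kappa> > 0"
  shows "integrable lborel (\<lambda>x. exp (- \<kappa> * \<bar>x\<bar>))"
proof (rule Bochner_Integration.integrable_bound)
  have "integrable lborel (\<lambda>x::real. inverse (1 + x\<^sup>2))"
    using integrable_inverse_1_plus_square by (simp add: set_integrable_def einterval_eq_UNIV)
  then show "integrable lborel (\<lambda>x::real. (1 + 2 / \<kappa>\<^sup>2) * inverse (1 + x\<^sup>2))" by simp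
  show "(\<lambda>x. exp (- \<kappa> * \<bar>x\<bar>)) \<in> borel_measurable lborel" by measurable
  have "exp (- \<kappa> * \<bar>x\<bar>) \<le> (1 + 2 / \<kappa>\<^sup>2) * inverse (1 + x\<^sup>2)" for x
  proof -
    have "\<kappa>\<^sup>2 * x\<^sup>2 \<le> 2 * exp (\<kappa> * \<bar>x\<bar>)"
      using pow_le_fact_exp[of "\<kappa> * \<bar>x\<bar>" 2] assms by (simp add: power_mult_distrib)
    then have "x\<^sup>2 \<le> 2 / \<kappa>\<^sup>2 * exp (\<kappa> * \<bar>x\<bar>)" using assms by (simp add: field_simps)
    moreover have "1 \<le> exp (\<kappa> * \<bar>x\<bar>)" using assms by simp
    ultimately have "1 + x\<^sup>2 \<le> (1 + 2 / \<kappa>\<^sup>2) * exp (\<kappa> * \<bar>x\<bar>)" unfolding distrib_right by linarith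
    then have "(1 + x\<^sup>2) * exp (- (\<kappa> * \<bar>x\<bar>)) \<le> 1 + 2 / \<kappa>\<^sup>2"
      by (simp add: exp_minus divide_inverse[symmetric] pos_divide_le_eq)
    moreover have "1 + x\<^sup>2 > 0" by (simp add: add_pos_nonneg)
    ultimately have "exp (- (\<kappa> * \<bar>x\<bar>)) \<le> (1 + 2 / \<kappa>\<^sup>2) / (1 + x\<^sup>2)" by (simp add: pos_le_divide_eq mult.commute)
    then show ?thesis by (simp only: divide_inverse mult_minus_left)
  qed
  then show "AE x in lborel. norm (exp (- \<kappa> * \<bar>x\<bar>)) \<le> norm ((1 + 2 / \<kappa>\<^sup>2) * inverse (1 + x\<^sup>2))"
    using abs_ge_self order_trans by (intro AE_I2) (fastforce simp: abs_mult)
qed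

lemma integrable_decaying:
  fixes u :: "real \<Rightarrow> 'a::{banach, second_countable_topology}"
  assumes "continuous_on UNIV u" "\<And>x. norm (u x) \<le> C * exp (- \<kappa> * \<bar>x\<bar>)" "\<kappa> > 0"
  shows "integrable lborel u"
proof (rule Bochner_Integration.integrable_bound)
  show "integrable lborel (\<lambda>x. C * exp (- \<kappa> * \<bar>x\<bar>))" using integrable_exp_abs[OF assms(3)] by simp
  show "u \<in> borel_measurable lborel" using assms(1) by (simp add: borel_measurable_continuous_onI)
  show "AE x in lborel. norm (u x) \<le> norm (C * exp (- \<kappa> * \<bar>x\<bar>))"
    using assms(2) abs_ge_self order_trans by (intro AE_I2) fastforce
qed

lemma fourier_lborel:
  assumes "continuous_on UNIV f"
  shows "fourier f \<xi> = (LINT t|lborel. f t * exp (- 2 * pi * \<i> * complex_of_real (t * \<xi>)))"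
proof -
  have "(\<lambda>t. f t * exp (- 2 * pi * \<i> * complex_of_real (t * \<xi>))) \<in> borel_measurable borel"
    by (intro borel_measurable_continuous_onI continuous_intros assms)
  then show ?thesis unfolding fourier_def by (intro integral_completion) simp
qed

lemma continuous_on_jet: "jet F \<Longrightarrow> continuous_on UNIV (F s)"
  by (meson DERIV_isCont continuous_at_imp_continuous_on jetD)

lemma decay_jet_tendsto_0:
  assumes G: "decay_jet \<kappa> G" and \<kappa>: "\<kappa> > 0"
  shows "(G s \<longlongrightarrow> 0) at_top" "(G s \<longlongrightarrow> 0) at_bot"
proof -
  obtain C where C: "\<And>x. \<bar>G s x\<bar> \<le> C * exp (- \<kappa> * \<bar>x\<bar>)" using G by (auto simp: decay_jet_def)
  have 1: "((\<lambda>x. C * exp (- \<kappa> * x)) \<longlongrightarrow> 0) at_top" "((\<lambda>x. C * exp (- \<kappa> * (- x))) \<longlongrightarrow> 0) at_bot"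
    using \<kappa> by real_asymp+
  have "\<forall>\<^sub>F x in at_top. \<bar>G s x\<bar> \<le> C * exp (- \<kappa> * x)"
    using eventually_ge_at_top[of 0] by eventually_elim (use C in \<open>simp add: abs_of_nonneg\<close>, metis abs_of_nonneg)
  then show "(G s \<longlongrightarrow> 0) at_top" by (intro tendsto_rabs_zero_cancel[OF tendsto_sandwich[OF _ _ tendsto_const 1(1)]]) auto
  have "\<forall>\<^sub>F x in at_bot. \<bar>G s x\<bar> \<le> C * exp (- \<kappa> * (- x))"
    using eventually_le_at_bot[of 0] by eventually_elim (use C in \<open>metis abs_of_nonpos\<close>)
  then show "(G s \<longlongrightarrow> 0) at_bot" by (intro tendsto_rabs_zero_cancel[OF tendsto_sandwich[OF _ _ tendsto_const 1(2)]]) auto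
qed

text \<open>Integration by parts, in the form that the derivative of \<open>G s t\<close> times the
  exponential has integral 0 because the product tends to 0 at both ends.\<close>

lemma fourier_decay_jet_deriv:
  assumes G: "decay_jet \<kappa> G" and \<kappa>: "\<kappa> > 0"
  shows "fourier (\<lambda>t. of_real (G (Suc s) t)) \<xi> = 2 * pi * \<i> * of_real \<xi> * fourier (\<lambda>t. of_real (G s t)) \<xi>"
proof -
  let ?e = "\<lambda>t. exp (- 2 * pi * \<i> * complex_of_real (t * \<xi>))"
  let ?f = "\<lambda>t. of_real (G (Suc s) t) * ?e t - 2 * pi * \<i> * of_real \<xi> * (of_real (G s t) * ?e t)"
  have jG: "jet G" using G by (simp add: decay_jet_def)
  have cont: "continuous_on UNIV (\<lambda>t. complex_of_real (G s t))" for s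
    using continuous_on_jet[OF jG] by (intro continuous_intros)
  have int: "integrable lborel (\<lambda>t. of_real (G s t) * ?e t)" for s
  proof -
    obtain C where C: "\<And>x. \<bar>G s x\<bar> \<le> C * exp (- \<kappa> * \<bar>x\<bar>)" using G by (auto simp: decay_jet_def)
    show ?thesis using C by (intro integrable_decaying[OF _ _ \<kappa>] continuous_intros cont) (simp add: norm_mult)
  qed
  have contf: "continuous_on UNIV ?f" by (intro continuous_intros cont)
  have der: "((\<lambda>t. of_real (G s t) * ?e t) has_vector_derivative ?f t) (at t)" for t
  proof -
    have e: "((\<lambda>t. ?e t) has_vector_derivative (- 2 * pi * \<i> * of_real \<xi>) * ?e t) (at t)"
    proof -
      have "((\<lambda>z. exp (- 2 * pi * \<i> * (z * of_real \<xi>))) has_field_derivative (- 2 * pi * \<i> * of_real \<xi>) * exp (- 2 * pi * \<i> * (of_real t * of_real \<xi>))) (at (of_real t))"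
        by (auto intro!: derivative_eq_intros)
      then show ?thesis unfolding of_real_mult by (rule has_vector_derivative_real_field)
    qed
    have "((\<lambda>t. complex_of_real (G s t)) has_vector_derivative of_real (G (Suc s) t)) (at t)"
      using jetD[OF jG] by (intro has_vector_derivative_of_real) (simp add: has_real_derivative_iff_has_vector_derivative)
    from has_vector_derivative_mult[OF this e] show ?thesis by (simp add: algebra_simps)
  qed
  have tend: "((\<lambda>t. of_real (G s t) * ?e t) \<longlongrightarrow> 0) F" if "(G s \<longlongrightarrow> 0) F" for F
    by (rule tendsto_norm_zero_cancel) (use tendsto_rabs_zero[OF that] in \<open>simp add: norm_mult\<close>)
  have "(LBINT t=-\<infinity>..\<infinity>. ?f t) = 0 - 0"
  proof (rule interval_integral_FTC_integrable)
    show "isCont ?f x" for x using contf by (simp add: continuous_on_eq_continuous_at)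
    show "set_integrable lborel (einterval (- \<infinity>) \<infinity>) ?f"
      using int by (simp add: set_integrable_def einterval_eq_UNIV)
    show "(((\<lambda>t. of_real (G s t) * ?e t) \<circ> real_of_ereal) \<longlongrightarrow> 0) (at_right (- \<infinity>))"
      unfolding ereal_tendsto_simps by (rule tend) (rule decay_jet_tendsto_0[OF G \<kappa>])
    show "(((\<lambda>t. of_real (G s t) * ?e t) \<circ> real_of_ereal) \<longlongrightarrow> 0) (at_left \<infinity>)"
      unfolding ereal_tendsto_simps by (rule tend) (rule decay_jet_tendsto_0[OF G \<kappa>])
  qed (use der in auto)
  then have "(LINT t|lborel. ?f t) = 0"
    by (simp add: interval_lebesgue_integral_def set_lebesgue_integral_def einterval_eq_UNIV)
  then show ?thesis unfolding fourier_lborel[OF cont] using int by simp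
qed

lemma fourier_exponential_convolution:
  assumes H: "decay_jet \<kappa> H" and \<kappa>: "\<kappa> > 0" and rel: "\<And>x. H 0 x + \<delta> * H 1 x = G 0 x"
  shows "fourier (\<lambda>t. of_real (G 0 t)) \<xi> = (1 + 2 * pi * \<i> * complex_of_real (\<delta> * \<xi>)) * fourier (\<lambda>t. of_real (H 0 t)) \<xi>"
proof -
  let ?e = "\<lambda>t. exp (- 2 * pi * \<i> * complex_of_real (t * \<xi>))"
  have jH: "jet H" using H by (simp add: decay_jet_def)
  have cont: "continuous_on UNIV (\<lambda>t. complex_of_real (H s t))" for s
    using continuous_on_jet[OF jH] by (intro continuous_intros)
  have int: "integrable lborel (\<lambda>t. of_real (H s t) * ?e t)" for s
  proof -
    obtain C where C: "\<And>x. \<bar>H s x\<bar> \<le> C * exp (- \<kappa> * \<bar>x\<bar>)" using H by (auto simp: decay_jet_def)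
    show ?thesis using C by (intro integrable_decaying[OF _ _ \<kappa>] continuous_intros cont) (simp add: norm_mult)
  qed
  have contG: "continuous_on UNIV (\<lambda>t. complex_of_real (G 0 t))"
    unfolding rel[symmetric] using continuous_on_jet[OF jH] by (intro continuous_intros)
  have "fourier (\<lambda>t. of_real (G 0 t)) \<xi> = (LINT t|lborel. of_real (H 0 t) * ?e t + of_real \<delta> * (of_real (H (Suc 0) t) * ?e t))"
    unfolding fourier_lborel[OF contG] unfolding rel[symmetric] by (simp add: algebra_simps)
  also have "\<dots> = fourier (\<lambda>t. of_real (H 0 t)) \<xi> + of_real \<delta> * fourier (\<lambda>t. of_real (H (Suc 0) t)) \<xi>"
    using int by (simp add: fourier_lborel[OF cont])
  finally show ?thesis unfolding fourier_decay_jet_deriv[OF H \<kappa>] by (simp add: algebra_simps)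
qed

text \<open>The substitution with \<open>b = 1 / sqrt (2 * a)\<close> turns the Gaussian into the
  standard normal density, so the value comes from the characteristic function of the normal
  distribution.\<close>

lemma fourier_gauss:
  assumes c: "c > 0"
  defines "a \<equiv> pi\<^sup>2 / c"
  shows "fourier (\<lambda>t. of_real (sqrt (a / pi) * exp (- a * t\<^sup>2))) \<xi> = exp (- complex_of_real (c * \<xi>\<^sup>2))"
proof -
  have a: "a > 0" using c by (simp add: a_def)
  define b where "b = 1 / sqrt (2 * a)"
  have b: "b > 0" using a by (simp add: b_def)
  have b2: "b\<^sup>2 = 1 / (2 * a)" using a by (simp add: b_def power_divide)
  let ?f = "\<lambda>t. complex_of_real (sqrt (a / pi) * exp (- a * t\<^sup>2)) * exp (- 2 * pi * \<i> * complex_of_real (t * \<xi>))"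
  have "fourier (\<lambda>t. of_real (sqrt (a / pi) * exp (- a * t\<^sup>2))) \<xi> = (LINT t|lborel. ?f t)"
    by (intro fourier_lborel continuous_intros)
  also have "\<dots> = \<bar>b\<bar> *\<^sub>R (LINT x|lborel. ?f (0 + b * x))" using b by (intro lborel_integral_real_affine) auto
  also have "\<dots> = (LINT x|lborel. std_normal_density x *\<^sub>R iexp ((- 2 * pi * b * \<xi>) * x))"
  proof -
    have "b * sqrt (a / pi) = 1 / sqrt (2 * pi)" using a by (simp add: b_def real_sqrt_divide real_sqrt_mult)
    moreover have "- a * (b * x)\<^sup>2 = - x\<^sup>2 / 2" for x using a by (simp add: power_mult_distrib b2)
    ultimately have "b * (sqrt (a / pi) * exp (- a * (b * x)\<^sup>2)) = std_normal_density x" for x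
      unfolding std_normal_density_def by (simp only: mult.assoc[symmetric])
    moreover have "- 2 * pi * \<i> * complex_of_real ((0 + b * x) * \<xi>) = \<i> * complex_of_real ((- 2 * pi * b * \<xi>) * x)" for x
      by simp
    ultimately have "\<bar>b\<bar> *\<^sub>R ?f (0 + b * x) = std_normal_density x *\<^sub>R iexp ((- 2 * pi * b * \<xi>) * x)" for x
      using b by (simp only: scaleR_conv_of_real mult.assoc[symmetric] of_real_mult[symmetric] abs_of_pos add_0_left)
    then show ?thesis by (simp flip: integral_scaleR_right)
  qed
  also have "\<dots> = char std_normal_distribution (- 2 * pi * b * \<xi>)"
    unfolding char_def by (subst integral_density) (auto simp: normal_density_nonneg)
  also have "\<dots> = complex_of_real (exp (- ((- 2 * pi * b * \<xi>)\<^sup>2) / 2))" by (simp add: char_std_normal_distribution)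
  also have "- ((- 2 * pi * b * \<xi>)\<^sup>2) / 2 = - (c * \<xi>\<^sup>2)"
    using c by (simp add: power_mult_distrib b2 a_def field_simps)
  finally show ?thesis by (simp only: exp_of_real flip: of_real_minus)
qed

lemma continuous_AE_zero:
  fixes u :: "real \<Rightarrow> 'a::real_normed_vector"
  assumes cont: "continuous_on UNIV u" and ae: "AE x in lborel. u x = 0"
  shows "u x = 0"
proof (rule ccontr)
  assume "u x \<noteq> 0"
  have op: "open {x. u x \<noteq> 0}" using cont by (intro open_Collect_neq continuous_intros)
  have "{x. u x \<noteq> 0} \<in> null_sets lborel" using ae op by (subst AE_iff_null_sets) auto
  then have "negligible {x. u x \<noteq> 0}" by (simp add: negligible_iff_null_sets null_sets_completionI)
  then show False using open_not_negligible[OF op] \<open>u x \<noteq> 0\<close> by blast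
qed

text \<open>The positive and the negative part of \<open>u\<close> have the same transform, hence
  (at frequency 0) the same integral \<open>m\<close>. If \<open>m > 0\<close>, division by
  \<open>m\<close> gives two probability densities with equal characteristic functions, which agree
  by Levy's uniqueness theorem. Continuity removes the null set.\<close>

lemma fourier_zero_real:
  fixes u :: "real \<Rightarrow> real"
  assumes cont: "continuous_on UNIV u" and int: "integrable lborel u"
    and z: "\<And>\<xi>. fourier (\<lambda>t. of_real (u t)) \<xi> = 0"
  shows "u x = 0"
proof (rule continuous_AE_zero[OF cont])
  define p q where "p x = max 0 (u x)" and "q x = max 0 (- u x)" for x
  have [measurable]: "u \<in> borel_measurable lborel" using int by auto
  have pq: "u x = p x - q x" "p x \<ge> 0" "q x \<ge> 0" for x by (auto simp: p_def q_def)
  have ip: "integrable lborel p" and iq: "integrable lborel q"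
    unfolding p_def q_def using int by auto
  have [measurable]: "p \<in> borel_measurable lborel" "q \<in> borel_measurable lborel" using ip iq by auto
  have ft: "(LINT t|lborel. p t *\<^sub>R iexp (s * t)) = (LINT t|lborel. q t *\<^sub>R iexp (s * t))" for s
  proof -
    have "fourier (\<lambda>t. of_real (u t)) (- s / (2 * pi)) = (LINT t|lborel. p t *\<^sub>R iexp (s * t) - q t *\<^sub>R iexp (s * t))"
    proof -
      have "continuous_on UNIV (\<lambda>t. complex_of_real (u t))" using cont by (intro continuous_intros)
      then show ?thesis by (simp only: fourier_lborel)
        (intro Bochner_Integration.integral_cong refl, simp add: pq(1) scaleR_conv_of_real algebra_simps)
    qed
    also have "\<dots> = (LINT t|lborel. p t *\<^sub>R iexp (s * t)) - (LINT t|lborel. q t *\<^sub>R iexp (s * t))"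
      by (intro Bochner_Integration.integral_diff Bochner_Integration.integrable_bound[OF ip] Bochner_Integration.integrable_bound[OF iq])
        (auto simp: pq)
    finally show ?thesis using z by simp
  qed
  define m where "m = (LINT t|lborel. p t)"
  have mq: "m = (LINT t|lborel. q t)" using ft[of 0] by (simp add: m_def scaleR_conv_of_real)
  show "AE x in lborel. u x = 0"
  proof (cases "m = 0")
    case True
    then have "AE x in lborel. p x = 0" "AE x in lborel. q x = 0"
      using integral_nonneg_eq_0_iff_AE[OF ip] integral_nonneg_eq_0_iff_AE[OF iq] pq mq by (auto simp: m_def)
    then show ?thesis by eventually_elim (simp add: pq(1))
  next
    case False
    have m: "m > 0" 
    proof -
      have "0 \<le> m" unfolding m_def by (rule Bochner_Integration.integral_nonneg) (rule pq)
      then show ?thesis using False by simp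
    qed
    let ?D = "\<lambda>p. density lborel (\<lambda>x. ennreal (p x / m))"
    have rd: "real_distribution (?D p)" if "integrable lborel p" "\<And>x. p x \<ge> 0" "m = (LINT t|lborel. p t)" for p
    proof -
      have [measurable]: "p \<in> borel_measurable lborel" using that by auto
      have "emeasure (?D p) (space (?D p)) = (\<integral>\<^sup>+x. ennreal (p x / m) \<partial>lborel)"
        by (simp add: emeasure_density)
      also have "\<dots> = ennreal (LINT x|lborel. p x / m)"
        using that m by (intro nn_integral_eq_integral) auto
      also have "(LINT x|lborel. p x / m) = 1" using that(3) m by simp
      finally have "prob_space (?D p)" by (intro prob_spaceI) simp
      then show ?thesis by (simp add: real_distribution_def real_distribution_axioms_def)
    qed
    have ch: "char (?D p) s = (LINT t|lborel. p t *\<^sub>R iexp (s * t)) / m" if "p \<in> borel_measurable lborel" "\<And>x. p x \<ge> 0" for p s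
    proof -
      have [measurable]: "p \<in> borel_measurable lborel" using that by auto
      have "char (?D p) s = (LINT t|lborel. (p t / m) *\<^sub>R iexp (s * t))"
        unfolding char_def using that m by (subst integral_density) auto
      also have "\<dots> = (LINT t|lborel. p t *\<^sub>R iexp (s * t) / m)"
        by (simp add: scaleR_conv_of_real)
      also have "\<dots> = (LINT t|lborel. p t *\<^sub>R iexp (s * t)) / m" by simp
      finally show ?thesis .
    qed
    have "?D p = ?D q"
    proof (intro Levy_uniqueness rd ip iq pq m_def mq ext)
      fix s
      show "char (?D p) s = char (?D q) s"
        by (subst (1 2) ch) (use pq ft in auto)
    qed
    then have "AE x in lborel. ennreal (p x / m) = ennreal (q x / m)"
      by (subst (asm) sigma_finite_measure.density_unique_iff[OF sigma_finite_lborel]) auto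
    then show ?thesis by eventually_elim (use m pq in auto)
  qed
qed

text \<open>Conjugating \<open>u\<close> conjugates the transform and reflects the frequency, so the
  transforms of \<open>u\<close> and of its conjugate both vanish, and with them those of the real
  and imaginary part.\<close>

lemma fourier_zero:
  fixes u :: "real \<Rightarrow> complex"
  assumes cont: "continuous_on UNIV u" and int: "integrable lborel u"
    and z: "\<And>\<xi>. fourier u \<xi> = 0"
  shows "u x = 0"
proof -
  let ?e = "\<lambda>\<xi> t. exp (- 2 * pi * \<i> * complex_of_real (t * \<xi>))"
  have i: "integrable lborel (\<lambda>t. u t * ?e \<xi> t)" "integrable lborel (\<lambda>t. cnj (u t) * ?e \<xi> t)" for \<xi>
    using cont by (auto intro!: Bochner_Integration.integrable_bound[OF int] borel_measurable_continuous_onI continuous_intros simp: norm_mult)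
  have 0: "(LINT t|lborel. u t * ?e \<xi> t) = 0" for \<xi> using z[of \<xi>] by (simp add: fourier_lborel[OF cont])
  have "(LINT t|lborel. cnj (u t) * ?e \<xi> t) = cnj (LINT t|lborel. u t * ?e (- \<xi>) t)" for \<xi>
  proof -
    have "(LINT t|lborel. cnj (u t) * ?e \<xi> t) = (LINT t|lborel. cnj (u t * ?e (- \<xi>) t))"
      by (intro Bochner_Integration.integral_cong refl) (simp add: exp_cnj)
    then show ?thesis by (simp only: Bochner_Integration.integral_cnj)
  qed
  then have 1: "(LINT t|lborel. cnj (u t) * ?e \<xi> t) = 0" for \<xi> by (simp only: 0 complex_cnj_zero)
  have "fourier (\<lambda>t. of_real (Re (u t))) \<xi> = 0" for \<xi>
  proof -
    have "fourier (\<lambda>t. of_real (Re (u t))) \<xi> = (LINT t|lborel. (u t * ?e \<xi> t + cnj (u t) * ?e \<xi> t) / 2)"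
      using cont by (subst fourier_lborel) (auto intro!: continuous_intros Bochner_Integration.integral_cong
          simp: complex_add_cnj distrib_right[symmetric])
    then show ?thesis using i[of \<xi>] 0[of \<xi>] 1[of \<xi>] by simp
  qed
  moreover have "fourier (\<lambda>t. of_real (Im (u t))) \<xi> = 0" for \<xi>
  proof -
    have "fourier (\<lambda>t. of_real (Im (u t))) \<xi> = (LINT t|lborel. (u t * ?e \<xi> t - cnj (u t) * ?e \<xi> t) / (2 * \<i>))"
    proof -
      have "continuous_on UNIV (\<lambda>t. complex_of_real (Im (u t)))" using cont by (intro continuous_intros)
      moreover have "of_real (Im (u t)) * ?e \<xi> t = (u t * ?e \<xi> t - cnj (u t) * ?e \<xi> t) / (2 * \<i>)" for t
        unfolding left_diff_distrib[symmetric] complex_diff_cnj by (subst nonzero_eq_divide_eq) simp_all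
      ultimately show ?thesis by (simp only: fourier_lborel)
    qed
    then show ?thesis using i[of \<xi>] 0[of \<xi>] 1[of \<xi>] by simp
  qed
  ultimately have "Re (u x) = 0" "Im (u x) = 0"
    using cont int
    by (auto intro!: fourier_zero_real[where u = "\<lambda>t. Re (u t)"] fourier_zero_real[where u = "\<lambda>t. Im (u t)"] continuous_intros)
  then show ?thesis by (simp add: complex_eq_iff)
qed

text \<open>Factors are added one at a time to the Gaussian, each step preserving decay and
  uniqueness; a vanishing \<open>\<delta> j\<close> contributes the factor 1. Injectivity of the
  Fourier transform on continuous integrable functions identifies the outcome with
  \<open>g\<close>.\<close>

theorem tp_gaussian_type_jet:
  assumes "tp_gaussian_type g"
  shows "\<exists>\<kappa> G. \<kappa> > 0 \<and> decay_jet \<kappa> G \<and> g = (\<lambda>x. of_real (G 0 x)) \<and> (\<forall>\<epsilon><\<kappa>. zero_uniq \<epsilon> G)"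
proof -
  from assms obtain n :: nat and \<delta> c where cont: "continuous_on UNIV g" and int: "integrable lebesgue g" and c: "c > 0"
    and ft: "\<And>\<xi>. fourier g \<xi> = (\<Prod>j\<in>{1..n}. inverse (1 + 2 * pi * \<i> * complex_of_real (\<delta> j * \<xi>))) * exp (- complex_of_real (c * \<xi>\<^sup>2))"
    unfolding tp_gaussian_type_def by blast
  \<comment> \<open>Small enough that \<open>\<kappa> * \<bar>\<delta> j\<bar> < 1\<close> for every
    \<open>j\<close>, so one decay rate survives all steps; the 1 in the denominator covers the
    empty product.\<close>
  define \<kappa> where "\<kappa> = 1 / (1 + (\<Sum>j\<in>{1..n}. \<bar>\<delta> j\<bar>))"
  have S: "(\<Sum>j\<in>{1..n}. \<bar>\<delta> j\<bar>) \<ge> 0" by (intro sum_nonneg) auto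
  then have "1 + (\<Sum>j\<in>{1..n}. \<bar>\<delta> j\<bar>) > 0" by linarith
  then have \<kappa>: "\<kappa> > 0" unfolding \<kappa>_def by (rule divide_pos_pos[OF zero_less_one])
  have small: "\<kappa> * \<bar>\<delta> j\<bar> < 1" if "j \<in> {1..n}" for j
  proof -
    have "\<bar>\<delta> j\<bar> \<le> (\<Sum>j\<in>{1..n}. \<bar>\<delta> j\<bar>)" using that by (intro member_le_sum) auto
    then show ?thesis using S by (simp add: \<kappa>_def)
  qed
  have "\<exists>G. decay_jet \<kappa> G \<and> (\<forall>\<epsilon><\<kappa>. zero_uniq \<epsilon> G) \<and> (\<forall>\<xi>. fourier (\<lambda>t. of_real (G 0 t)) \<xi> =
      (\<Prod>j\<in>{1..m}. inverse (1 + 2 * pi * \<i> * complex_of_real (\<delta> j * \<xi>))) * exp (- complex_of_real (c * \<xi>\<^sup>2)))" if "m \<le> n" for m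
    using that
  proof (induction m)
    case 0
    define a where "a = pi\<^sup>2 / c"
    have a: "a > 0" "sqrt (a / pi) \<noteq> 0" using c by (auto simp: a_def)
    show ?case
      using decay_jet_gauss_jet[OF a(1)] zero_uniq_gauss_jet[OF a] fourier_gauss[OF c]
      by (intro exI[of _ "gauss_jet (sqrt (a / pi)) a"]) (simp add: gauss_jet_0 a_def)
  next
    case (Suc m)
    then obtain G where G: "decay_jet \<kappa> G" "\<And>\<epsilon>. \<epsilon> < \<kappa> \<Longrightarrow> zero_uniq \<epsilon> G"
      "\<And>\<xi>. fourier (\<lambda>t. of_real (G 0 t)) \<xi> = (\<Prod>j\<in>{1..m}. inverse (1 + 2 * pi * \<i> * complex_of_real (\<delta> j * \<xi>))) * exp (- complex_of_real (c * \<xi>\<^sup>2))"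
      by auto
    show ?case
    proof (cases "\<delta> (Suc m) = 0")
      case True
      then show ?thesis using G by (intro exI[of _ G]) simp
    next
      case False
      obtain H where H: "decay_jet \<kappa> H" "\<And>s x. H s x + \<delta> (Suc m) * H (Suc s) x = G s x"
        using exponential_convolution_jet[OF G(1) False \<kappa> small] Suc.prems by auto
      have "fourier (\<lambda>t. of_real (H 0 t)) \<xi> = (\<Prod>j\<in>{1..Suc m}. inverse (1 + 2 * pi * \<i> * complex_of_real (\<delta> j * \<xi>))) * exp (- complex_of_real (c * \<xi>\<^sup>2))" for \<xi>
      proof -
        let ?w = "1 + 2 * pi * \<i> * complex_of_real (\<delta> (Suc m) * \<xi>)"
        have "Re ?w = 1" by simp
        then have "?w \<noteq> 0" by (metis zero_complex.sel(1) zero_neq_one)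
        moreover have "fourier (\<lambda>t. of_real (G 0 t)) \<xi> = ?w * fourier (\<lambda>t. of_real (H 0 t)) \<xi>"
          using H(2)[of 0] by (intro fourier_exponential_convolution[OF H(1) \<kappa>]) simp
        ultimately have "fourier (\<lambda>t. of_real (H 0 t)) \<xi> = inverse ?w * fourier (\<lambda>t. of_real (G 0 t)) \<xi>"
          by simp
        then show ?thesis unfolding G(3) by (simp add: mult_ac)
      qed
      moreover have "zero_uniq \<epsilon> H" if "\<epsilon> < \<kappa>" for \<epsilon>
        using \<kappa> by (intro zero_uniq_step[OF G(1) H(1) that _ False H(2) G(2)[OF that]]) simp
      ultimately show ?thesis using H(1) by blast
    qed
  qed
  then obtain G where G: "decay_jet \<kappa> G" "\<And>\<epsilon>. \<epsilon> < \<kappa> \<Longrightarrow> zero_uniq \<epsilon> G"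
    and Gft: "\<And>\<xi>. fourier (\<lambda>t. of_real (G 0 t)) \<xi> = fourier g \<xi>" unfolding ft by blast
  have contG: "continuous_on UNIV (\<lambda>t. complex_of_real (G 0 t))"
    using G(1) continuous_on_jet by (auto simp: decay_jet_def intro!: continuous_intros)
  obtain C where "\<And>x. \<bar>G 0 x\<bar> \<le> C * exp (- \<kappa> * \<bar>x\<bar>)" using G(1) by (auto simp: decay_jet_def)
  then have intG: "integrable lborel (\<lambda>t. complex_of_real (G 0 t))"
    by (intro integrable_decaying[OF contG _ \<kappa>]) simp
  have intg: "integrable lborel g"
    using int cont by (simp add: integrable_completion borel_measurable_continuous_onI)
  have "fourier (\<lambda>t. g t - of_real (G 0 t)) \<xi> = 0" for \<xi>
  proof -
    let ?e = "\<lambda>t. exp (- 2 * pi * \<i> * complex_of_real (t * \<xi>))"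
    have "fourier (\<lambda>t. g t - of_real (G 0 t)) \<xi> = (LINT t|lborel. g t * ?e t - of_real (G 0 t) * ?e t)"
      using cont contG by (subst fourier_lborel) (auto intro!: continuous_intros simp: left_diff_distrib)
    also have "\<dots> = (LINT t|lborel. g t * ?e t) - (LINT t|lborel. of_real (G 0 t) * ?e t)"
      using intg intG
      by (intro Bochner_Integration.integral_diff Bochner_Integration.integrable_bound[OF intg] Bochner_Integration.integrable_bound[OF intG])
        (auto simp: norm_mult)
    finally show ?thesis using Gft[of \<xi>] by (simp add: fourier_lborel[OF cont] fourier_lborel[OF contG])
  qed
  then have "g x - of_real (G 0 x) = 0" for x
    using cont contG intg intG by (intro fourier_zero[where u = "\<lambda>t. g t - of_real (G 0 t)"] continuous_intros) auto
  then show ?thesis using G \<kappa> by (intro exI[of _ \<kappa>] exI[of _ G]) (auto simp: fun_eq_iff)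
qed

section \<open>The hyperbolic secant\<close>

text \<open>The recursion differentiates \<open>P(T) / cosh (a * x)\<close> with
  \<open>T = tanh (a * x)\<close>, using \<open>T' = a * (1 - T\<^sup>2)\<close>. As
  \<open>T\<close> is bounded, every derivative decays like the secant itself.\<close>

fun sech_poly :: "real \<Rightarrow> nat \<Rightarrow> real poly" where
  "sech_poly a 0 = 1"
| "sech_poly a (Suc s) = smult a ([:1, 0, -1:] * pderiv (sech_poly a s) - [:0, 1:] * sech_poly a s)"

definition sech_jet :: "real \<Rightarrow> nat \<Rightarrow> real \<Rightarrow> real" where
  "sech_jet a s x = poly (sech_poly a s) (tanh (a * x)) / cosh (a * x)"

lemma sech_jet_0: "sech_jet a 0 x = 1 / cosh (a * x)"
  by (simp add: sech_jet_def)

lemma jet_sech_jet: "jet (sech_jet a)"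
  unfolding jet_def
proof (intro allI)
  fix s x
  let ?P = "sech_poly a s" and ?T = "tanh (a * x)" and ?c = "cosh (a * x)"
  have c: "?c \<noteq> 0" by (simp add: cosh_real_nonzero)
  have "((\<lambda>x. poly ?P (tanh (a * x)) / cosh (a * x)) has_real_derivative
     (poly (pderiv ?P) ?T * ((1 - ?T\<^sup>2) * a) * ?c - poly ?P ?T * (sinh (a * x) * a)) / (?c * ?c)) (at x)"
    using c by (auto intro!: derivative_eq_intros simp: cosh_real_nonzero)
  also have "sinh (a * x) = ?T * ?c" using c by (simp add: tanh_def)
  also have "(poly (pderiv ?P) ?T * ((1 - ?T\<^sup>2) * a) * ?c - poly ?P ?T * (?T * ?c * a)) / (?c * ?c) = sech_jet a (Suc s) x"
    using c by (simp add: sech_jet_def field_simps power2_eq_square)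
  finally show "(sech_jet a s has_real_derivative sech_jet a (Suc s) x) (at x)"
    by (simp add: sech_jet_def[abs_def])
qed

lemma decay_jet_sech_jet:
  assumes "a > 0"
  shows "decay_jet a (sech_jet a)"
  unfolding decay_jet_def
proof (intro conjI allI jet_sech_jet)
  fix s
  let ?M = "\<Sum>i\<le>degree (sech_poly a s). \<bar>coeff (sech_poly a s) i\<bar>"
  show "\<exists>C. \<forall>x. \<bar>sech_jet a s x\<bar> \<le> C * exp (- a * \<bar>x\<bar>)"
  proof (intro exI allI)
    fix x
    have T: "\<bar>tanh (a * x)\<bar> \<le> 1" using tanh_real_bounds[of "a * x"] by auto
    have "\<bar>poly (sech_poly a s) (tanh (a * x))\<bar> \<le> (\<Sum>i\<le>degree (sech_poly a s). \<bar>coeff (sech_poly a s) i * tanh (a * x) ^ i\<bar>)"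
      unfolding poly_altdef by (rule sum_abs)
    also have "\<dots> \<le> ?M"
      unfolding abs_mult power_abs using T by (intro sum_mono mult_left_le power_le_one) auto
    finally have 1: "\<bar>poly (sech_poly a s) (tanh (a * x))\<bar> \<le> ?M" .
    have "exp \<bar>a * x\<bar> \<le> 2 * cosh (a * x)" by (auto simp: cosh_field_def abs_if)
    then have "1 / cosh (a * x) \<le> 2 * exp (- \<bar>a * x\<bar>)"
      by (simp add: exp_minus field_simps cosh_real_pos)
    then have "\<bar>poly (sech_poly a s) (tanh (a * x))\<bar> * (1 / cosh (a * x)) \<le> ?M * (2 * exp (- \<bar>a * x\<bar>))"
      using 1 by (intro mult_mono sum_nonneg) (auto simp: cosh_real_pos less_imp_le)
    moreover have "\<bar>sech_jet a s x\<bar> = \<bar>poly (sech_poly a s) (tanh (a * x))\<bar> * (1 / cosh (a * x))"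
      using cosh_real_pos[of "a * x"] by (simp add: sech_jet_def abs_divide)
    ultimately show "\<bar>sech_jet a s x\<bar> \<le> (?M * 2) * exp (- a * \<bar>x\<bar>)"
      using assms by (simp add: abs_mult)
  qed
qed

section \<open>Dividing a theta function by one of its linear factors\<close>

context
  fixes a :: real
  assumes a: "a > 0"
begin

text \<open>The Laurent coefficients of the quotient, apart from the Gaussian weight and the sign.
  Comparing coefficients gives the recurrence \<open>sech_coeff_rec\<close>; for
  \<open>m \<ge> 0\<close>, solving it for the smaller index and iterating upwards produces this
  series, and the absolute value continues it evenly.\<close>

definition sech_coeff :: "int \<Rightarrow> real" where
  "sech_coeff m = (\<Sum>l. (-1) ^ l * exp (- a * ((2 * real l + 1) * \<bar>of_int m\<bar> + real l * (real l + 1))))"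

lemma sech_coeff_term_le:
  "norm ((-1) ^ l * exp (- a * ((2 * real l + 1) * \<bar>of_int m\<bar> + real l * (real l + 1)))) \<le> exp (- a * \<bar>of_int m\<bar>) * exp (- a) ^ l"
proof -
  have "\<bar>of_int m\<bar> + real l \<le> (2 * real l + 1) * \<bar>of_int m\<bar> + real l * (real l + 1)"
    by (simp add: algebra_simps)
  then have "a * (\<bar>of_int m\<bar> + real l) \<le> a * ((2 * real l + 1) * \<bar>of_int m\<bar> + real l * (real l + 1))"
    using a by (intro mult_left_mono) auto
  then have "exp (- a * ((2 * real l + 1) * \<bar>of_int m\<bar> + real l * (real l + 1))) \<le> exp (- a * \<bar>of_int m\<bar> + real l * - a)"
    by (simp add: algebra_simps)
  also have "\<dots> = exp (- a * \<bar>of_int m\<bar>) * exp (- a) ^ l" by (simp only: exp_add exp_of_nat_mult)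
  finally show ?thesis by (simp add: abs_mult power_abs)
qed

lemma sech_coeff_summable:
  "summable (\<lambda>l. (-1) ^ l * exp (- a * ((2 * real l + 1) * \<bar>of_int m\<bar> + real l * (real l + 1))))"
  by (rule summable_comparison_test'[OF summable_mult[OF summable_geometric] sech_coeff_term_le]) (use a in simp)

lemma sech_coeff_bound: "\<bar>sech_coeff m\<bar> \<le> 1 / (1 - exp (- a)) * exp (- a * \<bar>of_int m\<bar>)"
proof -
  have s: "(\<lambda>l. exp (- a * \<bar>of_int m\<bar>) * exp (- a) ^ l) sums (exp (- a * \<bar>of_int m\<bar>) * (1 / (1 - exp (- a))))"
    using a by (intro sums_mult geometric_sums) simp
  have "norm (sech_coeff m) \<le> (\<Sum>l. exp (- a * \<bar>of_int m\<bar>) * exp (- a) ^ l)"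
    unfolding sech_coeff_def by (rule norm_suminf_le[OF sech_coeff_term_le]) (use s in \<open>simp add: sums_iff\<close>)
  then show ?thesis using s by (simp add: sums_iff)
qed

lemma sech_coeff_minus: "sech_coeff (- m) = sech_coeff m"
  by (simp add: sech_coeff_def)

text \<open>Apart from its first term, the series at \<open>m - 1\<close> times the exponential
  factor is the negative of the series at \<open>m\<close>, shifted by one index.\<close>

lemma sech_coeff_rec_pos:
  assumes "m \<ge> 1"
  shows "sech_coeff m + exp (a * (2 * of_int m - 1)) * sech_coeff (m - 1) = exp (a * of_int m)"
proof -
  let ?u = "\<lambda>l. (-1) ^ l * exp (- a * ((2 * real l + 1) * \<bar>of_int (m - 1)\<bar> + real l * (real l + 1)))"
  let ?v = "\<lambda>l. (-1) ^ l * exp (- a * ((2 * real l + 1) * \<bar>of_int m\<bar> + real l * (real l + 1)))"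
  let ?c = "exp (a * (2 * of_int m - 1))"
  have m: "\<bar>of_int m\<bar> = real_of_int m" "\<bar>of_int (m - 1)\<bar> = real_of_int m - 1" using assms by auto
  have sm: "summable (\<lambda>l. ?c * ?u l)" by (intro summable_mult sech_coeff_summable)
  have "?c * sech_coeff (m - 1) = (\<Sum>l. ?c * ?u l)"
    unfolding sech_coeff_def by (rule suminf_mult[OF sech_coeff_summable, symmetric])
  also have "\<dots> = ?c * ?u 0 + (\<Sum>l. ?c * ?u (Suc l))" using suminf_split_head[OF sm] by simp
  also have "?c * ?u 0 = exp (a * of_int m)"
    unfolding m by (simp add: exp_add[symmetric] algebra_simps)
  also have "(\<lambda>l. ?c * ?u (Suc l)) = (\<lambda>l. - ?v l)"
  proof
    fix l
    have "a * (2 * of_int m - 1) + - a * ((2 * real (Suc l) + 1) * (of_int m - 1) + real (Suc l) * (real (Suc l) + 1))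
      = - a * ((2 * real l + 1) * of_int m + real l * (real l + 1))" by (simp add: algebra_simps)
    then have "?c * exp (- a * ((2 * real (Suc l) + 1) * (of_int m - 1) + real (Suc l) * (real (Suc l) + 1)))
      = exp (- a * ((2 * real l + 1) * of_int m + real l * (real l + 1)))" by (simp only: exp_add[symmetric])
    then show "?c * ?u (Suc l) = - ?v l" unfolding m by simp
  qed
  also have "(\<Sum>l. - ?v l) = - sech_coeff m"
    unfolding sech_coeff_def by (rule suminf_minus[OF sech_coeff_summable])
  finally show ?thesis by simp
qed

text \<open>For \<open>m \<le> 0\<close> the evenness of \<open>sech_coeff\<close> turns the
  recurrence at \<open>1 - m\<close> into the one at \<open>m\<close>.\<close>

lemma sech_coeff_rec:
  "sech_coeff m + exp (a * (2 * of_int m - 1)) * sech_coeff (m - 1) = exp (a * of_int m)"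
proof (cases "m \<ge> 1")
  case False
  let ?c = "exp (a * (2 * of_int m - 1))"
  have "sech_coeff (1 - m) + exp (a * (2 * of_int (1 - m) - 1)) * sech_coeff (1 - m - 1) = exp (a * of_int (1 - m))"
    using False by (intro sech_coeff_rec_pos) auto
  moreover have "sech_coeff (1 - m) = sech_coeff (m - 1)" "sech_coeff (1 - m - 1) = sech_coeff m"
    using sech_coeff_minus[of "m - 1"] sech_coeff_minus[of m] by simp_all
  ultimately have "?c * sech_coeff (m - 1) + (?c * exp (a * (2 * of_int (1 - m) - 1))) * sech_coeff m = ?c * exp (a * of_int (1 - m))"
    by (simp add: distrib_left[symmetric] mult.assoc)
  moreover have "?c * exp (a * (2 * of_int (1 - m) - 1)) = 1" "?c * exp (a * of_int (1 - m)) = exp (a * of_int m)"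
    by (simp_all add: exp_add[symmetric] algebra_simps)
  ultimately show ?thesis by simp
qed (rule sech_coeff_rec_pos)

lemma sech_coeff_conv_term_bound:
  fixes c :: "int \<Rightarrow> real"
  assumes c: "\<bar>c k\<bar> \<le> C * exp (\<epsilon> * \<bar>of_int k\<bar>)" and \<epsilon>: "0 \<le> \<epsilon>"
  shows "\<bar>c k * sech_coeff (j - k)\<bar> \<le> C / (1 - exp (- a)) * exp (\<epsilon> * \<bar>of_int j\<bar>) * exp (- (a - \<epsilon>) * \<bar>of_int k - of_int j\<bar>)"
proof -
  have C: "C \<ge> 0" using c by (rule bound_const_nonneg)
  have p: "0 \<le> C / (1 - exp (- a))" using a C by simp
  have "\<bar>c k * sech_coeff (j - k)\<bar> \<le> (C * exp (\<epsilon> * \<bar>of_int k\<bar>)) * (1 / (1 - exp (- a)) * exp (- a * \<bar>of_int (j - k)\<bar>))"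
    unfolding abs_mult using C by (intro mult_mono c sech_coeff_bound) auto
  also have "\<dots> = C / (1 - exp (- a)) * exp (\<epsilon> * \<bar>of_int k\<bar> + - a * \<bar>of_int (j - k)\<bar>)"
    by (simp only: exp_add) simp
  also have "\<dots> \<le> C / (1 - exp (- a)) * exp (\<epsilon> * \<bar>of_int j\<bar> + - (a - \<epsilon>) * \<bar>of_int k - of_int j\<bar>)"
  proof -
    have "\<epsilon> * \<bar>of_int k\<bar> \<le> \<epsilon> * (\<bar>of_int j\<bar> + \<bar>of_int k - of_int j\<bar>)" using \<epsilon> by (intro mult_left_mono) auto
    moreover have "\<bar>of_int (j - k)\<bar> = \<bar>real_of_int k - of_int j\<bar>" by simp
    ultimately have "\<epsilon> * \<bar>of_int k\<bar> + - a * \<bar>of_int (j - k)\<bar> \<le> \<epsilon> * \<bar>of_int j\<bar> + - (a - \<epsilon>) * \<bar>of_int k - of_int j\<bar>"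
      by (simp add: algebra_simps)
    then show ?thesis using p by (intro mult_left_mono) auto
  qed
  finally show ?thesis by (simp only: exp_add mult.assoc)
qed

context
  fixes c :: "int \<Rightarrow> real" and C \<epsilon> :: real
  assumes c: "\<And>k. \<bar>c k\<bar> \<le> C * exp (\<epsilon> * \<bar>of_int k\<bar>)" and \<epsilon>: "0 \<le> \<epsilon>" "\<epsilon> < a"
begin

lemma sech_coeff_conv_summable: "(\<lambda>k. norm (c k * sech_coeff (j - k))) summable_on UNIV"
  by (rule abs_summable_on_exp_bound[where \<kappa> = "a - \<epsilon>" and x = "of_int j"])
    (use \<epsilon> in simp, simp only: real_norm_def, rule sech_coeff_conv_term_bound[where c = c, OF c \<epsilon>(1)])

lemma sech_coeff_conv_abs_bound:
  "(\<Sum>\<^sub>\<infinity>k. \<bar>c k * sech_coeff (j - k)\<bar>) \<le> C / (1 - exp (- a)) * (2 * (1 + 1 / (a - \<epsilon>))) * exp (\<epsilon> * \<bar>of_int j\<bar>)"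
proof -
  have C: "C \<ge> 0" using c by (rule bound_const_nonneg)
  let ?M = "C / (1 - exp (- a)) * exp (\<epsilon> * \<bar>of_int j\<bar>)"
  have "(\<Sum>\<^sub>\<infinity>k. \<bar>c k * sech_coeff (j - k)\<bar>) \<le> (\<Sum>\<^sub>\<infinity>k::int. ?M * exp (- (a - \<epsilon>) * \<bar>of_int k - of_int j\<bar>))"
    using sech_coeff_conv_term_bound[where c = c, OF c \<epsilon>(1)] sech_coeff_conv_summable \<epsilon>
    by (intro infsum_mono summable_on_cmult_right summable_on_exp_int) auto
  also have "\<dots> = ?M * (\<Sum>\<^sub>\<infinity>k::int. exp (- (a - \<epsilon>) * \<bar>of_int k - of_int j\<bar>))" by (rule infsum_cmult_right')
  also have "\<dots> \<le> ?M * (2 * (1 + 1 / (a - \<epsilon>)))"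
    using C a \<epsilon> by (intro mult_left_mono infsum_exp_int_bound) auto
  finally show ?thesis by (simp add: mult_ac)
qed

lemma sech_coeff_conv_bound:
  "\<bar>\<Sum>\<^sub>\<infinity>k. c k * sech_coeff (j - k)\<bar> \<le> C / (1 - exp (- a)) * (2 * (1 + 1 / (a - \<epsilon>))) * exp (\<epsilon> * \<bar>of_int j\<bar>)"
  using norm_infsum_bound[OF sech_coeff_conv_summable[of j]] sech_coeff_conv_abs_bound[of j] by simp

end

text \<open>Up to normalisation, \<open>theta_quot k\<close> is \<open>theta_full\<close> divided by one of its linear factors; the
  sign \<open>\<sigma>\<close> selects the half-line on which both are evaluated.\<close>
context
  fixes \<sigma> :: real and sg :: "int \<Rightarrow> real"
  assumes sg1: "\<And>j. \<bar>sg j\<bar> = 1" and sgS: "\<And>j. sg (j + 1) = \<sigma> * sg j"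
begin

abbreviation "theta_full \<equiv> theta_series a (\<lambda>j. sg j * exp (a * of_int j))"
abbreviation "theta_quot k \<equiv> theta_series a (\<lambda>j. sg j * sech_coeff (j - k))"

lemma theta_full_coeff_bound: "\<bar>sg j * exp (a * of_int j)\<bar> \<le> 1 * exp (a * \<bar>of_int j\<bar>)"
  using a by (simp add: abs_mult sg1)

lemma theta_quot_coeff_bound:
  "\<bar>sg j * sech_coeff (j - k)\<bar> \<le> 1 / (1 - exp (- a)) * exp (0 * \<bar>of_int j\<bar>)"
proof -
  have p: "0 \<le> 1 / (1 - exp (- a))" using a by simp
  have "\<bar>sg j * sech_coeff (j - k)\<bar> \<le> 1 / (1 - exp (- a)) * exp (- a * \<bar>of_int (j - k)\<bar>)"
    using sech_coeff_bound[of "j - k"] by (simp only: abs_mult sg1 mult_1)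
  also have "\<dots> \<le> 1 / (1 - exp (- a)) * exp (0 * \<bar>of_int j\<bar>)"
    using a p by (intro mult_left_mono) auto
  finally show ?thesis .
qed

text \<open>Coefficientwise this is \<open>sech_coeff_rec\<close> at \<open>j - k\<close>. For
  \<open>\<sigma> = 1\<close> the linear factor equals
  \<open>2 * exp (a * x) * cosh (a * (x - k))\<close>; for \<open>\<sigma> = - 1\<close> it vanishes
  exactly at \<open>x = k\<close>.\<close>

lemma theta_factor: "(\<sigma> * exp (2 * a * x - a * of_int k) + exp (a * of_int k)) * theta_quot k 0 x = theta_full 0 x"
proof -
  let ?e = "\<lambda>j. exp (- a * (of_int j)\<^sup>2 + 2 * a * of_int j * x)"
  let ?u = "\<lambda>j. sg j * sech_coeff (j - k) * ((2 * a * of_int j) ^ 0 * ?e j)"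
  have s: "?u summable_on UNIV" by (rule theta_series_summable[OF a theta_quot_coeff_bound])
  let ?v = "\<lambda>j. (\<sigma> * exp (2 * a * x - a * of_int k)) * ?u j"
  have bij: "bij_betw (\<lambda>j. j - 1) (UNIV :: int set) UNIV"
    by (rule bij_betwI[where g = "\<lambda>j. j + 1"]) auto
  have sv: "?v summable_on UNIV" by (intro summable_on_cmult_right s)
  then have sv': "(\<lambda>j. ?v (j - 1)) summable_on UNIV" using summable_on_reindex_bij_betw[OF bij, of ?v] by simp
  have "(\<sigma> * exp (2 * a * x - a * of_int k)) * theta_quot k 0 x = (\<Sum>\<^sub>\<infinity>j. ?v j)"
    unfolding theta_series_def by (rule infsum_cmult_right[OF s, symmetric])
  also have "\<dots> = (\<Sum>\<^sub>\<infinity>j. ?v (j - 1))" using infsum_reindex_bij_betw[OF bij, of ?v] by simp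
  finally have 1: "(\<sigma> * exp (2 * a * x - a * of_int k)) * theta_quot k 0 x = (\<Sum>\<^sub>\<infinity>j. ?v (j - 1))" .
  have 2: "exp (a * of_int k) * theta_quot k 0 x = (\<Sum>\<^sub>\<infinity>j. exp (a * of_int k) * ?u j)"
    unfolding theta_series_def by (rule infsum_cmult_right[OF s, symmetric])
  have "?v (j - 1) + exp (a * of_int k) * ?u j = sg j * exp (a * of_int j) * ((2 * a * of_int j) ^ 0 * ?e j)" for j
  proof -
    have g: "sg j = \<sigma> * sg (j - 1)" using sgS[of "j - 1"] by simp
    have "exp (2 * a * x - a * of_int k) * ?e (j - 1) = exp (a * (2 * of_int (j - k) - 1)) * exp (a * of_int k) * ?e j"
      unfolding exp_add[symmetric] by (rule arg_cong[where f = exp]) (simp add: power2_eq_square algebra_simps)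
    then have "?v (j - 1) = sg j * exp (a * (2 * of_int (j - k) - 1)) * exp (a * of_int k) * ?e j * sech_coeff (j - k - 1)"
      unfolding g by (simp add: mult_ac diff_diff_add add.commute)
    then have "?v (j - 1) + exp (a * of_int k) * ?u j = sg j * exp (a * of_int k) * ?e j *
        (sech_coeff (j - k) + exp (a * (2 * of_int (j - k) - 1)) * sech_coeff (j - k - 1))"
      by (simp add: algebra_simps)
    also have "\<dots> = sg j * (exp (a * of_int k) * exp (a * of_int (j - k))) * ?e j"
      unfolding sech_coeff_rec by (simp add: mult_ac)
    also have "exp (a * of_int k) * exp (a * of_int (j - k)) = exp (a * of_int j)"
      by (simp add: exp_add[symmetric] algebra_simps)
    finally show ?thesis by simp
  qed
  then have "(\<Sum>\<^sub>\<infinity>j. ?v (j - 1) + exp (a * of_int k) * ?u j) = theta_full 0 x"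
    unfolding theta_series_def by simp
  moreover have "(\<Sum>\<^sub>\<infinity>j. ?v (j - 1) + exp (a * of_int k) * ?u j) = (\<Sum>\<^sub>\<infinity>j. ?v (j - 1)) + (\<Sum>\<^sub>\<infinity>j. exp (a * of_int k) * ?u j)"
    by (rule infsum_add[OF sv' summable_on_cmult_right[OF s]])
  ultimately show ?thesis using 1 2 by (simp only: distrib_right)
qed

text \<open>An interchange of summation: the convolution of \<open>c\<close> with
  \<open>sech_coeff\<close> grows at most like \<open>exp (\<epsilon> * \<bar>j\<bar>)\<close>, so
  the Gaussian weight makes the double series absolutely convergent.\<close>

lemma theta_conv:
  fixes c :: "int \<Rightarrow> real"
  assumes c: "\<And>k. \<bar>c k\<bar> \<le> C * exp (\<epsilon> * \<bar>of_int k\<bar>)" and \<epsilon>: "0 \<le> \<epsilon>" "\<epsilon> < a"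
  shows
  "(\<Sum>\<^sub>\<infinity>k. c k * theta_quot k 0 x) = theta_series a (\<lambda>j. sg j * (\<Sum>\<^sub>\<infinity>k. c k * sech_coeff (j - k))) 0 x"
proof -
  let ?e = "\<lambda>j. exp (- a * (of_int j)\<^sup>2 + 2 * a * of_int j * x)"
  let ?f = "\<lambda>j k. (sg j * ?e j) * (c k * sech_coeff (j - k))"
  let ?D = "C / (1 - exp (- a)) * (2 * (1 + 1 / (a - \<epsilon>)))"
  have D: "?D \<ge> 0" using bound_const_nonneg[OF c] a \<epsilon> by simp
  have "(\<lambda>(j, k). ?f j k) summable_on UNIV \<times> UNIV"
  proof (rule Infinite_Sum.abs_summable_summable, rule Infinite_Sum.abs_summable_on_Sigma_iff[THEN iffD2], intro conjI ballI)
    fix j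
    show "(\<lambda>k. norm (case (j, k) of (j, k) \<Rightarrow> ?f j k)) summable_on UNIV"
      using summable_on_cmult_right[OF sech_coeff_conv_summable[where c = c, OF c \<epsilon>, of j], of "\<bar>sg j * ?e j\<bar>"] by (simp add: abs_mult mult_ac)
  next
    have inner: "(\<Sum>\<^sub>\<infinity>k. norm (case (j, k) of (j, k) \<Rightarrow> ?f j k)) = ?e j * (\<Sum>\<^sub>\<infinity>k. \<bar>c k * sech_coeff (j - k)\<bar>)" for j
    proof -
      have "norm (case (j, k) of (j, k) \<Rightarrow> ?f j k) = ?e j * \<bar>c k * sech_coeff (j - k)\<bar>" for k
        by (simp add: abs_mult sg1)
      then show ?thesis by (simp only: infsum_cmult_right')
    qed
    have s: "(\<lambda>j. (?D * exp (\<epsilon> * \<bar>of_int j\<bar>)) * ((2 * a * of_int j) ^ 0 * ?e j)) summable_on UNIV"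
      by (rule theta_series_summable[OF a, where B = \<epsilon> and C = ?D]) (rule eq_refl, rule abs_of_nonneg, rule mult_nonneg_nonneg[OF D], simp)
    show "(\<lambda>j. norm (\<Sum>\<^sub>\<infinity>k. norm (case (j, k) of (j, k) \<Rightarrow> ?f j k))) summable_on UNIV"
    proof (rule Infinite_Sum.abs_summable_on_comparison_test'[OF s])
      fix j :: int
      have "0 \<le> (\<Sum>\<^sub>\<infinity>k. \<bar>c k * sech_coeff (j - k)\<bar>)" by (rule infsum_nonneg) simp
      then show "norm (\<Sum>\<^sub>\<infinity>k. norm (case (j, k) of (j, k) \<Rightarrow> ?f j k)) \<le> (?D * exp (\<epsilon> * \<bar>of_int j\<bar>)) * ((2 * a * of_int j) ^ 0 * ?e j)"
        unfolding inner using mult_right_mono[OF sech_coeff_conv_abs_bound[where c = c, OF c \<epsilon>, of j], of "?e j"] by (simp add: abs_mult mult_ac)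
    qed
  qed
  then have "(\<Sum>\<^sub>\<infinity>j. \<Sum>\<^sub>\<infinity>k. ?f j k) = (\<Sum>\<^sub>\<infinity>k. \<Sum>\<^sub>\<infinity>j. ?f j k)" by (rule infsum_swap_banach)
  moreover have "(\<Sum>\<^sub>\<infinity>j. ?f j k) = c k * theta_quot k 0 x" for k
    unfolding theta_series_def infsum_cmult_right'[symmetric] by (simp add: mult_ac)
  moreover have "(\<Sum>\<^sub>\<infinity>k. ?f j k) = sg j * (\<Sum>\<^sub>\<infinity>k. c k * sech_coeff (j - k)) * ((2 * a * of_int j) ^ 0 * ?e j)" for j
    unfolding infsum_cmult_right' by (simp add: mult_ac)
  ultimately show ?thesis unfolding theta_series_def by simp
qed

end

end


text \<open>The theta function with \<open>\<sigma> = 1\<close> clears all denominators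
  \<open>cosh (a * (x - k))\<close> at once, and uniqueness for theta series shows that the
  convolution of \<open>c\<close> with \<open>sech_coeff\<close> vanishes. To undo the convolution,
  the same coefficients are used with alternating signs, that is, at negative \<open>w\<close>:
  there the \<open>k\<close>-th quotient vanishes at every integer except \<open>k\<close>, so
  evaluation at \<open>m\<close> isolates \<open>c m\<close>.\<close>

lemma zero_uniq_sech_jet:
  assumes a: "a > 0" and \<epsilon>: "\<epsilon> < a"
  shows "zero_uniq \<epsilon> (sech_jet a)"
  unfolding zero_uniq_def
proof (intro allI impI)
  fix c C \<theta> K t m
  assume c: "\<forall>k. \<bar>c k\<bar> \<le> C * exp (\<epsilon> * \<bar>of_int k\<bar>)" and \<theta>: "0 < \<theta>" "\<theta> < 1"
    and t: "\<forall>i. \<bar>t i - \<theta> * of_int i\<bar> \<le> K" and z: "zero_seq (shift_series c (sech_jet a)) t"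
  \<comment> \<open>A negative rate is raised to 0, since the convolution bounds assume a
    nonnegative rate below \<open>a\<close>.\<close>
  define \<eta> where "\<eta> = max 0 \<epsilon>"
  have \<eta>: "0 \<le> \<eta>" "\<eta> < a" using a \<epsilon> by (auto simp: \<eta>_def)
  have c': "\<bar>c k\<bar> \<le> C * exp (\<eta> * \<bar>of_int k\<bar>)" for k
  proof -
    have "C \<ge> 0" using spec[OF c, of k] by (rule bound_const_nonneg)
    then have "C * exp (\<epsilon> * \<bar>of_int k\<bar>) \<le> C * exp (\<eta> * \<bar>of_int k\<bar>)"
      by (intro mult_left_mono) (auto simp: \<eta>_def intro!: mult_right_mono)
    then show ?thesis using spec[OF c, of k] by linarith
  qed
  let ?d = "\<lambda>j. \<Sum>\<^sub>\<infinity>k. c k * sech_coeff a (j - k)"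
  let ?D = "C / (1 - exp (- a)) * (2 * (1 + 1 / (a - \<eta>)))"
  have db: "\<bar>1 * ?d j\<bar> \<le> ?D * exp (\<eta> * \<bar>of_int j\<bar>)" for j
    using sech_coeff_conv_bound[where c = c, OF a c' \<eta>, of j] by simp
  let ?T = "theta_series a (\<lambda>j. 1 * exp (a * of_int j))"
  let ?E = "jet_prod (\<lambda>s x. (- a) ^ s * (exp (- a * x) / 2)) ?T"
  have sg: "\<bar>1::real\<bar> = 1" "1 = 1 * (1::real)" by simp_all
  have jE: "jet ?E"
  proof (rule jet_jet_prod)
    show "jet (\<lambda>s x. (- a) ^ s * (exp (- a * x) / 2))"
      unfolding jet_def by (auto intro!: derivative_eq_intros)
    show "jet ?T" using jet_theta_series[OF a theta_full_coeff_bound[where sg = "\<lambda>_. 1", OF a sg]] .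
  qed
  have jF: "jet (shift_series c (sech_jet a))"
    using a by (intro jet_shift_series[OF decay_jet_sech_jet[OF a] c' \<eta>(2)]) simp
  have "zero_seq (theta_series a (\<lambda>j. 1 * ?d j)) t"
  proof (rule zero_seq_mult[OF jE jF jet_theta_series[OF a db] _ z])
    fix x
    let ?q = "\<lambda>k. theta_series a (\<lambda>j. 1 * sech_coeff a (j - k)) 0 x"
    have "c k * ?q k = (exp (- a * x) / 2 * ?T 0 x) * (c k * sech_jet a 0 (x - of_int k))" for k
    proof -
      let ?y = "a * (x - of_int k)"
      have f: "(1 * exp (2 * a * x - a * of_int k) + exp (a * of_int k)) * ?q k = ?T 0 x"
        by (rule theta_factor[where \<sigma> = 1 and sg = "\<lambda>_. 1", OF a sg])
      have "exp (a * x) * exp ?y = exp (2 * a * x - a * of_int k)" "exp (a * x) * exp (- ?y) = exp (a * of_int k)"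
        unfolding exp_add[symmetric] by (simp_all add: algebra_simps)
      then have e: "1 * exp (2 * a * x - a * of_int k) + exp (a * of_int k) = exp (a * x) * (2 * cosh ?y)"
        by (simp add: cosh_field_def distrib_left)
      have "exp (- a * x) * exp (a * x) = 1" by (simp add: exp_add[symmetric])
      then have "exp (- a * x) / 2 * ?T 0 x = cosh ?y * ?q k"
        unfolding f[symmetric] e by (simp add: mult_ac)
      then show ?thesis using cosh_real_pos[of ?y] by (simp add: sech_jet_0)
    qed
    then have "(\<Sum>\<^sub>\<infinity>k. c k * ?q k) = (exp (- a * x) / 2 * ?T 0 x) * shift_series c (sech_jet a) 0 x"
      unfolding shift_series_def by (simp only: infsum_cmult_right')
    then show "theta_series a (\<lambda>j. 1 * ?d j) 0 x = ?E 0 x * shift_series c (sech_jet a) 0 x"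
      using theta_conv[where \<sigma> = 1 and sg = "\<lambda>_. 1" and c = c, OF a sg c' \<eta>, of x] by (simp add: jet_prod_def)
  qed
  then have d0: "?d j = 0" for j
    using theta_zeros_unique[OF a \<theta> db, of t K j] t by simp

  define sg where "sg j = (if even j then 1 else - 1 :: real)" for j :: int
  have sg1: "\<bar>sg j\<bar> = 1" and sgS: "sg (j + 1) = - 1 * sg j" for j by (auto simp: sg_def)
  have sg_add: "sg (i + j) = sg i * sg j" for i j by (auto simp: sg_def)
  let ?F = "theta_series a (\<lambda>j. sg j * exp (a * of_int j))"
  let ?q = "\<lambda>k. theta_series a (\<lambda>j. sg j * sech_coeff a (j - k))"
  have fac: "(- 1 * exp (2 * a * x - a * of_int k) + exp (a * of_int k)) * ?q k 0 x = ?F 0 x" for k x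
    by (rule theta_factor[where \<sigma> = "- 1" and sg = sg, OF a sg1 sgS])
  have F0: "?F 0 (of_int n) = 0" for n
    using fac[of "of_int n" n] by (simp add: algebra_simps)
  have q0: "?q k 0 (of_int n) = 0" if "k \<noteq> n" for k n
  proof -
    have "a * of_int k \<noteq> 2 * a * of_int n - a * of_int k"
    proof
      assume "a * of_int k = 2 * a * of_int n - a * of_int k"
      then have "2 * a * (of_int k - of_int n) = 0" by (simp add: algebra_simps)
      then show False using a that by simp
    qed
    then have "- 1 * exp (2 * a * of_int n - a * of_int k) + exp (a * of_int k) \<noteq> 0" by simp
    then show ?thesis using fac[of "of_int n" k] unfolding F0 mult_eq_0_iff by blast
  qed
  \<comment> \<open>Translation by \<open>n\<close> reduces all diagonal values to this single
    number, up to a nonzero factor.\<close>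
  define S where "S = (\<Sum>\<^sub>\<infinity>i. sg i * sech_coeff a i * exp (- a * (of_int i)\<^sup>2))"
  have qn: "?q n 0 (of_int n) = sg n * exp (a * (of_int n)\<^sup>2) * S" for n
  proof -
    have bij: "bij_betw (\<lambda>i. i + n) (UNIV :: int set) UNIV"
      by (rule bij_betwI[where g = "\<lambda>j. j - n"]) auto
    have "?q n 0 (of_int n) = (\<Sum>\<^sub>\<infinity>i. sg (i + n) * sech_coeff a (i + n - n) * ((2 * a * of_int (i + n)) ^ 0 *
        exp (- a * (of_int (i + n))\<^sup>2 + 2 * a * of_int (i + n) * of_int n)))"
      unfolding theta_series_def by (rule infsum_reindex_bij_betw[OF bij, symmetric])
    also have "\<dots> = (\<Sum>\<^sub>\<infinity>i. (sg n * exp (a * (of_int n)\<^sup>2)) * (sg i * sech_coeff a i * exp (- a * (of_int i)\<^sup>2)))"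
    proof (intro infsum_cong)
      fix i :: int
      have "exp (- a * (of_int (i + n))\<^sup>2 + 2 * a * of_int (i + n) * of_int n) = exp (a * (of_int n)\<^sup>2) * exp (- a * (of_int i)\<^sup>2)"
        unfolding exp_add[symmetric] by (rule arg_cong[where f = exp]) (simp add: power2_eq_square algebra_simps)
      then show "sg (i + n) * sech_coeff a (i + n - n) * ((2 * a * of_int (i + n)) ^ 0 * exp (- a * (of_int (i + n))\<^sup>2 + 2 * a * of_int (i + n) * of_int n))
         = (sg n * exp (a * (of_int n)\<^sup>2)) * (sg i * sech_coeff a i * exp (- a * (of_int i)\<^sup>2))"
        by (simp add: sg_add)
    qed
    finally show ?thesis unfolding S_def by (simp only: infsum_cmult_right')
  qed
  have jT: "jet ?F" by (rule jet_theta_series[OF a theta_full_coeff_bound[where sg = sg, OF a sg1 sgS]])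
  have jq: "jet (?q n)" for n by (rule jet_theta_series[OF a theta_quot_coeff_bound[where sg = sg, OF a sg1 sgS]])
  text \<open>Otherwise every integer is a double zero of the theta function \<open>?F\<close>, twice the critical density.\<close>
  have "S \<noteq> 0"
  proof
    assume S: "S = 0"
    have F1: "?F 1 (of_int n) = 0" for n
    proof -
      have "((\<lambda>x. (- 1 * exp (2 * a * x - a * of_int n) + exp (a * of_int n)) * ?q n 0 x) has_real_derivative 0) (at (of_int n))"
        by (auto intro!: derivative_eq_intros jetD[OF jq] simp: qn S)
      then have "(?F 0 has_real_derivative 0) (at (of_int n))" unfolding fac .
      then show ?thesis using DERIV_unique[OF jetD[OF jT]] by simp
    qed
    \<comment> \<open>The sequence \<open>i div 2\<close> lists every integer twice, so its runs
      have two terms and its mean spacing is \<open>1 / 2\<close>.\<close>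
    have "zero_seq ?F (\<lambda>i. of_int (i div 2))"
      unfolding zero_seq_def
    proof (intro conjI allI impI)
      show "mono (\<lambda>i. real_of_int (i div 2))" by (intro monoI) (simp add: zdiv_mono1)
      fix i s assume "real_of_int ((i + int s) div 2) = real_of_int (i div 2)"
      then have "s = 0 \<or> s = 1" by (simp only: of_int_eq_iff) presburger
      then show "?F s (of_int (i div 2)) = 0" using F0 F1 by auto
    qed
    moreover have "\<bar>real_of_int (i div 2) - 1 / 2 * of_int i\<bar> \<le> 1" for i
    proof -
      have "i = 2 * (i div 2) + i mod 2" "0 \<le> i mod 2" "i mod 2 < 2" by auto
      then have "real_of_int i = 2 * of_int (i div 2) + of_int (i mod 2)" "0 \<le> real_of_int (i mod 2)" "real_of_int (i mod 2) < 2"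
        by (metis of_int_add of_int_mult of_int_numeral, simp, simp)
      then show ?thesis unfolding abs_le_iff by linarith
    qed
    ultimately have "sg 0 * exp (a * of_int 0) = 0"
      using theta_zeros_unique[OF a _ _ theta_full_coeff_bound[where sg = sg, OF a sg1 sgS], of "1 / 2" "\<lambda>i. of_int (i div 2)" 1 0] by simp
    then show False by (simp add: sg_def)
  qed
  have "(\<Sum>\<^sub>\<infinity>k. c k * ?q k 0 (of_int m)) = 0"
    using theta_conv[where \<sigma> = "- 1" and sg = sg and c = c, OF a sg1 sgS c' \<eta>, of "of_int m"] d0
    by (simp add: theta_series_def)
  moreover have "(\<Sum>\<^sub>\<infinity>k. c k * ?q k 0 (of_int m)) = (\<Sum>\<^sub>\<infinity>k\<in>{m}. c k * ?q k 0 (of_int m))"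
    using q0 by (intro infsum_cong_neutral) auto
  ultimately have "c m * (sg m * exp (a * (of_int m)\<^sup>2) * S) = 0" by (simp add: qn)
  then show "c m = 0" using \<open>S \<noteq> 0\<close> sg1[of m] by auto
qed

section \<open>Sampling inequalities\<close>

text \<open>Tychonoff's theorem in place of a diagonal argument: a countable product of intervals is
  compact and sequentially compact.\<close>

lemma pointwise_bounded_subsequence:
  fixes X :: "nat \<Rightarrow> int \<Rightarrow> real"
  assumes "\<And>n i. \<bar>X n i\<bar> \<le> B i"
  obtains l r where "strict_mono r" "\<And>i. (\<lambda>n. X (r n) i) \<longlonglongrightarrow> l i"
proof -
  have "compactin (product_topology (\<lambda>i. euclidean) (UNIV :: int set)) (PiE UNIV (\<lambda>i. {- B i..B i}))"
    by (subst compactin_PiE) (auto simp: compactin_euclidean_iff)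
  then have "compact (PiE UNIV (\<lambda>i. {- B i..B i}) :: (int \<Rightarrow> real) set)"
    by (simp add: euclidean_product_topology compactin_euclidean_iff)
  then have "seq_compact (PiE UNIV (\<lambda>i. {- B i..B i}) :: (int \<Rightarrow> real) set)" by (rule compact_imp_seq_compact)
  moreover have "X n \<in> PiE UNIV (\<lambda>i. {- B i..B i})" for n using assms by (auto simp: abs_le_iff minus_le_iff)
  ultimately obtain l r where r: "strict_mono r" and l: "(X \<circ> r) \<longlonglongrightarrow> l" unfolding seq_compact_def by metis
  have "(\<lambda>n. X (r n) i) \<longlonglongrightarrow> l i" for i
  proof -
    have "continuous_on UNIV (\<lambda>x::int \<Rightarrow> real. x i)" by (rule continuous_on_product_coordinates)
    then show ?thesis using continuous_on_tendsto_compose[OF _ l, of UNIV "\<lambda>x. x i"] by (simp add: o_def)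
  qed
  then show ?thesis using that r by blast
qed

text \<open>Choose the first \<open>M\<close> points in each of the intervals \<open>[j L', j L' + L]\<close>; the gaps between these
  intervals keep the sequence separated.\<close>
lemma regular_enumeration:
  fixes T :: "real set" and d L L' :: real and M :: nat
  assumes d: "d > 0" and L: "0 < L" "L < L'" and M: "M > 0"
    and sep: "\<And>x y. x \<in> T \<Longrightarrow> y \<in> T \<Longrightarrow> x \<noteq> y \<Longrightarrow> d \<le> \<bar>x - y\<bar>"
    and card: "\<And>x. M \<le> card (T \<inter> {x..x + L})"
  obtains s :: "int \<Rightarrow> real" where "\<And>i. s i \<in> T" "\<And>i. s i + min d (L' - L) \<le> s (i + 1)"
    "\<And>i. \<bar>s i - L' / real M * of_int i\<bar> \<le> L'"
proof -
  define A where "A j = T \<inter> {of_int j * L'..of_int j * L' + L}" for j :: int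
  have fin: "finite (A j)" and len: "M \<le> length (sorted_list_of_set (A j))" for j
  proof -
    have "M \<le> card (A j)" unfolding A_def by (rule card)
    then show "finite (A j)" using M by (metis card.infinite not_le)
    with \<open>M \<le> card (A j)\<close> show "M \<le> length (sorted_list_of_set (A j))" by simp
  qed
  \<comment> \<open>The quotient of \<open>i\<close> by \<open>M\<close> selects the interval, the
    remainder the rank of the point in it; hence the mean spacing \<open>L' / M\<close>.\<close>
  define s where "s i = sorted_list_of_set (A (i div int M)) ! nat (i mod int M)" for i
  have Mz: "int M > 0" using M by simp
  have idx: "nat (i mod int M) < length (sorted_list_of_set (A (i div int M)))" for i
  proof -
    have "nat (i mod int M) < M" using pos_mod_bound[OF Mz, of i] pos_mod_sign[OF Mz, of i] by linarith
    then show ?thesis using len by (rule less_le_trans)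
  qed
  have sA: "s i \<in> A (i div int M)" for i
    using nth_mem[OF idx[of i]] fin[of "i div int M"] by (simp add: s_def)
  have step: "s i + min d (L' - L) \<le> s (i + 1)" for i
  proof (cases "(i + 1) div int M = i div int M")
    case True
    have "(i + 1) mod int M = i mod int M + 1"
      using True by (simp add: minus_div_mult_eq_mod[symmetric])
    then have n: "nat ((i + 1) mod int M) = Suc (nat (i mod int M))"
      using pos_mod_sign[OF Mz, of i] by simp
    have "s i < s (i + 1)"
      using idx[of "i + 1"] strict_sorted_list_of_set[of "A (i div int M)"]
      unfolding s_def n True by (simp add: sorted_wrt_nth_less)
    moreover have "s i \<in> T" "s (i + 1) \<in> T" using sA by (auto simp: A_def)
    ultimately show ?thesis using sep[of "s i" "s (i + 1)"] by auto
  next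
    case False
    have "i div int M \<le> (i + 1) div int M" using Mz by (intro zdiv_mono1) auto
    then have "i div int M + 1 \<le> (i + 1) div int M" using False by linarith
    then have "real_of_int (i div int M) + 1 \<le> of_int ((i + 1) div int M)" by linarith
    then have "(real_of_int (i div int M) + 1) * L' \<le> of_int ((i + 1) div int M) * L'"
      using L by (intro mult_right_mono) auto
    then show ?thesis using sA[of i] sA[of "i + 1"] by (auto simp: A_def distrib_right)
  qed
  have "\<bar>s i - L' / real M * of_int i\<bar> \<le> L'" for i
  proof -
    let ?j = "real_of_int (i div int M)" and ?r = "real_of_int (i mod int M)"
    have "i = int M * (i div int M) + i mod int M" by simp
    then have "real_of_int i = real M * ?j + ?r" by (metis of_int_add of_int_mult of_int_of_nat_eq)
    then have e: "L' / real M * of_int i = ?j * L' + L' / real M * ?r" using M by (simp add: field_simps)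
    have "0 \<le> ?r" "?r \<le> real M" using pos_mod_bound[OF Mz, of i] pos_mod_sign[OF Mz, of i] by linarith+
    then have "0 \<le> L' / real M * ?r" "L' / real M * ?r \<le> L' / real M * real M" using L
      by (simp, intro mult_left_mono) auto
    moreover have "?j * L' \<le> s i" "s i \<le> ?j * L' + L" using sA[of i] by (auto simp: A_def)
    moreover have "L' / real M * real M = L'" using M by simp
    ultimately show ?thesis using L unfolding e abs_le_iff by linarith
  qed
  moreover have "s i \<in> T" for i using sA by (auto simp: A_def)
  ultimately show ?thesis using that step by blast
qed

text \<open>In contrast to \<open>separated\<close> the constant is visible, because compactness
  needs the same \<open>d\<close> for a whole family of sets.\<close>

definition separated_by :: "real \<Rightarrow> real set \<Rightarrow> bool" where
  "separated_by d T \<longleftrightarrow> (\<forall>x\<in>T. \<forall>y\<in>T. x \<noteq> y \<longrightarrow> d \<le> \<bar>x - y\<bar>)"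

lemma separated_by_translate: "separated_by d T \<Longrightarrow> separated_by d ((\<lambda>x. x + y) ` T)"
  by (auto simp: separated_by_def)

text \<open>Each of \<open>n\<close> points in the interval contributes at least
  \<open>exp (- \<bar>b - a\<bar>)\<close> to an exponential sum that is bounded independently of
  \<open>n\<close>.\<close>

lemma separated_by_finite:
  assumes "separated_by d T" "d > 0"
  shows "finite (T \<inter> {a..b})"
proof (rule ccontr)
  assume inf: "infinite (T \<inter> {a..b})"
  obtain n :: nat where n: "exp (1 * d) * (2 * (1 + 1 / (1 * d))) * exp \<bar>b - a\<bar> < real n" using reals_Archimedean2 by blast
  obtain S where S: "finite S" "card S = n" "S \<subseteq> T \<inter> {a..b}" using infinite_arbitrarily_large[OF inf] by blast
  have "real n * exp (- \<bar>b - a\<bar>) = (\<Sum>y\<in>S. exp (- \<bar>b - a\<bar>))" using S by simp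
  also have "\<dots> \<le> (\<Sum>y\<in>S. exp (- 1 * \<bar>y - a\<bar>))" using S by (intro sum_mono) auto
  also have "\<dots> \<le> exp (1 * d) * (2 * (1 + 1 / (1 * d)))"
    using S assms by (intro sum_exp_separated_bound) (auto simp: separated_by_def)
  finally have "real n \<le> exp (1 * d) * (2 * (1 + 1 / (1 * d))) * exp \<bar>b - a\<bar>"
    by (simp add: exp_minus divide_inverse[symmetric] pos_divide_le_eq)
  then show False using n by simp
qed

lemma card_translate_interval: "card ((\<lambda>x. x + y) ` T \<inter> {a..a + L}) = card (T \<inter> {a - y..a - y + L})" for y :: real
proof -
  have "(\<lambda>x. x + y) ` T \<inter> {a..a + L} = (\<lambda>x. x + y) ` (T \<inter> {a - y..a - y + L})" by auto
  then show ?thesis by (simp add: card_image)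
qed

lemma shift_series_translate:
  "shift_series (\<lambda>k. c (k + m)) G s (x - of_int m) = shift_series c G s x"
proof -
  have bij: "bij_betw (\<lambda>k. k + m) (UNIV :: int set) UNIV"
    by (rule bij_betwI[where g = "\<lambda>j. j - m"]) auto
  have "shift_series c G s x = (\<Sum>\<^sub>\<infinity>k. c (k + m) * G s (x - of_int (k + m)))"
    unfolding shift_series_def by (rule infsum_reindex_bij_betw[OF bij, symmetric])
  then show ?thesis unfolding shift_series_def by (simp add: algebra_simps)
qed

context
  fixes \<kappa> \<epsilon> d L :: real and G :: "nat \<Rightarrow> real \<Rightarrow> real" and M N :: nat
  assumes G: "decay_jet \<kappa> G" and uniq: "zero_uniq \<epsilon> G" and \<epsilon>: "0 < \<epsilon>" "\<epsilon> < \<kappa>"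
    and d: "d > 0" and L: "L > 0" and M: "M > 0" and N: "N > 0" and dens: "L < real M * real N"
begin

definition dense_separated :: "real set \<Rightarrow> bool" where
  "dense_separated T \<longleftrightarrow> separated_by d T \<and> (\<forall>x. M \<le> card (T \<inter> {x..x + L}))"

text \<open>Compactness: a sequence of counterexamples, translated and normalised, would have a limit with
  \<open>c 0 = 1\<close> and too many zeros.\<close>
lemma local_sampling_at_0:
  assumes \<eta>: "\<eta> > 0"
  shows "\<exists>n::nat. \<forall>T c K. dense_separated T \<longrightarrow> finite K \<longrightarrow> (\<forall>k. k \<notin> K \<longrightarrow> c k = 0) \<longrightarrow>
    (c 0)\<^sup>2 \<le> \<eta> * (\<Sum>k\<in>K. exp (- 2 * \<epsilon> * \<bar>of_int k\<bar>) * (c k)\<^sup>2)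
      + real n * (\<Sum>y\<in>T \<inter> {- real n..real n}. \<Sum>s<N. (shift_series c G s y)\<^sup>2)"
proof (rule ccontr)
  let ?W = "\<lambda>K c. (\<Sum>k\<in>K. exp (- 2 * \<epsilon> * \<bar>of_int k\<bar>) * (c k)\<^sup>2)"
  let ?S = "\<lambda>T c n. (\<Sum>y\<in>T \<inter> {- real n..real n}. \<Sum>s<N. (shift_series c G s y)\<^sup>2)"
  assume "\<not> ?thesis"
  then have "\<forall>n. \<exists>T c K. dense_separated T \<and> finite K \<and> (\<forall>k. k \<notin> K \<longrightarrow> c k = 0) \<and>
    (c 0)\<^sup>2 > \<eta> * ?W K c + real n * ?S T c n" by (simp add: not_le)
  then obtain T c K where T: "\<And>n. dense_separated (T n)" and K: "\<And>n. finite (K n)"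
    and c: "\<And>n k. k \<notin> K n \<Longrightarrow> c n k = 0" and big: "\<And>n. (c n 0)\<^sup>2 > \<eta> * ?W (K n) (c n) + real n * ?S (T n) (c n) n"
    by (simp only: choice_iff) blast
  have W0: "?W K c \<ge> 0" and S0: "?S T c n \<ge> 0" for K c T n by (auto intro!: sum_nonneg)
  have c0: "c n 0 \<noteq> 0" for n
  proof
    assume "c n 0 = 0"
    moreover have "0 \<le> \<eta> * ?W (K n) (c n) + real n * ?S (T n) (c n) n"
      using W0 S0 \<eta> by (intro add_nonneg_nonneg mult_nonneg_nonneg) auto
    ultimately show False using big[of n] by simp
  qed
  \<comment> \<open>After normalisation the \<open>\<eta>\<close>-term bounds \<open>b n k\<close>
    by a multiple of \<open>exp (\<epsilon> * \<bar>k\<bar>)\<close>, the growth that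
    \<open>zero_uniq\<close> admits, while the factor \<open>n\<close> forces the sampled values to
    0. This is the purpose of the weighted term in the statement.\<close>
  define b where "b n k = c n k / c n 0" for n k
  have b0: "b n 0 = 1" for n using c0 by (simp add: b_def)
  have bW: "?W (K n) (b n) = ?W (K n) (c n) / (c n 0)\<^sup>2" for n
    by (simp add: b_def power_divide sum_divide_distrib)
  have Fb: "shift_series (b n) G s x = shift_series (c n) G s x / c n 0" for n s x
  proof -
    have "b n k * G s (x - of_int k) = (1 / c n 0) * (c n k * G s (x - of_int k))" for k by (simp add: b_def)
    then show ?thesis unfolding shift_series_def by (simp only: infsum_cmult_right') simp
  qed
  have bS: "?S (T n) (b n) n = ?S (T n) (c n) n / (c n 0)\<^sup>2" for n
    by (simp add: Fb power_divide sum_divide_distrib)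
  have lt1: "\<eta> * ?W (K n) (b n) + real n * ?S (T n) (b n) n < 1" for n
  proof -
    have "(\<eta> * ?W (K n) (c n) + real n * ?S (T n) (c n) n) / (c n 0)\<^sup>2 < 1"
      using big[of n] c0[of n] by simp
    then show ?thesis unfolding bW bS by (simp add: add_divide_distrib)
  qed
  define C where "C = sqrt (1 / \<eta>)"
  have bb: "\<bar>b n k\<bar> \<le> C * exp (\<epsilon> * \<bar>of_int k\<bar>)" for n k
  proof (cases "k \<in> K n")
    case True
    have "exp (- 2 * \<epsilon> * \<bar>of_int k\<bar>) * (b n k)\<^sup>2 \<le> ?W (K n) (b n)"
      using True K by (intro member_le_sum) auto
    moreover have "\<eta> * ?W (K n) (b n) \<le> 1"
    proof -
      have "0 \<le> real n * ?S (T n) (b n) n" by (intro mult_nonneg_nonneg S0) simp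
      then show ?thesis using lt1[of n] by linarith
    qed
    ultimately have "\<eta> * (exp (- 2 * \<epsilon> * \<bar>of_int k\<bar>) * (b n k)\<^sup>2) \<le> 1"
      using \<eta> by (meson less_imp_le mult_left_mono order_trans)
    then have "(exp (- \<epsilon> * \<bar>of_int k\<bar>) * \<bar>b n k\<bar>)\<^sup>2 \<le> 1 / \<eta>"
      using \<eta> by (simp add: power_mult_distrib exp_double[symmetric] field_simps)
    then have "exp (- \<epsilon> * \<bar>of_int k\<bar>) * \<bar>b n k\<bar> \<le> C" unfolding C_def by (rule real_le_rsqrt)
    then show ?thesis by (simp add: exp_minus divide_inverse[symmetric] pos_divide_le_eq field_simps)
  next
    case False
    then show ?thesis using c[of k n] \<eta> by (simp add: b_def C_def)
  qed
  \<comment> \<open>Cells slightly longer than \<open>L\<close> leave gaps between the selected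
    points; the mean spacing \<open>L' / M\<close> is still below \<open>N\<close>.\<close>
  obtain L' where L': "L < L'" "L' < real M * real N" using dens dense by blast
  define \<delta> where "\<delta> = min d (L' - L)"
  have \<delta>: "\<delta> > 0" using d L' by (simp add: \<delta>_def)
  have "\<exists>s. (\<forall>i. s i \<in> T n) \<and> (\<forall>i. s i + \<delta> \<le> s (i + 1)) \<and> (\<forall>i. \<bar>s i - L' / real M * of_int i\<bar> \<le> L')" for n
  proof -
    have sep: "\<And>x y. x \<in> T n \<Longrightarrow> y \<in> T n \<Longrightarrow> x \<noteq> y \<Longrightarrow> d \<le> \<bar>x - y\<bar>"
      and card: "\<And>x. M \<le> card (T n \<inter> {x..x + L})"
      using T[of n] unfolding dense_separated_def separated_by_def by blast+
    show ?thesis by (rule regular_enumeration[OF d L L'(1) M sep card]) (auto simp: \<delta>_def)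
  qed
  then have "\<forall>n. \<exists>s. (\<forall>i. s i \<in> T n) \<and> (\<forall>i. s i + \<delta> \<le> s (i + 1)) \<and> (\<forall>i. \<bar>s i - L' / real M * of_int i\<bar> \<le> L')"
    by blast
  then obtain s where s: "\<And>n i. s n i \<in> T n" "\<And>n i. s n i + \<delta> \<le> s n (i + 1)" "\<And>n i. \<bar>s n i - L' / real M * of_int i\<bar> \<le> L'"
    by (simp only: choice_iff) blast
  define R where "R i = L' + L' / real M * \<bar>of_int i\<bar>" for i :: int
  have sR: "\<bar>s n i\<bar> \<le> R i" for n i
  proof -
    have "\<bar>L' / real M * of_int i\<bar> = L' / real M * \<bar>of_int i\<bar>" using L L' by (simp add: abs_mult)
    then show ?thesis using s(3)[of n i] unfolding R_def by linarith
  qed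
  obtain r1 b' where r1: "strict_mono r1" and b': "\<And>k. (\<lambda>n. b (r1 n) k) \<longlonglongrightarrow> b' k"
    by (rule pointwise_bounded_subsequence[where X = b, OF bb]) blast
  obtain r2 s' where r2: "strict_mono r2" and s': "\<And>i. (\<lambda>n. s (r1 (r2 n)) i) \<longlonglongrightarrow> s' i"
    by (rule pointwise_bounded_subsequence[of "\<lambda>n. s (r1 n)" R]) (use sR in auto)
  define r where "r n = r1 (r2 n)" for n
  have r: "n \<le> r n" for n
    unfolding r_def using strict_mono_compose[OF r1 r2] seq_suble by (auto simp: o_def)
  have br: "(\<lambda>n. b (r n) k) \<longlonglongrightarrow> b' k" for k
    unfolding r_def using LIMSEQ_subseq_LIMSEQ[OF b' r2] by (simp add: o_def)
  have sr: "(\<lambda>n. s (r n) i) \<longlonglongrightarrow> s' i" for i unfolding r_def by (rule s')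
  have b'b: "\<bar>b' k\<bar> \<le> C * exp (\<epsilon> * \<bar>of_int k\<bar>)" for k
    using bb by (intro LIMSEQ_le_const2[OF tendsto_rabs[OF br]]) auto
  \<comment> \<open>Two points merging in the limit would be a zero of order \<open>N\<close> only,
    not \<open>2 * N\<close>. The uniform gap excludes this.\<close>
  have s'step: "s' i + \<delta> \<le> s' (i + 1)" for i
    using s(2) by (intro LIMSEQ_le[OF tendsto_add[OF sr tendsto_const] sr]) auto
  have s'K: "\<bar>s' i - L' / real M * of_int i\<bar> \<le> L'" for i
    using s(3) by (intro LIMSEQ_le_const2[OF tendsto_rabs[OF tendsto_diff[OF sr tendsto_const]]]) auto
  have zero: "shift_series b' G \<sigma> (s' i) = 0" if \<sigma>: "\<sigma> < N" for \<sigma> i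
  proof -
    have jG: "jet G" using G by (simp add: decay_jet_def)
    obtain D where D: "\<And>x. \<bar>G \<sigma> x\<bar> \<le> D * exp (- \<kappa> * \<bar>x\<bar>)" using G by (auto simp: decay_jet_def)
    have lim1: "(\<lambda>n. shift_series (b (r n)) G \<sigma> (s (r n) i)) \<longlonglongrightarrow> shift_series b' G \<sigma> (s' i)"
      unfolding shift_series_def
    proof (rule infsum_int_tendsto)
      fix k
      have "isCont (G \<sigma>) (s' i - of_int k)" using jetD[OF jG] by (rule DERIV_isCont)
      then show "(\<lambda>n. b (r n) k * G \<sigma> (s (r n) i - of_int k)) \<longlonglongrightarrow> b' k * G \<sigma> (s' i - of_int k)"
        by (intro tendsto_mult br isCont_tendsto_compose[where g = "G \<sigma>"] tendsto_diff sr tendsto_const)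
      fix n
      show "norm (b (r n) k * G \<sigma> (s (r n) i - of_int k)) \<le> C * D * exp (\<kappa> * R i) * exp (- (\<kappa> - \<epsilon>) * \<bar>of_int k - 0\<bar>)"
        using \<epsilon> by (simp only: real_norm_def) (intro shift_term_bound bb D sR, simp)
    next
      show "(\<lambda>k::int. C * D * exp (\<kappa> * R i) * exp (- (\<kappa> - \<epsilon>) * \<bar>of_int k - 0\<bar>)) summable_on UNIV"
        using \<epsilon> by (intro summable_on_cmult_right summable_on_exp_int) auto
    qed
    obtain n0 :: nat where n0: "R i \<le> real n0" using real_arch_simple by blast
    have "(shift_series (b (r n)) G \<sigma> (s (r n) i))\<^sup>2 \<le> 1 / real n" if n: "n \<ge> max 1 n0" for n
    proof -
      let ?T = "T (r n) \<inter> {- real (r n)..real (r n)}"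
      let ?\<Phi> = "\<lambda>y. \<Sum>s<N. (shift_series (b (r n)) G s y)\<^sup>2"
      have "R i \<le> real (r n)" using n0 n r[of n] by linarith
      then have "\<bar>s (r n) i\<bar> \<le> real (r n)" using sR[of "r n" i] by linarith
      then have mem: "s (r n) i \<in> ?T" using s(1)[of "r n" i] by (auto simp: abs_le_iff)
      have fin: "finite ?T" using T[of "r n"] d separated_by_finite unfolding dense_separated_def by blast
      have "(shift_series (b (r n)) G \<sigma> (s (r n) i))\<^sup>2 \<le> ?\<Phi> (s (r n) i)"
        using \<sigma> by (intro member_le_sum) auto
      also have "\<dots> \<le> sum ?\<Phi> ?T" using mem fin by (intro member_le_sum) (auto intro!: sum_nonneg)
      finally have le: "(shift_series (b (r n)) G \<sigma> (s (r n) i))\<^sup>2 \<le> sum ?\<Phi> ?T" .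
      have "0 \<le> \<eta> * ?W (K (r n)) (b (r n))" using W0 \<eta> by (intro mult_nonneg_nonneg) auto
      then have "real (r n) * sum ?\<Phi> ?T \<le> 1" using lt1[of "r n"] by linarith
      moreover have "real n * sum ?\<Phi> ?T \<le> real (r n) * sum ?\<Phi> ?T"
        using r[of n] by (intro mult_right_mono) (auto intro!: sum_nonneg)
      ultimately have "real n * sum ?\<Phi> ?T \<le> 1" by linarith
      then have "sum ?\<Phi> ?T \<le> 1 / real n" using n by (simp add: field_simps)
      then show ?thesis using le by linarith
    qed
    then have "\<forall>\<^sub>F n in sequentially. (shift_series (b (r n)) G \<sigma> (s (r n) i))\<^sup>2 \<le> 1 / real n"
      unfolding eventually_sequentially by blast
    then have "(\<lambda>n. (shift_series (b (r n)) G \<sigma> (s (r n) i))\<^sup>2) \<longlonglongrightarrow> 0"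
      by (intro tendsto_sandwich[OF _ _ tendsto_const lim_1_over_n]) auto
    moreover have "(\<lambda>n. (shift_series (b (r n)) G \<sigma> (s (r n) i))\<^sup>2) \<longlonglongrightarrow> (shift_series b' G \<sigma> (s' i))\<^sup>2"
      by (intro tendsto_intros lim1)
    ultimately show ?thesis using LIMSEQ_unique by fastforce
  qed
  have smono: "s' i < s' j" if "i < j" for i j
    using that
  proof (induction j rule: int_gr_induct)
    case base
    then show ?case using s'step[of i] \<delta> by simp
  next
    case (step j)
    then show ?case using s'step[of j] \<delta> by simp
  qed
  \<comment> \<open>Each limit point is listed \<open>N\<close> times, as a zero of order
    \<open>N\<close>; the mean spacing becomes \<open>L' / (M * N) < 1\<close>.\<close>
  define t where "t i = s' (i div int N)" for i
  have "zero_seq (shift_series b' G) t"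
    unfolding zero_seq_def
  proof (intro conjI allI impI)
    show "mono t"
    proof (rule monoI)
      fix i j :: int assume "i \<le> j"
      then have "i div int N \<le> j div int N" using N by (intro zdiv_mono1) auto
      then show "t i \<le> t j" unfolding t_def using smono[of "i div int N" "j div int N"] by (cases "i div int N = j div int N") auto
    qed
    fix i \<sigma> assume "t (i + int \<sigma>) = t i"
    then have e: "(i + int \<sigma>) div int N = i div int N"
      unfolding t_def using smono by (metis less_irrefl linorder_neqE)
    have "\<sigma> < N"
    proof (rule ccontr)
      assume "\<not> \<sigma> < N"
      then have "(i + int N) div int N \<le> (i + int \<sigma>) div int N" using N by (intro zdiv_mono1) auto
      then show False using e N by simp
    qed
    then show "shift_series b' G \<sigma> (t i) = 0" unfolding t_def by (rule zero)
  qed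
  moreover have "\<bar>t i - L' / real M / real N * of_int i\<bar> \<le> L' + L' / real M" for i
  proof -
    let ?j = "real_of_int (i div int N)" and ?r = "real_of_int (i mod int N)"
    have Nz: "int N > 0" using N by simp
    have "i = int N * (i div int N) + i mod int N" by simp
    then have "real_of_int i = real N * ?j + ?r" by (metis of_int_add of_int_mult of_int_of_nat_eq)
    then have e: "L' / real M / real N * of_int i = L' / real M * ?j + L' / real M * (?r / real N)"
      using N M by (simp add: field_simps)
    have "0 \<le> ?r / real N" "?r / real N \<le> 1" 
    proof -
      have "0 \<le> ?r" "?r \<le> real N" using pos_mod_bound[OF Nz, of i] pos_mod_sign[OF Nz, of i] by linarith+
      then show "0 \<le> ?r / real N" "?r / real N \<le> 1" using N by (simp_all add: divide_le_eq)
    qed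
    then have "0 \<le> L' / real M * (?r / real N)" "L' / real M * (?r / real N) \<le> L' / real M * 1"
      using L L' by (intro mult_nonneg_nonneg mult_left_mono; simp)+
    then show ?thesis using s'K[of "i div int N"] unfolding e t_def by (simp add: abs_le_iff)
  qed
  moreover have "0 < L' / real M / real N" "L' / real M / real N < 1" using L L' M N by (auto simp: field_simps)
  ultimately have "b' 0 = 0" using uniq b'b unfolding zero_uniq_def by blast
  moreover have "(\<lambda>n. b (r n) 0) \<longlonglongrightarrow> 1" by (simp add: b0)
  ultimately show False using LIMSEQ_unique[OF br[of 0]] by fastforce
qed

lemma local_sampling:
  assumes "\<eta> > 0"
  obtains n :: nat where "\<And>T c K m. dense_separated T \<Longrightarrow> finite K \<Longrightarrow> (\<And>k. k \<notin> K \<Longrightarrow> c k = 0) \<Longrightarrow>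
    (c m)\<^sup>2 \<le> \<eta> * (\<Sum>k\<in>K. exp (- 2 * \<epsilon> * \<bar>of_int k - of_int m\<bar>) * (c k)\<^sup>2)
      + real n * (\<Sum>y\<in>T \<inter> {of_int m - real n..of_int m + real n}. \<Sum>s<N. (shift_series c G s y)\<^sup>2)"
proof -
  obtain n :: nat where n: "\<And>T c K. dense_separated T \<Longrightarrow> finite K \<Longrightarrow> (\<And>k. k \<notin> K \<Longrightarrow> c k = 0) \<Longrightarrow>
    (c 0)\<^sup>2 \<le> \<eta> * (\<Sum>k\<in>K. exp (- 2 * \<epsilon> * \<bar>of_int k\<bar>) * (c k)\<^sup>2)
      + real n * (\<Sum>y\<in>T \<inter> {- real n..real n}. \<Sum>s<N. (shift_series c G s y)\<^sup>2)"
    using local_sampling_at_0[OF assms] by blast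
  show ?thesis
  proof (rule that)
    fix T and c :: "int \<Rightarrow> real" and K :: "int set" and m :: int
    assume T: "dense_separated T" and K: "finite K" and c: "\<And>k. k \<notin> K \<Longrightarrow> c k = 0"
    let ?T = "(\<lambda>x. x + - of_int m) ` T" and ?K = "(\<lambda>k. k - m) ` K"
    have "dense_separated ?T"
      using T separated_by_translate[of d T "- of_int m"] unfolding dense_separated_def card_translate_interval by blast
    moreover have "c (k + m) = 0" if "k \<notin> ?K" for k
    proof (rule c)
      show "k + m \<notin> K" using that by (metis add_diff_cancel_right' image_eqI)
    qed
    ultimately have "(c (0 + m))\<^sup>2 \<le> \<eta> * (\<Sum>k\<in>?K. exp (- 2 * \<epsilon> * \<bar>of_int k\<bar>) * (c (k + m))\<^sup>2)
      + real n * (\<Sum>y\<in>?T \<inter> {- real n..real n}. \<Sum>s<N. (shift_series (\<lambda>k. c (k + m)) G s y)\<^sup>2)"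
      using K by (intro n) auto
    moreover have "(\<Sum>k\<in>?K. exp (- 2 * \<epsilon> * \<bar>of_int k\<bar>) * (c (k + m))\<^sup>2)
      = (\<Sum>k\<in>K. exp (- 2 * \<epsilon> * \<bar>of_int k - of_int m\<bar>) * (c k)\<^sup>2)"
      by (subst sum.reindex) (auto simp: inj_on_def)
    moreover have "?T \<inter> {- real n..real n} = (\<lambda>x. x + - of_int m) ` (T \<inter> {of_int m - real n..of_int m + real n})" by auto
    moreover have "(\<Sum>y\<in>(\<lambda>x. x + - of_int m) ` (T \<inter> {of_int m - real n..of_int m + real n}). \<Sum>s<N. (shift_series (\<lambda>k. c (k + m)) G s y)\<^sup>2)
      = (\<Sum>y\<in>T \<inter> {of_int m - real n..of_int m + real n}. \<Sum>s<N. (shift_series c G s y)\<^sup>2)"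
      using shift_series_translate[of c m G] by (subst sum.reindex) (auto simp: inj_on_def)
    ultimately show "(c m)\<^sup>2 \<le> \<eta> * (\<Sum>k\<in>K. exp (- 2 * \<epsilon> * \<bar>of_int k - of_int m\<bar>) * (c k)\<^sup>2)
      + real n * (\<Sum>y\<in>T \<inter> {of_int m - real n..of_int m + real n}. \<Sum>s<N. (shift_series c G s y)\<^sup>2)"
      by simp
  qed
qed

text \<open>The local inequality is summed over \<open>m\<close>. By the choice of
  \<open>\<eta>\<close> its weighted term adds up to at most half of the left-hand side and is
  absorbed, which is possible because the left-hand side is a finite sum.\<close>

theorem sampling_inequality:
  obtains C where "C > 0" "\<And>T c (R :: real). dense_separated T \<Longrightarrow> (\<And>k. \<bar>of_int k\<bar> > R \<Longrightarrow> c k = 0) \<Longrightarrow>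
    (\<Sum>k | \<bar>real_of_int k\<bar> \<le> R. (c k)\<^sup>2) \<le> C * (\<Sum>y\<in>T \<inter> {- (R + C)..R + C}. \<Sum>s<N. (shift_series c G s y)\<^sup>2)"
proof -
  define \<eta> where "\<eta> = 1 / (2 * (2 * (1 + 1 / (2 * \<epsilon>))))"
  have P: "1 + 1 / (2 * \<epsilon>) > 0" using \<epsilon> by (simp add: add_pos_pos)
  then have \<eta>: "\<eta> > 0" by (simp add: \<eta>_def)
  obtain n :: nat where n: "\<And>T c K m. dense_separated T \<Longrightarrow> finite K \<Longrightarrow> (\<And>k. k \<notin> K \<Longrightarrow> c k = 0) \<Longrightarrow>
    (c m)\<^sup>2 \<le> \<eta> * (\<Sum>k\<in>K. exp (- 2 * \<epsilon> * \<bar>of_int k - of_int m\<bar>) * (c k)\<^sup>2)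
      + real n * (\<Sum>y\<in>T \<inter> {of_int m - real n..of_int m + real n}. \<Sum>s<N. (shift_series c G s y)\<^sup>2)"
    by (rule local_sampling[OF \<eta>]) blast
  define C where "C = 2 * real n * (exp (real n) * 4) + real n + 1"
  have "C > 0" by (simp add: C_def add_nonneg_pos)
  show ?thesis
  proof (rule that[OF \<open>C > 0\<close>])
    fix T and c :: "int \<Rightarrow> real" and R :: real assume T: "dense_separated T" and c: "\<And>k. \<bar>of_int k\<bar> > R \<Longrightarrow> c k = 0"
    define K where "K = {k. \<bar>real_of_int k\<bar> \<le> R}"
    have "K \<subseteq> {- \<lceil>R\<rceil>..\<lceil>R\<rceil>}" unfolding K_def by auto linarith+
    then have K: "finite K" by (rule finite_subset) simp
    have cK: "c k = 0" if "k \<notin> K" for k using that c by (simp add: K_def)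
    let ?\<Phi> = "\<lambda>y. \<Sum>s<N. (shift_series c G s y)\<^sup>2"
    let ?U = "T \<inter> {- (R + C)..R + C}"
    have U: "finite ?U" using T d separated_by_finite unfolding dense_separated_def by blast
    have \<Phi>0: "?\<Phi> y \<ge> 0" for y by (intro sum_nonneg) auto
    let ?E = "\<Sum>k\<in>K. (c k)\<^sup>2"
    have "?E \<le> (\<Sum>m\<in>K. \<eta> * (\<Sum>k\<in>K. exp (- 2 * \<epsilon> * \<bar>of_int k - of_int m\<bar>) * (c k)\<^sup>2)
      + real n * (\<Sum>y\<in>T \<inter> {of_int m - real n..of_int m + real n}. ?\<Phi> y))"
      by (intro sum_mono n T K cK)
    also have "\<dots> = \<eta> * (\<Sum>m\<in>K. \<Sum>k\<in>K. exp (- 2 * \<epsilon> * \<bar>of_int k - of_int m\<bar>) * (c k)\<^sup>2)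
      + real n * (\<Sum>m\<in>K. \<Sum>y\<in>T \<inter> {of_int m - real n..of_int m + real n}. ?\<Phi> y)"
      by (simp add: sum.distrib sum_distrib_left)
    finally have 1: "?E \<le> \<dots>" .
    have "(\<Sum>m\<in>K. \<Sum>k\<in>K. exp (- 2 * \<epsilon> * \<bar>of_int k - of_int m\<bar>) * (c k)\<^sup>2)
       = (\<Sum>k\<in>K. (\<Sum>m\<in>K. exp (- (2 * \<epsilon>) * \<bar>of_int m - of_int k\<bar>)) * (c k)\<^sup>2)"
      by (subst sum.swap) (simp add: sum_distrib_right abs_minus_commute)
    also have "\<dots> \<le> (\<Sum>k\<in>K. (2 * (1 + 1 / (2 * \<epsilon>))) * (c k)\<^sup>2)"
      using \<epsilon> K by (intro sum_mono mult_right_mono sum_exp_int_bound) auto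
    also have "\<dots> = (2 * (1 + 1 / (2 * \<epsilon>))) * ?E" by (simp add: sum_distrib_left)
    finally have "\<eta> * (\<Sum>m\<in>K. \<Sum>k\<in>K. exp (- 2 * \<epsilon> * \<bar>of_int k - of_int m\<bar>) * (c k)\<^sup>2) \<le> \<eta> * ((2 * (1 + 1 / (2 * \<epsilon>))) * ?E)"
      using \<eta> by (intro mult_left_mono) auto
    also have "\<dots> = ?E / 2"
    proof -
      have "\<eta> * (p * e) = e / 2" if "\<eta> = 1 / (2 * p)" "p > 0" for p e :: real using that by simp
      from this[OF \<eta>_def] P show ?thesis by simp
    qed
    finally have 2: "\<eta> * (\<Sum>m\<in>K. \<Sum>k\<in>K. exp (- 2 * \<epsilon> * \<bar>of_int k - of_int m\<bar>) * (c k)\<^sup>2) \<le> ?E / 2" .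
    have "(\<Sum>m\<in>K. \<Sum>y\<in>T \<inter> {of_int m - real n..of_int m + real n}. ?\<Phi> y)
       \<le> (\<Sum>m\<in>K. \<Sum>y\<in>?U. (exp (real n) * exp (- 1 * \<bar>of_int m - y\<bar>)) * ?\<Phi> y)"
    proof (rule sum_mono)
      fix m assume m: "m \<in> K"
      have "real n \<le> C" by (simp add: C_def)
      then have sub: "T \<inter> {of_int m - real n..of_int m + real n} \<subseteq> ?U" using m by (auto simp: K_def abs_le_iff)
      \<comment> \<open>The inserted factor is at least 1 on the window around \<open>m\<close> and
        summable over \<open>m\<close>, so it bounds how often a point \<open>y\<close> is
        counted.\<close>
      have "(\<Sum>y\<in>T \<inter> {of_int m - real n..of_int m + real n}. ?\<Phi> y)
        \<le> (\<Sum>y\<in>T \<inter> {of_int m - real n..of_int m + real n}. (exp (real n) * exp (- 1 * \<bar>of_int m - y\<bar>)) * ?\<Phi> y)"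
      proof (rule sum_mono)
        fix y assume "y \<in> T \<inter> {of_int m - real n..of_int m + real n}"
        then have "\<bar>of_int m - y\<bar> \<le> real n" by (auto simp: abs_le_iff)
        then have "1 \<le> exp (real n) * exp (- 1 * \<bar>of_int m - y\<bar>)" by (simp add: exp_add[symmetric])
        then show "?\<Phi> y \<le> (exp (real n) * exp (- 1 * \<bar>of_int m - y\<bar>)) * ?\<Phi> y"
          using mult_right_mono[OF _ \<Phi>0[of y]] by fastforce
      qed
      also have "\<dots> \<le> (\<Sum>y\<in>?U. (exp (real n) * exp (- 1 * \<bar>of_int m - y\<bar>)) * ?\<Phi> y)"
        using \<Phi>0 by (intro sum_mono2 U sub) auto
      finally show "(\<Sum>y\<in>T \<inter> {of_int m - real n..of_int m + real n}. ?\<Phi> y) \<le> \<dots>" .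
    qed
    also have "\<dots> = (\<Sum>y\<in>?U. (exp (real n) * (\<Sum>m\<in>K. exp (- 1 * \<bar>of_int m - y\<bar>))) * ?\<Phi> y)"
    proof -
      have "(\<Sum>m\<in>K. \<Sum>y\<in>U. (e * E m y) * \<Phi> y) = (\<Sum>y\<in>U. (e * (\<Sum>m\<in>K. E m y)) * \<Phi> y)"
        for E :: "int \<Rightarrow> real \<Rightarrow> real" and \<Phi> e U
        by (subst sum.swap) (simp only: sum_distrib_left sum_distrib_right)
      then show ?thesis .
    qed
    also have "\<dots> \<le> (\<Sum>y\<in>?U. (exp (real n) * 4) * ?\<Phi> y)"
    proof (intro sum_mono mult_right_mono mult_left_mono \<Phi>0)
      fix y :: real
      show "(\<Sum>m\<in>K. exp (- 1 * \<bar>of_int m - y\<bar>)) \<le> 4" using sum_exp_int_bound[of 1 K y] K by simp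
    qed simp
    also have "\<dots> = (exp (real n) * 4) * sum ?\<Phi> ?U" by (simp only: sum_distrib_left)
    finally have 3: "real n * (\<Sum>m\<in>K. \<Sum>y\<in>T \<inter> {of_int m - real n..of_int m + real n}. ?\<Phi> y) \<le> real n * ((exp (real n) * 4) * sum ?\<Phi> ?U)"
      by (rule mult_left_mono) simp
    have "?E \<le> 2 * real n * (exp (real n) * 4) * sum ?\<Phi> ?U" using 1 2 3 by (simp only: mult.assoc)
    also have "\<dots> \<le> C * sum ?\<Phi> ?U"
      by (intro mult_right_mono sum_nonneg \<Phi>0) (simp add: C_def)
    finally show "(\<Sum>k | \<bar>real_of_int k\<bar> \<le> R. (c k)\<^sup>2) \<le> C * (\<Sum>y\<in>?U. ?\<Phi> y)" by (simp add: K_def)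
  qed
qed

end

section \<open>Parseval's identity\<close>

definition trig_sum :: "int set \<Rightarrow> (int \<Rightarrow> complex) \<Rightarrow> real \<Rightarrow> complex" where
  "trig_sum J a x = (\<Sum>k\<in>J. a k * exp (2 * pi * \<i> * of_int k * complex_of_real x))"

lemma trig_sum_add:
  assumes "finite J" "finite J'"
  shows "\<exists>J'' a''. finite J'' \<and> (\<forall>x. trig_sum J a x + trig_sum J' a' x = trig_sum J'' a'' x)"
proof (intro exI conjI allI)
  fix x
  let ?e = "\<lambda>k. exp (2 * pi * \<i> * of_int k * complex_of_real x)"
  have "trig_sum J a x = (\<Sum>k\<in>J \<union> J'. (if k \<in> J then a k else 0) * ?e k)"
    unfolding trig_sum_def using assms by (intro sum.mono_neutral_cong_left) auto
  moreover have "trig_sum J' a' x = (\<Sum>k\<in>J \<union> J'. (if k \<in> J' then a' k else 0) * ?e k)"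
    unfolding trig_sum_def using assms by (intro sum.mono_neutral_cong_left) auto
  ultimately show "trig_sum J a x + trig_sum J' a' x
      = trig_sum (J \<union> J') (\<lambda>k. (if k \<in> J then a k else 0) + (if k \<in> J' then a' k else 0)) x"
    unfolding trig_sum_def by (simp only: sum.distrib distrib_right)
qed (use assms in simp)

lemma trig_sum_monom_mult:
  "c * exp (2 * pi * \<i> * of_int l * complex_of_real x) * trig_sum J a x = trig_sum ((\<lambda>k. k + l) ` J) (\<lambda>k. c * a (k - l)) x"
proof -
  have "trig_sum ((\<lambda>k. k + l) ` J) (\<lambda>k. c * a (k - l)) x
      = (\<Sum>k\<in>J. c * a k * exp (2 * pi * \<i> * of_int (k + l) * complex_of_real x))"
    unfolding trig_sum_def by (subst sum.reindex) (auto simp: inj_on_def)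
  also have "\<dots> = c * exp (2 * pi * \<i> * of_int l * complex_of_real x) * trig_sum J a x"
    unfolding trig_sum_def sum_distrib_left
    by (intro sum.cong refl) (simp add: distrib_left distrib_right exp_add mult_ac)
  finally show ?thesis by simp
qed

lemma trig_sum_mult:
  assumes "finite J" "finite J'"
  shows "\<exists>J'' a''. finite J'' \<and> (\<forall>x. trig_sum J a x * trig_sum J' a' x = trig_sum J'' a'' x)"
  using assms(1)
proof (induction J)
  case empty
  show ?case by (intro exI[of _ "{}"]) (simp add: trig_sum_def)
next
  case (insert k J)
  then obtain J1 a1 where 1: "finite J1" "\<And>x. trig_sum J a x * trig_sum J' a' x = trig_sum J1 a1 x" by blast
  obtain J2 a2 where 2: "finite J2"
    "\<And>x. trig_sum ((\<lambda>j. j + k) ` J') (\<lambda>j. a k * a' (j - k)) x + trig_sum J1 a1 x = trig_sum J2 a2 x"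
    using trig_sum_add[of "(\<lambda>j. j + k) ` J'" J1] 1(1) assms(2) by blast
  have "trig_sum (insert k J) a x * trig_sum J' a' x = trig_sum J2 a2 x" for x
    unfolding 2(2)[symmetric] 1(2)[symmetric] trig_sum_monom_mult[symmetric]
    using insert by (simp add: trig_sum_def distrib_right)
  then show ?case using 2(1) by blast
qed

text \<open>On the unit circle real and imaginary part are combinations of \<open>z\<close> and
  \<open>cnj z\<close>, the exponentials of frequency 1 and -1. This converts polynomial
  approximation on the circle into approximation by trigonometric sums.\<close>

lemma real_polynomial_function_trig_sum:
  fixes q :: "complex \<Rightarrow> real"
  assumes "real_polynomial_function q"
  shows "\<exists>J a. finite J \<and> (\<forall>x. complex_of_real (q (exp (2 * pi * \<i> * complex_of_real x))) = trig_sum J a x)"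
  using assms
proof induction
  case (linear f)
  let ?J = "{1, -1} :: int set" and ?a = "\<lambda>k::int. if k = 1 then Complex (f 1 / 2) (- f \<i> / 2) else Complex (f 1 / 2) (f \<i> / 2)"
  have "complex_of_real (f (exp (2 * pi * \<i> * complex_of_real x))) = trig_sum ?J ?a x" for x
  proof -
    let ?z = "exp (2 * pi * \<i> * complex_of_real x)"
    have lin: "linear f" using linear by (rule bounded_linear.linear)
    have "f z = Re z * f 1 + Im z * f \<i>" for z
    proof -
      have "z = Re z *\<^sub>R 1 + Im z *\<^sub>R \<i>" by (simp add: complex_eq_iff)
      then have "f z = f (Re z *\<^sub>R 1 + Im z *\<^sub>R \<i>)" by (rule arg_cong)
      then show ?thesis by (simp only: linear_add[OF lin] linear_scale[OF lin] real_scaleR_def)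
    qed
    then have fz: "f ?z = Re ?z * f 1 + Im ?z * f \<i>" .
    have c: "exp (2 * pi * \<i> * of_int (-1) * complex_of_real x) = cnj ?z" by (simp add: exp_cnj)
    have "trig_sum ?J ?a x = Complex (f 1 / 2) (- f \<i> / 2) * ?z + Complex (f 1 / 2) (f \<i> / 2) * cnj ?z"
      unfolding trig_sum_def c[symmetric] by simp
    also have "\<dots> = complex_of_real (f ?z)" unfolding fz by (simp add: complex_eq_iff algebra_simps)
    finally show ?thesis by simp
  qed
  then show ?case by (intro exI[of _ ?J] exI[of _ ?a]) simp
next
  case (const c)
  show ?case by (intro exI[of _ "{0}"] exI[of _ "\<lambda>_. of_real c"]) (simp add: trig_sum_def)
next
  case (add f g)
  then obtain J a J' a' where "finite J" "finite J'"
    "\<And>x. complex_of_real (f (exp (2 * pi * \<i> * complex_of_real x))) = trig_sum J a x"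
    "\<And>x. complex_of_real (g (exp (2 * pi * \<i> * complex_of_real x))) = trig_sum J' a' x" by blast
  then show ?case using trig_sum_add[of J J' a a'] by simp
next
  case (mult f g)
  then obtain J a J' a' where "finite J" "finite J'"
    "\<And>x. complex_of_real (f (exp (2 * pi * \<i> * complex_of_real x))) = trig_sum J a x"
    "\<And>x. complex_of_real (g (exp (2 * pi * \<i> * complex_of_real x))) = trig_sum J' a' x" by blast
  then show ?case using trig_sum_mult[of J J' a a'] by simp
qed

lemma trig_sum_dense:
  fixes P :: "real \<Rightarrow> complex"
  assumes cont: "continuous_on {0..1} P" and per: "P 0 = P 1" and e: "e > 0"
  shows "\<exists>J a. finite J \<and> (\<forall>x\<in>{0..1}. norm (P x - trig_sum J a x) < e)"
proof -
  define f where "f = P \<circ> (\<lambda>z. Arg2pi z / (2 * pi))"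
  \<comment> \<open>The constant homotopy serves only to obtain continuity of \<open>f\<close> on
    the circle, including the point 1, where \<open>Arg2pi\<close> jumps.\<close>
  have "homotopic_loops UNIV P P"
    using cont per by (simp add: homotopic_loops_refl path_def pathstart_def pathfinish_def)
  then have "homotopic_with_canon (\<lambda>h. True) (sphere 0 1) UNIV f f"
    unfolding f_def by (rule homotopic_loops_imp_homotopic_circlemaps)
  then have contf: "continuous_on (sphere 0 1) f" using homotopic_with_imp_continuous by blast
  obtain g where g: "polynomial_function g" "\<And>z. z \<in> sphere 0 1 \<Longrightarrow> norm (f z - g z) < e"
    using Stone_Weierstrass_polynomial_function[OF compact_sphere contf e] by blast
  have "real_polynomial_function (Re \<circ> g)" "real_polynomial_function (Im \<circ> g)"
    using g(1) bounded_linear_Re bounded_linear_Im unfolding polynomial_function_def by blast+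
  then obtain J a J' a' where J: "finite J" "finite J'"
    and a: "\<And>x. complex_of_real (Re (g (exp (2 * pi * \<i> * complex_of_real x)))) = trig_sum J a x"
    and a': "\<And>x. complex_of_real (Im (g (exp (2 * pi * \<i> * complex_of_real x)))) = trig_sum J' a' x"
    using real_polynomial_function_trig_sum by (metis comp_apply)
  have i: "\<i> * trig_sum J' a' x = trig_sum J' (\<lambda>k. \<i> * a' k) x" for x
    by (simp add: trig_sum_def sum_distrib_left mult_ac)
  obtain J2 a2 where J2: "finite J2" and a2: "\<And>x. trig_sum J a x + trig_sum J' (\<lambda>k. \<i> * a' k) x = trig_sum J2 a2 x"
    using trig_sum_add[OF J, of a "\<lambda>k. \<i> * a' k"] by blast
  have "norm (P x - trig_sum J2 a2 x) < e" if x: "x \<in> {0..1}" for x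
  proof -
    let ?z = "exp (2 * pi * \<i> * complex_of_real x)"
    have "trig_sum J2 a2 x = g ?z"
      unfolding a2[symmetric] i[symmetric] a[symmetric] a'[symmetric] by (simp add: complex_eq_iff)
    moreover have "f ?z = P x"
    proof (cases "x = 1")
      case True
      have "exp (2 * pi * \<i>) = 1" by (simp add: exp_eq_1)
      then have "Arg2pi ?z = 0" using True by (intro Arg2pi_unique[of 1]) auto
      then show ?thesis using True per by (simp add: f_def)
    next
      case False
      then have "Arg2pi ?z = 2 * pi * x"
        using x by (intro Arg2pi_unique[of 1]) (auto simp: mult_ac)
      then show ?thesis by (simp add: f_def)
    qed
    moreover have "?z \<in> sphere 0 1" by (simp add: norm_exp_eq_Re)
    ultimately show ?thesis using g(2) by metis
  qed
  then show ?thesis using J2 by blast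
qed

text \<open>The base point \<open>y\<close> stays free so that the cell can later be centred at a
  prescribed point.\<close>

definition fcoeff :: "real \<Rightarrow> (real \<Rightarrow> complex) \<Rightarrow> int \<Rightarrow> complex" where
  "fcoeff y P k = integral {y..y + 1} (\<lambda>x. P x * exp (- 2 * pi * \<i> * of_int k * complex_of_real x))"

text \<open>Completing the square in an orthonormal system. With \<open>a\<close> the Fourier
  coefficients it gives Bessel's inequality, with an approximating \<open>a\<close> the converse up
  to an error.\<close>

lemma trig_approx_error:
  fixes P :: "real \<Rightarrow> complex"
  assumes cont: "continuous_on {y..y + 1} P" and J: "finite J"
  shows "integral {y..y + 1} (\<lambda>x. (norm (P x - trig_sum J a x))\<^sup>2)
    = integral {y..y + 1} (\<lambda>x. (norm (P x))\<^sup>2) - (\<Sum>k\<in>J. (norm (fcoeff y P k))\<^sup>2) + (\<Sum>k\<in>J. (norm (fcoeff y P k - a k))\<^sup>2)"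
proof -
  let ?I = "{y..y + 1}"
  let ?e = "\<lambda>k x. exp (2 * pi * \<i> * of_int k * complex_of_real x)"
  have cn: "cnj (?e k x) = exp (- 2 * pi * \<i> * of_int k * complex_of_real x)" for k x by (simp add: exp_cnj)
  have contT: "continuous_on ?I (trig_sum J a)" unfolding trig_sum_def by (intro continuous_intros)
  have 1: "((\<lambda>x. P x * cnj (P x)) has_integral of_real (integral ?I (\<lambda>x. (norm (P x))\<^sup>2))) ?I"
  proof -
    have "((\<lambda>x. complex_of_real ((norm (P x))\<^sup>2)) has_integral of_real (integral ?I (\<lambda>x. (norm (P x))\<^sup>2))) ?I"
      by (intro has_integral_of_real integrable_integral integrable_continuous_real continuous_intros cont)
    then show ?thesis by (simp only: complex_norm_square)
  qed
  have 2: "((\<lambda>x. P x * cnj (?e k x)) has_integral fcoeff y P k) ?I" for k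
    unfolding fcoeff_def cn by (intro integrable_integral integrable_continuous_real continuous_intros cont)
  have 3: "((\<lambda>x. ?e k x * cnj (P x)) has_integral cnj (fcoeff y P k)) ?I" for k
    using has_integral_cnj[of "\<lambda>x. P x * cnj (?e k x)" "fcoeff y P k" ?I] 2[of k] by (simp add: o_def mult.commute)
  have 4: "((\<lambda>x. ?e k x * cnj (?e l x)) has_integral (if k = l then 1 else 0)) ?I" for k l
  proof -
    have "?e k x * cnj (?e l x) = ?e (k - l) x" for x unfolding cn exp_add[symmetric] by (simp add: algebra_simps)
    then show ?thesis using has_integral_exp_int[of "k - l" y] by simp
  qed
  let ?p = "fcoeff y P"
  have "((\<lambda>x. P x * cnj (P x) - (\<Sum>k\<in>J. cnj (a k) * (P x * cnj (?e k x))) - (\<Sum>k\<in>J. a k * (?e k x * cnj (P x)))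
        + (\<Sum>k\<in>J. a k * (\<Sum>l\<in>J. cnj (a l) * (?e k x * cnj (?e l x)))))
      has_integral (of_real (integral ?I (\<lambda>x. (norm (P x))\<^sup>2)) - (\<Sum>k\<in>J. cnj (a k) * ?p k) - (\<Sum>k\<in>J. a k * cnj (?p k))
        + (\<Sum>k\<in>J. a k * (\<Sum>l\<in>J. cnj (a l) * (if k = l then 1 else 0))))) ?I"
    by (intro has_integral_add has_integral_diff has_integral_sum has_integral_mult_right J 1 2 3 4)
  moreover have "P x * cnj (P x) - (\<Sum>k\<in>J. cnj (a k) * (P x * cnj (?e k x))) - (\<Sum>k\<in>J. a k * (?e k x * cnj (P x)))
        + (\<Sum>k\<in>J. a k * (\<Sum>l\<in>J. cnj (a l) * (?e k x * cnj (?e l x))))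
     = of_real ((norm (P x - trig_sum J a x))\<^sup>2)" for x
  proof -
    have c1: "P x * cnj (trig_sum J a x) = (\<Sum>k\<in>J. cnj (a k) * (P x * cnj (?e k x)))"
      by (simp only: trig_sum_def cnj_sum complex_cnj_mult sum_distrib_left mult_ac)
    have c2: "trig_sum J a x * cnj (P x) = (\<Sum>k\<in>J. a k * (?e k x * cnj (P x)))"
      by (simp only: trig_sum_def sum_distrib_right mult.assoc)
    have c3: "trig_sum J a x * cnj (trig_sum J a x) = (\<Sum>k\<in>J. a k * (\<Sum>l\<in>J. cnj (a l) * (?e k x * cnj (?e l x))))"
    proof -
      have "trig_sum J a x * cnj (trig_sum J a x) = (\<Sum>k\<in>J. \<Sum>l\<in>J. (a k * ?e k x) * (cnj (a l) * cnj (?e l x)))"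
        by (simp only: trig_sum_def cnj_sum complex_cnj_mult sum_product)
      also have "\<dots> = (\<Sum>k\<in>J. a k * (\<Sum>l\<in>J. cnj (a l) * (?e k x * cnj (?e l x))))"
        by (simp only: sum_distrib_left mult_ac)
      finally show ?thesis .
    qed
    show ?thesis unfolding complex_norm_square c1[symmetric] c2[symmetric] c3[symmetric]
      by (simp add: algebra_simps)
  qed
  moreover have "of_real (integral ?I (\<lambda>x. (norm (P x))\<^sup>2)) - (\<Sum>k\<in>J. cnj (a k) * ?p k) - (\<Sum>k\<in>J. a k * cnj (?p k))
        + (\<Sum>k\<in>J. a k * (\<Sum>l\<in>J. cnj (a l) * (if k = l then 1 else 0)))
     = complex_of_real (integral ?I (\<lambda>x. (norm (P x))\<^sup>2) - (\<Sum>k\<in>J. (norm (?p k))\<^sup>2) + (\<Sum>k\<in>J. (norm (?p k - a k))\<^sup>2))"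
  proof -
    have "(\<Sum>k\<in>J. a k * (\<Sum>l\<in>J. cnj (a l) * (if k = l then 1 else 0))) = (\<Sum>k\<in>J. a k * cnj (a k))"
      using J by (intro sum.cong refl) (simp add: if_distrib[where f = "\<lambda>z. _ * z"] cong: if_cong)
    then show ?thesis
      unfolding of_real_add of_real_diff of_real_sum complex_norm_square
      by (simp add: algebra_simps sum.distrib sum_subtractf)
  qed
  ultimately have "((\<lambda>x. complex_of_real ((norm (P x - trig_sum J a x))\<^sup>2)) has_integral
      complex_of_real (integral ?I (\<lambda>x. (norm (P x))\<^sup>2) - (\<Sum>k\<in>J. (norm (?p k))\<^sup>2) + (\<Sum>k\<in>J. (norm (?p k - a k))\<^sup>2))) ?I"
    by (simp only:)
  moreover have "((\<lambda>x. complex_of_real ((norm (P x - trig_sum J a x))\<^sup>2)) has_integral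
      complex_of_real (integral ?I (\<lambda>x. (norm (P x - trig_sum J a x))\<^sup>2))) ?I"
    by (intro has_integral_of_real integrable_integral integrable_continuous_real continuous_intros cont contT)
  ultimately show ?thesis using has_integral_unique of_real_eq_iff by blast
qed

lemma bessel_inequality:
  fixes P :: "real \<Rightarrow> complex"
  assumes "continuous_on {y..y + 1} P" "finite J"
  shows "(\<Sum>k\<in>J. (norm (fcoeff y P k))\<^sup>2) \<le> integral {y..y + 1} (\<lambda>x. (norm (P x))\<^sup>2)"
proof -
  have "0 \<le> integral {y..y + 1} (\<lambda>x. (norm (P x - trig_sum J (fcoeff y P) x))\<^sup>2)"
    unfolding trig_sum_def
    by (intro integral_nonneg integrable_continuous_real continuous_intros assms) simp
  then show ?thesis unfolding trig_approx_error[OF assms] by simp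
qed

text \<open>A finite partial sum up to \<open>e\<close> is enough, since lower frame bounds are
  verified with an arbitrarily small error.\<close>

lemma parseval_lower:
  fixes P :: "real \<Rightarrow> complex"
  assumes cont: "continuous_on {0..1} P" and per: "P 0 = P 1" and e: "e > 0"
  shows "\<exists>J. finite J \<and> integral {0..1} (\<lambda>x. (norm (P x))\<^sup>2) \<le> (\<Sum>k\<in>J. (norm (fcoeff 0 P k))\<^sup>2) + e"
proof -
  obtain J a where J: "finite J" and a: "\<And>x. x \<in> {0..1} \<Longrightarrow> norm (P x - trig_sum J a x) < sqrt e"
    using trig_sum_dense[OF cont per, of "sqrt e"] e real_sqrt_gt_zero by blast
  have "integral {0..1} (\<lambda>x. (norm (P x - trig_sum J a x))\<^sup>2) \<le> integral {0..1} (\<lambda>x::real. e)"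
  proof (intro integral_le)
    show "(\<lambda>x. (norm (P x - trig_sum J a x))\<^sup>2) integrable_on {0..1}"
      unfolding trig_sum_def by (intro integrable_continuous_real continuous_intros cont)
    show "(norm (P x - trig_sum J a x))\<^sup>2 \<le> e" if "x \<in> {0..1}" for x
      using power_mono[OF less_imp_le[OF a[OF that]], of 2] e by simp
  qed (rule integrable_continuous_real[OF continuous_on_const])
  moreover have "0 \<le> (\<Sum>k\<in>J. (norm (fcoeff 0 P k - a k))\<^sup>2)" by (intro sum_nonneg) auto
  ultimately show ?thesis using trig_approx_error[of 0 P J a] cont J by (intro exI[of _ J]) auto
qed

section \<open>Periodisation of integrals over the line\<close>

lemma integral_translate_unit:
  fixes u :: "real \<Rightarrow> 'a::euclidean_space"
  assumes "continuous_on UNIV u"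
  shows "((\<lambda>x. u (x + c)) has_integral integral {y + c..y + 1 + c} u) {y..y + 1}"
proof -
  have "(u has_integral integral {y + c..y + 1 + c} u) (cbox (y + c) (y + 1 + c))"
    unfolding cbox_interval
    using assms by (intro integrable_integral integrable_continuous_real) (rule continuous_on_subset, auto)
  from has_integral_affinity'[OF this zero_less_one, of c] show ?thesis by simp
qed

lemma integral_unit_intervals:
  fixes u :: "real \<Rightarrow> 'a::euclidean_space"
  assumes "continuous_on UNIV u"
  shows "integral {b..b + real n} u = (\<Sum>j<n. integral {b + real j..b + real j + 1} u)"
proof (induction n)
  case (Suc n)
  have "u integrable_on {b..b + real n + 1}"
    using assms by (intro integrable_continuous_real) (rule continuous_on_subset, auto)
  then have "integral {b..b + real n} u + integral {b + real n..b + real n + 1} u = integral {b..b + real n + 1} u"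
    by (intro Henstock_Kurzweil_Integration.integral_combine) auto
  then show ?case using Suc by (simp add: add_ac)
qed simp

text \<open>The unit cells with index from \<open>- m\<close> to \<open>m\<close> cover the support,
  and each is moved back to \<open>{y..y + 1}\<close>.\<close>

lemma lebesgue_integral_periodize:
  fixes u :: "real \<Rightarrow> 'a::euclidean_space"
  assumes cont: "continuous_on UNIV u" and supp: "\<And>t. \<bar>t - y\<bar> \<ge> real m \<Longrightarrow> u t = 0"
  shows "integrable lebesgue u"
    "(LINT t|lebesgue. u t) = integral {y..y + 1} (\<lambda>x. \<Sum>n\<in>{- int m..int m}. u (x + of_int n))"
proof -
  let ?S = "{y - real m..y - real m + real (2 * m + 1)}"
  have bm: "u \<in> borel_measurable borel" using cont by (rule borel_measurable_continuous_onI)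
  have ind: "indicator ?S t *\<^sub>R u t = u t" for t
  proof (cases "t \<in> ?S")
    case False
    then have "\<bar>t - y\<bar> \<ge> real m" by auto
    then show ?thesis using supp by simp
  qed simp
  have si: "set_integrable lborel ?S u"
    using cont by (intro borel_integrable_atLeastAtMost') (rule continuous_on_subset, auto)
  then have "integrable lborel u" unfolding set_integrable_def ind .
  then show "integrable lebesgue u" using bm by (simp add: integrable_completion)
  have "(LINT t|lebesgue. u t) = (LINT t|lborel. u t)" using bm by (intro integral_completion) simp
  also have "\<dots> = (LINT t:?S|lborel. u t)" unfolding set_lebesgue_integral_def ind ..
  also have "\<dots> = integral ?S u" by (rule set_borel_integral_eq_integral[OF si])
  also have "\<dots> = (\<Sum>j<2 * m + 1. integral {y - real m + real j..y - real m + real j + 1} u)"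
    by (rule integral_unit_intervals[OF cont])
  also have "\<dots> = (\<Sum>n\<in>{- int m..int m}. integral {y + of_int n..y + 1 + of_int n} u)"
    by (rule sum.reindex_bij_witness[where i = "\<lambda>n. nat (n + int m)" and j = "\<lambda>j. int j - int m"])
      (auto simp: algebra_simps)
  also have "\<dots> = integral {y..y + 1} (\<lambda>x. \<Sum>n\<in>{- int m..int m}. u (x + of_int n))"
    by (rule integral_unique[symmetric], intro has_integral_sum integral_translate_unit cont) simp
  finally show "(LINT t|lebesgue. u t) = \<dots>" .
qed

section \<open>Frames and fiberization\<close>

definition sq_norm :: "(real \<Rightarrow> complex) \<Rightarrow> real" where
  "sq_norm f = (LINT t|lebesgue. (cmod (f t))\<^sup>2)"

lemma sq_norm_nonneg: "sq_norm f \<ge> 0"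
  unfolding sq_norm_def by (rule Bochner_Integration.integral_nonneg) simp

lemma l2_norm_square: "(l2_norm f)\<^sup>2 = sq_norm f"
  using sq_norm_nonneg[of f] by (simp add: l2_norm_def sq_norm_def)

lemma norm_add_square_le: "(norm (x + y))\<^sup>2 \<le> 2 * (norm x)\<^sup>2 + 2 * (norm y)\<^sup>2" for x y :: "'a::real_normed_vector"
proof -
  have "(norm (x + y))\<^sup>2 \<le> (norm x + norm y)\<^sup>2" by (intro power_mono norm_triangle_ineq) simp
  also have "\<dots> \<le> 2 * (norm x)\<^sup>2 + 2 * (norm y)\<^sup>2"
    using sum_squares_bound[of "norm x" "norm y"] by (simp add: power2_sum)
  finally show ?thesis .
qed

lemma L2D: "f \<in> L2 \<Longrightarrow> f \<in> borel_measurable lebesgue" "f \<in> L2 \<Longrightarrow> integrable lebesgue (\<lambda>t. (cmod (f t))\<^sup>2)"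
  by (auto simp: L2_def)

lemma L2_diff:
  assumes f: "f \<in> L2" and h: "h \<in> L2"
  shows "(\<lambda>t. f t - h t) \<in> L2"
proof -
  have [measurable]: "f \<in> borel_measurable lebesgue" "h \<in> borel_measurable lebesgue" using f h by (auto dest: L2D)
  have "integrable lebesgue (\<lambda>t. (cmod (f t - h t))\<^sup>2)"
  proof (rule Bochner_Integration.integrable_bound)
    show "integrable lebesgue (\<lambda>t. 2 * (cmod (f t))\<^sup>2 + 2 * (cmod (h t))\<^sup>2)"
      using L2D(2)[OF f] L2D(2)[OF h] by simp
    show "AE t in lebesgue. norm ((cmod (f t - h t))\<^sup>2) \<le> norm (2 * (cmod (f t))\<^sup>2 + 2 * (cmod (h t))\<^sup>2)"
      using norm_add_square_le[of "f t" "- h t" for t] by (intro AE_I2) simp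
  qed measurable
  then show ?thesis by (simp add: L2_def)
qed

lemma sq_norm_le_diff:
  assumes f: "f \<in> L2" and h: "h \<in> L2"
  shows "sq_norm f \<le> 2 * sq_norm h + 2 * sq_norm (\<lambda>t. f t - h t)"
proof -
  have "sq_norm f \<le> (LINT t|lebesgue. 2 * (cmod (h t))\<^sup>2 + 2 * (cmod (f t - h t))\<^sup>2)"
    unfolding sq_norm_def
  proof (rule integral_mono)
    show "(cmod (f t))\<^sup>2 \<le> 2 * (cmod (h t))\<^sup>2 + 2 * (cmod (f t - h t))\<^sup>2" for t
      using norm_add_square_le[of "h t" "f t - h t"] by simp
  qed (use L2D(2)[OF f] L2D(2)[OF h] L2D(2)[OF L2_diff[OF f h]] in auto)
  then show ?thesis using L2D(2)[OF h] L2D(2)[OF L2_diff[OF f h]] by (simp add: sq_norm_def)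
qed

lemma sq_norm_minus_commute: "sq_norm (\<lambda>t. f t - h t) = sq_norm (\<lambda>t. h t - f t)"
  by (simp add: sq_norm_def norm_minus_commute)

lemma L2_inner_integrable:
  assumes f: "f \<in> L2" and h: "h \<in> L2"
  shows "integrable lebesgue (\<lambda>t. f t * cnj (h t))"
proof -
  have [measurable]: "f \<in> borel_measurable lebesgue" "h \<in> borel_measurable lebesgue" using f h by (auto dest: L2D)
  have "(\<lambda>t. cnj (h t)) \<in> borel_measurable lebesgue"
    by (intro measurable_compose[of h lebesgue borel cnj] borel_measurable_continuous_onI continuous_intros) auto
  then have m: "(\<lambda>t. f t * cnj (h t)) \<in> borel_measurable lebesgue" by measurable
  have i: "integrable lebesgue (\<lambda>t. (cmod (f t))\<^sup>2 + (cmod (h t))\<^sup>2)" using L2D(2)[OF f] L2D(2)[OF h] by simp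
  show ?thesis
  proof (rule Bochner_Integration.integrable_bound[OF i m], rule AE_I2)
    fix t
    have "cmod (f t) * cmod (h t) \<le> (cmod (f t))\<^sup>2 + (cmod (h t))\<^sup>2"
    proof -
      have "0 \<le> cmod (f t) * cmod (h t)" by simp
      then show ?thesis using sum_squares_bound[of "cmod (f t)" "cmod (h t)"] unfolding mult.assoc by linarith
    qed
    then show "norm (f t * cnj (h t)) \<le> norm ((cmod (f t))\<^sup>2 + (cmod (h t))\<^sup>2)" by (simp add: norm_mult)
  qed
qed

lemma l2_inner_diff:
  assumes "f \<in> L2" "h \<in> L2" "\<phi> \<in> L2"
  shows "l2_inner (\<lambda>t. f t - h t) \<phi> = l2_inner f \<phi> - l2_inner h \<phi>"
  unfolding l2_inner_def left_diff_distrib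
  by (rule Bochner_Integration.integral_diff[OF L2_inner_integrable[OF assms(1,3)] L2_inner_integrable[OF assms(2,3)]])

text \<open>The weighted arithmetic-geometric inequality with weight \<open>s = sqrt e\<close>
  replaces the Cauchy-Schwarz inequality; the constant is worse, but the order \<open>e\<close> is
  kept.\<close>

lemma l2_inner_small:
  assumes u: "u \<in> L2" and \<phi>: "\<phi> \<in> L2" and e: "e > 0" "sq_norm u \<le> e"
  shows "(cmod (l2_inner u \<phi>))\<^sup>2 \<le> e * (1 + sq_norm \<phi>)\<^sup>2"
proof -
  define s where "s = sqrt e"
  have s: "s > 0" "s\<^sup>2 = e" using e by (simp_all add: s_def)
  have "cmod (l2_inner u \<phi>) \<le> (LINT t|lebesgue. cmod (u t * cnj (\<phi> t)))"
    unfolding l2_inner_def by (rule integral_norm_bound)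
  also have "\<dots> \<le> (LINT t|lebesgue. (1 / s) * (cmod (u t))\<^sup>2 + s * (cmod (\<phi> t))\<^sup>2)"
  proof (rule integral_mono)
    show "integrable lebesgue (\<lambda>t. cmod (u t * cnj (\<phi> t)))" using L2_inner_integrable[OF u \<phi>] by simp
    show "integrable lebesgue (\<lambda>t. (1 / s) * (cmod (u t))\<^sup>2 + s * (cmod (\<phi> t))\<^sup>2)"
      using L2D(2)[OF u] L2D(2)[OF \<phi>] by simp
    fix t
    have "0 \<le> (cmod (u t) - s * cmod (\<phi> t))\<^sup>2" by simp
    then have "s * (cmod (u t) * cmod (\<phi> t)) \<le> (cmod (u t))\<^sup>2 + s\<^sup>2 * (cmod (\<phi> t))\<^sup>2"
    proof -
      have "0 \<le> s * (cmod (u t) * cmod (\<phi> t))" using s(1) by simp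
      moreover have "(cmod (u t) - s * cmod (\<phi> t))\<^sup>2 = (cmod (u t))\<^sup>2 + s\<^sup>2 * (cmod (\<phi> t))\<^sup>2 - 2 * (s * (cmod (u t) * cmod (\<phi> t)))"
        by (simp add: power2_eq_square algebra_simps)
      ultimately show ?thesis using \<open>0 \<le> (cmod (u t) - s * cmod (\<phi> t))\<^sup>2\<close> by linarith
    qed
    then show "cmod (u t * cnj (\<phi> t)) \<le> (1 / s) * (cmod (u t))\<^sup>2 + s * (cmod (\<phi> t))\<^sup>2"
      using s(1) by (simp add: norm_mult field_simps power2_eq_square)
  qed
  also have "\<dots> = (1 / s) * sq_norm u + s * sq_norm \<phi>"
    using L2D(2)[OF u] L2D(2)[OF \<phi>] by (simp add: sq_norm_def)
  also have "\<dots> \<le> (1 / s) * s\<^sup>2 + s * sq_norm \<phi>"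
    using e s by (intro add_right_mono mult_left_mono) auto
  also have "\<dots> = s * (1 + sq_norm \<phi>)" using s(1) by (simp add: power2_eq_square algebra_simps)
  finally have "(cmod (l2_inner u \<phi>))\<^sup>2 \<le> (s * (1 + sq_norm \<phi>))\<^sup>2" by (intro power_mono) auto
  then show ?thesis by (simp add: power_mult_distrib s)
qed

text \<open>The support radius is a natural number, so periodisations are finite sums over
  \<open>{- int m..int m}\<close>.\<close>

definition Cc :: "(real \<Rightarrow> complex) set" where
  "Cc = {h. continuous_on UNIV h \<and> (\<exists>m::nat. \<forall>t. \<bar>t\<bar> \<ge> real m \<longrightarrow> h t = 0)}"

lemma Cc_L2: "h \<in> Cc \<Longrightarrow> h \<in> L2"
proof -
  assume "h \<in> Cc"
  then obtain m :: nat where c: "continuous_on UNIV h" and m: "\<And>t. \<bar>t\<bar> \<ge> real m \<Longrightarrow> h t = 0" by (auto simp: Cc_def)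
  have "integrable lebesgue (\<lambda>t. (cmod (h t))\<^sup>2)"
    by (rule lebesgue_integral_periodize(1)[where y = 0 and m = m]) (use c m in \<open>auto intro!: continuous_intros\<close>)
  moreover have "h \<in> borel_measurable lebesgue"
    using c by (intro measurable_completion) (simp add: borel_measurable_continuous_onI)
  ultimately show ?thesis by (simp add: L2_def)
qed

lemma L2_truncation:
  assumes f: "f \<in> L2" and e: "e > 0"
  shows "\<exists>n::nat. sq_norm (\<lambda>t. f t - (if \<bar>t\<bar> \<le> real n \<and> cmod (f t) \<le> real n then f t else 0)) < e"
proof -
  have [measurable]: "f \<in> borel_measurable lebesgue" using f by (rule L2D)
  have [measurable]: "(\<lambda>t::real. t) \<in> borel_measurable lebesgue" by (intro measurable_completion) simp
  have "(\<lambda>n. LINT t|lebesgue. (cmod (f t - (if \<bar>t\<bar> \<le> real n \<and> cmod (f t) \<le> real n then f t else 0)))\<^sup>2)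
      \<longlonglongrightarrow> (LINT t|(lebesgue :: real measure). 0)"
  proof (rule integral_dominated_convergence)
    show "integrable lebesgue (\<lambda>t. (cmod (f t))\<^sup>2)" using f by (rule L2D)
    show "AE t in lebesgue. (\<lambda>n. (cmod (f t - (if \<bar>t\<bar> \<le> real n \<and> cmod (f t) \<le> real n then f t else 0)))\<^sup>2) \<longlonglongrightarrow> 0"
    proof (rule AE_I2, rule tendsto_eventually)
      fix t :: real
      obtain n0 :: nat where n0: "max \<bar>t\<bar> (cmod (f t)) \<le> real n0" using real_arch_simple by blast
      show "\<forall>\<^sub>F n in sequentially. (cmod (f t - (if \<bar>t\<bar> \<le> real n \<and> cmod (f t) \<le> real n then f t else 0)))\<^sup>2 = 0"
        using eventually_ge_at_top[of n0] by eventually_elim (use n0 in auto)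
    qed
  qed (auto intro!: AE_I2)
  then have "\<forall>\<^sub>F n in sequentially. sq_norm (\<lambda>t. f t - (if \<bar>t\<bar> \<le> real n \<and> cmod (f t) \<le> real n then f t else 0)) < e"
    unfolding sq_norm_def using e by (intro order_tendstoD) auto
  then show ?thesis by (auto simp: eventually_sequentially)
qed

text \<open>Measurability provides continuous functions converging to \<open>b\<close> off a null
  set. Clamping their values by \<open>cl\<close> and cutting off by \<open>\<psi>\<close> does not
  change the limit and supplies an integrable majorant.\<close>

lemma bounded_approx_Cc:
  assumes b: "b \<in> borel_measurable lebesgue" and bn: "\<And>t. cmod (b t) \<le> real n" and b0: "\<And>t. \<bar>t\<bar> > real n \<Longrightarrow> b t = 0"
    and e: "e > 0"
  shows "\<exists>h\<in>Cc. sq_norm (\<lambda>t. b t - h t) < e"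
proof -
  have "b measurable_on UNIV"
    using b lebesgue_measurable_imp_measurable_on[of b UNIV] by simp
  then obtain N g where N: "negligible N" and g: "\<And>k. continuous_on UNIV (g k)"
    and lim: "\<And>t. t \<notin> N \<Longrightarrow> (\<lambda>k::nat. g k t) \<longlonglongrightarrow> b t"
    unfolding measurable_on_def by auto
  define \<psi> where "\<psi> t = max 0 (min 1 (real n + 1 - \<bar>t\<bar>))" for t :: real
  define cl where "cl z = z /\<^sub>R max 1 (cmod z / (real n + 1))" for z :: complex
  have \<psi>: "0 \<le> \<psi> t" "\<psi> t \<le> 1" "\<bar>t\<bar> \<le> real n \<Longrightarrow> \<psi> t = 1" "\<bar>t\<bar> \<ge> real n + 1 \<Longrightarrow> \<psi> t = 0" for t
    by (auto simp: \<psi>_def)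
  have cl: "cmod (cl z) \<le> real n + 1" for z
  proof -
    define M where "M = max 1 (cmod z / (real n + 1))"
    have M: "M > 0" "cmod z / (real n + 1) \<le> M" by (auto simp: M_def less_max_iff_disj)
    then have "cmod z \<le> M * (real n + 1)" by (subst (asm) pos_divide_le_eq) simp_all
    then have "inverse M * cmod z \<le> inverse M * (M * (real n + 1))" using M(1) by (intro mult_left_mono) auto
    then show ?thesis using M(1) by (simp add: cl_def M_def[symmetric] mult.assoc[symmetric])
  qed
  have cl_id: "cl z = z" if "cmod z \<le> real n" for z
    using that by (simp add: cl_def max_def field_simps)
  have contcl: "continuous_on UNIV cl" unfolding cl_def
    by (intro continuous_intros) (auto simp: max_def)
  define h where "h k t = \<psi> t *\<^sub>R cl (g k t)" for k t
  have conth: "continuous_on UNIV (h k)" for k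
    unfolding h_def \<psi>_def
    by (intro continuous_intros continuous_on_compose2[OF contcl g]) auto
  have hCc: "h k \<in> Cc" for k
    using conth \<psi>(4) by (auto simp: Cc_def h_def intro!: exI[of _ "n + 1"])
  have [measurable]: "h k \<in> borel_measurable lebesgue" for k using Cc_L2[OF hCc] by (rule L2D)
  note b[measurable]
  have "(\<lambda>k. LINT t|lebesgue. (cmod (b t - h k t))\<^sup>2) \<longlonglongrightarrow> (LINT t|(lebesgue :: real measure). 0)"
  proof (rule integral_dominated_convergence)
    let ?w = "\<lambda>t. (2 * real n + 1)\<^sup>2 * indicator {- (real n + 1)..real n + 1} t :: real"
    show "integrable lebesgue ?w"
      by (intro integrable_mult_right integrable_completion[THEN iffD2] integrable_real_indicator) auto
    show "AE t in lebesgue. norm ((cmod (b t - h k t))\<^sup>2) \<le> ?w t" for k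
    proof (rule AE_I2)
      fix t
      show "norm ((cmod (b t - h k t))\<^sup>2) \<le> ?w t"
      proof (cases "\<bar>t\<bar> \<le> real n + 1")
        case True
        have "cmod (h k t) \<le> 1 * (real n + 1)" unfolding h_def norm_scaleR using \<psi> cl by (intro mult_mono) auto
        then have "cmod (b t - h k t) \<le> 2 * real n + 1" using norm_triangle_ineq4[of "b t" "h k t"] bn[of t] by simp
        then have "(cmod (b t - h k t))\<^sup>2 \<le> (2 * real n + 1)\<^sup>2" by (rule power_mono) simp
        moreover have "t \<in> {- (real n + 1)..real n + 1}" using True by auto
        ultimately show ?thesis by simp
      next
        case False
        then show ?thesis using b0[of t] \<psi>(4)[of t] by (simp add: h_def)
      qed
    qed
    have "AE t in lebesgue. t \<notin> N"
      using N by (intro AE_not_in) (simp add: negligible_iff_null_sets)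
    then show "AE t in lebesgue. (\<lambda>k. (cmod (b t - h k t))\<^sup>2) \<longlonglongrightarrow> 0"
    proof eventually_elim
      case (elim t)
      have "isCont cl (b t)" using contcl by (simp add: continuous_on_eq_continuous_at)
      then have "(\<lambda>k. cl (g k t)) \<longlonglongrightarrow> cl (b t)" using lim[OF elim] by (rule isCont_tendsto_compose)
      then have "(\<lambda>k. (cmod (b t - h k t))\<^sup>2) \<longlonglongrightarrow> (cmod (b t - \<psi> t *\<^sub>R cl (b t)))\<^sup>2"
        unfolding h_def by (intro tendsto_intros)
      moreover have "\<psi> t *\<^sub>R cl (b t) = b t" using cl_id[OF bn] cl_id[of 0] b0[of t] \<psi>(3)[of t] by (cases "\<bar>t\<bar> \<le> real n") auto
      ultimately show ?case by simp
    qed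
  qed auto
  then have "\<forall>\<^sub>F k in sequentially. sq_norm (\<lambda>t. b t - h k t) < e"
    unfolding sq_norm_def using e by (intro order_tendstoD) auto
  then show ?thesis using hCc by (auto simp: eventually_sequentially)
qed

lemma Cc_dense:
  assumes f: "f \<in> L2" and e: "e > 0"
  shows "\<exists>h\<in>Cc. sq_norm (\<lambda>t. f t - h t) < e"
proof -
  obtain n :: nat where n: "sq_norm (\<lambda>t. f t - (if \<bar>t\<bar> \<le> real n \<and> cmod (f t) \<le> real n then f t else 0)) < e / 4"
    using L2_truncation[OF f, of "e / 4"] e by auto
  define b where "b t = (if \<bar>t\<bar> \<le> real n \<and> cmod (f t) \<le> real n then f t else 0)" for t
  have [measurable]: "f \<in> borel_measurable lebesgue" using f by (rule L2D)
  have [measurable]: "(\<lambda>t::real. t) \<in> borel_measurable lebesgue" by (intro measurable_completion) simp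
  have bm[measurable]: "b \<in> borel_measurable lebesgue" unfolding b_def by measurable
  have "integrable lebesgue (\<lambda>t. (cmod (b t))\<^sup>2)"
    by (rule Bochner_Integration.integrable_bound[OF L2D(2)[OF f]]) (auto simp: b_def intro!: AE_I2)
  then have b: "b \<in> L2" using bm by (simp add: L2_def)
  obtain h where h: "h \<in> Cc" "sq_norm (\<lambda>t. b t - h t) < e / 4"
  proof -
    have "cmod (b t) \<le> real n" "\<bar>t\<bar> > real n \<Longrightarrow> b t = 0" for t by (auto simp: b_def)
    then show thesis using bounded_approx_Cc[OF bm, of n "e / 4"] e that by auto
  qed
  have "sq_norm (\<lambda>t. f t - h t) \<le> 2 * sq_norm (\<lambda>t. f t - b t) + 2 * sq_norm (\<lambda>t. (f t - h t) - (f t - b t))"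
    by (intro sq_norm_le_diff L2_diff f b Cc_L2 h)
  also have "\<dots> = 2 * sq_norm (\<lambda>t. f t - b t) + 2 * sq_norm (\<lambda>t. b t - h t)" by simp
  also have "\<dots> < e" using n h(2) by (simp add: b_def)
  finally show ?thesis using h(1) by blast
qed

lemma le_of_le_add_epsilon_mult:
  fixes x y K :: real
  assumes "\<And>e. e > 0 \<Longrightarrow> x \<le> y + K * e" "K \<ge> 0"
  shows "x \<le> y"
proof (rule field_le_epsilon)
  fix e :: real assume "e > 0"
  then have "x \<le> y + K * (e / (K + 1))" using assms by (intro assms(1)) auto
  also have "K * (e / (K + 1)) \<le> e" using \<open>e > 0\<close> assms(2) by (simp add: field_simps)
  finally show "x \<le> y + e" by simp
qed

text \<open>Splitting \<open>f\<close> into an approximant and a remainder costs factors of 2,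
  whence \<open>4 * B\<close> and \<open>A / 4\<close>. The upper bound must be extended first,
  because the lower one uses it for the remainder.\<close>

lemma is_frame_if_dense:
  assumes \<phi>: "\<And>i. i \<in> I \<Longrightarrow> \<phi> i \<in> L2" and A: "A > 0" and B: "B > 0"
    and upper: "\<And>h J. h \<in> Cc \<Longrightarrow> finite J \<Longrightarrow> J \<subseteq> I \<Longrightarrow> (\<Sum>i\<in>J. (cmod (l2_inner h (\<phi> i)))\<^sup>2) \<le> B * sq_norm h"
    and lower: "\<And>h e. h \<in> Cc \<Longrightarrow> e > 0 \<Longrightarrow> \<exists>J. finite J \<and> J \<subseteq> I \<and> A * sq_norm h \<le> (\<Sum>i\<in>J. (cmod (l2_inner h (\<phi> i)))\<^sup>2) + e"
  shows "is_frame I \<phi>"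
proof -
  let ?S = "\<lambda>f J. (\<Sum>i\<in>J. (cmod (l2_inner f (\<phi> i)))\<^sup>2)"
  have split: "?S f J \<le> 2 * ?S h J + 2 * ?S (\<lambda>t. f t - h t) J" if "f \<in> L2" "h \<in> L2" "J \<subseteq> I" for f h J
  proof -
    have "?S f J \<le> (\<Sum>i\<in>J. 2 * (cmod (l2_inner h (\<phi> i)))\<^sup>2 + 2 * (cmod (l2_inner (\<lambda>t. f t - h t) (\<phi> i)))\<^sup>2)"
    proof (rule sum_mono)
      fix i assume "i \<in> J"
      then have "l2_inner f (\<phi> i) = l2_inner h (\<phi> i) + l2_inner (\<lambda>t. f t - h t) (\<phi> i)"
        using that \<phi> by (subst l2_inner_diff) auto
      then show "(cmod (l2_inner f (\<phi> i)))\<^sup>2 \<le> 2 * (cmod (l2_inner h (\<phi> i)))\<^sup>2 + 2 * (cmod (l2_inner (\<lambda>t. f t - h t) (\<phi> i)))\<^sup>2"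
        using norm_add_square_le by simp
    qed
    then show ?thesis by (simp add: sum.distrib sum_distrib_left)
  qed
  \<comment> \<open>For a fixed finite \<open>J\<close> the remainder contributes at most
    \<open>e * ?K\<close>. The constant depends on \<open>J\<close>, but it disappears with
    \<open>e\<close>, and the bound that remains does not depend on \<open>J\<close>.\<close>
  have up: "?S f J \<le> 4 * B * sq_norm f" if f: "f \<in> L2" and J: "finite J" "J \<subseteq> I" for f J
  proof (rule le_of_le_add_epsilon_mult)
    let ?K = "\<Sum>i\<in>J. (1 + sq_norm (\<phi> i))\<^sup>2"
    show "0 \<le> 4 * B + 2 * ?K" using B by (intro add_nonneg_nonneg mult_nonneg_nonneg sum_nonneg) auto
    fix e :: real assume e: "e > 0"
    obtain h where h: "h \<in> Cc" "sq_norm (\<lambda>t. f t - h t) < e" using Cc_dense[OF f e] by blast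
    have d: "(\<lambda>t. f t - h t) \<in> L2" by (intro L2_diff f Cc_L2 h)
    have "?S (\<lambda>t. f t - h t) J \<le> (\<Sum>i\<in>J. e * (1 + sq_norm (\<phi> i))\<^sup>2)"
      using J h e by (intro sum_mono l2_inner_small d \<phi>) auto
    then have 1: "?S (\<lambda>t. f t - h t) J \<le> e * ?K" by (simp add: sum_distrib_left)
    have "sq_norm h \<le> 2 * sq_norm f + 2 * sq_norm (\<lambda>t. h t - f t)" by (intro sq_norm_le_diff f Cc_L2 h)
    then have "sq_norm h \<le> 2 * sq_norm f + 2 * e" using h(2) sq_norm_minus_commute[of h f] by simp
    then have "B * sq_norm h \<le> B * (2 * sq_norm f + 2 * e)" using B by (intro mult_left_mono) auto
    then have 2: "?S h J \<le> B * (2 * sq_norm f + 2 * e)" using upper[OF h(1) J] by simp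
    show "?S f J \<le> 4 * B * sq_norm f + (4 * B + 2 * ?K) * e"
      using split[OF f Cc_L2[OF h(1)] J(2)] 1 2 by (simp add: algebra_simps)
  qed
  have sm: "(\<lambda>i. (cmod (l2_inner f (\<phi> i)))\<^sup>2) summable_on I" if "f \<in> L2" for f
    by (rule nonneg_bdd_above_summable_on) (use up[OF that] in \<open>auto intro!: bdd_aboveI2\<close>)
  have lo: "A / 4 * sq_norm f \<le> (\<Sum>\<^sub>\<infinity>i\<in>I. (cmod (l2_inner f (\<phi> i)))\<^sup>2)" if f: "f \<in> L2" for f
  proof -
    let ?T = "\<Sum>\<^sub>\<infinity>i\<in>I. (cmod (l2_inner f (\<phi> i)))\<^sup>2"
    have "A * sq_norm f \<le> 4 * ?T"
    proof (rule le_of_le_add_epsilon_mult)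
      show "0 \<le> 16 * B + 2 + 2 * A" using A B by simp
      fix e :: real assume e: "e > 0"
      obtain h where h: "h \<in> Cc" "sq_norm (\<lambda>t. f t - h t) < e" using Cc_dense[OF f e] by blast
      obtain J where J: "finite J" "J \<subseteq> I" "A * sq_norm h \<le> ?S h J + e" using lower[OF h(1) e] by blast
      have d: "(\<lambda>t. h t - f t) \<in> L2" by (intro L2_diff f Cc_L2 h)
      have "4 * B * sq_norm (\<lambda>t. h t - f t) \<le> 4 * B * e"
        using h(2) sq_norm_minus_commute[of h f] B by (intro mult_left_mono) auto
      then have 1: "?S (\<lambda>t. h t - f t) J \<le> 4 * B * e" using up[OF d J(1,2)] by simp
      have 2: "?S f J \<le> ?T" by (intro finite_sum_le_infsum sm f J) auto
      have "sq_norm f \<le> 2 * sq_norm h + 2 * e" using sq_norm_le_diff[OF f Cc_L2[OF h(1)]] h(2) by simp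
      then have "A * sq_norm f \<le> A * (2 * sq_norm h + 2 * e)" using A by (intro mult_left_mono) auto
      then show "A * sq_norm f \<le> 4 * ?T + (16 * B + 2 + 2 * A) * e"
        using J(3) split[OF Cc_L2[OF h(1)] f J(2)] 1 2 by (simp add: algebra_simps)
    qed
    then show ?thesis by simp
  qed
  have "(\<Sum>\<^sub>\<infinity>i\<in>I. (cmod (l2_inner f (\<phi> i)))\<^sup>2) \<le> 4 * B * sq_norm f" if "f \<in> L2" for f
    by (rule infsum_le_finite_sums[OF sm[OF that]]) (use up[OF that] in auto)
  then show ?thesis unfolding is_frame_def l2_norm_square
    using \<phi> sm lo A B by (intro conjI ballI exI[of _ "A / 4"] exI[of _ "4 * B"]) auto
qed

section \<open>Fibers\<close>

lemma sq_norm_periodize: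
  assumes "continuous_on UNIV h" "\<And>t. \<bar>t - y\<bar> \<ge> real m \<Longrightarrow> h t = 0"
  shows "sq_norm h = integral {y..y + 1} (\<lambda>x. \<Sum>n\<in>{- int m..int m}. (cmod (h (x + of_int n)))\<^sup>2)"
  unfolding sq_norm_def
  by (rule lebesgue_integral_periodize(2)) (use assms in \<open>auto intro!: continuous_intros\<close>)

text \<open>The periodisation of \<open>h t * cnj (\<phi> (t + l))\<close> with period 1, as a
  finite sum over the support of \<open>h\<close>.\<close>

definition fiber :: "nat \<Rightarrow> (real \<Rightarrow> complex) \<Rightarrow> (real \<Rightarrow> complex) \<Rightarrow> real \<Rightarrow> real \<Rightarrow> complex" where
  "fiber m h \<phi> l x = (\<Sum>n\<in>{- int m..int m}. h (x + of_int n) * cnj (\<phi> (x + of_int n + l)))"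

lemma continuous_on_fiber:
  assumes "continuous_on UNIV h" "continuous_on UNIV \<phi>"
  shows "continuous_on S (fiber m h \<phi> l)"
  unfolding fiber_def
  by (intro continuous_intros continuous_on_compose2[OF assms(1)] continuous_on_compose2[OF assms(2)]) auto

text \<open>One outermost term vanishes at each end, and the remaining sums differ by an index
  shift.\<close>

lemma fiber_periodic:
  assumes "\<And>t. \<bar>t\<bar> \<ge> real m \<Longrightarrow> h t = 0"
  shows "fiber m h \<phi> l 0 = fiber m h \<phi> l 1"
proof -
  have "fiber m h \<phi> l 0 = (\<Sum>n\<in>{- int m + 1..int m}. h (of_int n) * cnj (\<phi> (of_int n + l)))"
    unfolding fiber_def by (intro sum.mono_neutral_cong_right) (auto simp: assms)
  also have "\<dots> = (\<Sum>n\<in>{- int m..int m - 1}. h (1 + of_int n) * cnj (\<phi> (1 + of_int n + l)))"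
    by (rule sum.reindex_bij_witness[where i = "\<lambda>n. n + 1" and j = "\<lambda>n. n - 1"]) auto
  also have "\<dots> = fiber m h \<phi> l 1"
    unfolding fiber_def by (intro sum.mono_neutral_cong_left) (auto simp: assms)
  finally show ?thesis .
qed

text \<open>A modulation by an integer has period 1 and factors out of the periodisation. So for
  fixed \<open>l\<close> the inner products are the Fourier coefficients of one function of
  \<open>x\<close>.\<close>

lemma l2_inner_tfshift:
  assumes h: "continuous_on UNIV h" "\<And>t. \<bar>t - y\<bar> \<ge> real m \<Longrightarrow> h t = 0" and \<phi>: "continuous_on UNIV \<phi>"
  shows "l2_inner h (tfshift (- l) (of_int k) \<phi>) = fcoeff y (fiber m h \<phi> l) k"
proof -
  let ?e = "\<lambda>t. exp (- 2 * pi * \<i> * of_int k * complex_of_real t)"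
  have per: "?e (x + of_int n) = ?e x" for x n
  proof -
    have "- 2 * pi * \<i> * of_int k * complex_of_real (x + of_int n) = - 2 * pi * \<i> * of_int k * complex_of_real x + 2 * of_int (- k * n) * pi * \<i>"
      by (simp add: algebra_simps)
    moreover have "exp (2 * of_int (- k * n) * pi * \<i>) = 1" by (rule exp_integer_2pi) simp
    ultimately show ?thesis by (simp only: exp_add mult_1_right)
  qed
  have "l2_inner h (tfshift (- l) (of_int k) \<phi>) = (LINT t|lebesgue. h t * cnj (\<phi> (t + l)) * ?e t)"
    unfolding l2_inner_def tfshift_def by (intro Bochner_Integration.integral_cong refl) (simp add: exp_cnj mult_ac)
  also have "\<dots> = integral {y..y + 1} (\<lambda>x. \<Sum>n\<in>{- int m..int m}. h (x + of_int n) * cnj (\<phi> (x + of_int n + l)) * ?e (x + of_int n))"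
    by (rule lebesgue_integral_periodize(2))
      (use h in \<open>auto intro!: continuous_intros continuous_on_compose2[OF \<phi>]\<close>)
  also have "\<dots> = fcoeff y (fiber m h \<phi> l) k"
    unfolding fcoeff_def fiber_def per sum_distrib_right ..
  finally show ?thesis .
qed

section \<open>Density from sampling inequalities\<close>

text \<open>Gaussian elimination: one equation is solved for an unknown \<open>k0\<close> with
  nonzero coefficient and substituted into the others.\<close>

lemma homogeneous_system_nontrivial:
  fixes A :: "'e \<Rightarrow> 'k \<Rightarrow> real"
  assumes "finite E" "finite J" "card E < card J"
  shows "\<exists>c. (\<exists>k\<in>J. c k \<noteq> 0) \<and> (\<forall>e\<in>E. (\<Sum>k\<in>J. A e k * c k) = 0)"
  using assms
proof (induction E arbitrary: J A rule: finite_induct)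
  case empty
  then obtain k where "k \<in> J" by fastforce
  then show ?case by (intro exI[of _ "\<lambda>_. 1"]) auto
next
  case (insert e E)
  show ?case
  proof (cases "\<forall>k\<in>J. A e k = 0")
    case True
    moreover obtain c where "\<exists>k\<in>J. c k \<noteq> 0" "\<forall>e\<in>E. (\<Sum>k\<in>J. A e k * c k) = 0"
      using insert.IH[of J A] insert.prems insert.hyps by auto
    ultimately show ?thesis by auto
  next
    case False
    then obtain k0 where k0: "k0 \<in> J" "A e k0 \<noteq> 0" by blast
    let ?J = "J - {k0}" and ?A = "\<lambda>e' k. A e' k - A e' k0 * A e k / A e k0"
    have "card E < card ?J" using insert k0 by simp
    then obtain c where c: "\<exists>k\<in>?J. c k \<noteq> 0" "\<And>e'. e' \<in> E \<Longrightarrow> (\<Sum>k\<in>?J. ?A e' k * c k) = 0"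
      using insert.IH[of ?J ?A] insert.prems(1) by blast
    define c' where "c' = c(k0 := - (\<Sum>k\<in>?J. A e k * c k) / A e k0)"
    have split: "(\<Sum>k\<in>J. A e' k * c' k) = A e' k0 * c' k0 + (\<Sum>k\<in>?J. A e' k * c k)" for e'
      using sum.remove[OF insert.prems(1) k0(1), of "\<lambda>k. A e' k * c' k"] by (simp add: c'_def)
    have "(\<Sum>k\<in>J. A e k * c' k) = 0" unfolding split using k0 by (simp add: c'_def)
    moreover have "(\<Sum>k\<in>J. A e' k * c' k) = 0" if "e' \<in> E" for e'
    proof -
      have "(\<Sum>k\<in>?J. ?A e' k * c k) = (\<Sum>k\<in>?J. A e' k * c k) - A e' k0 / A e k0 * (\<Sum>k\<in>?J. A e k * c k)"
        unfolding sum_distrib_left sum_subtractf[symmetric] by (intro sum.cong refl) (simp add: left_diff_distrib)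
      then show ?thesis unfolding split using c(2)[OF that] by (simp add: c'_def)
    qed
    moreover have "\<exists>k\<in>J. c' k \<noteq> 0" using c(1) by (auto simp: c'_def)
    ultimately show ?thesis by (intro exI[of _ c']) auto
  qed
qed

text \<open>The error is relative to \<open>exp (- a)\<close>, so the decay of the weight is not
  lost in the comparison.\<close>

lemma weight_diff_le:
  fixes a b v :: real
  assumes "\<bar>a - b\<bar> \<le> v"
  shows "\<bar>exp (- a) - exp (- b)\<bar> \<le> exp (- a) * (v * exp v)"
proof -
  have v: "v \<ge> 0" using assms by linarith
  have "1 - v \<le> exp (- v)" using exp_ge_add_one_self[of "- v"] by simp
  then have "exp v * (1 - v) \<le> exp v * exp (- v)" by (intro mult_left_mono) auto
  then have ev: "exp v - 1 \<le> v * exp v" by (simp add: exp_add[symmetric] algebra_simps)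
  have "\<bar>1 - exp (a - b)\<bar> \<le> exp v - 1"
  proof (cases "b \<le> a")
    case True
    then have "exp (a - b) \<le> exp v" "1 \<le> exp (a - b)" using assms by auto
    then show ?thesis by simp
  next
    case False
    have "exp (- v) \<le> exp (a - b)" "exp (a - b) \<le> 1" using assms False by auto
    moreover have "1 - exp (- v) \<le> exp v - 1" using v exp_ge_add_one_self[of v] \<open>1 - v \<le> exp (- v)\<close> by linarith
    ultimately show ?thesis by linarith
  qed
  then have "exp (- a) * \<bar>1 - exp (a - b)\<bar> \<le> exp (- a) * (v * exp v)" using ev by (intro mult_left_mono) auto
  moreover have "exp (- a) - exp (- b) = exp (- a) * (1 - exp (a - b))"
    by (simp add: right_diff_distrib exp_add[symmetric])
  ultimately show ?thesis by (simp add: abs_mult)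
qed

lemma linear_le_exp: "u \<le> (1 / q) * exp (q * u)" if "q > 0" for u q :: real
proof -
  have "q * u \<le> exp (q * u)" using exp_ge_add_one_self[of "q * u"] by linarith
  then show ?thesis using that by (simp add: field_simps)
qed

text \<open>What matters is the factor \<open>\<epsilon>\<close>. The difference splits into a
  displacement in the argument of \<open>F\<close> and a change of the weight. The weight has
  logarithmic slope \<open>\<epsilon>\<close>. The displacement is \<open>\<epsilon>\<^sup>2\<close>
  times a distance, and linear growth in the distances costs only a factor of order
  \<open>1 / \<epsilon>\<close> when part of the exponential decay is given up; hence the reduced
  rates \<open>\<epsilon> / 4\<close> and \<open>\<kappa> / 4\<close>.\<close>

lemma localized_term_bound:
  fixes F F' :: "real \<Rightarrow> real" and \<epsilon> \<kappa> D m y y' k :: real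
  assumes der: "\<And>x. (F has_real_derivative F' x) (at x)"
    and b: "\<And>x. \<bar>F x\<bar> \<le> D * exp (- \<kappa> * \<bar>x\<bar>)" "\<And>x. \<bar>F' x\<bar> \<le> D * exp (- \<kappa> * \<bar>x\<bar>)"
    and \<kappa>: "\<kappa> > 0" and \<epsilon>: "0 < \<epsilon>" "\<epsilon> \<le> 1 / 2" "\<epsilon> \<le> \<kappa> / 4" "\<kappa> * \<epsilon> \<le> 1 / 2"
    and y: "\<bar>y - y'\<bar> \<le> \<epsilon>\<^sup>2 * (\<bar>y' - m\<bar> + 1)"
  shows "\<bar>exp (- \<epsilon> * \<bar>k - m\<bar>) * F (y - k) - exp (- \<epsilon> * \<bar>y' - m\<bar>) * F (y' - k)\<bar>
    \<le> (4 * D / \<kappa> + 6 * D * exp \<kappa>) * \<epsilon> * (exp (- (\<epsilon> / 4) * \<bar>k - m\<bar>) * exp (- (\<kappa> / 4) * \<bar>y' - k\<bar>))"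
proof -
  define u v where "u = \<bar>y' - k\<bar>" and "v = \<bar>k - m\<bar>"
  have u: "u \<ge> 0" and v: "v \<ge> 0" by (auto simp: u_def v_def)
  have D: "D \<ge> 0" using b(1) by (rule bound_const_nonneg)
  have ym: "\<bar>y' - m\<bar> \<le> u + v" by (simp add: u_def v_def)
  have e2: "\<epsilon>\<^sup>2 \<le> 1 / 4" using \<epsilon> power_mono[of \<epsilon> "1 / 2" 2] by (simp add: power2_eq_square)
  have \<eta>: "\<bar>y - y'\<bar> \<le> \<epsilon>\<^sup>2 * (u + v + 1)"
    using y ym mult_left_mono[of "\<bar>y' - m\<bar> + 1" "u + v + 1" "\<epsilon>\<^sup>2"] by simp
  have first: "\<bar>F (y - k) - F (y' - k)\<bar> \<le> \<bar>y - y'\<bar> * (D * exp (- \<kappa> * (u - \<bar>y - y'\<bar>)))"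
  proof -
    have "norm (F (y - k) - F (y' - k)) \<le> (D * exp (- \<kappa> * (u - \<bar>y - y'\<bar>))) * norm ((y - k) - (y' - k))"
    proof (rule field_differentiable_bound[where f' = F' and S = "closed_segment (y' - k) (y - k)"])
      fix z assume z: "z \<in> closed_segment (y' - k) (y - k)"
      show "(F has_field_derivative F' z) (at z within closed_segment (y' - k) (y - k))"
        using der by (rule has_field_derivative_at_within)
      have "\<bar>z - (y' - k)\<bar> \<le> \<bar>y - y'\<bar>" using z by (auto simp: closed_segment_eq_real_ivl split: if_splits)
      then have "u - \<bar>y - y'\<bar> \<le> \<bar>z\<bar>" by (simp add: u_def)
      then have "\<kappa> * (u - \<bar>y - y'\<bar>) \<le> \<kappa> * \<bar>z\<bar>" using \<kappa> by (intro mult_left_mono) auto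
      then have "D * exp (- \<kappa> * \<bar>z\<bar>) \<le> D * exp (- \<kappa> * (u - \<bar>y - y'\<bar>))" using D by (intro mult_left_mono) auto
      then show "norm (F' z) \<le> D * exp (- \<kappa> * (u - \<bar>y - y'\<bar>))" using b(2)[of z] by simp
    qed auto
    then show ?thesis by (simp add: mult_ac)
  qed
  have expo: "- \<kappa> * (u - \<bar>y - y'\<bar>) \<le> \<kappa> + - (3 * \<kappa> / 4) * u + (\<epsilon> / 2) * v"
  proof -
    have "\<kappa> * \<bar>y - y'\<bar> \<le> \<kappa> * (\<epsilon>\<^sup>2 * (u + v + 1))" using \<eta> \<kappa> by (intro mult_left_mono) auto
    also have "\<dots> = \<kappa> * \<epsilon>\<^sup>2 * u + (\<kappa> * \<epsilon>) * \<epsilon> * v + \<kappa> * \<epsilon>\<^sup>2" by (simp add: power2_eq_square algebra_simps)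
    also have "\<dots> \<le> \<kappa> * (1 / 4) * u + (1 / 2) * \<epsilon> * v + \<kappa> * 1"
      using e2 \<kappa> \<epsilon> u v by (intro add_mono mult_right_mono mult_left_mono) auto
    finally show ?thesis by (simp add: algebra_simps)
  qed
  have uv: "u + v + 1 \<le> (4 / \<kappa> + 4 / \<epsilon> + 1) * (exp ((\<kappa> / 4) * u) * exp ((\<epsilon> / 4) * v))"
  proof -
    have 1: "1 \<le> exp ((\<kappa> / 4) * u)" "1 \<le> exp ((\<epsilon> / 4) * v)" using \<kappa> \<epsilon> u v by auto
    have "u \<le> (4 / \<kappa>) * (exp ((\<kappa> / 4) * u) * 1)" using linear_le_exp[of "\<kappa> / 4" u] \<kappa> by simp
    also have "\<dots> \<le> (4 / \<kappa>) * (exp ((\<kappa> / 4) * u) * exp ((\<epsilon> / 4) * v))" using 1 \<kappa> by (intro mult_left_mono) auto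
    finally have a: "u \<le> (4 / \<kappa>) * (exp ((\<kappa> / 4) * u) * exp ((\<epsilon> / 4) * v))" .
    have "v \<le> (4 / \<epsilon>) * (1 * exp ((\<epsilon> / 4) * v))" using linear_le_exp[of "\<epsilon> / 4" v] \<epsilon> by simp
    also have "\<dots> \<le> (4 / \<epsilon>) * (exp ((\<kappa> / 4) * u) * exp ((\<epsilon> / 4) * v))" using 1 \<epsilon> by (intro mult_left_mono mult_right_mono) auto
    finally have b: "v \<le> (4 / \<epsilon>) * (exp ((\<kappa> / 4) * u) * exp ((\<epsilon> / 4) * v))" .
    have "1 * 1 \<le> exp ((\<kappa> / 4) * u) * exp ((\<epsilon> / 4) * v)" using 1 by (intro mult_mono) auto
    with a b show ?thesis by (simp add: distrib_right)
  qed
  have \<epsilon>c: "\<epsilon>\<^sup>2 * (4 / \<kappa> + 4 / \<epsilon> + 1) \<le> 6 * \<epsilon>"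
  proof -
    have "\<epsilon> * (4 / \<kappa>) \<le> 1" using \<epsilon> \<kappa> by (simp add: field_simps)
    then have "\<epsilon> * (4 / \<kappa>) + 4 + \<epsilon> \<le> 6" using \<epsilon> by linarith
    then have "\<epsilon> * (\<epsilon> * (4 / \<kappa>) + 4 + \<epsilon>) \<le> \<epsilon> * 6" using \<epsilon> by (intro mult_left_mono) auto
    then show ?thesis using \<epsilon> by (simp add: power2_eq_square algebra_simps)
  qed
  let ?W = "exp (- (\<epsilon> / 4) * v) * exp (- (\<kappa> / 4) * u)"
  have A: "\<bar>exp (- \<epsilon> * v) * (F (y - k) - F (y' - k))\<bar> \<le> 6 * D * exp \<kappa> * \<epsilon> * ?W"
  proof -
    have "\<bar>F (y - k) - F (y' - k)\<bar> \<le> (\<epsilon>\<^sup>2 * (u + v + 1)) * (D * exp (\<kappa> + - (3 * \<kappa> / 4) * u + (\<epsilon> / 2) * v))"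
    proof (rule order_trans[OF first])
      show "\<bar>y - y'\<bar> * (D * exp (- \<kappa> * (u - \<bar>y - y'\<bar>))) \<le> (\<epsilon>\<^sup>2 * (u + v + 1)) * (D * exp (\<kappa> + - (3 * \<kappa> / 4) * u + (\<epsilon> / 2) * v))"
        using \<eta> expo D u v by (intro mult_mono) auto
    qed
    also have "\<dots> \<le> (\<epsilon>\<^sup>2 * ((4 / \<kappa> + 4 / \<epsilon> + 1) * (exp ((\<kappa> / 4) * u) * exp ((\<epsilon> / 4) * v)))) * (D * exp (\<kappa> + - (3 * \<kappa> / 4) * u + (\<epsilon> / 2) * v))"
      using uv D by (intro mult_right_mono mult_left_mono) auto
    also have "\<dots> = (\<epsilon>\<^sup>2 * (4 / \<kappa> + 4 / \<epsilon> + 1)) * (D * exp ((\<kappa> / 4) * u + (\<epsilon> / 4) * v + (\<kappa> + - (3 * \<kappa> / 4) * u + (\<epsilon> / 2) * v)))"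
      by (simp only: exp_add mult_ac)
    also have "\<dots> \<le> (6 * \<epsilon>) * (D * exp ((\<kappa> / 4) * u + (\<epsilon> / 4) * v + (\<kappa> + - (3 * \<kappa> / 4) * u + (\<epsilon> / 2) * v)))"
      using \<epsilon>c D by (intro mult_right_mono) auto
    finally have "exp (- \<epsilon> * v) * \<bar>F (y - k) - F (y' - k)\<bar>
      \<le> exp (- \<epsilon> * v) * ((6 * \<epsilon>) * (D * exp ((\<kappa> / 4) * u + (\<epsilon> / 4) * v + (\<kappa> + - (3 * \<kappa> / 4) * u + (\<epsilon> / 2) * v))))"
      by (rule mult_left_mono) simp
    also have "\<dots> = 6 * D * \<epsilon> * exp (- \<epsilon> * v + ((\<kappa> / 4) * u + (\<epsilon> / 4) * v + (\<kappa> + - (3 * \<kappa> / 4) * u + (\<epsilon> / 2) * v)))"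
      by (simp only: exp_add mult_ac)
    also have "\<dots> \<le> 6 * D * \<epsilon> * exp (\<kappa> + (- (\<epsilon> / 4) * v + - (\<kappa> / 4) * u))"
      using D \<epsilon> \<kappa> u by (intro mult_left_mono) (auto simp: field_simps)
    finally show ?thesis by (simp only: exp_add mult_ac abs_mult abs_exp_cancel)
  qed
  have B: "\<bar>(exp (- \<epsilon> * v) - exp (- \<epsilon> * \<bar>y' - m\<bar>)) * F (y' - k)\<bar> \<le> 4 * D / \<kappa> * \<epsilon> * ?W"
  proof -
    have "\<bar>\<epsilon> * v - \<epsilon> * \<bar>y' - m\<bar>\<bar> \<le> \<epsilon> * u"
    proof -
      have "\<bar>\<epsilon> * v - \<epsilon> * \<bar>y' - m\<bar>\<bar> = \<epsilon> * \<bar>v - \<bar>y' - m\<bar>\<bar>" using \<epsilon> by (simp add: abs_mult right_diff_distrib[symmetric])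
      also have "\<dots> \<le> \<epsilon> * u" using \<epsilon> by (intro mult_left_mono) (auto simp: u_def v_def)
      finally show ?thesis .
    qed
    then have "\<bar>exp (- (\<epsilon> * v)) - exp (- (\<epsilon> * \<bar>y' - m\<bar>))\<bar> \<le> exp (- (\<epsilon> * v)) * (\<epsilon> * u * exp (\<epsilon> * u))" by (rule weight_diff_le)
    then have "\<bar>(exp (- \<epsilon> * v) - exp (- \<epsilon> * \<bar>y' - m\<bar>)) * F (y' - k)\<bar> \<le> (exp (- (\<epsilon> * v)) * (\<epsilon> * u * exp (\<epsilon> * u))) * (D * exp (- \<kappa> * u))"
      unfolding abs_mult using b(1)[of "y' - k"] u \<epsilon> by (intro mult_mono) (auto simp: u_def)
    also have "\<dots> \<le> (exp (- (\<epsilon> * v)) * (\<epsilon> * ((4 / \<kappa>) * exp ((\<kappa> / 4) * u)) * exp (\<epsilon> * u))) * (D * exp (- \<kappa> * u))"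
      using linear_le_exp[of "\<kappa> / 4" u] \<kappa> \<epsilon> D by (intro mult_right_mono mult_left_mono) auto
    also have "\<dots> = 4 * D / \<kappa> * \<epsilon> * exp (- (\<epsilon> * v) + (\<kappa> / 4) * u + \<epsilon> * u + - \<kappa> * u)"
      by (simp only: exp_add) (simp add: mult_ac)
    also have "\<dots> \<le> 4 * D / \<kappa> * \<epsilon> * exp (- (\<epsilon> / 4) * v + - (\<kappa> / 4) * u)"
    proof -
      have "\<epsilon> * u \<le> \<kappa> / 4 * u" by (rule mult_right_mono[OF \<epsilon>(3) u])
      moreover have "0 \<le> \<epsilon> * v" "0 \<le> \<kappa> * u" using \<epsilon> \<kappa> u v by auto
      ultimately have "- (\<epsilon> * v) + (\<kappa> / 4) * u + \<epsilon> * u + - \<kappa> * u \<le> - (\<epsilon> / 4) * v + - (\<kappa> / 4) * u" by simp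
      then show ?thesis using D \<epsilon> \<kappa> by (intro mult_left_mono) auto
    qed
    finally show ?thesis by (simp only: exp_add)
  qed
  have "exp (- \<epsilon> * v) * F (y - k) - exp (- \<epsilon> * \<bar>y' - m\<bar>) * F (y' - k)
     = exp (- \<epsilon> * v) * (F (y - k) - F (y' - k)) + (exp (- \<epsilon> * v) - exp (- \<epsilon> * \<bar>y' - m\<bar>)) * F (y' - k)"
    by (simp add: algebra_simps)
  then have "\<bar>exp (- \<epsilon> * v) * F (y - k) - exp (- \<epsilon> * \<bar>y' - m\<bar>) * F (y' - k)\<bar> \<le> 6 * D * exp \<kappa> * \<epsilon> * ?W + 4 * D / \<kappa> * \<epsilon> * ?W"
    using A B by linarith
  then show ?thesis by (simp add: u_def v_def algebra_simps)
qed

lemma decay_jet_uniform_bound: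
  assumes "decay_jet \<kappa> G"
  obtains D where "D \<ge> 0" "\<And>s x. s \<le> N \<Longrightarrow> \<bar>G s x\<bar> \<le> D * exp (- \<kappa> * \<bar>x\<bar>)"
proof -
  obtain C where C: "\<And>s x. \<bar>G s x\<bar> \<le> C s * exp (- \<kappa> * \<bar>x\<bar>)" using assms unfolding decay_jet_def by metis
  have C0: "C s \<ge> 0" for s using C by (rule bound_const_nonneg)
  show ?thesis
  proof (rule that)
    show "(\<Sum>s\<le>N. C s) \<ge> 0" using C0 by (intro sum_nonneg) auto
    fix s x assume "s \<le> N"
    then have "C s \<le> (\<Sum>s\<le>N. C s)" using C0 by (intro member_le_sum) auto
    then have "C s * exp (- \<kappa> * \<bar>x\<bar>) \<le> (\<Sum>s\<le>N. C s) * exp (- \<kappa> * \<bar>x\<bar>)" by (intro mult_right_mono) auto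
    then show "\<bar>G s x\<bar> \<le> (\<Sum>s\<le>N. C s) * exp (- \<kappa> * \<bar>x\<bar>)" using C[of s x] by linarith
  qed
qed

text \<open>Deformation argument: if a dilate \<open>\<alpha> \<Lambda>\<close> had too few points in a long interval, some \<open>f\<close> with
  coefficients in that interval would vanish to order \<open>N\<close> on \<open>\<alpha> \<Lambda>\<close> there. Locally \<open>\<alpha> \<Lambda>\<close> is close to a
  translate of \<open>\<Lambda>\<close>, so testing the sampling inequalities for all translates on the localised
  coefficients \<open>c\<^sub>k e\<^sup>-\<^sup>\<epsilon>\<^sup>|\<^sup>k\<^sup>-\<^sup>m\<^sup>|\<close> and summing over \<open>m\<close> gives a contradiction.\<close>
lemma translated_sampling_density:
  fixes \<Lambda> :: "real set" and G :: "nat \<Rightarrow> real \<Rightarrow> real"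
  assumes G: "decay_jet \<kappa> G" and \<kappa>: "\<kappa> > 0" and d: "d > 0" and sep: "separated_by d \<Lambda>" and N: "N > 0" and C1: "C1 > 0"
    and samp: "\<And>x \<eta> c K b S. 0 < \<eta> \<Longrightarrow> \<eta> \<le> 1 / 2 \<Longrightarrow> finite K \<Longrightarrow>
      (\<And>l s t. l \<in> \<Lambda> \<Longrightarrow> s < N \<Longrightarrow> \<bar>t - x\<bar> \<le> \<eta> \<Longrightarrow> (\<Sum>k\<in>K. c k * G s (t + l - of_int k))\<^sup>2 \<le> b l) \<Longrightarrow>
      (\<And>F. finite F \<Longrightarrow> F \<subseteq> \<Lambda> \<Longrightarrow> sum b F \<le> S) \<Longrightarrow> (\<Sum>k\<in>K. (c k)\<^sup>2) \<le> C1 * S"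
  shows "\<exists>\<delta>>0. \<exists>R. \<forall>r\<ge>R. \<forall>x. (1 / real N + \<delta>) * (2 * r) \<le> real (card (\<Lambda> \<inter> {x - r..x + r}))"
proof -
  obtain D where D: "D \<ge> 0" "\<And>s x. s \<le> N \<Longrightarrow> \<bar>G s x\<bar> \<le> D * exp (- \<kappa> * \<bar>x\<bar>)"
    by (rule decay_jet_uniform_bound[OF G, of N]) blast
  have jG: "jet G" using G by (simp add: decay_jet_def)
  define C3 where "C3 = (4 * D / \<kappa> + 6 * D * exp \<kappa>) + D"
  define E1 where "E1 = 2 * (1 + 1 / (\<kappa> / 4))"
  define E2 where "E2 = exp (\<kappa> / 4 * d) * (2 * (1 + 1 / (\<kappa> / 4 * d)))"
  define C4 where "C4 = C1 * (C3\<^sup>2 * E1 * E2)"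
  have C3: "C3 \<ge> 0" and E1: "E1 \<ge> 0" and E2: "E2 \<ge> 0" using D \<kappa> d by (auto simp: C3_def E1_def E2_def)
  have C4: "C4 \<ge> 0" using C1 C3 E1 E2 by (simp add: C4_def)
  \<comment> \<open>The first three bounds give the smallness of \<open>\<epsilon> = 1 / n\<close>
    that \<open>localized_term_bound\<close> assumes; the last contradicts the final estimate
    \<open>n \<le> 6 * C4 * exp 2\<close>. The choice is possible because \<open>C4\<close> does not
    involve \<open>\<epsilon>\<close>.\<close>
  obtain n :: nat where n: "max (max 2 (4 / \<kappa>)) (max (2 * \<kappa>) (6 * C4 * exp 2)) < real n" using reals_Archimedean2 by blast
  define \<epsilon> where "\<epsilon> = 1 / real n"
  have n2: "real n > 2" and n0: "real n > 0" using n by auto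
  have \<epsilon>: "0 < \<epsilon>" "\<epsilon> \<le> 1 / 2" "\<epsilon> \<le> \<kappa> / 4" "\<kappa> * \<epsilon> \<le> 1 / 2"
    using n \<kappa> n2 n0 by (auto simp: \<epsilon>_def field_simps)
  \<comment> \<open>Over the localisation length \<open>1 / \<epsilon>\<close> a dilation by
    \<open>1 + \<epsilon>\<^sup>2\<close> displaces points relative to each other by no more than
    \<open>\<epsilon>\<close>.\<close>
  define \<eta> where "\<eta> = \<epsilon>\<^sup>2"
  define \<alpha> where "\<alpha> = 1 + \<eta>"
  have \<eta>: "0 < \<eta>" "\<eta> \<le> 1 / 2"
    using \<epsilon> power_mono[of \<epsilon> "1 / 2" 2] by (auto simp: \<eta>_def power2_eq_square)
  have \<alpha>: "\<alpha> \<ge> 1" using \<eta> by (simp add: \<alpha>_def)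
  \<comment> \<open>The width of a buffer at both ends of the coefficient interval: dilated points
    coming from outside \<open>{x - r..x + r}\<close> are at least \<open>K0\<close> away from all
    indices in \<open>J\<close>, and the decay of \<open>G\<close> over this distance yields the
    factor \<open>\<epsilon>\<close>.\<close>
  define K0 where "K0 = max 0 (- 2 * ln \<epsilon> / \<kappa>)"
  have K0: "K0 \<ge> 0" "exp (- (\<kappa> / 2) * K0) \<le> \<epsilon>"
  proof -
    have "- 2 * ln \<epsilon> / \<kappa> \<le> K0" by (simp add: K0_def)
    then have "- (\<kappa> / 2) * K0 \<le> ln \<epsilon>" using \<kappa> by (simp add: field_simps)
    then have "exp (- (\<kappa> / 2) * K0) \<le> exp (ln \<epsilon>)" by (simp only: exp_le_cancel_iff)
    then show "exp (- (\<kappa> / 2) * K0) \<le> \<epsilon>" using \<epsilon> by simp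
  qed (simp add: K0_def)
  \<comment> \<open>Ensures \<open>\<eta> * r \<ge> 2 * K0 + 2\<close>, so the surplus of indices
    gained by dilation outweighs both buffers and the rounding.\<close>
  define R where "R = (2 * K0 + 2) / \<eta>"
  have main: "(1 / real N + \<eta> / (2 * real N)) * (2 * r) \<le> real (card (\<Lambda> \<inter> {x - r..x + r}))" if r: "r \<ge> R" for r x
  proof (rule ccontr)
    assume "\<not> ?thesis"
    then have few: "real (card (\<Lambda> \<inter> {x - r..x + r})) < (1 / real N + \<eta> / (2 * real N)) * (2 * r)" by simp
    let ?\<Lambda> = "\<Lambda> \<inter> {x - r..x + r}"
    have fin\<Lambda>: "finite ?\<Lambda>" by (rule separated_by_finite[OF sep d])
    have \<eta>r: "\<eta> * r \<ge> 2 * K0 + 2" using r \<eta> by (simp add: R_def field_simps)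
    then have rpos: "r > 0" using K0 \<eta> by (smt (verit) mult_nonneg_nonpos not_less)
    define J where "J = {\<lceil>\<alpha> * (x - r) + K0\<rceil>..\<lfloor>\<alpha> * (x + r) - K0\<rfloor>}"
    have finJ: "finite J" by (simp add: J_def)
    have Jk: "\<alpha> * (x - r) + K0 \<le> of_int k" "of_int k \<le> \<alpha> * (x + r) - K0" if "k \<in> J" for k
      using that by (auto simp: J_def ceiling_le_iff le_floor_iff)
    have "real (card (?\<Lambda> \<times> {..<N})) < (1 + \<eta> / 2) * (2 * r)"
    proof -
      have "real (card ?\<Lambda>) * real N < (1 / real N + \<eta> / (2 * real N)) * (2 * r) * real N"
        using few N by (intro mult_strict_right_mono) auto
      also have "\<dots> = (1 + \<eta> / 2) * (2 * r)" using N by (simp add: field_simps)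
      finally show ?thesis by (simp add: card_cartesian_product)
    qed
    also have "\<dots> \<le> \<alpha> * (2 * r) - 2 * K0 - 2" using \<eta>r by (simp add: \<alpha>_def algebra_simps)
    also have "\<dots> \<le> real_of_int (\<lfloor>\<alpha> * (x + r) - K0\<rfloor> + 1 - \<lceil>\<alpha> * (x - r) + K0\<rceil>)"
    proof -
      have "\<alpha> * (x + r) - K0 < of_int \<lfloor>\<alpha> * (x + r) - K0\<rfloor> + 1" by linarith
      moreover have "of_int \<lceil>\<alpha> * (x - r) + K0\<rceil> < \<alpha> * (x - r) + K0 + 1" by linarith
      ultimately show ?thesis by (simp add: algebra_simps)
    qed
    also have "\<dots> \<le> real (card J)" by (simp add: J_def)
    finally have "card (?\<Lambda> \<times> {..<N}) < card J" by simp
    then obtain c where c0: "\<exists>k\<in>J. c k \<noteq> 0"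
      and ce: "\<forall>e\<in>?\<Lambda> \<times> {..<N}. (\<Sum>k\<in>J. G (snd e) (\<alpha> * fst e - of_int k) * c k) = 0"
      using homogeneous_system_nontrivial[of "?\<Lambda> \<times> {..<N}" J "\<lambda>e k. G (snd e) (\<alpha> * fst e - of_int k)"] fin\<Lambda> finJ by blast
    have cz: "(\<Sum>k\<in>J. G s (\<alpha> * l - of_int k) * c k) = 0" if "l \<in> ?\<Lambda>" "s < N" for l s
      using bspec[OF ce, of "(l, s)"] that by simp
    let ?W = "\<lambda>m l k. exp (- (\<epsilon> / 4) * \<bar>of_int k - of_int m\<bar>) * exp (- (\<kappa> / 4) * \<bar>\<alpha> * l - of_int k\<bar>)"
    \<comment> \<open>Near the index \<open>m\<close> one has \<open>\<alpha> * l\<close> close to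
      \<open>m\<close>, so \<open>\<alpha> * l - l = \<eta> * l\<close> is close to
      \<open>\<eta> * m / \<alpha>\<close>: there the dilated set looks like the translate of
      \<open>\<Lambda>\<close> by this amount.\<close>
    have pt: "\<bar>\<Sum>k\<in>J. (c k * exp (- \<epsilon> * \<bar>of_int k - of_int m\<bar>)) * G s (t + l - of_int k)\<bar> \<le> C3 * \<epsilon> * (\<Sum>k\<in>J. \<bar>c k\<bar> * ?W m l k)"
      if l: "l \<in> \<Lambda>" and s: "s < N" and t: "\<bar>t - \<eta> * of_int m / \<alpha>\<bar> \<le> \<eta>" for m :: int and l s t
    proof -
      let ?y = "t + l" and ?y' = "\<alpha> * l"
      have y: "\<bar>?y - ?y'\<bar> \<le> \<epsilon>\<^sup>2 * (\<bar>?y' - of_int m\<bar> + 1)"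
      proof -
        have "?y - ?y' = (t - \<eta> * of_int m / \<alpha>) + (\<eta> / \<alpha>) * (of_int m - ?y')"
        proof -
          have "(\<eta> / \<alpha>) * (of_int m - ?y') = \<eta> * of_int m / \<alpha> - \<eta> * l" using \<alpha> by (simp add: right_diff_distrib)
          then show ?thesis by (simp add: \<alpha>_def distrib_right)
        qed
        also have "\<bar>\<dots>\<bar> \<le> \<eta> + \<bar>(\<eta> / \<alpha>) * (of_int m - ?y')\<bar>" using t by linarith
        also have "\<bar>(\<eta> / \<alpha>) * (of_int m - ?y')\<bar> = (\<eta> / \<alpha>) * \<bar>?y' - of_int m\<bar>"
          using \<eta> \<alpha> by (simp add: abs_mult abs_minus_commute)
        also have "(\<eta> / \<alpha>) * \<bar>?y' - of_int m\<bar> \<le> \<eta> * \<bar>?y' - of_int m\<bar>"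
          using \<eta> \<alpha> by (intro mult_right_mono) (auto simp: divide_le_eq mult_left_le)
        finally show ?thesis by (simp add: \<eta>_def algebra_simps)
      qed
      let ?T = "\<lambda>k. exp (- \<epsilon> * \<bar>of_int k - of_int m\<bar>) * G s (?y - of_int k) - exp (- \<epsilon> * \<bar>?y' - of_int m\<bar>) * G s (?y' - of_int k)"
      let ?Z = "\<Sum>k\<in>J. G s (?y' - of_int k) * c k"
      have T: "\<bar>?T k\<bar> \<le> (4 * D / \<kappa> + 6 * D * exp \<kappa>) * \<epsilon> * ?W m l k" for k
        using s by (intro localized_term_bound[OF jetD[OF jG] _ _ \<kappa> \<epsilon> y] D(2)) auto
      \<comment> \<open>For points of the interval the sum is 0 by the choice of \<open>c\<close>;
        for all others the buffer makes it small.\<close>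
      have Zb: "\<bar>exp (- \<epsilon> * \<bar>?y' - of_int m\<bar>) * ?Z\<bar> \<le> D * \<epsilon> * (\<Sum>k\<in>J. \<bar>c k\<bar> * ?W m l k)"
      proof (cases "l \<in> ?\<Lambda>")
        case True
        have "0 \<le> (\<Sum>k\<in>J. \<bar>c k\<bar> * ?W m l k)" by (intro sum_nonneg) auto
        then show ?thesis using cz[OF True s] D \<epsilon> by simp
      next
        case False
        have far: "K0 \<le> \<bar>?y' - of_int k\<bar>" if "k \<in> J" for k
        proof -
          consider "l < x - r" | "l > x + r" using False l by force
          then show ?thesis
          proof cases
            case 1
            then have "?y' \<le> \<alpha> * (x - r)" using \<alpha> by (intro mult_left_mono) auto
            then show ?thesis using Jk(1)[OF that] by linarith
          next
            case 2
            then have "\<alpha> * (x + r) \<le> ?y'" using \<alpha> by (intro mult_left_mono) auto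
            then show ?thesis using Jk(2)[OF that] by linarith
          qed
        qed
        have "\<bar>exp (- \<epsilon> * \<bar>?y' - of_int m\<bar>) * ?Z\<bar> \<le> (\<Sum>k\<in>J. exp (- \<epsilon> * \<bar>?y' - of_int m\<bar>) * (\<bar>G s (?y' - of_int k)\<bar> * \<bar>c k\<bar>))"
          unfolding abs_mult abs_exp_cancel sum_distrib_left[symmetric]
          by (intro mult_left_mono order_trans[OF sum_abs]) (auto simp: abs_mult)
        also have "\<dots> \<le> (\<Sum>k\<in>J. D * \<epsilon> * (\<bar>c k\<bar> * ?W m l k))"
        proof (rule sum_mono)
          fix k assume k: "k \<in> J"
          let ?u = "\<bar>?y' - of_int k\<bar>" and ?v = "\<bar>real_of_int k - of_int m\<bar>" and ?z = "\<bar>?y' - of_int m\<bar>"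
          have "?v \<le> ?u + ?z" by linarith
          then have "\<epsilon> / 4 * ?v \<le> \<epsilon> / 4 * (?u + ?z)" using \<epsilon> by (intro mult_left_mono) auto
          moreover have "\<epsilon> / 4 * ?u \<le> \<kappa> / 4 * ?u" using \<epsilon> \<kappa> by (intro mult_right_mono) auto
          moreover have "0 \<le> \<epsilon> * ?z" using \<epsilon> by simp
          moreover have "\<kappa> / 2 * K0 \<le> \<kappa> / 2 * ?u" using far[OF k] \<kappa> by (intro mult_left_mono) auto
          ultimately have "- \<epsilon> * ?z + - \<kappa> * ?u \<le> - (\<kappa> / 2) * K0 + (- (\<epsilon> / 4) * ?v + - (\<kappa> / 4) * ?u)"
            by (simp add: algebra_simps)
          then have "exp (- \<epsilon> * ?z + - \<kappa> * ?u) \<le> exp (- (\<kappa> / 2) * K0) * ?W m l k"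
            unfolding exp_add[symmetric] by (simp only: exp_le_cancel_iff)
          also have "\<dots> \<le> \<epsilon> * ?W m l k" using K0 by (intro mult_right_mono) auto
          finally have e: "exp (- \<epsilon> * ?z) * exp (- \<kappa> * ?u) \<le> \<epsilon> * ?W m l k" by (simp only: exp_add)
          have "exp (- \<epsilon> * ?z) * (\<bar>G s (?y' - of_int k)\<bar> * \<bar>c k\<bar>) \<le> exp (- \<epsilon> * ?z) * ((D * exp (- \<kappa> * ?u)) * \<bar>c k\<bar>)"
            using s by (intro mult_left_mono mult_right_mono D(2)) auto
          also have "\<dots> = (D * \<bar>c k\<bar>) * (exp (- \<epsilon> * ?z) * exp (- \<kappa> * ?u))" by (simp only: mult_ac)
          also have "\<dots> \<le> (D * \<bar>c k\<bar>) * (\<epsilon> * ?W m l k)" using e D by (intro mult_left_mono) auto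
          finally show "exp (- \<epsilon> * ?z) * (\<bar>G s (?y' - of_int k)\<bar> * \<bar>c k\<bar>) \<le> D * \<epsilon> * (\<bar>c k\<bar> * ?W m l k)"
            by (simp only: mult_ac)
        qed
        finally show ?thesis by (simp only: sum_distrib_left)
      qed
      have "(\<Sum>k\<in>J. (c k * exp (- \<epsilon> * \<bar>of_int k - of_int m\<bar>)) * G s (?y - of_int k))
         = (\<Sum>k\<in>J. c k * ?T k) + exp (- \<epsilon> * \<bar>?y' - of_int m\<bar>) * ?Z"
        by (simp add: sum_distrib_left sum.distrib[symmetric] algebra_simps)
      moreover have "\<bar>\<Sum>k\<in>J. c k * ?T k\<bar> \<le> (\<Sum>k\<in>J. \<bar>c k\<bar> * ((4 * D / \<kappa> + 6 * D * exp \<kappa>) * \<epsilon> * ?W m l k))"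
        using T by (intro order_trans[OF sum_abs] sum_mono) (simp only: abs_mult, intro mult_left_mono, auto)
      moreover have "\<dots> = (4 * D / \<kappa> + 6 * D * exp \<kappa>) * \<epsilon> * (\<Sum>k\<in>J. \<bar>c k\<bar> * ?W m l k)"
        unfolding sum_distrib_left by (intro sum.cong refl) (simp only: mult_ac)
      ultimately have "\<bar>\<Sum>k\<in>J. (c k * exp (- \<epsilon> * \<bar>of_int k - of_int m\<bar>)) * G s (?y - of_int k)\<bar>
         \<le> (4 * D / \<kappa> + 6 * D * exp \<kappa>) * \<epsilon> * (\<Sum>k\<in>J. \<bar>c k\<bar> * ?W m l k) + D * \<epsilon> * (\<Sum>k\<in>J. \<bar>c k\<bar> * ?W m l k)"
        using Zb by linarith
      then show ?thesis by (simp only: C3_def distrib_right)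
    qed
    let ?b = "\<lambda>m l. (C3 * \<epsilon>)\<^sup>2 * E1 * (\<Sum>k\<in>J. (c k)\<^sup>2 * (exp (- (\<epsilon> / 2) * \<bar>of_int k - of_int m\<bar>) * exp (- (\<kappa> / 4) * \<bar>\<alpha> * l - of_int k\<bar>)))"
    have bl: "(\<Sum>k\<in>J. (c k * exp (- \<epsilon> * \<bar>of_int k - of_int m\<bar>)) * G s (t + l - of_int k))\<^sup>2 \<le> ?b m l"
      if "l \<in> \<Lambda>" "s < N" "\<bar>t - \<eta> * of_int m / \<alpha>\<bar> \<le> \<eta>" for m :: int and l s t
    proof -
      \<comment> \<open>The decaying kernel is written as a product of two square roots for the
        Cauchy-Schwarz inequality; one of them carries the coefficients.\<close>
      let ?a = "\<lambda>k. \<bar>c k\<bar> * exp (- (\<epsilon> / 4) * \<bar>of_int k - of_int m\<bar>) * exp (- (\<kappa> / 8) * \<bar>\<alpha> * l - of_int k\<bar>)"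
      let ?a' = "\<lambda>k::int. exp (- (\<kappa> / 8) * \<bar>\<alpha> * l - of_int k\<bar>)"
      have dbl: "exp (- (\<kappa> / 8) * z) * exp (- (\<kappa> / 8) * z) = exp (- (\<kappa> / 4) * z)" "exp (- (\<epsilon> / 4) * z) * exp (- (\<epsilon> / 4) * z) = exp (- (\<epsilon> / 2) * z)" for z
        by (simp_all add: exp_add[symmetric])
      have "(\<Sum>k\<in>J. \<bar>c k\<bar> * ?W m l k) = (\<Sum>k\<in>J. ?a k * ?a' k)"
        by (intro sum.cong refl) (simp only: mult.assoc dbl(1))
      then have "(\<Sum>k\<in>J. \<bar>c k\<bar> * ?W m l k)\<^sup>2 \<le> (\<Sum>k\<in>J. (?a k)\<^sup>2) * (\<Sum>k\<in>J. (?a' k)\<^sup>2)"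
        using Cauchy_Schwarz_ineq_sum[of ?a ?a' J] by simp
      also have "(\<Sum>k\<in>J. (?a' k)\<^sup>2) \<le> E1"
      proof -
        have "(\<Sum>k\<in>J. (?a' k)\<^sup>2) = (\<Sum>k\<in>J. exp (- (\<kappa> / 4) * \<bar>of_int k - \<alpha> * l\<bar>))"
          by (simp only: power2_eq_square dbl abs_minus_commute)
        also have "\<dots> \<le> E1" unfolding E1_def using \<kappa> finJ by (intro sum_exp_int_bound) auto
        finally show ?thesis .
      qed
      also have "(\<Sum>k\<in>J. (?a k)\<^sup>2) = (\<Sum>k\<in>J. (c k)\<^sup>2 * (exp (- (\<epsilon> / 2) * \<bar>of_int k - of_int m\<bar>) * exp (- (\<kappa> / 4) * \<bar>\<alpha> * l - of_int k\<bar>)))"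
        by (intro sum.cong refl) (simp only: power_mult_distrib power2_abs, simp only: power2_eq_square dbl mult.assoc)
      finally have cs: "(\<Sum>k\<in>J. \<bar>c k\<bar> * ?W m l k)\<^sup>2 \<le> (\<Sum>k\<in>J. (c k)\<^sup>2 * (exp (- (\<epsilon> / 2) * \<bar>of_int k - of_int m\<bar>) * exp (- (\<kappa> / 4) * \<bar>\<alpha> * l - of_int k\<bar>))) * E1"
        by (simp add: mult_left_mono sum_nonneg)
      have "(\<Sum>k\<in>J. (c k * exp (- \<epsilon> * \<bar>of_int k - of_int m\<bar>)) * G s (t + l - of_int k))\<^sup>2 \<le> (C3 * \<epsilon> * (\<Sum>k\<in>J. \<bar>c k\<bar> * ?W m l k))\<^sup>2"
        using power_mono[OF pt[OF that], of 2] by simp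
      also have "\<dots> = (C3 * \<epsilon>)\<^sup>2 * (\<Sum>k\<in>J. \<bar>c k\<bar> * ?W m l k)\<^sup>2" by (rule power_mult_distrib)
      also have "\<dots> \<le> (C3 * \<epsilon>)\<^sup>2 * ((\<Sum>k\<in>J. (c k)\<^sup>2 * (exp (- (\<epsilon> / 2) * \<bar>of_int k - of_int m\<bar>) * exp (- (\<kappa> / 4) * \<bar>\<alpha> * l - of_int k\<bar>))) * E1)"
        using cs by (intro mult_left_mono) auto
      finally show ?thesis by (simp only: mult_ac)
    qed
    let ?S = "\<lambda>m. (C3 * \<epsilon>)\<^sup>2 * E1 * E2 * (\<Sum>k\<in>J. (c k)\<^sup>2 * exp (- (\<epsilon> / 2) * \<bar>of_int k - of_int m\<bar>))"
    have Sb: "sum (?b m) F \<le> ?S m" if F: "finite F" "F \<subseteq> \<Lambda>" for F and m :: int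
    proof -
      have "(\<Sum>l\<in>F. \<Sum>k\<in>J. (c k)\<^sup>2 * (exp (- (\<epsilon> / 2) * \<bar>of_int k - of_int m\<bar>) * exp (- (\<kappa> / 4) * \<bar>\<alpha> * l - of_int k\<bar>)))
         = (\<Sum>k\<in>J. (c k)\<^sup>2 * exp (- (\<epsilon> / 2) * \<bar>of_int k - of_int m\<bar>) * (\<Sum>l\<in>F. exp (- (\<kappa> / 4) * \<bar>\<alpha> * l - of_int k\<bar>)))"
        by (subst sum.swap) (simp only: sum_distrib_left mult.assoc)
      also have "\<dots> \<le> (\<Sum>k\<in>J. (c k)\<^sup>2 * exp (- (\<epsilon> / 2) * \<bar>of_int k - of_int m\<bar>) * E2)"
      proof (intro sum_mono mult_left_mono)
        fix k
        show "(\<Sum>l\<in>F. exp (- (\<kappa> / 4) * \<bar>\<alpha> * l - of_int k\<bar>)) \<le> E2"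
          unfolding E2_def
        proof (rule sum_exp_separated_bound)
          fix y z assume "y \<in> F" "z \<in> F" "y \<noteq> z"
          then have "d \<le> \<bar>y - z\<bar>" using sep F by (auto simp: separated_by_def)
          also have "\<dots> \<le> \<alpha> * \<bar>y - z\<bar>" using \<alpha> by (simp add: mult_le_cancel_right1)
          also have "\<dots> = \<bar>\<alpha> * y - \<alpha> * z\<bar>" using \<alpha> by (simp add: abs_mult right_diff_distrib[symmetric])
          finally show "d \<le> \<bar>\<alpha> * y - \<alpha> * z\<bar>" .
        qed (use \<kappa> d F in auto)
      qed auto
      also have "\<dots> = (\<Sum>k\<in>J. (c k)\<^sup>2 * exp (- (\<epsilon> / 2) * \<bar>of_int k - of_int m\<bar>)) * E2" by (simp only: sum_distrib_right)
      finally have "(C3 * \<epsilon>)\<^sup>2 * E1 * (\<Sum>l\<in>F. \<Sum>k\<in>J. (c k)\<^sup>2 * (exp (- (\<epsilon> / 2) * \<bar>of_int k - of_int m\<bar>) * exp (- (\<kappa> / 4) * \<bar>\<alpha> * l - of_int k\<bar>)))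
         \<le> (C3 * \<epsilon>)\<^sup>2 * E1 * ((\<Sum>k\<in>J. (c k)\<^sup>2 * exp (- (\<epsilon> / 2) * \<bar>of_int k - of_int m\<bar>)) * E2)"
        using E1 by (intro mult_left_mono) auto
      then show ?thesis unfolding sum_distrib_left[symmetric] by (simp only: mult_ac)
    qed
    have "(\<Sum>k\<in>J. (c k * exp (- \<epsilon> * \<bar>of_int k - of_int m\<bar>))\<^sup>2) \<le> C1 * ?S m" for m :: int
      by (rule samp[OF \<eta> finJ bl Sb])
    moreover have "(c k * exp (- \<epsilon> * \<bar>of_int k - of_int m\<bar>))\<^sup>2 = (c k)\<^sup>2 * exp (- 2 * \<epsilon> * \<bar>of_int k - of_int m\<bar>)" for k m :: int
      by (simp add: power_mult_distrib exp_double[symmetric])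
    moreover have "C1 * ?S m = C4 * \<epsilon>\<^sup>2 * (\<Sum>k\<in>J. (c k)\<^sup>2 * exp (- (\<epsilon> / 2) * \<bar>of_int k - of_int m\<bar>))" for m :: int
      by (simp only: C4_def power_mult_distrib mult_ac)
    ultimately have fm: "(\<Sum>k\<in>J. (c k)\<^sup>2 * exp (- 2 * \<epsilon> * \<bar>of_int k - of_int m\<bar>)) \<le> C4 * \<epsilon>\<^sup>2 * (\<Sum>k\<in>J. (c k)\<^sup>2 * exp (- (\<epsilon> / 2) * \<bar>of_int k - of_int m\<bar>))" for m :: int
      by (simp only:)
    \<comment> \<open>For every \<open>k\<close> this contains the \<open>n = 1 / \<epsilon>\<close>
      indices from \<open>k\<close> on, where the weight is at least \<open>exp (- 2)\<close>.
      Summation over \<open>m\<close> thus gains a factor \<open>n\<close> on the left, while the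
      sum of the weights on the right is only of order \<open>1 / \<epsilon>\<close> against the
      factor \<open>\<epsilon>\<^sup>2\<close>.\<close>
    let ?M = "\<Union>k\<in>J. {k..<k + int n}"
    let ?E = "\<Sum>k\<in>J. (c k)\<^sup>2"
    have finM: "finite ?M" using finJ by simp
    have "exp (- 2) * real n * ?E = (\<Sum>k\<in>J. (c k)\<^sup>2 * (real n * exp (- 2)))" by (simp add: sum_distrib_left mult_ac)
    also have "\<dots> \<le> (\<Sum>k\<in>J. (c k)\<^sup>2 * (\<Sum>m\<in>?M. exp (- 2 * \<epsilon> * \<bar>of_int k - of_int m\<bar>)))"
    proof (intro sum_mono mult_left_mono)
      fix k assume k: "k \<in> J"
      have "real n * exp (- 2) = (\<Sum>m\<in>{k..<k + int n}. exp (- 2))" by simp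
      also have "\<dots> \<le> (\<Sum>m\<in>{k..<k + int n}. exp (- 2 * \<epsilon> * \<bar>of_int k - of_int m\<bar>))"
      proof (rule sum_mono)
        fix m assume "m \<in> {k..<k + int n}"
        then have "\<bar>real_of_int k - of_int m\<bar> \<le> real n" by auto
        then have "\<epsilon> * \<bar>real_of_int k - of_int m\<bar> \<le> \<epsilon> * real n" using \<epsilon> by (intro mult_left_mono) auto
        also have "\<dots> = 1" using n0 by (simp add: \<epsilon>_def)
        finally show "exp (- 2) \<le> exp (- 2 * \<epsilon> * \<bar>real_of_int k - of_int m\<bar>)" by simp
      qed
      also have "\<dots> \<le> (\<Sum>m\<in>?M. exp (- 2 * \<epsilon> * \<bar>of_int k - of_int m\<bar>))"
        using k finM by (intro sum_mono2) auto
      finally show "real n * exp (- 2) \<le> \<dots>" .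
    qed auto
    also have "\<dots> = (\<Sum>m\<in>?M. \<Sum>k\<in>J. (c k)\<^sup>2 * exp (- 2 * \<epsilon> * \<bar>of_int k - of_int m\<bar>))"
      unfolding sum_distrib_left by (rule sum.swap)
    also have "\<dots> \<le> (\<Sum>m\<in>?M. C4 * \<epsilon>\<^sup>2 * (\<Sum>k\<in>J. (c k)\<^sup>2 * exp (- (\<epsilon> / 2) * \<bar>of_int k - of_int m\<bar>)))"
      by (intro sum_mono fm)
    also have "\<dots> = C4 * \<epsilon>\<^sup>2 * (\<Sum>k\<in>J. (c k)\<^sup>2 * (\<Sum>m\<in>?M. exp (- (\<epsilon> / 2) * \<bar>of_int m - of_int k\<bar>)))"
      unfolding sum_distrib_left[symmetric] by (subst sum.swap) (simp only: sum_distrib_left abs_minus_commute)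
    also have "\<dots> \<le> C4 * \<epsilon>\<^sup>2 * (\<Sum>k\<in>J. (c k)\<^sup>2 * (2 * (1 + 1 / (\<epsilon> / 2))))"
      using C4 \<epsilon> finM by (intro mult_left_mono sum_mono sum_exp_int_bound) auto
    also have "\<dots> = C4 * (\<epsilon>\<^sup>2 * (2 * (1 + 1 / (\<epsilon> / 2)))) * ?E" by (simp add: sum_distrib_left sum_distrib_right mult_ac)
    also have "\<dots> \<le> C4 * 6 * ?E"
    proof (intro mult_right_mono mult_left_mono C4 sum_nonneg)
      have "\<epsilon>\<^sup>2 * (2 * (1 + 1 / (\<epsilon> / 2))) = 2 * \<epsilon>\<^sup>2 + 4 * \<epsilon>" using \<epsilon> by (simp add: power2_eq_square field_simps)
      also have "\<dots> \<le> 6" using \<epsilon> \<eta> by (simp add: \<eta>_def)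
      finally show "\<epsilon>\<^sup>2 * (2 * (1 + 1 / (\<epsilon> / 2))) \<le> 6" .
    qed auto
    finally have "exp (- 2) * real n * ?E \<le> C4 * 6 * ?E" .
    moreover have "?E > 0"
    proof -
      obtain k where k: "k \<in> J" "c k \<noteq> 0" using c0 by blast
      have "0 < (c k)\<^sup>2" using k by simp
      also have "\<dots> \<le> ?E" using k finJ by (intro member_le_sum) auto
      finally show ?thesis .
    qed
    ultimately have "exp (- 2) * real n \<le> C4 * 6" by (simp add: mult_le_cancel_right)
    then have "exp 2 * (exp (- 2) * real n) \<le> exp 2 * (C4 * 6)" by (intro mult_left_mono) auto
    moreover have "exp 2 * exp (- 2 :: real) = 1" by (simp flip: exp_add)
    ultimately have "real n \<le> exp 2 * (C4 * 6)" by (simp only: mult.assoc[symmetric] mult_1_left)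
    then have "real n \<le> 6 * C4 * exp 2" by (simp only: mult_ac)
    then show False using n by simp
  qed
  moreover have "\<eta> / (2 * real N) > 0" using \<eta> N by simp
  ultimately show ?thesis by blast
qed

section \<open>Gabor systems\<close>

lemma deriv_iter_jet:
  assumes "jet G"
  shows "deriv_iter k (\<lambda>x. of_real (G 0 x)) = (\<lambda>x. of_real (G k x))"
proof (induction k)
  case (Suc k)
  have "deriv_iter (Suc k) (\<lambda>x. of_real (G 0 x)) = (\<lambda>x. vector_derivative (deriv_iter k (\<lambda>x. of_real (G 0 x))) (at x))"
    by (simp add: deriv_iter_def)
  also have "\<dots> = (\<lambda>x. of_real (G (Suc k) x))"
  proof
    fix x
    have "((\<lambda>x. complex_of_real (G k x)) has_vector_derivative of_real (G (Suc k) x)) (at x)"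
      using jetD[OF assms] by (intro has_vector_derivative_of_real) (simp add: has_real_derivative_iff_has_vector_derivative)
    then show "vector_derivative (deriv_iter k (\<lambda>x. complex_of_real (G 0 x))) (at x) = of_real (G (Suc k) x)"
      unfolding Suc by (rule vector_derivative_at)
  qed
  finally show ?case .
qed (simp add: deriv_iter_def)

lemma norm_sum_mult_square_le:
  fixes a b :: "'i \<Rightarrow> 'a::real_normed_field"
  shows "(norm (\<Sum>i\<in>I. a i * b i))\<^sup>2 \<le> (\<Sum>i\<in>I. (norm (a i))\<^sup>2) * (\<Sum>i\<in>I. (norm (b i))\<^sup>2)"
proof -
  have "norm (\<Sum>i\<in>I. a i * b i) \<le> (\<Sum>i\<in>I. norm (a i) * norm (b i))"
    using norm_sum[of "\<lambda>i. a i * b i" I] by (simp add: norm_mult)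
  then have "(norm (\<Sum>i\<in>I. a i * b i))\<^sup>2 \<le> (\<Sum>i\<in>I. norm (a i) * norm (b i))\<^sup>2" by (intro power_mono) auto
  also have "\<dots> \<le> (\<Sum>i\<in>I. (norm (a i))\<^sup>2) * (\<Sum>i\<in>I. (norm (b i))\<^sup>2)" by (rule Cauchy_Schwarz_ineq_sum)
  finally show ?thesis .
qed

text \<open>A ratio \<open>z\<close> fits strictly between \<open>1 / N\<close> and the density.
  Counts are integers, so the lower bound \<open>2 * r * z\<close> may be rounded up to
  \<open>M\<close>.\<close>

lemma card_interval_of_lower_density:
  fixes \<Lambda> :: "real set"
  assumes "lower_density \<Lambda> > ereal (1 / real N)" "N > 0"
  obtains L :: real and M :: nat where "L > 0" "M > 0" "L < real M * real N" "\<And>x. M \<le> card (\<Lambda> \<inter> {x..x + L})"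
proof -
  have "\<forall>\<^sub>F r in at_top. ereal (1 / real N) < (INF x::real. ereal (real (card (\<Lambda> \<inter> {x - r..x + r})) / (2 * r)))"
    using assms(1) unfolding lower_density_def by (rule less_LiminfD)
  then have "\<forall>\<^sub>F r in at_top. r > 0 \<and> ereal (1 / real N) < (INF x::real. ereal (real (card (\<Lambda> \<inter> {x - r..x + r})) / (2 * r)))"
    using eventually_gt_at_top[of 0] by eventually_elim auto
  then obtain r :: real where r: "r > 0" "ereal (1 / real N) < (INF x::real. ereal (real (card (\<Lambda> \<inter> {x - r..x + r})) / (2 * r)))"
    by (auto dest!: eventually_happens'[OF trivial_limit_at_top_linorder])
  then obtain z where z: "ereal (1 / real N) < ereal z" "ereal z < (INF x::real. ereal (real (card (\<Lambda> \<inter> {x - r..x + r})) / (2 * r)))"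
    using ereal_dense2 by blast
  have cz: "2 * r * z \<le> real (card (\<Lambda> \<inter> {x - r..x + r}))" for x
  proof -
    have "ereal z < ereal (real (card (\<Lambda> \<inter> {x - r..x + r})) / (2 * r))"
      using z(2) by (rule less_INF_D) simp
    then show ?thesis using r(1) by (simp add: field_simps)
  qed
  have z0: "1 / real N < z" using z(1) by simp
  then have zp: "z > 0" using assms(2) by (smt (verit) divide_pos_pos of_nat_0_less_iff)
  define M where "M = nat \<lceil>2 * r * z\<rceil>"
  have M: "2 * r * z \<le> real M" by (simp add: M_def real_nat_ceiling_ge)
  have "0 < 2 * r * z" using r zp by simp
  then have "M > 0" using M by (metis gr0I leD of_nat_0)
  moreover have "2 * r < real M * real N"
  proof -
    have "2 * r * (1 / real N) < 2 * r * z" using z0 r by (intro mult_strict_left_mono) auto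
    then have "2 * r * (1 / real N) * real N < real M * real N" using M assms(2) by (intro mult_strict_right_mono) auto
    then show ?thesis using assms(2) by simp
  qed
  moreover have "M \<le> card (\<Lambda> \<inter> {x..x + 2 * r})" for x
  proof -
    have "\<lceil>2 * r * z\<rceil> \<le> int (card (\<Lambda> \<inter> {(x + r) - r..(x + r) + r}))"
      using cz[of "x + r"] by (simp add: ceiling_le_iff)
    moreover have "(x + r) - r = x" "(x + r) + r = x + 2 * r" by simp_all
    ultimately show ?thesis by (simp only: M_def nat_le_iff)
  qed
  ultimately show ?thesis using that[of "2 * r" M] r by simp
qed

section \<open>The multi-window system of a decaying jet\<close>

locale gabor_windows =
  fixes \<kappa> d :: real and G :: "nat \<Rightarrow> real \<Rightarrow> real" and \<Lambda> :: "real set" and N :: nat and p :: "nat \<Rightarrow> complex poly"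
  assumes G: "decay_jet \<kappa> G" and \<kappa>: "\<kappa> > 0" and sep: "separated_by d \<Lambda>" and d: "d > 0" and N: "N > 0"
    and basis: "poly_basis N p"
begin

definition win :: "nat \<Rightarrow> real \<Rightarrow> complex" where
  "win j = poly_diff_op (p j) (\<lambda>x. of_real (G 0 x))"

definition gabor_index :: "((real \<times> real) \<times> nat) set" where
  "gabor_index = ((\<lambda>(l, k). (- l, real_of_int k)) ` (\<Lambda> \<times> (UNIV :: int set))) \<times> {1..N}"

definition gabor_fun :: "(real \<times> real) \<times> nat \<Rightarrow> real \<Rightarrow> complex" where
  "gabor_fun = (\<lambda>((x, w), j). tfshift x w (win j))"

lemma jG: "jet G" using G by (simp add: decay_jet_def)

lemma win_eq:
  assumes "j \<in> {1..N}"
  shows "win j x = (\<Sum>s<N. coeff (p j) s * of_real (G s x))"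
proof -
  have "degree (p j) < N" using basis assms by (simp add: poly_basis_def)
  then have "(\<Sum>s\<le>degree (p j). coeff (p j) s * of_real (G s x)) = (\<Sum>s<N. coeff (p j) s * complex_of_real (G s x))"
    by (intro sum.mono_neutral_left) (auto simp: coeff_eq_0)
  then show ?thesis by (simp add: win_def poly_diff_op_def deriv_iter_jet[OF jG])
qed

lemma continuous_win: "continuous_on UNIV (win j)"
  unfolding win_def poly_diff_op_def[abs_def] deriv_iter_jet[OF jG]
  using continuous_on_jet[OF jG] by (intro continuous_intros)

lemma win_bound:
  obtains W where "W \<ge> 0" "\<And>j x. j \<in> {1..N} \<Longrightarrow> cmod (win j x) \<le> W * exp (- \<kappa> * \<bar>x\<bar>)"
proof -
  obtain D where D: "D \<ge> 0" "\<And>s x. s \<le> N \<Longrightarrow> \<bar>G s x\<bar> \<le> D * exp (- \<kappa> * \<bar>x\<bar>)"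
    by (rule decay_jet_uniform_bound[OF G, of N]) blast
  let ?w = "\<lambda>j. \<Sum>s<N. cmod (coeff (p j) s)"
  show ?thesis
  proof (rule that)
    show "0 \<le> (\<Sum>j\<in>{1..N}. ?w j) * D" using D by (intro mult_nonneg_nonneg sum_nonneg) auto
    fix j x assume j: "j \<in> {1..N}"
    have "cmod (win j x) \<le> (\<Sum>s<N. cmod (coeff (p j) s) * (D * exp (- \<kappa> * \<bar>x\<bar>)))"
      unfolding win_eq[OF j] using D(2)
      by (intro order_trans[OF norm_sum] sum_mono) (simp add: norm_mult mult_left_mono)
    also have "\<dots> = ?w j * (D * exp (- \<kappa> * \<bar>x\<bar>))" by (simp only: sum_distrib_right)
    also have "\<dots> \<le> (\<Sum>j\<in>{1..N}. ?w j) * (D * exp (- \<kappa> * \<bar>x\<bar>))"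
      using j D by (intro mult_right_mono member_le_sum sum_nonneg) auto
    finally show "cmod (win j x) \<le> (\<Sum>j\<in>{1..N}. ?w j) * D * exp (- \<kappa> * \<bar>x\<bar>)" by (simp add: mult.assoc)
  qed
qed

lemma gabor_fun_L2:
  assumes "i \<in> gabor_index"
  shows "gabor_fun i \<in> L2"
proof -
  obtain l k j where i: "i = ((- l, real_of_int k), j)" and j: "j \<in> {1..N}"
    using assms by (auto simp: gabor_index_def)
  obtain W where W: "W \<ge> 0" "\<And>j x. j \<in> {1..N} \<Longrightarrow> cmod (win j x) \<le> W * exp (- \<kappa> * \<bar>x\<bar>)" by (rule win_bound) blast
  have cont: "continuous_on UNIV (gabor_fun i)"
    unfolding i gabor_fun_def prod.case tfshift_def[abs_def]
    by (intro continuous_intros continuous_on_compose2[OF continuous_win]) auto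
  have bd: "norm ((cmod (gabor_fun i t))\<^sup>2) \<le> (W * exp (\<kappa> * \<bar>l\<bar>))\<^sup>2 * exp (- (2 * \<kappa>) * \<bar>t\<bar>)" for t
  proof -
    have "cmod (gabor_fun i t) = cmod (win j (t + l))" by (simp add: i gabor_fun_def tfshift_def norm_mult)
    also have "\<dots> \<le> W * exp (- \<kappa> * \<bar>t + l\<bar>)" by (rule W(2)[OF j])
    also have "\<dots> \<le> W * exp (\<kappa> * \<bar>l\<bar> + - \<kappa> * \<bar>t\<bar>)"
    proof -
      have "\<kappa> * \<bar>t\<bar> \<le> \<kappa> * (\<bar>t + l\<bar> + \<bar>l\<bar>)" using \<kappa> by (intro mult_left_mono) auto
      then show ?thesis using W(1) by (intro mult_left_mono) (auto simp: algebra_simps)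
    qed
    finally have "cmod (gabor_fun i t) \<le> (W * exp (\<kappa> * \<bar>l\<bar>)) * exp (- \<kappa> * \<bar>t\<bar>)" by (simp only: exp_add mult.assoc)
    then have "(cmod (gabor_fun i t))\<^sup>2 \<le> ((W * exp (\<kappa> * \<bar>l\<bar>)) * exp (- \<kappa> * \<bar>t\<bar>))\<^sup>2" by (rule power_mono) simp
    also have "\<dots> = (W * exp (\<kappa> * \<bar>l\<bar>))\<^sup>2 * exp (- (2 * \<kappa>) * \<bar>t\<bar>)" by (simp add: power_mult_distrib exp_double[symmetric])
    finally show ?thesis by simp
  qed
  have "integrable lborel (\<lambda>t. (cmod (gabor_fun i t))\<^sup>2)"
    using \<kappa> by (intro integrable_decaying[OF _ bd] continuous_intros cont) auto
  then have "integrable lebesgue (\<lambda>t. (cmod (gabor_fun i t))\<^sup>2)"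
    using cont by (subst integrable_completion) (auto intro!: borel_measurable_continuous_onI continuous_intros)
  moreover have "gabor_fun i \<in> borel_measurable lebesgue"
    using cont by (intro measurable_completion) (simp add: borel_measurable_continuous_onI)
  ultimately show ?thesis by (simp add: L2_def)
qed

lemma gabor_frame_iff:
  "gabor_frame (\<lambda>j. poly_diff_op (p j) (\<lambda>x. of_real (G 0 x))) N ((\<lambda>(l, k). (- l, real_of_int k)) ` (\<Lambda> \<times> (UNIV :: int set)))
    \<longleftrightarrow> is_frame gabor_index gabor_fun"
  unfolding gabor_frame_def gabor_index_def gabor_fun_def win_def ..

lemma l2_inner_gabor_fun:
  assumes "continuous_on UNIV h" "\<And>t. \<bar>t - y\<bar> \<ge> real m \<Longrightarrow> h t = 0"
  shows "l2_inner h (gabor_fun ((- l, real_of_int k), j)) = fcoeff y (fiber m h (win j) l) k"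
  unfolding gabor_fun_def prod.case by (rule l2_inner_tfshift[OF assms continuous_win])

text \<open>A finite index set lies in a product of translations, windows and modulations; for fixed
  \<open>l\<close> and \<open>j\<close> Bessel's inequality bounds the sum over the modulations by
  the energy of one fiber.\<close>

lemma gabor_sum_le:
  assumes h: "continuous_on UNIV h" "\<And>t. \<bar>t - y\<bar> \<ge> real m \<Longrightarrow> h t = 0" and J: "finite J" "J \<subseteq> gabor_index"
  obtains F where "finite F" "F \<subseteq> \<Lambda>"
    "(\<Sum>i\<in>J. (cmod (l2_inner h (gabor_fun i)))\<^sup>2) \<le> (\<Sum>l\<in>F. \<Sum>j\<in>{1..N}. integral {y..y + 1} (\<lambda>x. (cmod (fiber m h (win j) l x))\<^sup>2))"
proof -
  define F where "F = (\<lambda>i. - fst (fst i)) ` J"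
  define K where "K = (\<lambda>i. \<lfloor>snd (fst i)\<rfloor>) ` J"
  let ?\<iota> = "\<lambda>(l :: real, j :: nat, k). ((- l, real_of_int k), j)"
  have inj: "inj_on ?\<iota> S" for S by (auto simp: inj_on_def)
  have fin: "finite F" "finite K" using J by (auto simp: F_def K_def)
  have F: "F \<subseteq> \<Lambda>" using J(2) by (auto simp: F_def gabor_index_def)
  have sub: "J \<subseteq> ?\<iota> ` (F \<times> {1..N} \<times> K)"
  proof
    fix i assume i: "i \<in> J"
    then obtain l k j where e: "i = ((- l, real_of_int k), j)" and j: "j \<in> {1..N}"
      using J(2) by (auto simp: gabor_index_def)
    have "l \<in> F" "k \<in> K" using i by (force simp: F_def K_def e)+
    then show "i \<in> ?\<iota> ` (F \<times> {1..N} \<times> K)" using j e by (intro image_eqI[of _ _ "(l, j, k)"]) auto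
  qed
  have "(\<Sum>i\<in>J. (cmod (l2_inner h (gabor_fun i)))\<^sup>2) \<le> (\<Sum>i\<in>?\<iota> ` (F \<times> {1..N} \<times> K). (cmod (l2_inner h (gabor_fun i)))\<^sup>2)"
    using fin by (intro sum_mono2 sub) auto
  also have "\<dots> = (\<Sum>(l, j, k)\<in>F \<times> {1..N} \<times> K. (cmod (fcoeff y (fiber m h (win j) l) k))\<^sup>2)"
    by (subst sum.reindex[OF inj]) (auto intro!: sum.cong simp: l2_inner_gabor_fun[OF h])
  also have "\<dots> = (\<Sum>l\<in>F. \<Sum>j\<in>{1..N}. \<Sum>k\<in>K. (cmod (fcoeff y (fiber m h (win j) l) k))\<^sup>2)"
    by (simp add: sum.cartesian_product)
  also have "\<dots> \<le> (\<Sum>l\<in>F. \<Sum>j\<in>{1..N}. integral {y..y + 1} (\<lambda>x. (cmod (fiber m h (win j) l x))\<^sup>2))"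
    by (intro sum_mono bessel_inequality fin continuous_on_fiber h continuous_win)
  finally show ?thesis using that fin F by blast
qed

lemma fiber_win:
  assumes "j \<in> {1..N}"
  shows "fiber m h (win j) l x = (\<Sum>s<N. cnj (coeff (p j) s) * fiber m h (\<lambda>t. of_real (G s t)) l x)"
proof -
  have "fiber m h (win j) l x = (\<Sum>n\<in>{- int m..int m}. \<Sum>s<N. cnj (coeff (p j) s) * (h (x + of_int n) * of_real (G s (x + of_int n + l))))"
    unfolding fiber_def win_eq[OF assms] cnj_sum sum_distrib_left by (simp add: mult_ac)
  also have "\<dots> = (\<Sum>s<N. cnj (coeff (p j) s) * fiber m h (\<lambda>t. of_real (G s t)) l x)"
    unfolding fiber_def by (subst sum.swap) (simp add: sum_distrib_left)
  finally show ?thesis .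
qed

text \<open>Expanding the monomials in the basis \<open>p\<close> recovers the derivatives of order
  below \<open>N\<close> from the windows, so the choice of basis affects only the constant.\<close>

lemma fiber_jet_le_win:
  obtains \<Gamma> where "\<Gamma> > 0"
    "\<And>m h l x. (\<Sum>s<N. (cmod (fiber m h (\<lambda>t. of_real (G s t)) l x))\<^sup>2) \<le> \<Gamma> * (\<Sum>j\<in>{1..N}. (cmod (fiber m h (win j) l x))\<^sup>2)"
proof -
  have "\<forall>s. \<exists>g. s < N \<longrightarrow> monom 1 s = (\<Sum>j=1..N. smult (g j) (p j))"
  proof
    fix s
    show "\<exists>g. s < N \<longrightarrow> monom 1 s = (\<Sum>j=1..N. smult (g j) (p j))"
    proof (cases "s < N")
      case True
      then have "degree (monom 1 s :: complex poly) < N" by (simp add: degree_monom_eq)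
      then show ?thesis using basis unfolding poly_basis_def by blast
    qed simp
  qed
  then obtain \<gamma> where \<gamma>: "\<And>s. s < N \<Longrightarrow> monom 1 s = (\<Sum>j=1..N. smult (\<gamma> s j) (p j))"
    by (simp only: choice_iff) blast
  define \<Gamma> where "\<Gamma> = (\<Sum>s<N. \<Sum>j\<in>{1..N}. (cmod (\<gamma> s j))\<^sup>2) + 1"
  have \<Gamma>: "\<Gamma> > 0" unfolding \<Gamma>_def by (intro add_nonneg_pos sum_nonneg) auto
  show ?thesis
  proof (rule that[OF \<Gamma>])
    fix m h l x
    let ?Z = "\<lambda>s. fiber m h (\<lambda>t. of_real (G s t)) l x" and ?f = "\<lambda>j. fiber m h (win j) l x"
    have Z: "?Z s = (\<Sum>j\<in>{1..N}. cnj (\<gamma> s j) * ?f j)" if s: "s < N" for s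
    proof -
      have c: "(\<Sum>j\<in>{1..N}. \<gamma> s j * coeff (p j) i) = (if i = s then 1 else 0)" for i
        using arg_cong[OF \<gamma>[OF s], of "\<lambda>q. coeff q i"] by (simp add: coeff_sum eq_commute[of s i])
      have "(\<Sum>j\<in>{1..N}. cnj (\<gamma> s j) * ?f j) = (\<Sum>j\<in>{1..N}. \<Sum>i<N. cnj (\<gamma> s j * coeff (p j) i) * ?Z i)"
        by (intro sum.cong refl) (simp add: fiber_win sum_distrib_left mult_ac)
      also have "\<dots> = (\<Sum>i<N. cnj (\<Sum>j\<in>{1..N}. \<gamma> s j * coeff (p j) i) * ?Z i)"
        by (subst sum.swap) (simp only: cnj_sum sum_distrib_right)
      also have "\<dots> = (\<Sum>i<N. if i = s then ?Z i else 0)" unfolding c by (intro sum.cong) auto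
      also have "\<dots> = ?Z s" using s by simp
      finally show ?thesis by simp
    qed
    have "(\<Sum>s<N. (cmod (?Z s))\<^sup>2) \<le> (\<Sum>s<N. (\<Sum>j\<in>{1..N}. (cmod (\<gamma> s j))\<^sup>2) * (\<Sum>j\<in>{1..N}. (cmod (?f j))\<^sup>2))"
    proof (rule sum_mono)
      fix s assume "s \<in> {..<N}"
      then have "?Z s = (\<Sum>j\<in>{1..N}. cnj (\<gamma> s j) * ?f j)" by (simp add: Z)
      then show "(cmod (?Z s))\<^sup>2 \<le> (\<Sum>j\<in>{1..N}. (cmod (\<gamma> s j))\<^sup>2) * (\<Sum>j\<in>{1..N}. (cmod (?f j))\<^sup>2)"
        using norm_sum_mult_square_le[of "\<lambda>j. cnj (\<gamma> s j)" ?f "{1..N}"] by simp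
    qed
    also have "\<dots> = (\<Gamma> - 1) * (\<Sum>j\<in>{1..N}. (cmod (?f j))\<^sup>2)" by (simp add: \<Gamma>_def sum_distrib_right)
    also have "\<dots> \<le> \<Gamma> * (\<Sum>j\<in>{1..N}. (cmod (?f j))\<^sup>2)" by (intro mult_right_mono sum_nonneg) auto
    finally show "(\<Sum>s<N. (cmod (?Z s))\<^sup>2) \<le> \<Gamma> * (\<Sum>j\<in>{1..N}. (cmod (?f j))\<^sup>2)" .
  qed
qed

text \<open>Schur's test for the kernel \<open>exp (- \<kappa> * \<bar>x + n + l\<bar>)\<close>: its
  sums over the integers \<open>n\<close> and, by separation, over the points \<open>l\<close> are
  bounded. The square root \<open>?r\<close> splits the kernel for the Cauchy-Schwarz
  inequality.\<close>

lemma fiber_sum_upper: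
  obtains B where "B > 0" "\<And>m h F x j. finite F \<Longrightarrow> F \<subseteq> \<Lambda> \<Longrightarrow> j \<in> {1..N} \<Longrightarrow>
    (\<Sum>l\<in>F. (cmod (fiber m h (win j) l x))\<^sup>2) \<le> B * (\<Sum>n\<in>{- int m..int m}. (cmod (h (x + of_int n)))\<^sup>2)"
proof -
  obtain W where W: "W \<ge> 0" "\<And>j x. j \<in> {1..N} \<Longrightarrow> cmod (win j x) \<le> W * exp (- \<kappa> * \<bar>x\<bar>)" by (rule win_bound) blast
  define E1 where "E1 = 2 * (1 + 1 / \<kappa>)"
  define E2 where "E2 = exp (\<kappa> * d) * (2 * (1 + 1 / (\<kappa> * d)))"
  have E: "E1 \<ge> 0" "E2 \<ge> 0" using \<kappa> d by (auto simp: E1_def E2_def)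
  have B: "W\<^sup>2 * E1 * E2 + 1 > 0" using E by (intro add_nonneg_pos) auto
  show ?thesis
  proof (rule that[OF B])
    fix m h F x j assume F: "finite F" "F \<subseteq> \<Lambda>" and j: "j \<in> {1..N}"
    let ?n = "{- int m..int m}"
    let ?e = "\<lambda>l n. exp (- \<kappa> * \<bar>x + of_int n + l\<bar>)"
    have "(cmod (fiber m h (win j) l x))\<^sup>2 \<le> W\<^sup>2 * E1 * (\<Sum>n\<in>?n. (cmod (h (x + of_int n)))\<^sup>2 * ?e l n)" for l
    proof -
      let ?r = "\<lambda>n. sqrt (?e l n)"
      have r2: "?r n * ?r n = ?e l n" for n by simp
      have "cmod (fiber m h (win j) l x) \<le> (\<Sum>n\<in>?n. cmod (h (x + of_int n)) * (W * ?e l n))"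
        unfolding fiber_def using W(2)[OF j]
        by (intro order_trans[OF norm_sum] sum_mono) (simp add: norm_mult mult_left_mono)
      also have "\<dots> = (\<Sum>n\<in>?n. (cmod (h (x + of_int n)) * ?r n) * (W * ?r n))"
      proof (rule sum.cong[OF refl])
        fix n
        have "(cmod (h (x + of_int n)) * ?r n) * (W * ?r n) = cmod (h (x + of_int n)) * (W * (?r n * ?r n))" by (simp only: mult_ac)
        then show "cmod (h (x + of_int n)) * (W * ?e l n) = (cmod (h (x + of_int n)) * ?r n) * (W * ?r n)" by (simp only: r2)
      qed
      finally have "(cmod (fiber m h (win j) l x))\<^sup>2 \<le> (\<Sum>n\<in>?n. (cmod (h (x + of_int n)) * ?r n) * (W * ?r n))\<^sup>2"
        by (rule power_mono) simp
      also have "\<dots> \<le> (\<Sum>n\<in>?n. (cmod (h (x + of_int n)) * ?r n)\<^sup>2) * (\<Sum>n\<in>?n. (W * ?r n)\<^sup>2)"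
        by (rule Cauchy_Schwarz_ineq_sum)
      also have "(\<Sum>n\<in>?n. (W * ?r n)\<^sup>2) = W\<^sup>2 * (\<Sum>n\<in>?n. exp (- \<kappa> * \<bar>of_int n - (- x - l)\<bar>))"
        unfolding sum_distrib_left by (intro sum.cong refl) (simp add: power_mult_distrib algebra_simps)
      also have "(\<Sum>n\<in>?n. (cmod (h (x + of_int n)) * ?r n)\<^sup>2) * \<dots> \<le> (\<Sum>n\<in>?n. (cmod (h (x + of_int n)) * ?r n)\<^sup>2) * (W\<^sup>2 * E1)"
        unfolding E1_def using \<kappa> by (intro mult_left_mono sum_exp_int_bound sum_nonneg) auto
      also have "\<dots> = W\<^sup>2 * E1 * (\<Sum>n\<in>?n. (cmod (h (x + of_int n)))\<^sup>2 * ?e l n)"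
        by (simp add: power_mult_distrib mult_ac)
      finally show ?thesis .
    qed
    then have "(\<Sum>l\<in>F. (cmod (fiber m h (win j) l x))\<^sup>2) \<le> (\<Sum>l\<in>F. W\<^sup>2 * E1 * (\<Sum>n\<in>?n. (cmod (h (x + of_int n)))\<^sup>2 * ?e l n))"
      by (intro sum_mono)
    also have "\<dots> = W\<^sup>2 * E1 * (\<Sum>n\<in>?n. (cmod (h (x + of_int n)))\<^sup>2 * (\<Sum>l\<in>F. exp (- \<kappa> * \<bar>l - (- x - of_int n)\<bar>)))"
      unfolding sum_distrib_left[symmetric]
      by (subst sum.swap) (simp add: sum_distrib_left algebra_simps)
    also have "\<dots> \<le> W\<^sup>2 * E1 * (\<Sum>n\<in>?n. (cmod (h (x + of_int n)))\<^sup>2 * E2)"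
    proof (intro mult_left_mono sum_mono)
      fix n
      show "(\<Sum>l\<in>F. exp (- \<kappa> * \<bar>l - (- x - of_int n)\<bar>)) \<le> E2"
        unfolding E2_def using \<kappa> d F sep by (intro sum_exp_separated_bound) (auto simp: separated_by_def)
    qed (use E in auto)
    also have "\<dots> = W\<^sup>2 * E1 * E2 * (\<Sum>n\<in>?n. (cmod (h (x + of_int n)))\<^sup>2)" by (simp add: sum_distrib_left mult_ac)
    also have "\<dots> \<le> (W\<^sup>2 * E1 * E2 + 1) * (\<Sum>n\<in>?n. (cmod (h (x + of_int n)))\<^sup>2)"
      by (intro mult_right_mono sum_nonneg) auto
    finally show "(\<Sum>l\<in>F. (cmod (fiber m h (win j) l x))\<^sup>2) \<le> \<dots>" .
  qed
qed

lemma gabor_bessel: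
  obtains B where "B > 0"
    "\<And>h J. h \<in> Cc \<Longrightarrow> finite J \<Longrightarrow> J \<subseteq> gabor_index \<Longrightarrow> (\<Sum>i\<in>J. (cmod (l2_inner h (gabor_fun i)))\<^sup>2) \<le> B * sq_norm h"
proof -
  obtain B where B: "B > 0" "\<And>m h F x j. finite F \<Longrightarrow> F \<subseteq> \<Lambda> \<Longrightarrow> j \<in> {1..N} \<Longrightarrow>
    (\<Sum>l\<in>F. (cmod (fiber m h (win j) l x))\<^sup>2) \<le> B * (\<Sum>n\<in>{- int m..int m}. (cmod (h (x + of_int n)))\<^sup>2)"
    by (rule fiber_sum_upper) blast
  have "real N * B > 0" using N B by simp
  then show ?thesis
  proof (rule that)
    fix h J assume h: "h \<in> Cc" and J: "finite J" "J \<subseteq> gabor_index"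
    from h obtain m :: nat where c: "continuous_on UNIV h" and m: "\<And>t. \<bar>t - 0\<bar> \<ge> real m \<Longrightarrow> h t = 0" by (auto simp: Cc_def)
    obtain F where F: "finite F" "F \<subseteq> \<Lambda>"
      "(\<Sum>i\<in>J. (cmod (l2_inner h (gabor_fun i)))\<^sup>2) \<le> (\<Sum>l\<in>F. \<Sum>j\<in>{1..N}. integral {0..0 + 1} (\<lambda>x. (cmod (fiber m h (win j) l x))\<^sup>2))"
      by (rule gabor_sum_le[OF c m J]) blast
    have ci: "(\<lambda>x. (cmod (fiber m h (win j) l x))\<^sup>2) integrable_on {0..0 + 1}" for j l
      by (intro integrable_continuous_real continuous_intros continuous_on_fiber c continuous_win)
    have ch: "(\<lambda>x. B * (\<Sum>n\<in>{- int m..int m}. (cmod (h (x + of_int n)))\<^sup>2)) integrable_on {0..0 + 1}"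
      by (intro integrable_continuous_real continuous_intros continuous_on_compose2[OF c]) auto
    note F(3)
    also have "(\<Sum>l\<in>F. \<Sum>j\<in>{1..N}. integral {0..0 + 1} (\<lambda>x. (cmod (fiber m h (win j) l x))\<^sup>2))
       = (\<Sum>j\<in>{1..N}. integral {0..0 + 1} (\<lambda>x. \<Sum>l\<in>F. (cmod (fiber m h (win j) l x))\<^sup>2))"
      using F(1) ci by (subst sum.swap) (simp add: integral_sum)
    also have "\<dots> \<le> (\<Sum>j\<in>{1..N}. integral {0..0 + 1} (\<lambda>x. B * (\<Sum>n\<in>{- int m..int m}. (cmod (h (x + of_int n)))\<^sup>2)))"
      by (intro sum_mono integral_le integrable_sum ci ch F(1) B(2) F(2)) auto
    also have "\<dots> = real N * B * integral {0..0 + 1} (\<lambda>x. \<Sum>n\<in>{- int m..int m}. (cmod (h (x + of_int n)))\<^sup>2)" by simp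
    also have "integral {0..0 + 1} (\<lambda>x. \<Sum>n\<in>{- int m..int m}. (cmod (h (x + of_int n)))\<^sup>2) = sq_norm h"
      by (rule sq_norm_periodize[OF c m, symmetric])
    finally show "(\<Sum>i\<in>J. (cmod (l2_inner h (gabor_fun i)))\<^sup>2) \<le> real N * B * sq_norm h" .
  qed
qed

text \<open>The fiber for the derivative of order \<open>s\<close> is that derivative, at
  \<open>l + x\<close>, of the series with coefficients \<open>h (x - k)\<close>. Real and imaginary
  part are separated because the sampling inequality concerns real coefficients.\<close>

lemma fiber_jet_parts:
  assumes "\<And>k. \<bar>of_int k\<bar> > real m \<Longrightarrow> h (x - of_int k) = 0"
  shows "(cmod (fiber m h (\<lambda>t. of_real (G s t)) l x))\<^sup>2
    = (shift_series (\<lambda>k. Re (h (x - of_int k))) G s (l + x))\<^sup>2 + (shift_series (\<lambda>k. Im (h (x - of_int k))) G s (l + x))\<^sup>2"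
proof -
  have ss: "shift_series c G s (l + x) = (\<Sum>n\<in>{- int m..int m}. c (- n) * G s (x + of_int n + l))"
    if "\<And>k. \<bar>of_int k\<bar> > real m \<Longrightarrow> c k = 0" for c
  proof -
    have "c k = 0" if "k \<notin> {- int m..int m}" for k
      using that \<open>\<And>k. \<bar>of_int k\<bar> > real m \<Longrightarrow> c k = 0\<close>[of k] by force
    then have "shift_series c G s (l + x) = (\<Sum>\<^sub>\<infinity>k\<in>{- int m..int m}. c k * G s (l + x - of_int k))"
      unfolding shift_series_def by (intro infsum_cong_neutral) auto
    also have "\<dots> = (\<Sum>n\<in>{- int m..int m}. c (- n) * G s (x + of_int n + l))"
      by (simp, rule sum.reindex_bij_witness[where i = uminus and j = uminus]) (auto simp: algebra_simps)
    finally show ?thesis .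
  qed
  have "Re (fiber m h (\<lambda>t. of_real (G s t)) l x) = shift_series (\<lambda>k. Re (h (x - of_int k))) G s (l + x)"
    using assms by (subst ss) (auto simp: fiber_def)
  moreover have "Im (fiber m h (\<lambda>t. of_real (G s t)) l x) = shift_series (\<lambda>k. Im (h (x - of_int k))) G s (l + x)"
    using assms by (subst ss) (auto simp: fiber_def)
  ultimately show ?thesis by (simp add: cmod_power2)
qed

section \<open>The two implications between the frame property and the density\<close>

theorem frame_if_dense:
  assumes uniq: "zero_uniq (\<kappa> / 2) G" and dens: "lower_density \<Lambda> > ereal (1 / real N)"
  shows "is_frame gabor_index gabor_fun"
proof -
  obtain L :: real and M :: nat where L: "L > 0" and M: "M > 0" "L < real M * real N" and card: "\<And>x. M \<le> card (\<Lambda> \<inter> {x..x + L})"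
    by (rule card_interval_of_lower_density[OF dens N]) blast
  have \<kappa>2: "0 < \<kappa> / 2" "\<kappa> / 2 < \<kappa>" using \<kappa> by auto
  obtain C where C: "C > 0" and samp: "\<And>T c (R :: real). dense_separated d L M T \<Longrightarrow> (\<And>k. \<bar>of_int k\<bar> > R \<Longrightarrow> c k = 0) \<Longrightarrow>
    (\<Sum>k | \<bar>real_of_int k\<bar> \<le> R. (c k)\<^sup>2) \<le> C * (\<Sum>y\<in>T \<inter> {- (R + C)..R + C}. \<Sum>s<N. (shift_series c G s y)\<^sup>2)"
    by (rule sampling_inequality[OF G uniq \<kappa>2 d L M(1) N M(2)]) blast
  obtain \<Gamma> where \<Gamma>: "\<Gamma> > 0"
    "\<And>m h l x. (\<Sum>s<N. (cmod (fiber m h (\<lambda>t. of_real (G s t)) l x))\<^sup>2) \<le> \<Gamma> * (\<Sum>j\<in>{1..N}. (cmod (fiber m h (win j) l x))\<^sup>2)"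
    by (rule fiber_jet_le_win) blast
  obtain B where B: "B > 0"
    "\<And>h J. h \<in> Cc \<Longrightarrow> finite J \<Longrightarrow> J \<subseteq> gabor_index \<Longrightarrow> (\<Sum>i\<in>J. (cmod (l2_inner h (gabor_fun i)))\<^sup>2) \<le> B * sq_norm h"
    by (rule gabor_bessel) blast
  have A: "1 / (C * \<Gamma>) > 0" using C \<Gamma> by simp
  show ?thesis
  proof (rule is_frame_if_dense[OF gabor_fun_L2 A B])
    fix h e assume h: "h \<in> Cc" and e: "(e::real) > 0"
    from h obtain m0 :: nat where c: "continuous_on UNIV h" and m0: "\<And>t. \<bar>t\<bar> \<ge> real m0 \<Longrightarrow> h t = 0" by (auto simp: Cc_def)
    \<comment> \<open>One unit more than the support radius, so that \<open>x - k\<close> is outside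
      the support for all \<open>x\<close> in the unit cell and all \<open>k\<close> beyond
      \<open>m\<close>.\<close>
    define m where "m = m0 + 1"
    have m: "h t = 0" if "\<bar>t - 0\<bar> \<ge> real m" for t using that m0[of t] by (simp add: m_def)
    have m': "h t = 0" if "\<bar>t\<bar> \<ge> real m" for t using m that by simp
    \<comment> \<open>Contains, for every \<open>x\<close> in the cell at once, all points whose
      translate by \<open>x\<close> lies within \<open>C\<close> of the coefficient range; hence the
      summand 1.\<close>
    define F where "F = \<Lambda> \<inter> {- (real m + C + 1)..real m + C + 1}"
    have F: "finite F" unfolding F_def by (rule separated_by_finite[OF sep d])
    let ?P = "\<lambda>l j x. (cmod (fiber m h (win j) l x))\<^sup>2"
    have pt: "(\<Sum>n\<in>{- int m..int m}. (cmod (h (x + of_int n)))\<^sup>2) \<le> C * \<Gamma> * (\<Sum>l\<in>F. \<Sum>j\<in>{1..N}. ?P l j x)" if x: "x \<in> {0..1}" for x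
    proof -
      let ?T = "(\<lambda>l. l + x) ` \<Lambda>"
      have T: "dense_separated d L M ?T"
        unfolding dense_separated_def[OF G uniq \<kappa>2 d L M(1) N M(2)] card_translate_interval
        using separated_by_translate[OF sep] card by blast
      have hz: "h (x - of_int k) = 0" if "\<bar>of_int k\<bar> > real m" for k
      proof (rule m0)
        have "\<bar>of_int k\<bar> \<ge> real m" using that by simp
        then show "real m0 \<le> \<bar>x - of_int k\<bar>" using x by (auto simp: m_def)
      qed
      let ?cR = "\<lambda>k. Re (h (x - of_int k))" and ?cI = "\<lambda>k. Im (h (x - of_int k))"
      let ?U = "?T \<inter> {- (real m + C)..real m + C}"
      have "(\<Sum>n\<in>{- int m..int m}. (cmod (h (x + of_int n)))\<^sup>2) = (\<Sum>k | \<bar>real_of_int k\<bar> \<le> real m. (cmod (h (x - of_int k)))\<^sup>2)"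
        by (rule sum.reindex_bij_witness[where i = uminus and j = uminus]) (auto simp: abs_le_iff)
      also have "\<dots> = (\<Sum>k | \<bar>real_of_int k\<bar> \<le> real m. (?cR k)\<^sup>2) + (\<Sum>k | \<bar>real_of_int k\<bar> \<le> real m. (?cI k)\<^sup>2)"
        by (simp add: cmod_power2 sum.distrib)
      also have "\<dots> \<le> C * (\<Sum>y\<in>?U. \<Sum>s<N. (shift_series ?cR G s y)\<^sup>2) + C * (\<Sum>y\<in>?U. \<Sum>s<N. (shift_series ?cI G s y)\<^sup>2)"
        using hz by (intro add_mono samp[OF T]) auto
      also have "\<dots> = C * (\<Sum>y\<in>?U. \<Sum>s<N. (shift_series ?cR G s y)\<^sup>2 + (shift_series ?cI G s y)\<^sup>2)"
        by (simp add: sum.distrib distrib_left)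
      also have "\<dots> \<le> C * (\<Sum>y\<in>(\<lambda>l. l + x) ` F. \<Sum>s<N. (shift_series ?cR G s y)\<^sup>2 + (shift_series ?cI G s y)\<^sup>2)"
      proof (intro mult_left_mono sum_mono2 sum_nonneg)
        show "?U \<subseteq> (\<lambda>l. l + x) ` F" using x by (auto simp: F_def)
      qed (use F C in auto)
      also have "\<dots> = C * (\<Sum>l\<in>F. \<Sum>s<N. (cmod (fiber m h (\<lambda>t. of_real (G s t)) l x))\<^sup>2)"
        by (subst sum.reindex) (auto simp: inj_on_def fiber_jet_parts[of m h x, OF hz])
      also have "\<dots> \<le> C * (\<Sum>l\<in>F. \<Gamma> * (\<Sum>j\<in>{1..N}. ?P l j x))"
        using C by (intro mult_left_mono sum_mono \<Gamma>(2)) auto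
      also have "\<dots> = C * \<Gamma> * (\<Sum>l\<in>F. \<Sum>j\<in>{1..N}. ?P l j x)" by (simp add: sum_distrib_left mult_ac)
      finally show ?thesis .
    qed
    have ci: "?P l j integrable_on {0..0 + 1}" for j l
      by (intro integrable_continuous_real continuous_intros continuous_on_fiber c continuous_win)
    have "sq_norm h = integral {0..0 + 1} (\<lambda>x. \<Sum>n\<in>{- int m..int m}. (cmod (h (x + of_int n)))\<^sup>2)"
      by (rule sq_norm_periodize[OF c m])
    also have "\<dots> \<le> integral {0..0 + 1} (\<lambda>x. C * \<Gamma> * (\<Sum>l\<in>F. \<Sum>j\<in>{1..N}. ?P l j x))"
    proof (intro integral_le)
      show "(\<lambda>x. \<Sum>n\<in>{- int m..int m}. (cmod (h (x + of_int n)))\<^sup>2) integrable_on {0..0 + 1}"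
        by (intro integrable_continuous_real continuous_intros continuous_on_compose2[OF c]) auto
      show "(\<lambda>x. C * \<Gamma> * (\<Sum>l\<in>F. \<Sum>j\<in>{1..N}. ?P l j x)) integrable_on {0..0 + 1}"
        by (intro integrable_on_mult_right integrable_sum ci F) auto
    qed (use pt in auto)
    also have "\<dots> = C * \<Gamma> * (\<Sum>l\<in>F. \<Sum>j\<in>{1..N}. integral {0..0 + 1} (?P l j))"
      using F ci by (simp add: integral_sum integrable_sum)
    finally have main: "sq_norm h \<le> C * \<Gamma> * (\<Sum>l\<in>F. \<Sum>j\<in>{1..N}. integral {0..0 + 1} (?P l j))" .
    \<comment> \<open>The admissible error is divided among the fibers, one for each point of
      \<open>F\<close> and each window; the summand 1 avoids division by 0.\<close>
    define e' where "e' = e / (real (card F) * real N + 1)"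
    have e': "e' > 0" "real (card F) * real N * e' \<le> e"
    proof -
      have p: "real (card F) * real N + 1 > 0" by (simp add: add_nonneg_pos)
      then show "e' > 0" using e by (simp add: e'_def)
      then have "real (card F) * real N * e' \<le> (real (card F) * real N + 1) * e'" by simp
      also have "\<dots> = e" using p by (simp add: e'_def)
      finally show "real (card F) * real N * e' \<le> e" .
    qed
    have "\<forall>l j. \<exists>K. finite K \<and> integral {0..0 + 1} (?P l j) \<le> (\<Sum>k\<in>K. (cmod (fcoeff 0 (fiber m h (win j) l) k))\<^sup>2) + e'"
      using parseval_lower[OF continuous_on_fiber[OF c continuous_win] fiber_periodic[OF m'] e'(1)] by simp
    then obtain K where K: "\<And>l j. finite (K l j)"
      "\<And>l j. integral {0..0 + 1} (?P l j) \<le> (\<Sum>k\<in>K l j. (cmod (fcoeff 0 (fiber m h (win j) l) k))\<^sup>2) + e'"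
      by metis
    let ?I = "SIGMA l:F. SIGMA j:{1..N}. K l j" and ?\<iota> = "\<lambda>(l :: real, j :: nat, k). ((- l, real_of_int k), j)"
    have fc: "l2_inner h (gabor_fun ((- l, real_of_int k), j)) = fcoeff 0 (fiber m h (win j) l) k" for l k j
      by (rule l2_inner_gabor_fun[OF c m])
    have inj: "inj_on ?\<iota> ?I" by (auto simp: inj_on_def)
    have finI: "finite (?\<iota> ` ?I)" using F K(1) by (intro finite_imageI finite_SigmaI) auto
    have sub: "?\<iota> ` ?I \<subseteq> gabor_index" by (auto simp: gabor_index_def F_def)
    have "(\<Sum>i\<in>?\<iota> ` ?I. (cmod (l2_inner h (gabor_fun i)))\<^sup>2) = (\<Sum>(l, j, k)\<in>?I. (cmod (fcoeff 0 (fiber m h (win j) l) k))\<^sup>2)"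
      by (subst sum.reindex[OF inj]) (auto intro!: sum.cong simp: fc)
    also have "\<dots> = (\<Sum>l\<in>F. \<Sum>j\<in>{1..N}. \<Sum>k\<in>K l j. (cmod (fcoeff 0 (fiber m h (win j) l) k))\<^sup>2)"
      using F K(1) by (simp add: sum.Sigma)
    finally have S: "(\<Sum>i\<in>?\<iota> ` ?I. (cmod (l2_inner h (gabor_fun i)))\<^sup>2) = \<dots>" .
    have "(\<Sum>l\<in>F. \<Sum>j\<in>{1..N}. integral {0..0 + 1} (?P l j)) \<le> (\<Sum>l\<in>F. \<Sum>j\<in>{1..N}. (\<Sum>k\<in>K l j. (cmod (fcoeff 0 (fiber m h (win j) l) k))\<^sup>2) + e')"
      by (intro sum_mono K(2))
    also have "\<dots> = (\<Sum>i\<in>?\<iota> ` ?I. (cmod (l2_inner h (gabor_fun i)))\<^sup>2) + real (card F) * real N * e'"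
      unfolding S by (simp add: sum.distrib)
    finally have "C * \<Gamma> * (\<Sum>l\<in>F. \<Sum>j\<in>{1..N}. integral {0..0 + 1} (?P l j)) \<le> C * \<Gamma> * ((\<Sum>i\<in>?\<iota> ` ?I. (cmod (l2_inner h (gabor_fun i)))\<^sup>2) + e)"
      using C \<Gamma> e'(2) by (intro mult_left_mono) auto
    then have "sq_norm h \<le> C * \<Gamma> * ((\<Sum>i\<in>?\<iota> ` ?I. (cmod (l2_inner h (gabor_fun i)))\<^sup>2) + e)" using main by linarith
    then have "1 / (C * \<Gamma>) * sq_norm h \<le> (\<Sum>i\<in>?\<iota> ` ?I. (cmod (l2_inner h (gabor_fun i)))\<^sup>2) + e"
      using C \<Gamma> by (simp add: pos_divide_le_eq mult_ac)
    then show "\<exists>J. finite J \<and> J \<subseteq> gabor_index \<and> 1 / (C * \<Gamma>) * sq_norm h \<le> (\<Sum>i\<in>J. (cmod (l2_inner h (gabor_fun i)))\<^sup>2) + e"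
      using finI sub by blast
  qed
qed

text \<open>The test function carries the coefficient \<open>c k\<close> on a bump of half-width
  \<open>\<eta>\<close> at \<open>x - k\<close>, so its fibers near \<open>x\<close> are the bump
  times the sampled series. The energy of the bump appears on both sides and cancels, which makes
  the constant independent of \<open>\<eta>\<close>, as \<open>translated_sampling_density\<close>
  demands.\<close>

theorem dense_if_frame:
  assumes frame: "is_frame gabor_index gabor_fun"
  shows "lower_density \<Lambda> > ereal (1 / real N)"
proof -
  obtain A where A: "A > 0" and fr: "\<And>f. f \<in> L2 \<Longrightarrow> (\<lambda>i. (cmod (l2_inner f (gabor_fun i)))\<^sup>2) summable_on gabor_index"
    "\<And>f. f \<in> L2 \<Longrightarrow> A * sq_norm f \<le> (\<Sum>\<^sub>\<infinity>i\<in>gabor_index. (cmod (l2_inner f (gabor_fun i)))\<^sup>2)"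
    using frame unfolding is_frame_def l2_norm_square by blast
  define q where "q = (\<lambda>j. \<Sum>s<N. (cmod (coeff (p j) s))\<^sup>2)"
  define Q where "Q = (\<Sum>j\<in>{1..N}. q j)"
  have q0: "q j \<ge> 0" for j unfolding q_def by (intro sum_nonneg) auto
  have Q0: "Q \<ge> 0" unfolding Q_def by (intro sum_nonneg q0)
  have QN: "Q * real N + 1 > 0" using Q0 by (intro add_nonneg_pos mult_nonneg_nonneg) auto
  have samp: "(\<Sum>k\<in>K. (c k)\<^sup>2) \<le> (Q * real N + 1) / A * S"
    if \<eta>: "0 < \<eta>" "\<eta> \<le> 1 / 2" and K: "finite K"
      and b: "\<And>l s t. l \<in> \<Lambda> \<Longrightarrow> s < N \<Longrightarrow> \<bar>t - x\<bar> \<le> \<eta> \<Longrightarrow> (\<Sum>k\<in>K. c k * G s (t + l - of_int k))\<^sup>2 \<le> b l"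
      and S: "\<And>F. finite F \<Longrightarrow> F \<subseteq> \<Lambda> \<Longrightarrow> sum b F \<le> S"
    for x \<eta> :: real and c :: "int \<Rightarrow> real" and K b S
  proof -
    define v where "v = (\<lambda>s::real. max 0 (1 - \<bar>s\<bar> / \<eta>))"
    have v0: "v s = 0" if "\<bar>s\<bar> \<ge> \<eta>" for s using that \<eta> by (simp add: v_def field_simps)
    have cv: "continuous_on UNIV v" unfolding v_def using \<eta> by (intro continuous_intros) auto
    have "\<exists>M::nat. \<forall>n\<in>(\<lambda>k. nat \<bar>k\<bar>) ` K. n \<le> M"
      using K finite_nat_set_iff_bounded_le by blast
    then obtain M :: nat where M: "\<And>k. k \<in> K \<Longrightarrow> nat \<bar>k\<bar> \<le> M" by auto
    have M': "\<bar>k\<bar> \<le> int M" if "k \<in> K" for k using M[OF that] by simp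
    \<comment> \<open>Covers bumps up to distance \<open>M\<close> from \<open>x\<close>, their
      half-width and the offset \<open>1 / 2\<close> between \<open>x\<close> and
      \<open>y\<close>.\<close>
    define m where "m = M + 2"
    \<comment> \<open>The cell is centred at \<open>x\<close>. As \<open>\<eta> \<le> 1 / 2\<close>,
      each bump stays within its own translate of the cell and different coefficients do not
      interact.\<close>
    define y where "y = x - 1 / 2"
    define f where "f = (\<lambda>t. complex_of_real (\<Sum>k\<in>K. c k * v (t - x + of_int k)))"
    have cf: "continuous_on UNIV f" unfolding f_def by (intro continuous_intros continuous_on_compose2[OF cv]) auto
    have f0: "f t = 0" if t: "\<bar>t - y\<bar> \<ge> real m" for t
    proof -
      have "v (t - x + of_int k) = 0" if "k \<in> K" for k
      proof (rule v0)
        have "real_of_int \<bar>k\<bar> \<le> real_of_int (int M)" using M'[OF that] by (simp only: of_int_le_iff)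
        then have "\<bar>real_of_int k\<bar> \<le> real M" by simp
        then show "\<eta> \<le> \<bar>t - x + of_int k\<bar>" using t \<eta> unfolding m_def y_def by simp
      qed
      then show ?thesis by (simp add: f_def)
    qed
    have Ksub: "K \<subseteq> {- int m..int m}"
    proof
      fix k assume "k \<in> K"
      then show "k \<in> {- int m..int m}" using M'[of k] by (auto simp: m_def abs_le_iff)
    qed
    define C where "C = (\<lambda>k. if k \<in> K then c k else 0)"
    have cell: "f (t + of_int n) = of_real (v (t - x) * C (- n))" if t: "t \<in> {y..y + 1}" for t n
    proof -
      have "(\<Sum>k\<in>K. c k * v (t + of_int n - x + of_int k)) = (\<Sum>k\<in>K. if k = - n then c k * v (t - x) else 0)"
      proof (rule sum.cong[OF refl])
        fix k assume "k \<in> K"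
        show "c k * v (t + of_int n - x + of_int k) = (if k = - n then c k * v (t - x) else 0)"
        proof (cases "k = - n")
          case False
          then have "1 \<le> \<bar>n + k\<bar>" by linarith
          then have "real_of_int 1 \<le> real_of_int \<bar>n + k\<bar>" by (simp only: of_int_le_iff)
          then have "1 \<le> \<bar>real_of_int n + of_int k\<bar>" by simp
          moreover have "\<bar>real_of_int n + of_int k\<bar> \<le> \<bar>t + of_int n - x + of_int k\<bar> + \<bar>t - x\<bar>" by linarith
          moreover have "\<bar>t - x\<bar> \<le> 1 / 2" using t unfolding y_def abs_le_iff by auto
          ultimately have "\<eta> \<le> \<bar>t + of_int n - x + of_int k\<bar>" using \<eta> by linarith
          then show ?thesis using False by (simp add: v0)
        qed simp
      qed
      also have "\<dots> = v (t - x) * C (- n)" using K by (simp add: C_def)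
      finally show ?thesis by (simp only: f_def)
    qed
    have refl_sum: "(\<Sum>n\<in>{- int m..int m}. w (- n)) = sum w {- int m..int m}" for w :: "int \<Rightarrow> real"
      by (rule sum.reindex_bij_witness[where i = uminus and j = uminus]) auto
    have fib: "fiber m f (\<lambda>t. of_real (G s t)) l t = of_real (v (t - x) * (\<Sum>k\<in>K. c k * G s (t + l - of_int k)))"
      if t: "t \<in> {y..y + 1}" for s l t
    proof -
      have "fiber m f (\<lambda>t. of_real (G s t)) l t = of_real (\<Sum>n\<in>{- int m..int m}. v (t - x) * (C (- n) * G s (t + l - of_int (- n))))"
        unfolding fiber_def cell[OF t] by (simp add: algebra_simps)
      also have "(\<Sum>n\<in>{- int m..int m}. v (t - x) * (C (- n) * G s (t + l - of_int (- n)))) = v (t - x) * (\<Sum>k\<in>{- int m..int m}. C k * G s (t + l - of_int k))"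
        by (simp only: sum_distrib_left[symmetric] refl_sum[of "\<lambda>k. C k * G s (t + l - of_int k)"])
      also have "(\<Sum>k\<in>{- int m..int m}. C k * G s (t + l - of_int k)) = (\<Sum>k\<in>K. c k * G s (t + l - of_int k))"
        using Ksub by (intro sum.mono_neutral_cong_right) (auto simp: C_def)
      finally show ?thesis .
    qed
    have fw: "(cmod (fiber m f (win j) l t))\<^sup>2 \<le> q j * real N * b l * (v (t - x))\<^sup>2"
      if t: "t \<in> {y..y + 1}" and l: "l \<in> \<Lambda>" and j: "j \<in> {1..N}" for l t j
    proof -
      have e: "(cmod (fiber m f (\<lambda>t. of_real (G s t)) l t))\<^sup>2 \<le> (v (t - x))\<^sup>2 * b l" if s: "s < N" for s
      proof (cases "\<bar>t - x\<bar> \<le> \<eta>")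
        case True
        have "(cmod (fiber m f (\<lambda>t. of_real (G s t)) l t))\<^sup>2 = (v (t - x))\<^sup>2 * (\<Sum>k\<in>K. c k * G s (t + l - of_int k))\<^sup>2"
          unfolding fib[OF t] norm_of_real power2_abs power_mult_distrib ..
        also have "\<dots> \<le> (v (t - x))\<^sup>2 * b l" by (intro mult_left_mono b[OF l s True]) simp
        finally show ?thesis .
      next
        case False
        then show ?thesis unfolding fib[OF t] by (simp add: v0)
      qed
      have "(cmod (fiber m f (win j) l t))\<^sup>2 \<le> (\<Sum>s<N. (cmod (cnj (coeff (p j) s)))\<^sup>2) * (\<Sum>s<N. (cmod (fiber m f (\<lambda>t. of_real (G s t)) l t))\<^sup>2)"
        unfolding fiber_win[OF j] by (rule norm_sum_mult_square_le)
      also have "\<dots> \<le> q j * (\<Sum>s<N. (v (t - x))\<^sup>2 * b l)"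
        unfolding q_def complex_mod_cnj using e by (intro mult_left_mono sum_mono sum_nonneg) auto
      also have "\<dots> = q j * real N * b l * (v (t - x))\<^sup>2" by simp
      finally show ?thesis .
    qed
    have iv: "(\<lambda>t. a * (v (t - x))\<^sup>2) integrable_on {y..y + 1}" for a
      by (intro integrable_continuous_real continuous_intros continuous_on_compose2[OF cv]) auto
    define X where "X = integral {y..y + 1} (\<lambda>t. (v (t - x))\<^sup>2)"
    have X0: "X \<ge> 0" unfolding X_def using iv[of 1] by (intro Henstock_Kurzweil_Integration.integral_nonneg) auto
    have "X \<noteq> 0"
    proof
      assume "X = 0"
      moreover have "continuous_on {y..y + 1} (\<lambda>t. (v (t - x))\<^sup>2)"
        by (intro continuous_intros continuous_on_compose2[OF cv]) auto
      ultimately have "\<forall>t\<in>{y..y + 1}. (v (t - x))\<^sup>2 = 0"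
        by (subst (asm) X_def, subst (asm) integral_eq_0_iff) auto
      then have "(v (x - x))\<^sup>2 = 0" by (rule bspec) (simp add: y_def)
      then show False by (simp add: v_def)
    qed
    then have X: "X > 0" using X0 by simp
    have "sq_norm f = integral {y..y + 1} (\<lambda>t. \<Sum>n\<in>{- int m..int m}. (cmod (f (t + of_int n)))\<^sup>2)"
      by (rule sq_norm_periodize[OF cf f0])
    also have "\<dots> = integral {y..y + 1} (\<lambda>t. (\<Sum>k\<in>K. (c k)\<^sup>2) * (v (t - x))\<^sup>2)"
    proof (rule Henstock_Kurzweil_Integration.integral_cong)
      fix t assume t: "t \<in> {y..y + 1}"
      have "(\<Sum>n\<in>{- int m..int m}. (cmod (f (t + of_int n)))\<^sup>2) = (\<Sum>n\<in>{- int m..int m}. (v (t - x))\<^sup>2 * (C (- n))\<^sup>2)"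
        unfolding cell[OF t] norm_of_real power2_abs power_mult_distrib ..
      also have "\<dots> = (v (t - x))\<^sup>2 * (\<Sum>k\<in>{- int m..int m}. (C k)\<^sup>2)"
        by (simp only: sum_distrib_left[symmetric] refl_sum[of "\<lambda>k. (C k)\<^sup>2"])
      also have "(\<Sum>k\<in>{- int m..int m}. (C k)\<^sup>2) = (\<Sum>k\<in>K. (c k)\<^sup>2)"
        using Ksub by (intro sum.mono_neutral_cong_right) (auto simp: C_def)
      finally show "(\<Sum>n\<in>{- int m..int m}. (cmod (f (t + of_int n)))\<^sup>2) = (\<Sum>k\<in>K. (c k)\<^sup>2) * (v (t - x))\<^sup>2" by (simp only: mult.commute)
    qed
    also have "\<dots> = (\<Sum>k\<in>K. (c k)\<^sup>2) * X" by (simp add: X_def)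
    finally have sqf: "sq_norm f = (\<Sum>k\<in>K. (c k)\<^sup>2) * X" .
    have fin: "(\<Sum>i\<in>J. (cmod (l2_inner f (gabor_fun i)))\<^sup>2) \<le> Q * real N * S * X" if J: "finite J" "J \<subseteq> gabor_index" for J
    proof -
      obtain F where F: "finite F" "F \<subseteq> \<Lambda>"
        "(\<Sum>i\<in>J. (cmod (l2_inner f (gabor_fun i)))\<^sup>2) \<le> (\<Sum>l\<in>F. \<Sum>j\<in>{1..N}. integral {y..y + 1} (\<lambda>t. (cmod (fiber m f (win j) l t))\<^sup>2))"
        by (rule gabor_sum_le[OF cf f0 J]) blast
      note F(3)
      also have "(\<Sum>l\<in>F. \<Sum>j\<in>{1..N}. integral {y..y + 1} (\<lambda>t. (cmod (fiber m f (win j) l t))\<^sup>2)) \<le> (\<Sum>l\<in>F. \<Sum>j\<in>{1..N}. q j * real N * b l * X)"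
      proof (intro sum_mono)
        fix l j assume l: "l \<in> F" and j: "j \<in> {1..N}"
        have "integral {y..y + 1} (\<lambda>t. (cmod (fiber m f (win j) l t))\<^sup>2) \<le> integral {y..y + 1} (\<lambda>t. q j * real N * b l * (v (t - x))\<^sup>2)"
        proof (rule integral_le)
          show "(\<lambda>t. (cmod (fiber m f (win j) l t))\<^sup>2) integrable_on {y..y + 1}"
            by (intro integrable_continuous_real continuous_intros continuous_on_fiber cf continuous_win)
        qed (use iv fw F(2) l j in auto)
        also have "\<dots> = q j * real N * b l * X" by (simp add: X_def)
        finally show "integral {y..y + 1} (\<lambda>t. (cmod (fiber m f (win j) l t))\<^sup>2) \<le> \<dots>" .
      qed
      also have "\<dots> = Q * real N * sum b F * X" by (simp only: Q_def sum_distrib_left sum_distrib_right)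
      also have "\<dots> \<le> Q * real N * S * X" using S[OF F(1,2)] Q0 X0 by (intro mult_right_mono mult_left_mono) auto
      finally show ?thesis .
    qed
    have "f \<in> Cc"
    proof -
      have "f t = 0" if "\<bar>t\<bar> \<ge> real (m + nat \<lceil>\<bar>y\<bar>\<rceil>)" for t
      proof (rule f0)
        have "\<bar>y\<bar> \<le> real (nat \<lceil>\<bar>y\<bar>\<rceil>)" by (rule real_nat_ceiling_ge)
        then show "real m \<le> \<bar>t - y\<bar>" using that unfolding of_nat_add by linarith
      qed
      then show ?thesis unfolding Cc_def using cf by blast
    qed
    then have fL: "f \<in> L2" by (rule Cc_L2)
    have "A * sq_norm f \<le> Q * real N * S * X"
      using fr(2)[OF fL] infsum_le_finite_sums[OF fr(1)[OF fL] fin] by (rule order_trans)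
    \<comment> \<open>Cancelling \<open>X\<close>, the energy of the bump, removes every trace of
      its width.\<close>
    then have "(A * (\<Sum>k\<in>K. (c k)\<^sup>2)) * X \<le> (Q * real N * S) * X" by (simp only: sqf mult.assoc)
    then have "A * (\<Sum>k\<in>K. (c k)\<^sup>2) \<le> Q * real N * S" using X by (simp only: mult_le_cancel_right_pos)
    \<comment> \<open>The hypothesis on \<open>S\<close> for the empty set gives
      \<open>S \<ge> 0\<close>; the added 1 makes the constant positive even for
      \<open>Q = 0\<close>.\<close>
    also have "\<dots> \<le> (Q * real N + 1) * S" using S[of "{}"] by (simp add: distrib_right)
    finally show ?thesis using A by (simp add: pos_le_divide_eq mult.commute)
  qed
  have C1: "(Q * real N + 1) / A > 0" using QN A by simp
  have "\<exists>\<delta>>0. \<exists>R. \<forall>r\<ge>R. \<forall>x. (1 / real N + \<delta>) * (2 * r) \<le> real (card (\<Lambda> \<inter> {x - r..x + r}))"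
  proof (rule translated_sampling_density[OF G \<kappa> d sep N C1])
    fix x \<eta> :: real and c :: "int \<Rightarrow> real" and K b S
    assume a: "0 < \<eta>" "\<eta> \<le> 1 / 2" "finite K"
      and b: "\<And>l s t. l \<in> \<Lambda> \<Longrightarrow> s < N \<Longrightarrow> \<bar>t - x\<bar> \<le> \<eta> \<Longrightarrow> (\<Sum>k\<in>K. c k * G s (t + l - of_int k))\<^sup>2 \<le> b l"
      and S: "\<And>F. finite F \<Longrightarrow> F \<subseteq> \<Lambda> \<Longrightarrow> sum b F \<le> S"
    show "(\<Sum>k\<in>K. (c k)\<^sup>2) \<le> (Q * real N + 1) / A * S"
      by (rule samp[where \<eta> = \<eta> and K = K and x = x and c = c and b = b and S = S]) (fact a b S)+
  qed
  then obtain \<delta> R where \<delta>: "\<delta> > 0" and card: "\<And>r x. r \<ge> R \<Longrightarrow> (1 / real N + \<delta>) * (2 * r) \<le> real (card (\<Lambda> \<inter> {x - r..x + r}))"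
    by blast
  have "ereal (1 / real N + \<delta>) \<le> lower_density \<Lambda>"
    unfolding lower_density_def
  proof (rule Liminf_bounded)
    have "\<forall>\<^sub>F r in at_top. r \<ge> max R 1" by (rule eventually_ge_at_top)
    then show "\<forall>\<^sub>F r in at_top. ereal (1 / real N + \<delta>) \<le> (INF x. ereal (real (card (\<Lambda> \<inter> {x - r..x + r})) / (2 * r)))"
    proof eventually_elim
      fix r assume r: "r \<ge> max R 1"
      show "ereal (1 / real N + \<delta>) \<le> (INF x. ereal (real (card (\<Lambda> \<inter> {x - r..x + r})) / (2 * r)))"
      proof (rule INF_greatest)
        fix x :: real
        have "1 / real N + \<delta> \<le> real (card (\<Lambda> \<inter> {x - r..x + r})) / (2 * r)"
          using card[of r x] r by (subst pos_le_divide_eq) auto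
        then show "ereal (1 / real N + \<delta>) \<le> ereal (real (card (\<Lambda> \<inter> {x - r..x + r})) / (2 * r))" by simp
      qed
    qed
  qed
  moreover have "ereal (1 / real N) < ereal (1 / real N + \<delta>)" using \<delta> by simp
  ultimately show ?thesis by (rule less_le_trans[rotated])
qed

end

lemma separated_by_if_separated:
  assumes "separated \<Lambda>"
  obtains d where "d > 0" "separated_by d \<Lambda>"
  using assms unfolding separated_def separated_by_def by blast

theorem theorem6p2:
  fixes g :: "real \<Rightarrow> complex" and \<Lambda> :: "real set" and N :: nat
    and p :: "nat \<Rightarrow> complex poly"
  assumes "tp_gaussian_type g \<or> (\<exists>a>0. g = (\<lambda>x. complex_of_real (1 / cosh (a * x))))"
    and "separated \<Lambda>"
    and "N \<ge> 1"
    and "poly_basis N p"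
  shows "gabor_frame (\<lambda>j. poly_diff_op (p j) g) N
           ((\<lambda>(l, k). (- l, real_of_int k)) ` (\<Lambda> \<times> (UNIV :: int set)))
         \<longleftrightarrow> lower_density \<Lambda> > ereal (1 / real N)"
proof -
  \<comment> \<open>Both kinds of window are reduced to the same data: a decaying jet with
    uniqueness for every growth rate below its decay rate.\<close>
  have "\<exists>\<kappa> G. \<kappa> > 0 \<and> decay_jet \<kappa> G \<and> g = (\<lambda>x. of_real (G 0 x)) \<and> (\<forall>\<epsilon><\<kappa>. zero_uniq \<epsilon> G)"
    using assms(1)
  proof
    assume "\<exists>a>0. g = (\<lambda>x. complex_of_real (1 / cosh (a * x)))"
    then obtain a where a: "a > 0" "g = (\<lambda>x. complex_of_real (1 / cosh (a * x)))" by blast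
    then have "g = (\<lambda>x. of_real (sech_jet a 0 x))" by (simp add: sech_jet_0)
    then show ?thesis using a(1) decay_jet_sech_jet zero_uniq_sech_jet by blast
  qed (rule tp_gaussian_type_jet)
  then obtain \<kappa> G where \<kappa>: "\<kappa> > 0" and G: "decay_jet \<kappa> G" and g: "g = (\<lambda>x. of_real (G 0 x))"
    and uniq: "\<And>\<epsilon>. \<epsilon> < \<kappa> \<Longrightarrow> zero_uniq \<epsilon> G" by blast
  obtain d where "d > 0" "separated_by d \<Lambda>" using assms(2) by (rule separated_by_if_separated)
  then interpret gabor_windows \<kappa> d G \<Lambda> N p
    using G \<kappa> assms(3,4) by unfold_locales auto
  show ?thesis
    unfolding g gabor_frame_iff using dense_if_frame frame_if_dense[OF uniq] \<kappa> by auto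
qed

end
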